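(* Let $n\ge3$ and $\alpha>-1$. Then for every $\Lambda\in(0,\Lambda_1(1+\alpha))$ there exists a radially symmetric solution $u$ of problem (P0) with $\int_{\mathbb{R}^n}|x|^{n\alpha}e^{nu}dx=\Lambda$. For $\Lambda=\Lambda_1(1+\alpha)$ there exists a radially symmetric normal solution of (P0) with $\int_{\mathbb{R}^n}|x|^{n\alpha}e^{nu}dx=\Lambda_1(1+\alpha)$.
   Context: Throughout, $n\ge 2$ is an integer, $|S^n|$ is the volume of the unit $n$-sphere, $\gamma_n:=\frac{(n-1)!}{2}|S^n|$ and $\Lambda_1:=(n-1)!\,|S^n|=2\gamma_n$. For $s>0$, $L_s(\mathbb{R}^n):=\{w\in L^1_{loc}(\mathbb{R}^n):\int_{\mathbb{R}^n}\frac{|w(x)|}{1+|x|^{n+2s}}dx<\infty\}$. For a Schwartz function $\varphi$, $(-\Delta)^{s}\varphi:=\mathcal F^{-1}(|\xi|^{2s}\mathcal F\varphi)$. Given $m\ge1$ and a tempered distribution $f$, $u$ solves $(-\Delta)^{m/2}u=f$ in $\mathbb{R}^n$ if: for $m$ even, $u\in L^1_{loc}$ and $\int u(-\Delta)^{m/2}\varphi\,dx=\langle f,\varphi\rangle$ for all $\varphi\in C_c^\infty$; for $m$ odd, $u\in L_{m/2}$ and the identity holds for all Schwartz $\varphi$. Problem (P0), for $\alpha>-1$: $u$ solves $(-\Delta)^{n/2}u=|x|^{n\alpha}e^{nu}$ on $\mathbb{R}^n$ in this sense and $\Lambda:=\int_{\mathbb{R}^n}|x|^{n\alpha}e^{nu}dx<\infty$.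 A solution $u$ of (P0) is called normal if there is $c\in\mathbb{R}$ with $u(x)=\frac{1}{\gamma_n}\int_{\mathbb{R}^n}\log\left(\frac{1+|y|}{|x-y|}\right)|y|^{n\alpha}e^{nu(y)}dy+c$ for all $x$. *)

theory Defs
  imports "HOL-Analysis.Analysis"
begin

definition dderiv :: "'a::euclidean_space \<Rightarrow> ('a \<Rightarrow> real) \<Rightarrow> 'a \<Rightarrow> real" where
  "dderiv v f x = frechet_derivative f (at x) v"

fun iter_dderiv :: "'a::euclidean_space list \<Rightarrow> ('a \<Rightarrow> real) \<Rightarrow> 'a \<Rightarrow> real" where
  "iter_dderiv [] f = f"
| "iter_dderiv (v # vs) f = dderiv v (iter_dderiv vs f)"

definition smooth_fun :: "('a::euclidean_space \<Rightarrow> real) \<Rightarrow> bool" where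
  "smooth_fun f \<longleftrightarrow> (\<forall>vs. set vs \<subseteq> Basis \<longrightarrow> (\<forall>x. iter_dderiv vs f differentiable at x))"

definition schwartz :: "('a::euclidean_space \<Rightarrow> real) \<Rightarrow> bool" where
  "schwartz f \<longleftrightarrow> smooth_fun f \<and>
     (\<forall>vs k. set vs \<subseteq> Basis \<longrightarrow> bounded (range (\<lambda>x. norm x ^ k * iter_dderiv vs f x)))"

definition test_fun :: "('a::euclidean_space \<Rightarrow> real) \<Rightarrow> bool" where
  "test_fun f \<longleftrightarrow> smooth_fun f \<and> bounded {x. f x \<noteq> 0}"

definition fourier :: "('a::euclidean_space \<Rightarrow> complex) \<Rightarrow> 'a \<Rightarrow> complex" where
  "fourier f \<xi> = (LINT x|lborel. f x * cis (- (x \<bullet> \<xi>)))"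

definition fourier_inv :: "('a::euclidean_space \<Rightarrow> complex) \<Rightarrow> 'a \<Rightarrow> complex" where
  "fourier_inv g x = (LINT \<xi>|lborel. g \<xi> * cis (x \<bullet> \<xi>)) / (2 * pi) ^ DIM('a)"

(* (-\<Delta>)^s \<phi> = F^{-1}(|\<xi>|^{2s} F \<phi>); real-valued for real \<phi> *)
definition frac_lap :: "real \<Rightarrow> ('a::euclidean_space \<Rightarrow> real) \<Rightarrow> 'a \<Rightarrow> real" where
  "frac_lap s \<phi> x = Re (fourier_inv (\<lambda>\<xi>. complex_of_real (norm \<xi> powr (2 * s)) * fourier (\<lambda>y. complex_of_real (\<phi> y)) \<xi>) x)"

definition locally_integrable :: "('a::euclidean_space \<Rightarrow> real) \<Rightarrow> bool" where
  "locally_integrable u \<longleftrightarrow> (\<forall>K. compact K \<longrightarrow> set_integrable lborel K u)"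

definition L_s :: "real \<Rightarrow> ('a::euclidean_space \<Rightarrow> real) \<Rightarrow> bool" where
  "L_s s u \<longleftrightarrow> integrable lborel (\<lambda>x. \<bar>u x\<bar> / (1 + norm x powr (real DIM('a) + 2 * s)))"

definition rhs :: "real \<Rightarrow> ('a::euclidean_space \<Rightarrow> real) \<Rightarrow> 'a \<Rightarrow> real" where
  "rhs \<alpha> u x = norm x powr (real DIM('a) * \<alpha>) * exp (real DIM('a) * u x)"

(* u solves (-\<Delta>)^{n/2} u = |x|^(n alpha) e^(n u) in R^n, n = DIM('a), and \<Lambda> < \<infinity> *)
definition P0_solution :: "real \<Rightarrow> ('a::euclidean_space \<Rightarrow> real) \<Rightarrow> bool" where
  "P0_solution \<alpha> u \<longleftrightarrow>
     integrable lborel (rhs \<alpha> u) \<and>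
     (if even DIM('a) then
        locally_integrable u \<and>
        (\<forall>\<phi>. test_fun \<phi> \<longrightarrow>
           integrable lborel (\<lambda>x. u x * frac_lap (real DIM('a) / 2) \<phi> x) \<and>
           (LINT x|lborel. u x * frac_lap (real DIM('a) / 2) \<phi> x) = (LINT x|lborel. rhs \<alpha> u x * \<phi> x))
      else
        u \<in> borel_measurable lborel \<and> L_s (real DIM('a) / 2) u \<and>
        (\<forall>\<phi>. schwartz \<phi> \<longrightarrow>
           integrable lborel (\<lambda>x. u x * frac_lap (real DIM('a) / 2) \<phi> x) \<and>
           (LINT x|lborel. u x * frac_lap (real DIM('a) / 2) \<phi> x) = (LINT x|lborel. rhs \<alpha> u x * \<phi> x)))"

(* |S^n| = volume of unit n-sphere in R^{n+1} *)
definition sphere_vol :: "nat \<Rightarrow> real" where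
  "sphere_vol n = 2 * pi powr ((real n + 1) / 2) / Gamma ((real n + 1) / 2)"

definition gamma_n :: "nat \<Rightarrow> real" where
  "gamma_n n = fact (n - 1) / 2 * sphere_vol n"

definition Lambda1 :: "nat \<Rightarrow> real" where
  "Lambda1 n = fact (n - 1) * sphere_vol n"

definition radial :: "('a::real_normed_vector \<Rightarrow> real) \<Rightarrow> bool" where
  "radial u \<longleftrightarrow> (\<forall>x y. norm x = norm y \<longrightarrow> u x = u y)"

definition normal_solution :: "real \<Rightarrow> ('a::euclidean_space \<Rightarrow> real) \<Rightarrow> bool" where
  "normal_solution \<alpha> u \<longleftrightarrow> P0_solution \<alpha> u \<and>
     (\<exists>c. \<forall>x. integrable lborel (\<lambda>y. ln ((1 + norm y) / norm (x - y)) * rhs \<alpha> u y) \<and>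
        u x = 1 / gamma_n DIM('a) * (LINT y|lborel. ln ((1 + norm y) / norm (x - y)) * rhs \<alpha> u y) + c)"

end

theory Submission
  imports Defs "HOL-Probability.Probability" "HOL-Complex_Analysis.Complex_Analysis"
begin

text \<open>
  Solutions are sought in the form \<open>u = - p / \<gamma>\<^sub>n - e |x|^2\<close> with \<open>e \<ge> 0\<close>, where \<open>f = rhs \<alpha> u\<close> is a radial
  density and \<open>p x = \<integral> ln (|x - y| / |y|) f y dy\<close> its logarithmic potential. For radial \<open>f\<close> of mass \<open>M\<close>, averaging the
  logarithm over circles gives \<open>0 \<le> p (l x) - p x \<le> M ln l\<close> for \<open>l \<ge> 1\<close>. This monotonicity makes the self-consistent
  densities compact: a discretised problem, in which \<open>e\<close> is an additional unknown that grows only while the mass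
  exceeds \<open>\<Lambda>\<close>, is solved by Brouwer's theorem, and in the limit the mass is at most \<open>\<Lambda>\<close>, with equality if \<open>e > 0\<close>.

  The Pohozaev identity, obtained by comparing \<open>f\<close> with its dilations, shows that \<open>M \<ge> \<Lambda>\<^sub>1 (1 + \<alpha>)\<close> if \<open>e = 0\<close> and
  \<open>M < \<Lambda>\<^sub>1 (1 + \<alpha>)\<close> if \<open>e > 0\<close>. Hence \<open>M = \<Lambda>\<close> in all cases, and \<open>e = 0\<close> at the critical value, where \<open>u\<close> is normal.

  That \<open>u\<close> solves the equation reduces to facts about \<open>\<psi> = (-\<Delta>)^(n/2) \<phi>\<close> for Schwartz \<open>\<phi>\<close>: \<open>(1 + |x|^2) \<psi>\<close> is integrable
  (this needs \<open>n > 2\<close>), the integrals of \<open>\<psi>\<close> and \<open>|x|^2 \<psi>\<close> vanish, and \<open>\<integral> ln |x - y| \<psi> x dx = - \<gamma>\<^sub>n \<phi> y\<close>. The decay comes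
  from writing \<open>|\<xi>|^n\<close> as an integral of powers of \<open>1 - exp (- t |\<xi>|^2)\<close>, and the identities from pairing \<open>\<psi>\<close> with Gaussians
  and integrating over their width.
\<close>

text \<open>The potential is normalised by p(0) = 0, so u(0) = 0 and the mass is tuned by e, not by
  an additive constant. Dilations u(l x) + (1 + \<alpha>) ln l keep the mass and the form of u,
  hence nothing is lost. As p and e are nonnegative, every density lies below |x|^(n \<alpha>), a
  common majorant on balls. The obstacle is infinity: if e tends to 0, mass may escape and Fatou
  yields only an upper bound, which the Pohozaev lower bound turns into equality; if e stays
  positive, a Gaussian majorant excludes the loss. The quadratic term can be used because
  (-\<Delta>)^(n/2) annihilates |x|^2 for n > 2. It alters the density but not the equation. The
  potential is never differentiated: dilation estimates replace equicontinuity, and the Pohozaev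
  relations come from difference quotients in the dilation factor. Integrals of radial powers are
  reduced to Gaussians and Gamma integrals, and spherical means to rotations of a single plane,
  where the mean of the logarithm is explicit by Cauchy's formula.\<close>

lemma nn_integral_lborel_affine:
  fixes f :: "'a::euclidean_space \<Rightarrow> ennreal"
  assumes [measurable]: "f \<in> borel_measurable borel" and c: "c \<noteq> 0"
  shows "(\<integral>\<^sup>+x. f x \<partial>lborel) = ennreal (\<bar>c\<bar> ^ DIM('a)) * (\<integral>\<^sup>+x. f (t + c *\<^sub>R x) \<partial>lborel)"
  by (subst lborel_affine[OF c, of t])
     (simp add: nn_integral_density nn_integral_distr nn_integral_cmult ennreal_power)

lemma nn_integral_lborel_shift:
  fixes f :: "'a::euclidean_space \<Rightarrow> ennreal"
  assumes [measurable]: "f \<in> borel_measurable borel"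
  shows "(\<integral>\<^sup>+x. f (t + x) \<partial>lborel) = (\<integral>\<^sup>+x. f x \<partial>lborel)"
    and "(\<integral>\<^sup>+x. f (t - x) \<partial>lborel) = (\<integral>\<^sup>+x. f x \<partial>lborel)"
  using nn_integral_lborel_affine[of f 1 t] nn_integral_lborel_affine[of f "-1" t] by simp_all

lemma integrable_lborel_affine_iff:
  fixes f :: "'a::euclidean_space \<Rightarrow> 'b::{banach, second_countable_topology}"
  assumes [measurable]: "f \<in> borel_measurable borel" and c: "c \<noteq> 0"
  shows "integrable lborel (\<lambda>x. f (t + c *\<^sub>R x)) \<longleftrightarrow> integrable lborel f"
proof -
  have "(\<integral>\<^sup>+x. ennreal (norm (f x)) \<partial>lborel)
      = ennreal (\<bar>c\<bar> ^ DIM('a)) * (\<integral>\<^sup>+x. ennreal (norm (f (t + c *\<^sub>R x))) \<partial>lborel)"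
    by (rule nn_integral_lborel_affine) (use c in auto)
  then show ?thesis
    using c unfolding integrable_iff_bounded by (auto simp: ennreal_mult_less_top)
qed

lemma integral_lborel_affine:
  fixes f :: "'a::euclidean_space \<Rightarrow> 'b::{banach, second_countable_topology}"
  assumes [measurable]: "f \<in> borel_measurable borel" and c: "c \<noteq> 0"
  shows "(\<integral>x. f x \<partial>lborel) = \<bar>c\<bar> ^ DIM('a) *\<^sub>R (\<integral>x. f (t + c *\<^sub>R x) \<partial>lborel)"
  by (subst lborel_affine[OF c, of t])
     (subst integral_density; simp add: integral_distr)

lemma integral_lborel_shift:
  fixes f :: "'a::euclidean_space \<Rightarrow> 'b::{banach, second_countable_topology}"
  assumes [measurable]: "f \<in> borel_measurable borel"
  shows "(\<integral>x. f (t + x) \<partial>lborel) = (\<integral>x. f x \<partial>lborel)"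
    and "(\<integral>x. f (t - x) \<partial>lborel) = (\<integral>x. f x \<partial>lborel)"
  using integral_lborel_affine[of f 1 t] integral_lborel_affine[of f "-1" t] by simp_all

lemma integrable_lborel_shift:
  fixes f :: "'a::euclidean_space \<Rightarrow> 'b::{banach, second_countable_topology}"
  assumes "integrable lborel f"
  shows "integrable lborel (\<lambda>x. f (t + x))" "integrable lborel (\<lambda>x. f (t - x))"
  using integrable_lborel_affine_iff[of f 1 t] integrable_lborel_affine_iff[of f "-1" t]
    borel_measurable_integrable[OF assms] assms by simp_all

subsection \<open>Gaussian integrals\<close>

text \<open>This is the characteristic function of the standard normal law after the substitution
  \<open>sqrt (2 * t) * x\<close>, which turns its density into a multiple of exp (- t x^2) and the
  frequency s into y.\<close>

lemma gauss_fourier_real: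
  fixes y :: real
  assumes t: "0 < t"
  shows "has_bochner_integral lborel (\<lambda>x. complex_of_real (exp (- t * x^2)) * cis (x * y))
           (complex_of_real (sqrt (pi / t) * exp (- (y^2) / (4 * t))))"
proof -
  define s where "s = y / sqrt (2 * t)"
  define h where "h x = std_normal_density x *\<^sub>R cis (s * x)" for x :: real
  have st: "sqrt (2 * t) > 0" using t by simp
  interpret real_distribution std_normal_distribution by (rule real_dist_normal_dist)
  have [measurable]: "h \<in> borel_measurable borel"
    unfolding h_def by (intro borel_measurable_continuous_onI continuous_intros)
      (auto simp: normal_density_def intro!: continuous_intros)
  have int_cis: "integrable std_normal_distribution (\<lambda>x. iexp (s * x))"
    by (rule integrable_iexp) simp_all
  then have inth: "integrable lborel h"
    by (subst (asm) integrable_density) (auto simp: h_def[abs_def] cis_conv_exp intro: normal_density_nonneg)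
  have "(\<integral>x. h x \<partial>lborel) = char std_normal_distribution s"
    unfolding char_def h_def
    by (subst integral_density) (auto simp: cis_conv_exp intro: normal_density_nonneg)
  also have "\<dots> = complex_of_real (exp (- (s^2) / 2))"
    by (simp add: char_std_normal_distribution)
  finally have "has_bochner_integral lborel h (complex_of_real (exp (- (s^2) / 2)))"
    using inth by (simp add: has_bochner_integral_iff)
  from this[unfolded lborel_has_bochner_integral_real_affine_iff[OF less_imp_neq[OF st, symmetric], of h _ 0]]
  have 1: "has_bochner_integral lborel (\<lambda>x. h (sqrt (2 * t) * x)) (complex_of_real (exp (- (s^2) / 2)) /\<^sub>R sqrt (2 * t))"
    using t by simp
  have 2: "h (sqrt (2 * t) * x) = complex_of_real (1 / sqrt (2 * pi)) * (complex_of_real (exp (- t * x^2)) * cis (x * y))" for x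
    using st t by (simp add: h_def normal_density_def s_def power_mult_distrib scaleR_conv_of_real mult.commute)
  have "has_bochner_integral lborel (\<lambda>x. complex_of_real (sqrt (2 * pi)) * h (sqrt (2 * t) * x))
     (complex_of_real (sqrt (2 * pi)) * (complex_of_real (exp (- (s^2) / 2)) /\<^sub>R sqrt (2 * t)))"
    using 1 by (rule has_bochner_integral_mult_right)
  also have "(\<lambda>x. complex_of_real (sqrt (2 * pi)) * h (sqrt (2 * t) * x)) = (\<lambda>x. complex_of_real (exp (- t * x^2)) * cis (x * y))"
    by (rule ext, subst 2) (simp add: mult.assoc[symmetric])
  also have "complex_of_real (sqrt (2 * pi)) * (complex_of_real (exp (- (s^2) / 2)) /\<^sub>R sqrt (2 * t))
     = complex_of_real (sqrt (pi / t) * exp (- (y^2) / (4 * t)))"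
  proof -
    have "s^2 / 2 = y^2 / (4 * t)" using t by (simp add: s_def power_divide)
    moreover have "sqrt (2 * pi) / sqrt (2 * t) = sqrt (pi / t)"
      by (simp add: real_sqrt_divide real_sqrt_mult)
    ultimately show ?thesis
      by (simp add: scaleR_conv_of_real flip: of_real_mult of_real_inverse) (simp add: field_simps)
  qed
  finally show ?thesis .
qed

text \<open>Both the Gaussian and the character factor over the coordinates, and
  \<open>lborel\<close> is the image of a product measure, so the one-dimensional values
  multiply.\<close>

lemma gauss_fourier:
  fixes \<xi> :: "'a::euclidean_space"
  assumes t: "0 < t"
  shows "has_bochner_integral lborel (\<lambda>x. complex_of_real (exp (- t * (norm x)^2)) * cis (x \<bullet> \<xi>))
           (complex_of_real ((pi / t) powr (DIM('a) / 2) * exp (- ((norm \<xi>)^2) / (4 * t))))"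
proof -
  define F where "F b x = complex_of_real (exp (- t * x^2)) * cis (x * (\<xi> \<bullet> b))" for b x
  have F: "has_bochner_integral lborel (F b) (complex_of_real (sqrt (pi / t) * exp (- ((\<xi> \<bullet> b)^2) / (4 * t))))" for b
    unfolding F_def by (rule gauss_fourier_real[OF t])
  have [measurable]: "F b \<in> borel_measurable borel" for b
    using F[of b] by (auto simp: has_bochner_integral_iff dest: borel_measurable_integrable)
  interpret product_sigma_finite "\<lambda>_::'a. lborel :: real measure" ..
  have nrm: "(norm x)^2 = (\<Sum>b\<in>Basis. (x \<bullet> b)^2)" for x :: 'a
    unfolding power2_norm_eq_inner by (subst euclidean_inner) (simp add: power2_eq_square)
  have cisprod: "cis (\<Sum>b\<in>A. g b) = (\<Prod>b\<in>A. cis (g b))" if "finite A" for A :: "'a set" and g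
    using that by (induction A) (auto simp: cis_mult[symmetric])
  have eq: "complex_of_real (exp (- t * (norm x)^2)) * cis (x \<bullet> \<xi>) = (\<Prod>b\<in>Basis. F b (x \<bullet> b))" for x
    unfolding F_def prod.distrib nrm
    by (subst euclidean_inner) (simp add: cisprod sum_distrib_left exp_sum flip: sum_negf)
  have proj: "(\<Sum>b\<in>Basis. f b *\<^sub>R b) \<bullet> c = f c" if "c \<in> Basis" for f and c :: 'a
    using that by (simp add: inner_sum_left inner_Basis if_distrib cong: if_cong)
  have meas: "(\<lambda>f. \<Sum>b\<in>Basis. f b *\<^sub>R b) \<in> measurable (\<Pi>\<^sub>M b\<in>Basis. lborel) (borel :: 'a measure)"
    by measurable
  have pi: "has_bochner_integral (\<Pi>\<^sub>M b\<in>Basis. lborel) (\<lambda>f. \<Prod>b\<in>Basis. F b (f b))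
     (\<Prod>b\<in>Basis. complex_of_real (sqrt (pi / t) * exp (- ((\<xi> \<bullet> b)^2) / (4 * t))))"
    using product_integral_prod[of "Basis :: 'a set" F] product_integrable_prod[of "Basis :: 'a set" F] F
    by (auto simp: has_bochner_integral_iff)
  have "has_bochner_integral lborel (\<lambda>x::'a. \<Prod>b\<in>Basis. F b (x \<bullet> b)) (\<Prod>b\<in>Basis. complex_of_real (sqrt (pi / t) * exp (- ((\<xi> \<bullet> b)^2) / (4 * t))))"
    unfolding lborel_eq[where 'a='a]
    using pi by (intro has_bochner_integral_distr[OF _ meas]) (auto simp: proj cong: prod.cong)
  also have "(\<Prod>b\<in>Basis. complex_of_real (sqrt (pi / t) * exp (- ((\<xi> \<bullet> b)^2) / (4 * t))))
     = complex_of_real (sqrt (pi / t) ^ DIM('a) * exp (- ((norm \<xi>)^2) / (4 * t)))"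
    unfolding nrm of_real_prod[symmetric] prod.distrib
    by (simp add: exp_sum[symmetric] sum_negf sum_divide_distrib)
  also have "sqrt (pi / t) ^ DIM('a) = (pi / t) powr (DIM('a) / 2)"
    using t by (simp add: powr_half_sqrt[symmetric] powr_powr powr_realpow[symmetric] del: powr_half_sqrt)
  finally show ?thesis unfolding eq .
qed

lemma gauss_integral:
  assumes t: "0 < t"
  shows "has_bochner_integral lborel (\<lambda>x::'a::euclidean_space. exp (- t * (norm x)^2)) ((pi / t) powr (DIM('a) / 2))"
proof -
  have "has_bochner_integral lborel (\<lambda>x::'a. complex_of_real (exp (- t * (norm x)^2))) (complex_of_real ((pi / t) powr (DIM('a) / 2)))"
    using gauss_fourier[OF t, of "0::'a"] by simp
  then show ?thesis using integrable_Re[of lborel "\<lambda>x::'a. complex_of_real (exp (- t * (norm x)^2))"]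
    unfolding has_bochner_integral_iff by simp
qed

lemma gauss_nn_integral:
  assumes t: "0 < t"
  shows "(\<integral>\<^sup>+x. ennreal (exp (- t * (norm (x::'a::euclidean_space))^2)) \<partial>lborel) = ennreal ((pi / t) powr (DIM('a) / 2))"
  using gauss_integral[OF t, where 'a='a] by (subst nn_integral_eq_integral) (auto simp: has_bochner_integral_iff)

subsection \<open>Invariance under linear isometries\<close>

text \<open>Determinant-free argument. The left side times the mass G of a Gaussian is a double
  integral of f (y + R x) g y, by translation invariance and surjectivity of R. Shifting y by R x
  moves the isometry into the Gaussian, which depends on the norm only, and G, being finite and
  positive, cancels.\<close>

lemma nn_integral_isometry:
  fixes R :: "'a::euclidean_space \<Rightarrow> 'a"
  assumes R: "linear R" "\<And>x. norm (R x) = norm x" and [measurable]: "f \<in> borel_measurable borel"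
  shows "(\<integral>\<^sup>+x. f (R x) \<partial>lborel) = (\<integral>\<^sup>+x. f x \<partial>lborel)"
proof -
  define g where "g x = ennreal (exp (- 1 * (norm x)^2))" for x :: 'a
  define G where "G = (\<integral>\<^sup>+x. g x \<partial>lborel)"
  have G: "G = ennreal ((pi / 1) powr (DIM('a) / 2))"
    unfolding G_def g_def by (rule gauss_nn_integral) simp
  have [measurable]: "R \<in> borel_measurable borel"
    using R(1) by (intro borel_measurable_continuous_onI linear_continuous_on linear_conv_bounded_linear[THEN iffD1])
  have [measurable]: "g \<in> borel_measurable borel" unfolding g_def by measurable
  have "inj R" using R by (intro linear_injective_0[THEN iffD2]) (auto, metis norm_eq_zero)
  then have "surj R" using R(1) linear_injective_imp_surjective by blast
  have R_diff: "R (x - y) = R x - R y" and R_add: "R (x + y) = R x + R y" for x y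
    using R(1) by (auto simp: linear_diff linear_add)
  have 1: "(\<integral>\<^sup>+x. f (R x) \<partial>lborel) = (\<integral>\<^sup>+x. f (y + R x) \<partial>lborel)" for y
  proof -
    obtain z where "y = R z" using \<open>surj R\<close> by auto
    then show ?thesis using nn_integral_lborel_shift(1)[of "\<lambda>x. f (R x)" z] by (simp add: R_add)
  qed
  have 2: "(\<integral>\<^sup>+x. g (y - R x) \<partial>lborel) = G" for y
  proof -
    obtain z where z: "y = R z" using \<open>surj R\<close> by auto
    have "g (y - R x) = g (z - x)" for x by (simp add: g_def z R_diff[symmetric] R(2))
    then show ?thesis using nn_integral_lborel_shift(2)[of g z] by (simp add: G_def)
  qed
  have "(\<integral>\<^sup>+x. f (R x) \<partial>lborel) * G = (\<integral>\<^sup>+y. (\<integral>\<^sup>+x. f (y + R x) * g y \<partial>lborel) \<partial>lborel)"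
    by (simp add: nn_integral_multc 1[symmetric] nn_integral_cmult G_def)
  also have "\<dots> = (\<integral>\<^sup>+x. (\<integral>\<^sup>+y. f (y + R x) * g y \<partial>lborel) \<partial>lborel)"
    by (rule lborel_pair.Fubini') measurable
  also have "\<dots> = (\<integral>\<^sup>+x. (\<integral>\<^sup>+y. f y * g (y - R x) \<partial>lborel) \<partial>lborel)"
  proof (rule nn_integral_cong)
    fix x
    show "(\<integral>\<^sup>+y. f (y + R x) * g y \<partial>lborel) = (\<integral>\<^sup>+y. f y * g (y - R x) \<partial>lborel)"
      using nn_integral_lborel_shift(1)[of "\<lambda>y. f y * g (y - R x)" "R x"] by (simp add: add.commute)
  qed
  also have "\<dots> = (\<integral>\<^sup>+y. (\<integral>\<^sup>+x. f y * g (y - R x) \<partial>lborel) \<partial>lborel)"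
    by (rule lborel_pair.Fubini') measurable
  also have "\<dots> = (\<integral>\<^sup>+y. f y \<partial>lborel) * G"
    by (simp add: nn_integral_cmult nn_integral_multc 2)
  finally show ?thesis
    unfolding G by (subst (asm) (1 2) mult.commute, subst (asm) ennreal_mult_cancel_left) simp
qed

lemma distr_lborel_isometry:
  fixes R :: "'a::euclidean_space \<Rightarrow> 'a"
  assumes R: "linear R" "\<And>x. norm (R x) = norm x"
  shows "distr lborel borel R = lborel"
proof (rule measure_eqI)
  have m[measurable]: "R \<in> borel_measurable borel"
    using R(1) by (intro borel_measurable_continuous_onI linear_continuous_on linear_conv_bounded_linear[THEN iffD1])
  fix A assume "A \<in> sets (distr lborel borel R)"
  then have [measurable]: "A \<in> sets borel" by simp
  show "emeasure (distr lborel borel R) A = emeasure lborel A"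
    using nn_integral_isometry[OF R, of "indicator A"] nn_integral_distr[OF m[folded measurable_lborel2], of "indicator A"]
    by simp
qed simp

lemma integral_isometry:
  fixes R :: "'a::euclidean_space \<Rightarrow> 'a" and f :: "'a \<Rightarrow> 'b::{banach, second_countable_topology}"
  assumes R: "linear R" "\<And>x. norm (R x) = norm x" and [measurable]: "f \<in> borel_measurable borel"
  shows "(\<integral>x. f (R x) \<partial>lborel) = (\<integral>x. f x \<partial>lborel)"
    and "integrable lborel (\<lambda>x. f (R x)) \<longleftrightarrow> integrable lborel f"
proof -
  have m[measurable]: "R \<in> borel_measurable borel"
    using R(1) by (intro borel_measurable_continuous_onI linear_continuous_on linear_conv_bounded_linear[THEN iffD1])
  show "(\<integral>x. f (R x) \<partial>lborel) = (\<integral>x. f x \<partial>lborel)"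
    using integral_distr[of R lborel borel f] by (simp add: distr_lborel_isometry[OF R])
  show "integrable lborel (\<lambda>x. f (R x)) \<longleftrightarrow> integrable lborel f"
    using integrable_distr_eq[of R lborel borel f] by (simp add: distr_lborel_isometry[OF R])
qed

subsection \<open>Integrability of radial powers\<close>

lemma gamma_nn_integral:
  assumes b: "0 < b" and c: "0 < c"
  shows "(\<integral>\<^sup>+t. ennreal (indicator {0..} t * t powr (b - 1) * exp (- c * t)) \<partial>lborel)
      = ennreal (Gamma b * c powr (- b))" (is "?I = _")
proof -
  have "ennreal (Gamma b) = (\<integral>\<^sup>+t. ennreal (indicator {0..} t * t powr (b - 1) / exp t) \<partial>lborel)"
    using b by (rule Gamma_conv_nn_integral_real)
  also have "\<dots> = ennreal c * (\<integral>\<^sup>+t. ennreal (indicator {0..} (0 + c * t) * (0 + c * t) powr (b - 1) / exp (0 + c * t)) \<partial>lborel)"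
    using c nn_integral_real_affine[of "\<lambda>t. ennreal (indicator {0..} t * t powr (b - 1) / exp t)" c 0] by simp
  also have "\<dots> = ennreal c * (\<integral>\<^sup>+t. ennreal (c powr (b - 1)) * ennreal (indicator {0..} t * t powr (b - 1) * exp (- c * t)) \<partial>lborel)"
    using c by (intro arg_cong2[where f="(*)"] nn_integral_cong refl)
      (auto simp: indicator_def zero_le_mult_iff powr_mult exp_minus field_simps simp flip: ennreal_mult)
  also have "\<dots> = ennreal (c powr b) * ?I"
    using c by (subst nn_integral_cmult) (auto simp: powr_diff mult.assoc[symmetric] simp flip: ennreal_mult)
  finally have "ennreal (c powr (- b)) * ennreal (Gamma b) = ennreal (c powr (- b)) * (ennreal (c powr b) * ?I)"
    by simp
  also have "\<dots> = ?I"
    using c by (simp add: mult.assoc[symmetric] powr_minus flip: ennreal_mult)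
  finally show ?thesis using b c by (simp add: ennreal_mult mult.commute)
qed

text \<open>Replaces polar coordinates: |y|^(-2b) is a Gamma integral of exp (- t |y|^2), the
  y-integral is Gaussian, and the resulting (c + t)^(-n/2) is again a Gamma integral, in s.
  Integrating t out leaves a Gamma integral with parameter n/2 - b, which is where b < n/2 is
  used.\<close>

lemma integrable_norm_powr_gauss_neg:
  assumes b: "0 < b" "b < DIM('a::euclidean_space) / 2" and c: "0 < c"
  shows "integrable lborel (\<lambda>y::'a. norm y powr (- 2 * b) * exp (- c * (norm y)^2))"
proof -
  let ?n = "DIM('a) / 2"
  define g where "g b t = indicator {0..} t * t powr (b - 1)" for b t :: real
  have g0: "g b t \<ge> 0" for b t unfolding g_def by auto
  have [measurable]: "(\<lambda>t. g b t) \<in> borel_measurable borel" for b unfolding g_def by measurable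
  have n0: "?n > 0" by simp
  have e1: "exp (- (c + t) * N) = exp (- N * t) * exp (- c * N)"
    and e2: "exp (- (c + t) * N) = exp (- c * N) * exp (- N * t)" for t N
    by (simp_all add: exp_add[symmetric] algebra_simps)
  \<comment> \<open>Only an inequality: at y = 0 the left integrand is 0, since
    \<open>0 powr a = 0\<close>. The factor \<open>Gamma ?n\<close> is put in front so that (c +
    t)^(-n/2) can be opened up as a second Gamma integral.\<close>
  have "ennreal (Gamma ?n) * (ennreal (Gamma b) * (\<integral>\<^sup>+y. ennreal (norm (y::'a) powr (- 2 * b) * exp (- c * (norm y)^2)) \<partial>lborel))
     \<le> ennreal (Gamma ?n) * (\<integral>\<^sup>+y. (\<integral>\<^sup>+t. ennreal (g b t * exp (- (c + t) * (norm (y::'a))^2)) \<partial>lborel) \<partial>lborel)"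
  proof -
    have "ennreal (Gamma b) * ennreal (norm y powr (- 2 * b) * exp (- c * (norm y)^2))
        \<le> (\<integral>\<^sup>+t. ennreal (g b t * exp (- (c + t) * (norm y)^2)) \<partial>lborel)" for y :: 'a
    proof (cases "y = 0")
      case False
      have "(\<integral>\<^sup>+t. ennreal (g b t * exp (- (c + t) * (norm y)^2)) \<partial>lborel)
         = (\<integral>\<^sup>+t. ennreal (g b t * exp (- ((norm y)^2) * t)) * ennreal (exp (- c * (norm y)^2)) \<partial>lborel)"
        using g0 by (intro nn_integral_cong, subst e1) (simp add: ennreal_mult[symmetric] mult.assoc)
      also have "\<dots> = ennreal (Gamma b * ((norm y)^2) powr (- b)) * ennreal (exp (- c * (norm y)^2))"
        using False gamma_nn_integral[OF b(1), of "(norm y)^2"]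
        by (subst nn_integral_multc) (auto simp: g_def)
      also have "((norm y)^2) powr (- b) = norm y powr (- 2 * b)"
        using False by (simp add: power2_eq_square powr_mult powr_add[symmetric])
      finally show ?thesis
        using b(1) by (simp flip: ennreal_mult add: mult.assoc)
    qed simp
    then show ?thesis
      by (subst nn_integral_cmult[symmetric]) (auto intro!: mult_left_mono nn_integral_mono)
  qed
  also have "(\<integral>\<^sup>+y. (\<integral>\<^sup>+t. ennreal (g b t * exp (- (c + t) * (norm (y::'a))^2)) \<partial>lborel) \<partial>lborel)
     = (\<integral>\<^sup>+t. (\<integral>\<^sup>+y. ennreal (g b t * exp (- (c + t) * (norm (y::'a))^2)) \<partial>lborel) \<partial>lborel)"
    by (rule lborel_pair.Fubini') measurable
  also have "\<dots> = (\<integral>\<^sup>+t. ennreal (g b t * (pi / (c + t)) powr ?n) \<partial>lborel)"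
  proof (rule nn_integral_cong)
    fix t :: real
    show "(\<integral>\<^sup>+y. ennreal (g b t * exp (- (c + t) * (norm (y::'a))^2)) \<partial>lborel) = ennreal (g b t * (pi / (c + t)) powr ?n)"
    proof (cases "t \<ge> 0")
      case True
      have "(\<integral>\<^sup>+y. ennreal (g b t * exp (- (c + t) * (norm (y::'a))^2)) \<partial>lborel)
        = ennreal (g b t) * (\<integral>\<^sup>+y. ennreal (exp (- (c + t) * (norm (y::'a))^2)) \<partial>lborel)"
        using g0 by (subst nn_integral_cmult[symmetric]) (auto simp: ennreal_mult)
      then show ?thesis
        using True c g0 gauss_nn_integral[of "c + t", where 'a='a] by (simp add: ennreal_mult del: minus_add_distrib mult_minus_left)
    qed (simp add: g_def)
  qed
  also have "ennreal (Gamma ?n) * \<dots> = ennreal (pi powr ?n) * (\<integral>\<^sup>+t. (\<integral>\<^sup>+s. ennreal (g b t * (g ?n s * exp (- (c + t) * s))) \<partial>lborel) \<partial>lborel)"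
  proof -
    have "ennreal (Gamma ?n) * ennreal (g b t * (pi / (c + t)) powr ?n)
       = ennreal (pi powr ?n) * (\<integral>\<^sup>+s. ennreal (g b t * (g ?n s * exp (- (c + t) * s))) \<partial>lborel)" for t
    proof (cases "t \<ge> 0")
      case True
      have "(\<integral>\<^sup>+s. ennreal (g b t * (g ?n s * exp (- (c + t) * s))) \<partial>lborel) = ennreal (g b t) * ennreal (Gamma ?n * (c + t) powr (- ?n))"
      proof -
        have "(\<integral>\<^sup>+s. ennreal (g b t * (g ?n s * exp (- (c + t) * s))) \<partial>lborel)
            = (\<integral>\<^sup>+s. ennreal (g b t) * ennreal (g ?n s * exp (- (c + t) * s)) \<partial>lborel)"
          using g0 by (simp add: ennreal_mult)
        also have "\<dots> = ennreal (g b t) * (\<integral>\<^sup>+s. ennreal (g ?n s * exp (- (c + t) * s)) \<partial>lborel)"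
          by (rule nn_integral_cmult) measurable
        also have "(\<integral>\<^sup>+s. ennreal (g ?n s * exp (- (c + t) * s)) \<partial>lborel) = ennreal (Gamma ?n * (c + t) powr (- ?n))"
          unfolding g_def using True c by (intro gamma_nn_integral[OF n0]) simp
        finally show ?thesis .
      qed
      moreover have "(pi / (c + t)) powr ?n = pi powr ?n * (c + t) powr (- ?n)"
        using True c powr_divide[of pi "c + t" ?n] by (simp add: powr_minus_divide del: powr_divide)
      moreover have "ennreal A * ennreal (G * (P * C)) = ennreal P * (ennreal G * ennreal (A * C))"
        if "A \<ge> 0" "G \<ge> 0" "P \<ge> 0" "C \<ge> 0" for A G P C
        using that by (simp add: ennreal_mult ac_simps)
      moreover have "Gamma ?n \<ge> 0" using n0 by (intro less_imp_le Gamma_real_pos)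
      ultimately show ?thesis using g0 by (simp only: powr_ge_zero)
    qed (simp add: g_def)
    then show ?thesis by (simp add: nn_integral_cmult[symmetric])
  qed
  also have "(\<integral>\<^sup>+t. (\<integral>\<^sup>+s. ennreal (g b t * (g ?n s * exp (- (c + t) * s))) \<partial>lborel) \<partial>lborel)
     = (\<integral>\<^sup>+s. (\<integral>\<^sup>+t. ennreal (g b t * (g ?n s * exp (- (c + t) * s))) \<partial>lborel) \<partial>lborel)"
    by (rule lborel_pair.Fubini') measurable
  also have "\<dots> = (\<integral>\<^sup>+s. ennreal (Gamma b) * ennreal (g (?n - b) s * exp (- c * s)) \<partial>lborel)"
  proof (rule nn_integral_cong)
    fix s :: real
    show "(\<integral>\<^sup>+t. ennreal (g b t * (g ?n s * exp (- (c + t) * s))) \<partial>lborel) = ennreal (Gamma b) * ennreal (g (?n - b) s * exp (- c * s))"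
    proof (cases "s > 0")
      case True
      have "(\<integral>\<^sup>+t. ennreal (g b t * (g ?n s * exp (- (c + t) * s))) \<partial>lborel)
          = (\<integral>\<^sup>+t. ennreal (g ?n s * exp (- c * s)) * ennreal (g b t * exp (- s * t)) \<partial>lborel)"
        using g0 by (intro nn_integral_cong, subst e2) (simp add: ennreal_mult[symmetric] ac_simps)
      also have "\<dots> = ennreal (g ?n s * exp (- c * s)) * ennreal (Gamma b * s powr (- b))"
        using gamma_nn_integral[OF b(1) True] by (subst nn_integral_cmult) (auto simp: g_def)
      also have "\<dots> = ennreal (Gamma b) * ennreal (g (?n - b) s * exp (- c * s))"
      proof -
        have "g ?n s * s powr (- b) = g (?n - b) s"
          using True by (simp add: g_def powr_add[symmetric] algebra_simps)
        moreover have "ennreal (A * E) * ennreal (G * P) = ennreal G * ennreal (A * P * E)"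
          if "A \<ge> 0" "G \<ge> 0" "P \<ge> 0" "E \<ge> 0" for A G P E
          using that by (simp add: ennreal_mult ac_simps)
        moreover have "Gamma b \<ge> 0" using b by (intro less_imp_le Gamma_real_pos)
        ultimately show ?thesis using g0 by (simp only: powr_ge_zero exp_ge_zero)
      qed
      finally show ?thesis .
    next
      case False
      then show ?thesis by (auto simp: g_def indicator_def)
    qed
  qed
  also have "\<dots> = ennreal (Gamma b) * ennreal (Gamma (?n - b) * c powr (- (?n - b)))"
    using gamma_nn_integral[of "?n - b" c] b c by (subst nn_integral_cmult) (auto simp: g_def)
  finally have "ennreal (Gamma ?n) * (ennreal (Gamma b) * (\<integral>\<^sup>+y. ennreal (norm (y::'a) powr (- 2 * b) * exp (- c * (norm y)^2)) \<partial>lborel)) < \<infinity>"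
    by (rule order.strict_trans1) (simp add: ennreal_mult_less_top)
  moreover have "Gamma ?n > 0" "Gamma b > 0" using b n0 by (simp_all add: Gamma_real_pos)
  ultimately show ?thesis
    by (auto simp: integrable_iff_bounded ennreal_mult_less_top)
qed

lemma integrable_norm_powr_gauss:
  assumes a: "a > - real DIM('a::euclidean_space)" and c: "0 < c"
  shows "integrable lborel (\<lambda>y::'a. norm y powr a * exp (- c * (norm y)^2))"
proof (cases "a < 0")
  case True
  then show ?thesis using integrable_norm_powr_gauss_neg[of "- a / 2" c, where 'a='a] a c by simp
next
  case False
  \<comment> \<open>Half of the Gaussian absorbs the power: a ln r \<le> a r, and completing the
    square gives a r \<le> a^2 / (2 c) + (c / 2) r^2, whence the constant.\<close>
  have "integrable lborel (\<lambda>y::'a. exp (a^2 / (2 * c)) * exp (- (c / 2) * (norm y)^2))"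
    using gauss_integral[of "c/2", where 'a='a] c by (simp add: has_bochner_integral_iff)
  then show ?thesis
  proof (rule Bochner_Integration.integrable_bound, goal_cases)
    case 2
    have "norm y powr a * exp (- c * (norm y)^2) \<le> exp (a^2 / (2 * c)) * exp (- (c / 2) * (norm y)^2)" for y :: 'a
    proof (cases "y = 0")
      case False
      have "a * ln (norm y) \<le> a * norm y"
        using False \<open>\<not> a < 0\<close> by (intro mult_left_mono) (auto intro: less_imp_le ln_less_self)
      also have "\<dots> \<le> a^2 / (2 * c) + (c / 2) * (norm y)^2"
      proof -
        have "0 \<le> (a - c * norm y)^2 / (2 * c)" using c by simp
        also have "\<dots> = a^2 / (2 * c) + (c / 2) * (norm y)^2 - a * norm y"
          using c by (simp add: power2_eq_square field_simps)
        finally show ?thesis by simp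
      qed
      finally have "a * ln (norm y) - c * (norm y)^2 \<le> a^2 / (2 * c) - (c / 2) * (norm y)^2" by simp
      then have "exp (a * ln (norm y) - c * (norm y)^2) \<le> exp (a^2 / (2 * c) - (c / 2) * (norm y)^2)" by simp
      then show ?thesis using False by (simp add: powr_def exp_add[symmetric])
    qed simp
    then show ?case by simp
  qed simp
qed

lemma integrable_norm_powr_ball:
  assumes a: "a > - real DIM('a::euclidean_space)"
  shows "integrable lborel (\<lambda>y::'a. norm y powr a * indicator (cball 0 r) y)"
proof (rule Bochner_Integration.integrable_bound)
  show "integrable lborel (\<lambda>y::'a. exp (r^2) * (norm y powr a * exp (- 1 * (norm y)^2)))"
    using integrable_norm_powr_gauss[OF a, of 1] by simp
  have "norm y powr a \<le> exp (r^2) * (norm y powr a * exp (- 1 * (norm y)^2))" if "norm y \<le> r" for y :: 'a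
  proof -
    have "(norm y)^2 \<le> r^2" using that by (intro power_mono) auto
    then have "1 \<le> exp (r^2) * exp (- ((norm y)^2))" by (simp flip: exp_add)
    then have "norm y powr a * 1 \<le> norm y powr a * (exp (r^2) * exp (- ((norm y)^2)))"
      by (intro mult_left_mono) auto
    then show ?thesis by (simp add: ac_simps)
  qed
  moreover have [measurable]: "cball 0 r \<in> sets (borel :: 'a measure)" by simp
  ultimately show "AE y in lborel. norm (norm y powr a * indicator (cball 0 r) y) \<le> norm (exp (r^2) * (norm (y::'a) powr a * exp (- 1 * (norm y)^2)))"
    by (auto split: split_indicator)
  show "(\<lambda>y. norm y powr a * indicator (cball 0 r) y) \<in> borel_measurable (lborel :: 'a measure)"
    by (intro borel_measurable_times borel_measurable_indicator) auto
qed

text \<open>Same device: the power is a Gamma integral of Gaussians, and after the y-integration a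
  Gamma integral with parameter s - n/2 remains.\<close>

lemma integrable_one_plus_norm_sq_powr:
  assumes s: "s > DIM('a::euclidean_space) / 2"
  shows "integrable lborel (\<lambda>y::'a. (1 + (norm y)^2) powr (- s))"
proof -
  let ?n = "DIM('a) / 2"
  have s0: "s > 0" using s by (rule order.strict_trans[rotated]) simp
  define g where "g b t = indicator {0..} t * t powr (b - 1)" for b t :: real
  have g0: "g b t \<ge> 0" for b t unfolding g_def by auto
  have [measurable]: "(\<lambda>t. g b t) \<in> borel_measurable borel" for b unfolding g_def by measurable
  have e1: "exp (- (1 + N) * t) = exp (- t) * exp (- t * N)" for t N :: real
    by (simp add: exp_add[symmetric] algebra_simps)
  have pos: "1 + (norm y)^2 > 0" for y :: 'a by (simp add: add_pos_nonneg)
  have "ennreal (Gamma s) * (\<integral>\<^sup>+y. ennreal ((1 + (norm (y::'a))^2) powr (- s)) \<partial>lborel)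
    = (\<integral>\<^sup>+y. (\<integral>\<^sup>+t. ennreal (g s t * exp (- (1 + (norm (y::'a))^2) * t)) \<partial>lborel) \<partial>lborel)"
    using gamma_nn_integral[OF s0 pos] s0
    by (subst nn_integral_cmult[symmetric]) (auto simp: g_def ennreal_mult)
  also have "\<dots> = (\<integral>\<^sup>+t. (\<integral>\<^sup>+y. ennreal (g s t * exp (- (1 + (norm (y::'a))^2) * t)) \<partial>lborel) \<partial>lborel)"
    by (rule lborel_pair.Fubini') measurable
  also have "\<dots> = (\<integral>\<^sup>+t. ennreal (pi powr ?n) * ennreal (g (s - ?n) t * exp (- 1 * t)) \<partial>lborel)"
  proof (rule nn_integral_cong_AE)
    show "AE t in lborel. (\<integral>\<^sup>+y. ennreal (g s t * exp (- (1 + (norm (y::'a))^2) * t)) \<partial>lborel) = ennreal (pi powr ?n) * ennreal (g (s - ?n) t * exp (- 1 * t))"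
      using AE_lborel_singleton[of 0]
    proof eventually_elim
      case (elim t)
      show ?case
      proof (cases "t > 0")
        case True
        have "(\<integral>\<^sup>+y. ennreal (g s t * exp (- (1 + (norm (y::'a))^2) * t)) \<partial>lborel)
           = (\<integral>\<^sup>+y. ennreal (g s t * exp (- t)) * ennreal (exp (- t * (norm (y::'a))^2)) \<partial>lborel)"
          using g0 by (intro nn_integral_cong, subst e1) (simp add: ennreal_mult[symmetric] mult.assoc)
        also have "\<dots> = ennreal (g s t * exp (- t)) * ennreal ((pi / t) powr ?n)"
          by (subst nn_integral_cmult) (auto simp: gauss_nn_integral[OF True, where 'a='a, simplified])
        also have "\<dots> = ennreal (g s t * exp (- t) * (pi / t) powr ?n)"
          using g0 by (simp add: ennreal_mult[symmetric])
        also have "g s t * exp (- t) * (pi / t) powr ?n = pi powr ?n * (g (s - ?n) t * exp (- 1 * t))"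
        proof -
          have p: "t powr (s - 1) = t powr ?n * t powr (s - ?n - 1)" by (simp flip: powr_add)
          have q: "(pi / t) powr ?n = pi powr ?n / t powr ?n" using True by (simp add: powr_divide)
          show ?thesis unfolding g_def p q using True by (simp add: indicator_def)
        qed
        also have "ennreal \<dots> = ennreal (pi powr ?n) * ennreal (g (s - ?n) t * exp (- 1 * t))"
          using g0 by (simp add: ennreal_mult[symmetric])
        finally show ?thesis .
      qed (use elim in \<open>auto simp: g_def\<close>)
    qed
  qed
  also have "\<dots> = ennreal (pi powr ?n) * ennreal (Gamma (s - ?n) * 1 powr (- (s - ?n)))"
    using gamma_nn_integral[of "s - ?n" 1] s by (subst nn_integral_cmult) (auto simp: g_def)
  finally have "ennreal (Gamma s) * (\<integral>\<^sup>+y. ennreal ((1 + (norm (y::'a))^2) powr (- s)) \<partial>lborel) < \<infinity>"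
    by (simp add: ennreal_mult_less_top)
  then show ?thesis
    using Gamma_real_pos[OF s0] by (auto simp: integrable_iff_bounded ennreal_mult_less_top)
qed

subsection \<open>A fixed point theorem on the cube\<close>

text \<open>The cube is indexed by \<open>{..<n}\<close> instead of a type, since the number of unknowns grows with the discretisation.\<close>
lemma brouwer_cube_seq:
  fixes F :: "(nat \<Rightarrow> real) \<Rightarrow> nat \<Rightarrow> real" and n :: nat
  assumes F01: "\<And>x i. (\<And>j. j < n \<Longrightarrow> 0 \<le> x j \<and> x j \<le> 1) \<Longrightarrow> i < n \<Longrightarrow> 0 \<le> F x i \<and> F x i \<le> 1"
    and cont: "\<And>X x i. (\<And>k j. j < n \<Longrightarrow> 0 \<le> X k j \<and> X k j \<le> 1) \<Longrightarrow> (\<And>j. j < n \<Longrightarrow> (\<lambda>k. X k j) \<longlonglongrightarrow> x j)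
                 \<Longrightarrow> i < n \<Longrightarrow> (\<lambda>k. F (X k) i) \<longlonglongrightarrow> F x i"
  obtains x where "\<And>i. i < n \<Longrightarrow> 0 \<le> x i \<and> x i \<le> 1" "\<And>i. i < n \<Longrightarrow> F x i = x i"
proof -
  \<comment> \<open>Kuhn's labelling of the grid of mesh 1/p: label 0 marks a coordinate that F does
    not decrease. On the face \<open>x i = 0\<close> it is 0 because F is nonnegative; on the face
    \<open>x i = p\<close> it is 1 by decree, as \<open>kuhn_lemma\<close> demands.\<close>
  define label where "label p x i = (if x i < p \<and> real (x i) / real p \<le> F (\<lambda>j. real (x j) / real p) i then 0 else 1 :: nat)"
    for p :: nat and x :: "nat \<Rightarrow> nat" and i
  have grid: "0 \<le> real (x i) / real p \<and> real (x i) / real p \<le> 1" if "x i \<le> p" "0 < p" for x :: "nat \<Rightarrow> nat" and i p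
    using that by simp
  have "\<exists>q a b. (\<forall>i<n. q i < p) \<and> (\<forall>i<n. (\<forall>j<n. q j \<le> a i j \<and> a i j \<le> q j + 1) \<and> (\<forall>j<n. q j \<le> b i j \<and> b i j \<le> q j + 1)
      \<and> label p (a i) i = 0 \<and> label p (b i) i = 1)" if p: "0 < p" for p
  proof -
    have l0: "label p x i = 0" if "\<forall>i<n. x i \<le> p" "i < n" "x i = 0" for x i
      using that p F01[of "\<lambda>j. real (x j) / real p" i] grid[of x _ p] by (auto simp: label_def)
    obtain q where q: "\<forall>i<n. q i < p" and rs: "\<forall>i<n. \<exists>r s. (\<forall>j<n. q j \<le> r j \<and> r j \<le> q j + 1) \<and> (\<forall>j<n. q j \<le> s j \<and> s j \<le> q j + 1) \<and> label p r i \<noteq> label p s i"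
      by (rule kuhn_lemma[of p n "label p"]) (use p l0 in \<open>auto simp: label_def\<close>)
    have "\<exists>a b. (\<forall>j<n. q j \<le> a j \<and> a j \<le> q j + 1) \<and> (\<forall>j<n. q j \<le> b j \<and> b j \<le> q j + 1) \<and> label p a i = 0 \<and> label p b i = 1"
      if i: "i < n" for i
    proof -
      obtain r s where r: "\<forall>j<n. q j \<le> r j \<and> r j \<le> q j + 1" and s: "\<forall>j<n. q j \<le> s j \<and> s j \<le> q j + 1" and ne: "label p r i \<noteq> label p s i"
        using rs i by blast
      have "label p r i = 0 \<and> label p s i = 1 \<or> label p r i = 1 \<and> label p s i = 0"
        using ne by (auto simp: label_def split: if_splits)
      then show ?thesis using r s by blast
    qed
    then have "\<forall>i. \<exists>ab. i < n \<longrightarrow> (\<forall>j<n. q j \<le> fst ab j \<and> fst ab j \<le> q j + 1) \<and> (\<forall>j<n. q j \<le> snd ab j \<and> snd ab j \<le> q j + 1)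
        \<and> label p (fst ab) i = 0 \<and> label p (snd ab) i = 1"
      by fastforce
    from choice[OF this] obtain ab where ab: "\<forall>i<n. (\<forall>j<n. q j \<le> fst (ab i) j \<and> fst (ab i) j \<le> q j + 1)
        \<and> (\<forall>j<n. q j \<le> snd (ab i) j \<and> snd (ab i) j \<le> q j + 1) \<and> label p (fst (ab i)) i = 0 \<and> label p (snd (ab i)) i = 1"
      by blast
    show ?thesis
      by (rule exI[of _ q], rule exI[of _ "\<lambda>i. fst (ab i)"], rule exI[of _ "\<lambda>i. snd (ab i)"]) (intro conjI q ab)
  qed
  then have "\<forall>p. \<exists>qab. 0 < p \<longrightarrow> (case qab of (q, a, b) \<Rightarrow> (\<forall>i<n. q i < p) \<and> (\<forall>i<n. (\<forall>j<n. q j \<le> a i j \<and> a i j \<le> q j + 1) \<and> (\<forall>j<n. q j \<le> b i j \<and> b i j \<le> q j + 1)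
      \<and> label p (a i) i = 0 \<and> label p (b i) i = 1))"
    by fastforce
  from choice[OF this] obtain qab where qab: "\<And>p. 0 < p \<Longrightarrow> (case qab p of (q, a, b) \<Rightarrow> (\<forall>i<n. q i < p) \<and> (\<forall>i<n. (\<forall>j<n. q j \<le> a i j \<and> a i j \<le> q j + 1) \<and> (\<forall>j<n. q j \<le> b i j \<and> b i j \<le> q j + 1)
      \<and> label p (a i) i = 0 \<and> label p (b i) i = 1))"
    by blast
  define q where "q p = fst (qab p)" for p
  define a where "a p = fst (snd (qab p))" for p
  define b where "b p = snd (snd (qab p))" for p
  have q: "\<And>p i. 0 < p \<Longrightarrow> i < n \<Longrightarrow> q p i < p"
    and a: "\<And>p i j. 0 < p \<Longrightarrow> i < n \<Longrightarrow> j < n \<Longrightarrow> q p j \<le> a p i j \<and> a p i j \<le> q p j + 1"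
    and b: "\<And>p i j. 0 < p \<Longrightarrow> i < n \<Longrightarrow> j < n \<Longrightarrow> q p j \<le> b p i j \<and> b p i j \<le> q p j + 1"
    and la: "\<And>p i. 0 < p \<Longrightarrow> i < n \<Longrightarrow> label p (a p i) i = 0"
    and lb: "\<And>p i. 0 < p \<Longrightarrow> i < n \<Longrightarrow> label p (b p i) i = 1"
    using qab unfolding q_def a_def b_def by (force simp: case_prod_beta)+
  define X where "X k j = real (q (Suc k) j) / real (Suc k)" for k j
  have X01: "0 \<le> X k j \<and> X k j \<le> 1" if "j < n" for k j
    using q[of "Suc k" j] that by (simp add: X_def)
  obtain r where r: "strict_mono r" and conv: "\<And>j. j \<in> {..<n} \<Longrightarrow> \<exists>l. (\<lambda>k. X (r k) j) \<longlonglongrightarrow> l"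
    by (rule function_convergent_subsequence[of "{..<n}" X 1]) (use X01 in auto)
  then obtain x where x: "\<And>j. j < n \<Longrightarrow> (\<lambda>k. X (r k) j) \<longlonglongrightarrow> x j" by (metis lessThan_iff)
  have inv0: "(\<lambda>k. 1 / real (Suc (r k))) \<longlonglongrightarrow> 0"
    using LIMSEQ_subseq_LIMSEQ[OF LIMSEQ_Suc[OF lim_1_over_n] r] by (simp add: o_def)
  \<comment> \<open>The oppositely labelled vertices lie in one cell of side 1/p, so both families
    converge to the limit of the lower corners.\<close>
  have near: "(\<lambda>k. real (c (Suc (r k)) i j) / real (Suc (r k))) \<longlonglongrightarrow> x j"
    if c: "\<And>p i j. 0 < p \<Longrightarrow> i < n \<Longrightarrow> j < n \<Longrightarrow> q p j \<le> c p i j \<and> c p i j \<le> q p j + 1" and ij: "i < n" "j < n"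
    for c :: "nat \<Rightarrow> nat \<Rightarrow> nat \<Rightarrow> nat" and i j
  proof (rule tendsto_sandwich[OF _ _ x[OF ij(2)]])
    show "(\<lambda>k. X (r k) j + 1 / real (Suc (r k))) \<longlonglongrightarrow> x j"
      using tendsto_add[OF x[OF ij(2)] inv0] by simp
    have "q (Suc (r k)) j \<le> c (Suc (r k)) i j" "c (Suc (r k)) i j \<le> q (Suc (r k)) j + 1" for k
      using c[of "Suc (r k)" i j] ij by auto
    then have "real (q (Suc (r k)) j) \<le> real (c (Suc (r k)) i j)" "real (c (Suc (r k)) i j) \<le> real (q (Suc (r k)) j + 1)" for k
      unfolding of_nat_le_iff by blast+
    then show "\<forall>\<^sub>F k in sequentially. X (r k) j \<le> real (c (Suc (r k)) i j) / real (Suc (r k))"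
      "\<forall>\<^sub>F k in sequentially. real (c (Suc (r k)) i j) / real (Suc (r k)) \<le> X (r k) j + 1 / real (Suc (r k))"
      unfolding X_def add_divide_distrib[symmetric] by (auto simp: divide_right_mono add.commute)
  qed
  have bnd: "real (c (Suc k) i j) \<le> 1 + real k" if "\<And>p i j. 0 < p \<Longrightarrow> i < n \<Longrightarrow> j < n \<Longrightarrow> q p j \<le> c p i j \<and> c p i j \<le> q p j + 1" "i < n" "j < n"
    for c :: "nat \<Rightarrow> nat \<Rightarrow> nat \<Rightarrow> nat" and i j k
    using that(1)[of "Suc k" i j] that(2,3) q[of "Suc k" j] by simp
  show ?thesis
  proof (rule that[of x])
    fix i assume i: "i < n"
    show "0 \<le> x i \<and> x i \<le> 1"
      using LIMSEQ_le_const[OF x[OF i], of 0] LIMSEQ_le_const2[OF x[OF i], of 1] X01[OF i] by blast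
    let ?A = "\<lambda>k j. real (a (Suc (r k)) i j) / real (Suc (r k))"
    let ?B = "\<lambda>k j. real (b (Suc (r k)) i j) / real (Suc (r k))"
    have "(\<lambda>k. F (?A k) i) \<longlonglongrightarrow> F x i"
      using near[of a, OF a i] by (intro cont[OF _ _ i]) (use bnd[of a, OF a i] in auto)
    moreover have "?A k i \<le> F (?A k) i" for k
      using la[of "Suc (r k)" i] i by (auto simp: label_def split: if_splits)
    ultimately have 1: "x i \<le> F x i"
      using near[of a, OF a i i] by (intro LIMSEQ_le[of "\<lambda>k. ?A k i" _ "\<lambda>k. F (?A k) i"]) auto
    have "(\<lambda>k. F (?B k) i) \<longlonglongrightarrow> F x i"
      using near[of b, OF b i] by (intro cont[OF _ _ i]) (use bnd[of b, OF b i] in auto)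
    \<comment> \<open>On the top face the label 1 carries no information; there the coordinate is at
      least 1 and \<open>F\<close> is at most 1.\<close>
    moreover have "F (?B k) i \<le> ?B k i" for k
    proof (cases "b (Suc (r k)) i i < Suc (r k)")
      case True
      then show ?thesis using lb[of "Suc (r k)" i] i by (auto simp: label_def split: if_splits)
    next
      case False
      then have "?B k i \<ge> 1" by (simp add: field_simps)
      moreover have "F (?B k) i \<le> 1"
        using F01[of "?B k" i] i bnd[of b, OF b i] by auto
      ultimately show ?thesis by (rule order_trans[rotated])
    qed
    ultimately have 2: "F x i \<le> x i"
      using near[of b, OF b i i] by (intro LIMSEQ_le[of "\<lambda>k. F (?B k) i" _ "\<lambda>k. ?B k i"]) auto
    show "F x i = x i" using 1 2 by simp
  qed
qed

subsection \<open>Logarithmic potentials of radial densities: circle averages\<close>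

lemma AE_lborel_norm_neq: "AE y in lborel. norm (y::'a::euclidean_space) \<noteq> r"
proof -
  have "negligible (sphere (0::'a) r)" by (rule negligible_sphere)
  then have "sphere (0::'a) r \<in> null_sets lborel"
    unfolding negligible_iff_null_sets by (subst (asm) null_sets_completion_iff) auto
  then show ?thesis
    by (rule AE_I') auto
qed

text \<open>Mean value property of ln |p - c w| on the unit circle: Cauchy's formula at the centre
  for \<open>Ln (p - c w)\<close>, then real parts. The bound |c| < p keeps p - c w in the right
  half-plane, where \<open>Ln\<close> is holomorphic.\<close>

lemma circle_mean_ln:
  fixes c :: complex and p :: real
  assumes c: "norm c < p"
  shows "((\<lambda>t. ln (norm (complex_of_real p - c * exp (2 * of_real pi * \<i> * of_real t)))) has_integral ln p) {0..1}"
    and "continuous_on UNIV (\<lambda>t. ln (norm (complex_of_real p - c * exp (2 * of_real pi * \<i> * of_real t))))"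
proof -
  have p: "p > 0" using c by (rule order.strict_trans1[rotated]) simp
  have pos: "Re (complex_of_real p - c * w) > 0" if "norm w \<le> 1" for w
  proof -
    have "Re (c * w) \<le> norm (c * w)" by (rule complex_Re_le_cmod)
    also have "\<dots> \<le> norm c * 1" unfolding norm_mult using that by (intro mult_left_mono) auto
    finally show ?thesis using c by simp
  qed
  have "(\<lambda>w. Ln (complex_of_real p - c * w)) holomorphic_on cball 0 1"
    using pos by (intro holomorphic_intros) (force simp: complex_nonpos_Reals_iff)
  then have "((\<lambda>u. Ln (complex_of_real p - c * u) / (u - 0)) has_contour_integral (2 * of_real pi * \<i> * Ln (complex_of_real p - c * 0))) (circlepath 0 1)"
    by (rule Cauchy_integral_circlepath_simple) simp
  then have "((\<lambda>t. Ln (complex_of_real p - c * exp (2 * of_real pi * \<i> * of_real t)) / exp (2 * of_real pi * \<i> * of_real t)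
      * (2 * of_real pi * \<i> * exp (2 * of_real pi * \<i> * of_real t))) has_integral 2 * of_real pi * \<i> * Ln (complex_of_real p)) {0..1}"
    unfolding has_contour_integral_def mult_zero_right diff_zero
    by (rule has_integral_eq[rotated]) (clarsimp simp: vector_derivative_circlepath01, simp add: circlepath)
  then have hi: "((\<lambda>t. 2 * of_real pi * \<i> * Ln (complex_of_real p - c * exp (2 * of_real pi * \<i> * of_real t))) has_integral 2 * of_real pi * \<i> * Ln (complex_of_real p)) {0..1}"
    by (rule has_integral_eq[rotated]) simp
  have cc: "inverse (2 * complex_of_real pi * \<i>) * (2 * complex_of_real pi * \<i> * X) = X" for X
    by (subst mult.assoc[symmetric], subst left_inverse) simp_all
  have "((\<lambda>t. inverse (2 * of_real pi * \<i>) * (2 * of_real pi * \<i> * Ln (complex_of_real p - c * exp (2 * of_real pi * \<i> * of_real t)))) has_integral inverse (2 * of_real pi * \<i>) * (2 * of_real pi * \<i> * Ln (complex_of_real p))) {0..1}"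
    using hi by (rule has_integral_mult_right)
  then have "((\<lambda>t. Ln (complex_of_real p - c * exp (2 * of_real pi * \<i> * of_real t))) has_integral Ln (complex_of_real p)) {0..1}"
    unfolding cc .
  from has_integral_linear[OF this bounded_linear_Re]
  have "((\<lambda>t. Re (Ln (complex_of_real p - c * exp (2 * of_real pi * \<i> * of_real t)))) has_integral Re (Ln (complex_of_real p))) {0..1}"
    by (simp add: o_def)
  moreover have nz: "complex_of_real p - c * exp (2 * of_real pi * \<i> * of_real t) \<noteq> 0" for t
  proof -
    have "norm (exp (2 * of_real pi * \<i> * complex_of_real t)) \<le> 1" by simp
    from pos[OF this] show ?thesis by (metis order_less_irrefl zero_complex.simps(1))
  qed
  ultimately show "((\<lambda>t. ln (norm (complex_of_real p - c * exp (2 * of_real pi * \<i> * of_real t)))) has_integral ln p) {0..1}"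
    using p by simp
  show "continuous_on UNIV (\<lambda>t. ln (norm (complex_of_real p - c * exp (2 * of_real pi * \<i> * of_real t))))"
    using nz by (intro continuous_intros) auto
qed

text \<open>The larger root \<open>z\<close> of \<open>z^2 - (q + S) z + q P\<close>. For \<open>q = r^2\<close>, \<open>S = |y|^2\<close> and \<open>P\<close> the squared length of the projection
  of \<open>y\<close> to the plane of \<open>b\<close> and \<open>c\<close>, it is the geometric mean of \<open>|r b - R y|^2\<close> over the rotations \<open>R\<close> of that plane.\<close>
definition big_root :: "real \<Rightarrow> real \<Rightarrow> real \<Rightarrow> real" where
  "big_root q S P = (q + S + sqrt ((q + S)^2 - 4 * q * P)) / 2"

text \<open>P \<le> S makes the discriminant at least (q - S)^2, so the larger root dominates both q
  and S.\<close>

lemma big_root: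
  assumes "0 \<le> q" "0 \<le> P" "P \<le> S"
  shows "q \<le> big_root q S P" "S \<le> big_root q S P" "(big_root q S P)^2 = (q + S) * big_root q S P - q * P"
proof -
  let ?D = "(q + S)^2 - 4 * q * P"
  have D: "?D \<ge> (q - S)^2"
    using mult_left_mono[OF assms(3,1)] by (simp add: power2_eq_square algebra_simps)
  then have D0: "?D \<ge> 0" by (meson order_trans zero_le_power2)
  have "\<bar>q - S\<bar> \<le> sqrt ?D" using D by (simp add: real_le_rsqrt)
  then show "q \<le> big_root q S P" "S \<le> big_root q S P" by (auto simp: big_root_def)
  show "(big_root q S P)^2 = (q + S) * big_root q S P - q * P"
    using real_sqrt_pow2[OF D0] by (simp add: big_root_def power2_eq_square field_simps)
qed

lemma big_root_factor:
  assumes "0 \<le> q" "0 \<le> P" "P \<le> S"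
  shows "w^2 - (q + S) * w + q * P = (w - big_root q S P) * (w - (q + S - big_root q S P))"
  using big_root(3)[OF assms] by (simp add: power2_eq_square algebra_simps)

text \<open>At the root z belonging to q, the quadratic for q' has the value (q' - q) (P - z) \<le>
  0, so z cannot exceed the larger root for q'.\<close>

lemma big_root_mono:
  assumes "0 \<le> q" "q \<le> q'" "0 \<le> P" "P \<le> S"
  shows "big_root q S P \<le> big_root q' S P"
proof (rule ccontr)
  assume neg: "\<not> ?thesis"
  define z where "z = big_root q S P"
  define z' where "z' = big_root q' S P"
  have lt: "z' < z" using neg by (simp add: z_def z'_def)
  have a: "0 \<le> q'" using assms by simp
  note Z = big_root[OF assms(1,3,4), folded z_def]
  note Z' = big_root[OF a assms(3,4), folded z'_def]
  have "z^2 - (q' + S) * z + q' * P = (q' - q) * (P - z)"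
    unfolding Z(3) by (simp add: algebra_simps)
  also have "\<dots> \<le> 0" using assms Z(2) by (intro mult_nonneg_nonpos) auto
  finally have "(z - z') * (z - (q' + S - z')) \<le> 0"
    using big_root_factor[OF a assms(3,4), of z] by (simp add: z'_def)
  moreover have "(z - z') * (z - (q' + S - z')) > 0"
    using lt Z'(1,2) Z(2) assms by (intro mult_pos_pos) auto
  ultimately show False by simp
qed

text \<open>At k z the quadratic for k q has the value k (k - 1) z (z - q) \<ge> 0. If k z were
  below the larger root it would still exceed the smaller one, which makes the value
  negative.\<close>

lemma big_root_scale:
  assumes "0 \<le> q" "0 \<le> P" "P \<le> S" "1 \<le> k"
  shows "big_root (k * q) S P \<le> k * big_root q S P"
proof (rule ccontr)
  assume neg: "\<not> ?thesis"
  define z where "z = big_root q S P"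
  define z' where "z' = big_root (k * q) S P"
  have lt: "k * z < z'" using neg by (simp add: z_def z'_def)
  have a: "0 \<le> k * q" using assms by simp
  note Z = big_root[OF assms(1,2,3), folded z_def]
  have "(k * z)^2 - (k * q + S) * (k * z) + k * q * P = k * (k * z^2 - (k * q + S) * z + q * P)"
    by (simp add: power2_eq_square algebra_simps)
  also have "\<dots> = k * ((k - 1) * (z * (z - q)))"
  proof -
    have "k * z^2 - (k * q + S) * z + q * P = (k - 1) * (z * (z - q)) + (z^2 - ((q + S) * z - q * P))"
      by (simp add: power2_eq_square algebra_simps)
    then show ?thesis using Z(3) by simp
  qed
  also have "\<dots> \<ge> 0" using assms Z by (intro mult_nonneg_nonneg) auto
  finally have "(k * z - z') * (k * z - (k * q + S - z')) \<ge> 0"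
    using big_root_factor[OF a assms(2,3), of "k * z"] by (simp add: z'_def)
  moreover have "k * q \<le> k * z" using Z(1) assms by (intro mult_left_mono) auto
  moreover have "z \<le> k * z" using Z(1) assms mult_right_mono[of 1 k z] by simp
  then have "S \<le> k * z" using Z(2) by simp
  ultimately have "(k * z - z') * (k * z - (k * q + S - z')) < 0"
    using lt by (intro mult_neg_pos) auto
  then show False using \<open>(k * z - z') * (k * z - (k * q + S - z')) \<ge> 0\<close> by simp
qed

text \<open>Written as the identity plus a correction in the span of b and c, so the orthogonal
  complement is fixed without decomposing y.\<close>

definition plane_rot :: "'a::euclidean_space \<Rightarrow> 'a \<Rightarrow> real \<Rightarrow> 'a \<Rightarrow> 'a" where
  "plane_rot b c \<theta> y = y + ((y \<bullet> b) * (cos \<theta> - 1) - (y \<bullet> c) * sin \<theta>) *\<^sub>R b + ((y \<bullet> b) * sin \<theta> + (y \<bullet> c) * (cos \<theta> - 1)) *\<^sub>R c"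

lemma plane_rot:
  fixes b c :: "'a::euclidean_space"
  assumes bc: "b \<in> Basis" "c \<in> Basis" "b \<noteq> c"
  shows "linear (plane_rot b c \<theta>)" "norm (plane_rot b c \<theta> y) = norm y"
    "(norm (r *\<^sub>R b - plane_rot b c \<theta> y))^2 = r^2 + (norm y)^2 - 2 * r * ((y \<bullet> b) * cos \<theta> - (y \<bullet> c) * sin \<theta>)"
proof -
  show "linear (plane_rot b c \<theta>)"
    unfolding plane_rot_def by (rule linearI) (simp_all add: algebra_simps inner_add_left)
  define A where "A = (y \<bullet> b) * (cos \<theta> - 1) - (y \<bullet> c) * sin \<theta>"
  define B where "B = (y \<bullet> b) * sin \<theta> + (y \<bullet> c) * (cos \<theta> - 1)"
  have R: "plane_rot b c \<theta> y = y + A *\<^sub>R b + B *\<^sub>R c" by (simp add: plane_rot_def A_def B_def)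
  have i: "b \<bullet> b = 1" "c \<bullet> c = 1" "b \<bullet> c = 0" "c \<bullet> b = 0"
    using bc by (auto simp: inner_Basis)
  have z: "A^2 + B^2 + 2 * (A * (y \<bullet> b) + B * (y \<bullet> c)) = 0"
  proof -
    have "A^2 + B^2 + 2 * (A * (y \<bullet> b) + B * (y \<bullet> c)) = ((y \<bullet> b)^2 + (y \<bullet> c)^2) * ((sin \<theta>)^2 + (cos \<theta>)^2 - 1)"
      unfolding A_def B_def by algebra
    then show ?thesis by simp
  qed
  have n: "(norm (plane_rot b c \<theta> y))^2 = (norm y)^2"
    unfolding power2_norm_eq_inner R
    using z by (simp add: inner_add_left inner_add_right i inner_commute[of b y] inner_commute[of c y] power2_eq_square algebra_simps)
  then show "norm (plane_rot b c \<theta> y) = norm y" by simp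
  have "(norm (r *\<^sub>R b - plane_rot b c \<theta> y))^2 = r^2 + (norm (plane_rot b c \<theta> y))^2 - 2 * r * (plane_rot b c \<theta> y \<bullet> b)"
    unfolding power2_norm_eq_inner by (simp add: inner_diff_left inner_diff_right i inner_commute power2_eq_square)
  also have "plane_rot b c \<theta> y \<bullet> b = (y \<bullet> b) * cos \<theta> - (y \<bullet> c) * sin \<theta>"
    unfolding R by (simp add: inner_add_left i A_def algebra_simps)
  finally show "(norm (r *\<^sub>R b - plane_rot b c \<theta> y))^2 = r^2 + (norm y)^2 - 2 * r * ((y \<bullet> b) * cos \<theta> - (y \<bullet> c) * sin \<theta>)"
    unfolding n .
qed

text \<open>Put w = (y . b) + i (y . c). The squared distance is r^2 + |y|^2 - 2 r Re (w e^(i t)),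
  and it is to be matched with |p - v e^(i t)|^2. This forces v = (r / p) w and p^2 + r^2 P / p^2 =
  r^2 + |y|^2, so p^2 is a root of the quadratic behind \<open>big_root\<close>; the larger root
  gives |v| < p.\<close>

lemma plane_rot_mean_ln:
  fixes b c y :: "'a::euclidean_space"
  assumes bc: "b \<in> Basis" "c \<in> Basis" "b \<noteq> c" and r: "0 \<le> r" "norm y \<noteq> r"
  shows "((\<lambda>t. ln (norm (r *\<^sub>R b - plane_rot b c (2 * pi * t) y))) has_integral
            ln (big_root (r^2) ((norm y)^2) ((y \<bullet> b)^2 + (y \<bullet> c)^2)) / 2) {0..1}"
    and "continuous_on UNIV (\<lambda>t. ln (norm (r *\<^sub>R b - plane_rot b c (2 * pi * t) y)))"
    and "big_root (r^2) ((norm y)^2) ((y \<bullet> b)^2 + (y \<bullet> c)^2) > 0"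
    and "(y \<bullet> b)^2 + (y \<bullet> c)^2 \<le> (norm y)^2"
proof -
  define P where "P = (y \<bullet> b)^2 + (y \<bullet> c)^2"
  define z where "z = big_root (r^2) ((norm y)^2) P"
  define p where "p = sqrt z"
  define w where "w = Complex (y \<bullet> b) (y \<bullet> c)"
  define v where "v = complex_of_real (r / p) * w"
  have P: "P \<le> (norm y)^2"
  proof -
    have "P = (\<Sum>d\<in>{b,c}. (y \<bullet> d)^2)" using bc by (simp add: P_def)
    also have "\<dots> \<le> (\<Sum>d\<in>Basis. (y \<bullet> d)^2)" using bc by (intro sum_mono2) auto
    also have "\<dots> = (norm y)^2"
      unfolding power2_norm_eq_inner by (subst (2) euclidean_inner) (simp add: power2_eq_square)
    finally show ?thesis .
  qed
  have P0: "0 \<le> P" by (simp add: P_def)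
  note Z = big_root[OF zero_le_power2[of r] P0 P, folded z_def]
  have "r^2 \<noteq> (norm y)^2" using r by (metis norm_ge_zero power2_eq_iff_nonneg)
  then have z: "z > 0" using Z by (smt (verit) zero_le_power2)
  have p: "p > 0" "p^2 = z" using z by (auto simp: p_def)
  have wP: "(norm w)^2 = P" by (simp add: w_def P_def cmod_power2)
  \<comment> \<open>Equivalent to |v| < p. Since z is at least r^2 and |y|^2, strictness comes from
    |y| \<noteq> r.\<close>
  have "r^2 * P < z^2"
  proof -
    have "r^2 * P \<le> r^2 * (norm y)^2" using P by (intro mult_left_mono) auto
    also have "\<dots> < z * z"
      using Z(1,2) \<open>r^2 \<noteq> (norm y)^2\<close> z
      by (metis less_eq_real_def mult_mono' mult_strict_mono' mult_less_le_imp_less not_less zero_le_power2 mult.commute)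
    finally show ?thesis by (simp add: power2_eq_square)
  qed
  then have "(r * norm w)^2 < (p^2)^2" by (simp add: power_mult_distrib wP p)
  then have "r * norm w < p^2" by (rule power2_less_imp_less) simp
  then have vp: "norm v < p"
    using p r by (simp add: v_def norm_mult norm_divide field_simps power2_eq_square)
  have eq: "norm (r *\<^sub>R b - plane_rot b c (2 * pi * t) y) = norm (complex_of_real p - v * exp (2 * of_real pi * \<i> * of_real t))" for t
  proof -
    let ?e = "cis (2 * pi * t)"
    have e: "exp (2 * of_real pi * \<i> * of_real t) = ?e" by (simp add: cis_conv_exp mult_ac)
    have "(norm (complex_of_real p - v * ?e))^2 = p^2 + (norm v)^2 - 2 * p * Re (v * ?e)"
      unfolding cmod_power2 by (simp add: power2_eq_square algebra_simps cos_squared_eq sin_squared_eq)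
         (simp add: power2_eq_square flip: distrib_left)
    also have "(norm v)^2 = r^2 * P / z"
      using p by (simp add: v_def norm_mult norm_divide power_mult_distrib power_divide wP)
    also have "p^2 + r^2 * P / z = r^2 + (norm y)^2"
      unfolding p(2) using Z(3) z by (simp add: field_simps power2_eq_square)
    also have "2 * p * Re (v * ?e) = 2 * r * ((y \<bullet> b) * cos (2 * pi * t) - (y \<bullet> c) * sin (2 * pi * t))"
      using p by (simp add: v_def w_def field_simps)
    finally have "(norm (r *\<^sub>R b - plane_rot b c (2 * pi * t) y))^2 = (norm (complex_of_real p - v * ?e))^2"
      by (simp add: plane_rot(3)[OF bc])
    then show ?thesis unfolding e by simp
  qed
  have lnp: "ln p = ln z / 2" using z by (simp add: p_def ln_sqrt)
  show "((\<lambda>t. ln (norm (r *\<^sub>R b - plane_rot b c (2 * pi * t) y))) has_integral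
            ln (big_root (r^2) ((norm y)^2) ((y \<bullet> b)^2 + (y \<bullet> c)^2)) / 2) {0..1}"
    using circle_mean_ln(1)[OF vp] unfolding lnp eq P_def[symmetric] z_def[symmetric] .
  show "continuous_on UNIV (\<lambda>t. ln (norm (r *\<^sub>R b - plane_rot b c (2 * pi * t) y)))"
    using circle_mean_ln(2)[OF vp] by (simp add: eq)
  show "big_root (r^2) ((norm y)^2) ((y \<bullet> b)^2 + (y \<bullet> c)^2) > 0" using z by (simp add: z_def P_def)
  show "(y \<bullet> b)^2 + (y \<bullet> c)^2 \<le> (norm y)^2" using P by (simp add: P_def)
qed

section \<open>Comparison of a radial potential at two points\<close>

text \<open>A difference of logarithms rather than the logarithm of a quotient: additivity in the
  two base points then holds everywhere, also where a norm vanishes and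
  \<open>ln 0 = 0\<close>.\<close>

definition log_ratio :: "'a::euclidean_space \<Rightarrow> 'a \<Rightarrow> 'a \<Rightarrow> real" where
  "log_ratio x x' y = ln (norm (x' - y)) - ln (norm (x - y))"

lemma borel_measurable_log_ratio [measurable]: "log_ratio x x' \<in> borel_measurable borel"
  unfolding log_ratio_def[abs_def] by measurable

text \<open>Since f is radial, the kernel may be averaged over the rotations of y in the plane of b
  and c. The mean is half the difference of ln Z at the radii r' and r, and the monotonicity and
  scaling of \<open>big_root\<close> confine it to the interval from 0 to ln (r' / r) for almost
  every y.\<close>

lemma radial_log_ratio_mono_axis:
  fixes f :: "'a::euclidean_space \<Rightarrow> real"
  assumes bc: "b \<in> Basis" "c \<in> Basis" "b \<noteq> c" and r: "0 \<le> r" "r \<le> r'"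
    and f: "integrable lborel f" "radial f" "\<And>y. 0 \<le> f y"
    and int: "integrable lborel (\<lambda>y. log_ratio (r *\<^sub>R b) (r' *\<^sub>R b) y * f y)"
  shows "0 \<le> (\<integral>y. log_ratio (r *\<^sub>R b) (r' *\<^sub>R b) y * f y \<partial>lborel)"
    and "0 < r \<Longrightarrow> (\<integral>y. log_ratio (r *\<^sub>R b) (r' *\<^sub>R b) y * f y \<partial>lborel) \<le> ln (r' / r) * (\<integral>y. f y \<partial>lborel)"
proof -
  have [measurable]: "f \<in> borel_measurable borel" using f(1) by auto
  define K where "K y = log_ratio (r *\<^sub>R b) (r' *\<^sub>R b) y" for y
  define R where "R t y = plane_rot b c (2 * pi * t) y" for t y
  have linR: "linear (R t)" and normR: "norm (R t y) = norm y" for t y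
    unfolding R_def by (simp_all add: plane_rot(1,2)[OF bc])
  have [measurable]: "K \<in> borel_measurable borel" unfolding K_def[abs_def] by measurable
  have mR[measurable]: "(\<lambda>(t, y). R t y) \<in> borel_measurable (lborel \<Otimes>\<^sub>M lborel)"
    unfolding R_def plane_rot_def split_beta
    by measurable
  have fR: "f (R t y) = f y" for t y using f(2) normR unfolding radial_def by blast
  have intK: "integrable lborel (\<lambda>y. K (R t y) * f y)" "(\<integral>y. K (R t y) * f y \<partial>lborel) = (\<integral>y. K y * f y \<partial>lborel)"
    "(\<integral>y. norm (K (R t y) * f y) \<partial>lborel) = (\<integral>y. norm (K y * f y) \<partial>lborel)" for t
    using integral_isometry[OF linR normR, of "\<lambda>y. K y * f y" t] integral_isometry[OF linR normR, of "\<lambda>y. norm (K y * f y)" t]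
      int by (simp_all add: fR K_def)
  define I where "I = (indicator {0..1} :: real \<Rightarrow> real)"
  have intI: "integrable lborel (\<lambda>t. I t * C)" and I1: "(\<integral>t. I t * C \<partial>lborel) = C" for C :: real
    unfolding I_def by auto
  have [measurable]: "I \<in> borel_measurable borel" unfolding I_def by measurable
  have I0: "I t \<ge> 0" for t by (simp add: I_def)
  define G where "G t y = I t * (K (R t y) * f y)" for t y
  have mG: "(\<lambda>(t, y). G t y) \<in> borel_measurable (lborel \<Otimes>\<^sub>M lborel)"
  proof -
    have "(\<lambda>p. K (case p of (t, y) \<Rightarrow> R t y)) \<in> borel_measurable (lborel \<Otimes>\<^sub>M lborel)"
      by (rule measurable_compose[OF mR]) measurable
    then have [measurable]: "(\<lambda>p. K (R (fst p) (snd p))) \<in> borel_measurable (lborel \<Otimes>\<^sub>M lborel)"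
      by (simp add: split_beta)
    show ?thesis unfolding G_def split_beta by measurable
  qed
  have "integrable (lborel \<Otimes>\<^sub>M lborel) (\<lambda>(t, y). G t y)"
  proof (rule lborel_pair.Fubini_integrable[OF mG])
    show "integrable lborel (\<lambda>t. \<integral>y. norm (case (t, y) of (t, y) \<Rightarrow> G t y) \<partial>lborel)"
    proof -
      have "norm (G t y) = I t * norm (K (R t y) * f y)" for t y
        using I0 by (simp add: G_def abs_mult)
      then show ?thesis
        using intI[of "\<integral>y. norm (K y * f y) \<partial>lborel"] by (simp only: prod.case integral_mult_right_zero intK(3))
    qed
    show "AE t in lborel. integrable lborel (\<lambda>y. case (t, y) of (t, y) \<Rightarrow> G t y)"
      using intK(1) by (auto simp: G_def)
  qed
  then have "(\<integral>y. (\<integral>t. G t y \<partial>lborel) \<partial>lborel) = (\<integral>t. (\<integral>y. G t y \<partial>lborel) \<partial>lborel)"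
    and intG: "integrable lborel (\<lambda>y. \<integral>t. G t y \<partial>lborel)"
    using lborel_pair.Fubini_integral[of G] lborel_pair.integrable_snd[of G] by auto
  moreover have "(\<integral>y. G t y \<partial>lborel) = I t * (\<integral>y. K y * f y \<partial>lborel)" for t
    by (simp add: G_def intK(2))
  ultimately have eq: "(\<integral>y. K y * f y \<partial>lborel) = (\<integral>y. (\<integral>t. G t y \<partial>lborel) \<partial>lborel)"
    using I1[of 1] by simp
  have bounds: "AE y in lborel. 0 \<le> (\<integral>t. G t y \<partial>lborel) \<and> (0 < r \<longrightarrow> (\<integral>t. G t y \<partial>lborel) \<le> ln (r' / r) * f y)"
    using AE_lborel_norm_neq[of r] AE_lborel_norm_neq[of r']
  proof eventually_elim
    case (elim y)
    define P where "P = (y \<bullet> b)^2 + (y \<bullet> c)^2"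
    define Z where "Z s = big_root (s^2) ((norm y)^2) P" for s
    have r': "0 \<le> r'" using r by simp
    note 1 = plane_rot_mean_ln[OF bc r(1) elim(1), folded P_def Z_def, folded R_def]
    note 2 = plane_rot_mean_ln[OF bc r' elim(2), folded P_def Z_def, folded R_def]
    have hi: "((\<lambda>t. K (R t y)) has_integral (ln (Z r') / 2 - ln (Z r) / 2)) {0..1}"
      unfolding K_def log_ratio_def by (rule has_integral_diff[OF 2(1) 1(1)])
    have cont: "continuous_on {0..1} (\<lambda>t. K (R t y))"
      unfolding K_def log_ratio_def
      by (intro continuous_on_diff continuous_on_subset[OF 2(2)] continuous_on_subset[OF 1(2)]) auto
    have "(LINT t:{0..1}|lborel. K (R t y)) = integral {0..1} (\<lambda>t. K (R t y))"
      by (rule set_borel_integral_eq_integral) (rule borel_integrable_atLeastAtMost'[OF cont])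
    also have "\<dots> = ln (Z r') / 2 - ln (Z r) / 2" using hi by (rule integral_unique)
    finally have "(\<integral>t. I t * K (R t y) \<partial>lborel) = ln (Z r') / 2 - ln (Z r) / 2"
      by (simp add: set_lebesgue_integral_def I_def)
    then have G: "(\<integral>t. G t y \<partial>lborel) = (ln (Z r') / 2 - ln (Z r) / 2) * f y"
      unfolding G_def mult.assoc[symmetric] by simp
    have P0: "0 \<le> P" by (simp add: P_def)
    have "Z r \<le> Z r'"
      unfolding Z_def using r 1(4) P0 by (intro big_root_mono) (auto intro: power_mono)
    then have "ln (Z r) \<le> ln (Z r')" using 1(3) by simp
    moreover have "ln (Z r') / 2 - ln (Z r) / 2 \<le> ln (r' / r)" if "0 < r"
    proof -
      \<comment> \<open>\<open>Z\<close> depends on the squared radius, hence the squared ratio; the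
        factor 1/2 in the mean undoes the square.\<close>
      define k where "k = (r' / r)^2"
      have k: "1 \<le> k" "k * r^2 = r'^2" using r that by (auto simp: k_def power_divide intro!: one_le_power)
      have "Z r' \<le> k * Z r"
        unfolding Z_def k(2)[symmetric] using 1(4) P0 k by (intro big_root_scale) auto
      then have "ln (Z r') \<le> ln (k * Z r)" using 2(3) 1(3) k by (subst ln_le_cancel_iff) auto
      also have "\<dots> = 2 * ln (r' / r) + ln (Z r)"
        using 1(3) k r that by (simp add: ln_mult k_def ln_realpow)
      finally show ?thesis by simp
    qed
    ultimately show ?case unfolding G using f(3)[of y] by (auto intro: mult_right_mono)
  qed
  show "0 \<le> (\<integral>y. log_ratio (r *\<^sub>R b) (r' *\<^sub>R b) y * f y \<partial>lborel)"
    using eq bounds unfolding K_def by (auto intro!: integral_nonneg_AE elim: eventually_mono)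
  assume "0 < r"
  then have "(\<integral>y. (\<integral>t. G t y \<partial>lborel) \<partial>lborel) \<le> (\<integral>y. ln (r' / r) * f y \<partial>lborel)"
    using bounds by (intro integral_mono_AE intG) (auto intro: f(1) elim: eventually_mono)
  then show "(\<integral>y. log_ratio (r *\<^sub>R b) (r' *\<^sub>R b) y * f y \<partial>lborel) \<le> ln (r' / r) * (\<integral>y. f y \<partial>lborel)"
    using eq by (simp add: K_def)
qed

text \<open>Householder reflection in the hyperplane orthogonal to x - y.\<close>

lemma isometry_exists:
  fixes x y :: "'a::euclidean_space"
  assumes "norm x = norm y"
  obtains H where "linear H" "\<And>z. norm (H z) = norm z" "H x = y"
proof (cases "x = y")
  case True
  then show ?thesis by (intro that[of id]) (auto simp: linear_id)
next
  case False
  define v where "v = x - y"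
  define H where "H z = z - (2 * (z \<bullet> v) / (v \<bullet> v)) *\<^sub>R v" for z
  have v: "v \<bullet> v > 0" using False by (simp add: v_def)
  show ?thesis
  proof (rule that[of H])
    show "linear H" unfolding H_def
      by (rule linearI) (simp_all add: inner_add_left algebra_simps add_divide_distrib)
    have "(norm (H z))^2 = (norm z)^2" for z
      unfolding power2_norm_eq_inner H_def using v
      by (simp add: inner_diff_left inner_diff_right inner_commute[of v z] field_simps)
    then show "norm (H z) = norm z" for z by simp
    have "x \<bullet> x = y \<bullet> y" using assms by (simp add: norm_eq)
    then have "2 * (x \<bullet> v) = v \<bullet> v"
      by (simp add: v_def inner_diff_left inner_diff_right inner_commute)
    then show "H x = y" using v by (simp add: H_def v_def)
  qed
qed

lemma integral_log_ratio_isometry: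
  fixes f :: "'a::euclidean_space \<Rightarrow> real"
  assumes H: "linear H" "\<And>z. norm (H z) = norm z" and f: "f \<in> borel_measurable borel" "radial f"
  shows "(\<integral>y. log_ratio (H x) (H x') y * f y \<partial>lborel) = (\<integral>y. log_ratio x x' y * f y \<partial>lborel)"
    and "integrable lborel (\<lambda>y. log_ratio (H x) (H x') y * f y) \<longleftrightarrow> integrable lborel (\<lambda>y. log_ratio x x' y * f y)"
proof -
  have [measurable]: "f \<in> borel_measurable borel" by fact
  have "norm (H a - H y) = norm (a - y)" for a y using H by (metis linear_diff)
  moreover have "f (H y) = f y" for y using f(2) H(2) unfolding radial_def by blast
  ultimately have "log_ratio (H x) (H x') (H y) * f (H y) = log_ratio x x' y * f y" for y
    by (simp add: log_ratio_def)
  then show "(\<integral>y. log_ratio (H x) (H x') y * f y \<partial>lborel) = (\<integral>y. log_ratio x x' y * f y \<partial>lborel)"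
     "integrable lborel (\<lambda>y. log_ratio (H x) (H x') y * f y) \<longleftrightarrow> integrable lborel (\<lambda>y. log_ratio x x' y * f y)"
    using integral_isometry[OF H, of "\<lambda>y. log_ratio (H x) (H x') y * f y"] by simp_all
qed

text \<open>An isometry carries the ray of x to a coordinate axis; dimension at least 2 supplies the
  second axis needed for rotations.\<close>

lemma radial_log_ratio_mono:
  fixes f :: "'a::euclidean_space \<Rightarrow> real"
  assumes dim: "2 \<le> DIM('a)" and k: "1 \<le> k"
    and f: "integrable lborel f" "radial f" "\<And>y. 0 \<le> f y"
    and int: "integrable lborel (\<lambda>y. log_ratio x (k *\<^sub>R x) y * f y)"
  shows "0 \<le> (\<integral>y. log_ratio x (k *\<^sub>R x) y * f y \<partial>lborel)"
    and "(\<integral>y. log_ratio x (k *\<^sub>R x) y * f y \<partial>lborel) \<le> ln k * (\<integral>y. f y \<partial>lborel)"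
proof -
  obtain b c :: 'a where bc: "b \<in> Basis" "c \<in> Basis" "b \<noteq> c"
    using dim card_le_Suc0_iff_eq[of "Basis :: 'a set"] by auto
  have fm: "f \<in> borel_measurable borel" using f(1) by auto
  define r where "r = norm x"
  obtain H where H: "linear H" "\<And>z. norm (H z) = norm z" "H x = r *\<^sub>R b"
    using isometry_exists[of x "r *\<^sub>R b"] bc by (auto simp: r_def)
  have Hk: "H (k *\<^sub>R x) = (k * r) *\<^sub>R b" using H by (simp add: linear_scale)
  note iso = integral_log_ratio_isometry[OF H(1,2) fm f(2), of x "k *\<^sub>R x", unfolded H(3) Hk]
  have le: "r \<le> k * r" "0 \<le> r" using k mult_right_mono[of 1 k r] by (auto simp: r_def)
  note ax = radial_log_ratio_mono_axis[OF bc le(2,1) f(1,2,3), unfolded iso, OF int]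
  show nn: "0 \<le> (\<integral>y. log_ratio x (k *\<^sub>R x) y * f y \<partial>lborel)" by (rule ax(1))
  show "(\<integral>y. log_ratio x (k *\<^sub>R x) y * f y \<partial>lborel) \<le> ln k * (\<integral>y. f y \<partial>lborel)"
  proof (cases "x = 0")
    case True
    then show ?thesis using k f(3) by (simp add: log_ratio_def)
  next
    case False
    then have "0 < r" by (simp add: r_def)
    then show ?thesis using ax(2) by simp
  qed
qed

lemma radial_log_ratio_zero_nonneg:
  fixes f :: "'a::euclidean_space \<Rightarrow> real"
  assumes dim: "2 \<le> DIM('a)"
    and f: "integrable lborel f" "radial f" "\<And>y. 0 \<le> f y"
    and int: "integrable lborel (\<lambda>y. log_ratio 0 x y * f y)"
  shows "0 \<le> (\<integral>y. log_ratio 0 x y * f y \<partial>lborel)"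
proof -
  obtain b c :: 'a where bc: "b \<in> Basis" "c \<in> Basis" "b \<noteq> c"
    using dim card_le_Suc0_iff_eq[of "Basis :: 'a set"] by auto
  have fm: "f \<in> borel_measurable borel" using f(1) by auto
  obtain H where H: "linear H" "\<And>z. norm (H z) = norm z" "H x = norm x *\<^sub>R b"
    using isometry_exists[of x "norm x *\<^sub>R b"] bc by auto
  have H0: "H 0 = 0 *\<^sub>R b" using H by (simp add: linear_0)
  note iso = integral_log_ratio_isometry[OF H(1,2) fm f(2), of 0 x, unfolded H(3) H0]
  show ?thesis
    by (rule radial_log_ratio_mono_axis(1)[OF bc order_refl norm_ge_zero[of x] f(1,2,3), unfolded iso, OF int])
qed

subsection \<open>Fourier integrals\<close>

text \<open>Inverse Fourier integral without the power of 2 pi; in this form it also represents the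
  forward transform, at - \<xi>.\<close>

definition ift :: "('a::euclidean_space \<Rightarrow> complex) \<Rightarrow> 'a \<Rightarrow> complex" where
  "ift g x = (LINT \<xi>|lborel. g \<xi> * cis (x \<bullet> \<xi>))"

lemma borel_measurable_cis [measurable]: "cis \<in> borel_measurable borel"
  by (intro borel_measurable_continuous_onI continuous_intros)

lemma borel_measurable_cis_inner [measurable]:
  fixes f g :: "'c \<Rightarrow> 'a::euclidean_space"
  assumes [measurable]: "f \<in> borel_measurable M" "g \<in> borel_measurable M"
  shows "(\<lambda>x. cis (f x \<bullet> g x)) \<in> borel_measurable M"
  by (rule measurable_compose[OF _ borel_measurable_cis]) measurable

lemma integrable_mult_bounded:
  fixes f :: "'a::euclidean_space \<Rightarrow> complex"
  assumes f: "integrable lborel f" and [measurable]: "h \<in> borel_measurable borel"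
    and h: "\<And>x. norm (h x) \<le> B"
  shows "integrable lborel (\<lambda>x. f x * h x)"
proof (rule Bochner_Integration.integrable_bound)
  show "integrable lborel (\<lambda>x. B * norm (f x))" using f by simp
  have [measurable]: "f \<in> borel_measurable borel" using f by auto
  show "(\<lambda>x. f x * h x) \<in> borel_measurable lborel" by measurable
  show "AE x in lborel. norm (f x * h x) \<le> norm (B * norm (f x))"
  proof (rule AE_I2)
    fix x
    have "norm (f x * h x) \<le> B * norm (f x)"
      using mult_right_mono[OF h[of x], of "norm (f x)"] by (simp add: norm_mult mult.commute)
    then show "norm (f x * h x) \<le> norm (B * norm (f x))" by simp
  qed
qed

lemma integrable_mult_cis:
  fixes f :: "'a::euclidean_space \<Rightarrow> complex"
  assumes "integrable lborel f"
  shows "integrable lborel (\<lambda>\<xi>. f \<xi> * cis (x \<bullet> \<xi>))" "integrable lborel (\<lambda>\<xi>. f \<xi> * cis (\<xi> \<bullet> x))"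
  by (rule integrable_mult_bounded[OF assms, of _ 1]; simp)+

lemma integrable_pair_bounded:
  fixes f :: "'a::euclidean_space \<Rightarrow> complex" and g :: "'b::euclidean_space \<Rightarrow> complex"
  assumes f: "integrable lborel f" and g: "integrable lborel g"
    and h[measurable]: "h \<in> borel_measurable (lborel \<Otimes>\<^sub>M lborel)" and h1: "\<And>p. norm (h p) \<le> 1"
  shows "integrable (lborel \<Otimes>\<^sub>M lborel) (\<lambda>(x, y). f x * g y * h (x, y))"
proof -
  have [measurable]: "f \<in> borel_measurable borel" "g \<in> borel_measurable borel" using f g by auto
  have "integrable (lborel \<Otimes>\<^sub>M lborel) (\<lambda>p. norm (f (fst p)) * norm (g (snd p)))"
  proof (rule lborel_pair.Fubini_integrable)
    show "integrable lborel (\<lambda>x. \<integral>y. norm (norm (f (fst (x, y))) * norm (g (snd (x, y)))) \<partial>lborel)"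
      using f by (simp add: norm_mult abs_mult)
  qed (use g in auto)
  then show ?thesis
  proof (rule Bochner_Integration.integrable_bound)
    show "AE p in lborel \<Otimes>\<^sub>M lborel. norm (case p of (x, y) \<Rightarrow> f x * g y * h (x, y)) \<le> norm (norm (f (fst p)) * norm (g (snd p)))"
    proof (rule AE_I2, clarify)
      fix x y
      have "norm (f x * g y) * norm (h (x, y)) \<le> norm (f x * g y) * 1"
        by (rule mult_left_mono[OF h1]) simp
      then show "norm (f x * g y * h (x, y)) \<le> norm (norm (f (fst (x, y))) * norm (g (snd (x, y))))"
        by (simp add: norm_mult abs_mult)
    qed
  qed (unfold split_beta, measurable)
qed

lemma ennreal_mult_leI:
  assumes "0 \<le> a" "0 \<le> b" "0 \<le> c" "0 \<le> d" "a * b \<le> c * d"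
  shows "ennreal a * ennreal b \<le> ennreal c * ennreal d"
  using assms by (subst (1 2) ennreal_mult[symmetric]) (auto intro: ennreal_leI)

lemma norm_integral_le_nn_integral:
  fixes f :: "'b \<Rightarrow> 'c::{banach, second_countable_topology}"
  shows "ennreal (norm (integral\<^sup>L M f)) \<le> (\<integral>\<^sup>+x. ennreal (norm (f x)) \<partial>M)"
  by (cases "integrable M f") (auto intro: integral_norm_bound_ennreal simp: not_integrable_integral_eq)

lemma ift_mult_formula:
  fixes f g :: "'a::euclidean_space \<Rightarrow> complex"
  assumes f: "integrable lborel f" and g: "integrable lborel g"
  shows "(LINT x|lborel. f x * ift g x) = (LINT \<xi>|lborel. g \<xi> * ift f \<xi>)"
proof -
  have I: "integrable (lborel \<Otimes>\<^sub>M lborel) (\<lambda>(x, y). f x * g y * (case (x, y) of (x, y) \<Rightarrow> cis (x \<bullet> y)))"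
    by (rule integrable_pair_bounded[OF f g]) (auto simp: split_beta)
  have "(LINT x|lborel. f x * ift g x) = (LINT x|lborel. LINT y|lborel. f x * g y * cis (x \<bullet> y))"
    by (simp add: ift_def mult.assoc)
  also have "\<dots> = (LINT y|lborel. LINT x|lborel. f x * g y * cis (x \<bullet> y))"
    using lborel_pair.Fubini_integral[of "\<lambda>x y. f x * g y * cis (x \<bullet> y)"] I by simp
  also have "\<dots> = (LINT y|lborel. g y * ift f y)"
  proof (rule Bochner_Integration.integral_cong[OF refl])
    fix y
    have "(\<lambda>x. f x * g y * cis (x \<bullet> y)) = (\<lambda>x. g y * (f x * cis (y \<bullet> x)))"
      by (simp add: inner_commute mult_ac)
    then show "(LINT x|lborel. f x * g y * cis (x \<bullet> y)) = g y * ift f y"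
      by (simp add: ift_def)
  qed
  finally show ?thesis .
qed

lemma ift_bound:
  fixes g :: "'a::euclidean_space \<Rightarrow> complex"
  shows "norm (ift g x) \<le> (LINT \<xi>|lborel. norm (g \<xi>))"
proof -
  have "norm (ift g x) \<le> (LINT \<xi>|lborel. norm (g \<xi> * cis (x \<bullet> \<xi>)))"
    unfolding ift_def by (rule integral_norm_bound)
  then show ?thesis by (simp add: norm_mult)
qed

lemma borel_measurable_ift [measurable]:
  fixes g :: "'a::euclidean_space \<Rightarrow> complex"
  assumes [measurable]: "g \<in> borel_measurable borel"
  shows "ift g \<in> borel_measurable borel"
  unfolding ift_def[abs_def] by measurable

lemma ift_shift: "ift g (x + y) = ift (\<lambda>\<xi>. g \<xi> * cis (x \<bullet> \<xi>)) y"
  by (simp add: ift_def inner_add_left cis_mult[symmetric] mult.assoc)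

lemma ift_add:
  assumes "integrable lborel f" "integrable lborel g"
  shows "ift (\<lambda>\<xi>. f \<xi> + g \<xi>) x = ift f x + ift g x"
  using integrable_mult_cis(1)[OF assms(1), of x] integrable_mult_cis(1)[OF assms(2), of x]
  by (simp add: ift_def distrib_right)

lemma gauss_ift:
  fixes g :: "'a::euclidean_space \<Rightarrow> complex"
  assumes g: "integrable lborel g" and t: "0 < t"
  shows "(LINT z|lborel. complex_of_real (exp (- t * (norm z)^2)) * ift g (x + z))
     = ift (\<lambda>\<xi>. complex_of_real ((pi / t) powr (DIM('a) / 2) * exp (- ((norm \<xi>)^2) / (4 * t))) * g \<xi>) x"
proof -
  let ?f = "\<lambda>z::'a. complex_of_real (exp (- t * (norm z)^2))"
  have f: "integrable lborel ?f" using gauss_integral[OF t, where 'a='a] by (simp add: has_bochner_integral_iff)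
  have ft: "ift ?f \<xi> = complex_of_real ((pi / t) powr (DIM('a) / 2) * exp (- ((norm \<xi>)^2) / (4 * t)))" for \<xi>
    using gauss_fourier[OF t, of \<xi>] unfolding ift_def by (simp add: has_bochner_integral_iff inner_commute)
  have "(LINT z|lborel. ?f z * ift g (x + z)) = (LINT z|lborel. ?f z * ift (\<lambda>\<xi>. g \<xi> * cis (x \<bullet> \<xi>)) z)"
    by (simp add: ift_shift)
  also have "\<dots> = (LINT \<xi>|lborel. g \<xi> * cis (x \<bullet> \<xi>) * ift ?f \<xi>)"
    by (rule ift_mult_formula[OF f integrable_mult_cis(1)[OF g]])
  finally show ?thesis
    unfolding ft by (simp add: ift_def mult_ac)
qed

text \<open>The multiplier exp (- s |\<xi>|^2) acts as convolution with the heat kernel: the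
  preceding identity at t = 1 / (4 s).\<close>

lemma heat_ift:
  fixes g :: "'a::euclidean_space \<Rightarrow> complex"
  assumes g: "integrable lborel g" and s: "0 < s"
  shows "ift (\<lambda>\<xi>. complex_of_real (exp (- s * (norm \<xi>)^2)) * g \<xi>) x
     = complex_of_real ((4 * pi * s) powr (- (DIM('a) / 2))) *
        (LINT z|lborel. complex_of_real (exp (- (1 / (4 * s)) * (norm z)^2)) * ift g (x + z))"
proof -
  define c where "c = (4 * pi * s) powr (DIM('a) / 2)"
  have c: "c > 0" using s by (simp add: c_def)
  have "(LINT z|lborel. complex_of_real (exp (- (1 / (4 * s)) * (norm z)^2)) * ift g (x + z))
    = ift (\<lambda>\<xi>. complex_of_real (c * exp (- s * (norm \<xi>)^2)) * g \<xi>) x"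
    using gauss_ift[OF g, of "1 / (4 * s)" x] s by (simp add: c_def mult_ac)
  also have "\<dots> = of_real c * ift (\<lambda>\<xi>. complex_of_real (exp (- s * (norm \<xi>)^2)) * g \<xi>) x"
    by (simp add: ift_def mult.assoc)
  also have "(4 * pi * s) powr (- (DIM('a) / 2)) = inverse c" by (simp add: c_def powr_minus)
  ultimately show ?thesis using c by (simp only: mult.assoc[symmetric] of_real_mult[symmetric]) simp
qed

subsection \<open>The weighted norm\<close>

text \<open>The weight matches the quadratic growth of the term e |x|^2 in the solution. With values
  in \<open>ennreal\<close>, bounds can be derived before finiteness is known.\<close>

definition wnorm :: "('a::euclidean_space \<Rightarrow> complex) \<Rightarrow> ennreal" where
  "wnorm f = (\<integral>\<^sup>+x. ennreal ((1 + (norm x)^2) * norm (f x)) \<partial>lborel)"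

lemma wnorm_add:
  assumes [measurable]: "f \<in> borel_measurable borel" "g \<in> borel_measurable borel"
  shows "wnorm (\<lambda>x. f x + g x) \<le> wnorm f + wnorm g"
proof -
  have "wnorm (\<lambda>x. f x + g x) \<le> (\<integral>\<^sup>+x. ennreal ((1 + (norm x)^2) * norm (f x)) + ennreal ((1 + (norm x)^2) * norm (g x)) \<partial>lborel)"
    unfolding wnorm_def
    by (intro nn_integral_mono)
       (simp flip: ennreal_plus distrib_left add: mult_left_mono norm_triangle_ineq)
  also have "\<dots> = wnorm f + wnorm g" unfolding wnorm_def by (rule nn_integral_add) measurable
  finally show ?thesis .
qed

lemma wnorm_cmult:
  assumes [measurable]: "f \<in> borel_measurable borel"
  shows "wnorm (\<lambda>x. c * f x) = ennreal (norm c) * wnorm f"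
proof -
  have "ennreal ((1 + (norm x)^2) * norm (c * f x)) = ennreal (norm c) * ennreal ((1 + (norm x)^2) * norm (f x))" for x
    by (simp add: norm_mult mult_ac flip: ennreal_mult)
  then show ?thesis unfolding wnorm_def by (simp add: nn_integral_cmult)
qed

text \<open>Peetre-type inequality: the weight is submultiplicative up to a factor 2, so convolution
  with a kernel of finite weighted mass preserves finiteness of \<open>wnorm\<close>.\<close>

lemma one_plus_norm_sq_add_le: "1 + (norm (x + y))^2 \<le> 2 * (1 + (norm x)^2) * (1 + (norm (y::'a::real_inner))^2)"
proof -
  have "norm (x + y) \<le> norm x + norm y" by (rule norm_triangle_ineq)
  then have "(norm (x + y))^2 \<le> (norm x + norm y)^2" by (intro power_mono) auto
  also have "\<dots> \<le> 2 * (norm x)^2 + 2 * (norm y)^2"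
    using zero_le_power2[of "norm x - norm y"] by (simp add: power2_eq_square algebra_simps)
  finally have "1 + (norm (x + y))^2 \<le> 2 + 2 * (norm x)^2 + 2 * (norm y)^2 + 2 * ((norm x)^2 * (norm y)^2)"
    by (smt (verit) mult_nonneg_nonneg zero_le_power2)
  then show ?thesis by (simp add: algebra_simps)
qed

text \<open>Mass plus second moment of the heat kernel at time s. Scaling by
  \<open>2 * sqrt s\<close> shows that the moment is linear in s; this growth is what later has to
  be beaten by the decay of the subordination kernel.\<close>

lemma gauss_weighted_le:
  "\<exists>C::real. C \<ge> 0 \<and> (\<forall>s>0. (\<integral>\<^sup>+z. ennreal ((4 * pi * s) powr (- (DIM('a) / 2)) * exp (- (1 / (4 * s)) * (norm z)^2) * (1 + (norm (z::'a::euclidean_space))^2)) \<partial>lborel) \<le> ennreal (C * (1 + s)))"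
proof -
  let ?n = "DIM('a) / 2"
  define m where "m = (\<integral>z. exp (- 1 * (norm (z::'a))^2) * (norm z)^2 \<partial>lborel)"
  have i2: "integrable lborel (\<lambda>z::'a. exp (- 1 * (norm z)^2) * (norm z)^2)"
  proof -
    have "norm y powr 2 = (norm y)^2" for y :: 'a
      by simp
    then show ?thesis
      using integrable_norm_powr_gauss[of 2 1, where 'a='a] by (simp add: mult.commute)
  qed
  have i0: "has_bochner_integral lborel (\<lambda>z::'a. exp (- 1 * (norm z)^2)) (pi powr ?n)"
    using gauss_integral[of 1, where 'a='a] by simp
  have m0: "m \<ge> 0" unfolding m_def by (intro integral_nonneg_AE) auto
  have main: "(\<integral>\<^sup>+z. ennreal ((4 * pi * s) powr (- ?n) * exp (- (1 / (4 * s)) * (norm z)^2) * (1 + (norm (z::'a))^2)) \<partial>lborel)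
     = ennreal (pi powr (- ?n) * (pi powr ?n + 4 * s * m))" if s: "s > 0" for s
  proof -
    define c where "c = 2 * sqrt s"
    have c: "c > 0" "c^2 = 4 * s" using s by (auto simp: c_def power_mult_distrib)
    have cn: "\<bar>c\<bar> ^ DIM('a) = (4 * s) powr ?n"
    proof -
      have "c ^ DIM('a) = c powr (2 * ?n)" using c by (simp add: powr_realpow)
      also have "\<dots> = (c powr 2) powr ?n" by (simp add: powr_powr)
      also have "c powr 2 = 4 * s" using c by simp
      finally show ?thesis using c by simp
    qed
    have "(\<integral>\<^sup>+z. ennreal ((4 * pi * s) powr (- ?n) * exp (- (1 / (4 * s)) * (norm z)^2) * (1 + (norm (z::'a))^2)) \<partial>lborel)
      = ennreal (\<bar>c\<bar> ^ DIM('a)) * (\<integral>\<^sup>+z. ennreal ((4 * pi * s) powr (- ?n) * exp (- (1 / (4 * s)) * (norm (0 + c *\<^sub>R z))^2) * (1 + (norm (0 + c *\<^sub>R (z::'a)))^2)) \<partial>lborel)"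
      by (rule nn_integral_lborel_affine) (use c in auto)
    also have "\<dots> = (\<integral>\<^sup>+z. ennreal (pi powr (- ?n) * (exp (- 1 * (norm z)^2) + 4 * s * (exp (- 1 * (norm z)^2) * (norm (z::'a))^2))) \<partial>lborel)"
    proof (subst nn_integral_cmult[symmetric], measurable, rule nn_integral_cong)
      fix z :: 'a
      have n2: "(norm (0 + c *\<^sub>R z))^2 = 4 * s * (norm z)^2" using c by (simp add: power_mult_distrib)
      have e: "- (1 / (4 * s)) * (4 * s * (norm z)^2) = - 1 * (norm z)^2" using s by simp
      have p: "\<bar>c\<bar> ^ DIM('a) * (4 * pi * s) powr (- ?n) = pi powr (- ?n)"
        unfolding cn using s powr_mult[of "4 * s" pi "- ?n"] by (simp add: mult_ac powr_minus)
      have "\<bar>c\<bar> ^ DIM('a) * ((4 * pi * s) powr (- ?n) * exp (- (1 / (4 * s)) * (norm (0 + c *\<^sub>R z))^2) * (1 + (norm (0 + c *\<^sub>R z))^2))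
        = (\<bar>c\<bar> ^ DIM('a) * (4 * pi * s) powr (- ?n)) * (exp (- 1 * (norm z)^2) * (1 + 4 * s * (norm z)^2))"
        unfolding n2 e by (simp only: mult.assoc)
      also have "\<dots> = pi powr (- ?n) * (exp (- 1 * (norm z)^2) + 4 * s * (exp (- 1 * (norm z)^2) * (norm z)^2))"
        unfolding p by (simp add: algebra_simps)
      finally show "ennreal (\<bar>c\<bar> ^ DIM('a)) * ennreal ((4 * pi * s) powr (- ?n) * exp (- (1 / (4 * s)) * (norm (0 + c *\<^sub>R z))^2) * (1 + (norm (0 + c *\<^sub>R z))^2))
        = ennreal (pi powr (- ?n) * (exp (- 1 * (norm z)^2) + 4 * s * (exp (- 1 * (norm z)^2) * (norm z)^2)))"
        by (subst ennreal_mult[symmetric]) auto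
    qed
    also have "\<dots> = ennreal (pi powr (- ?n) * (pi powr ?n + 4 * s * m))"
      using i0 i2 s by (subst nn_integral_eq_integral) (auto simp: has_bochner_integral_iff m_def)
    finally show ?thesis .
  qed
  show ?thesis
  proof (intro exI[of _ "1 + 4 * pi powr (- ?n) * m"] conjI allI impI)
    show "0 \<le> 1 + 4 * pi powr (- ?n) * m" using m0 by simp
    fix s :: real assume s: "s > 0"
    have "pi powr (- ?n) * (pi powr ?n + 4 * s * m) = 1 + 4 * pi powr (- ?n) * m * s"
      by (simp add: distrib_left powr_minus)
    also have "\<dots> \<le> (1 + 4 * pi powr (- ?n) * m) * (1 + s)"
      using s m0 by (simp add: algebra_simps)
    finally show "(\<integral>\<^sup>+z. ennreal ((4 * pi * s) powr (- ?n) * exp (- (1 / (4 * s)) * (norm z)^2) * (1 + (norm (z::'a))^2)) \<partial>lborel) \<le> ennreal ((1 + 4 * pi powr (- ?n) * m) * (1 + s))"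
      unfolding main[OF s] by (rule ennreal_leI)
  qed
qed

lemma wnorm_heat:
  "\<exists>C::real. C \<ge> 0 \<and> (\<forall>s>0. \<forall>g :: 'a::euclidean_space \<Rightarrow> complex. integrable lborel g \<longrightarrow>
      wnorm (ift (\<lambda>\<xi>. complex_of_real (exp (- s * (norm \<xi>)^2)) * g \<xi>)) \<le> ennreal (C * (1 + s)) * wnorm (ift g))"
proof -
  obtain C :: real where C: "C \<ge> 0" and le: "\<And>s. s > 0 \<Longrightarrow> (\<integral>\<^sup>+z. ennreal ((4 * pi * s) powr (- (DIM('a) / 2)) * exp (- (1 / (4 * s)) * (norm z)^2) * (1 + (norm (z::'a))^2)) \<partial>lborel) \<le> ennreal (C * (1 + s))"
    using gauss_weighted_le[where 'a='a] by blast
  have "wnorm (ift (\<lambda>\<xi>. complex_of_real (exp (- s * (norm \<xi>)^2)) * g \<xi>)) \<le> ennreal ((2 * C) * (1 + s)) * wnorm (ift g)"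
    if s: "s > 0" and g: "integrable lborel g" for s and g :: "'a \<Rightarrow> complex"
  proof -
    have [measurable]: "g \<in> borel_measurable borel" using g by auto
    define G where "G z = (4 * pi * s) powr (- (DIM('a) / 2)) * exp (- (1 / (4 * s)) * (norm z)^2)" for z :: 'a
    have G0: "G z \<ge> 0" for z by (simp add: G_def)
    have [measurable]: "G \<in> borel_measurable borel" unfolding G_def by measurable
    have 1: "ennreal (norm (ift (\<lambda>\<xi>. complex_of_real (exp (- s * (norm \<xi>)^2)) * g \<xi>) x)) \<le> (\<integral>\<^sup>+z. ennreal (G z * norm (ift g (x + z))) \<partial>lborel)" for x
    proof -
      have "ift (\<lambda>\<xi>. complex_of_real (exp (- s * (norm \<xi>)^2)) * g \<xi>) x = (LINT z|lborel. complex_of_real (G z) * ift g (x + z))"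
        by (subst heat_ift[OF g s]) (simp add: G_def mult.assoc)
      also have "ennreal (norm \<dots>) \<le> (\<integral>\<^sup>+z. ennreal (norm (complex_of_real (G z) * ift g (x + z))) \<partial>lborel)"
        by (rule norm_integral_le_nn_integral)
      finally show ?thesis using G0 by (simp add: norm_mult)
    qed
    have "wnorm (ift (\<lambda>\<xi>. complex_of_real (exp (- s * (norm \<xi>)^2)) * g \<xi>)) \<le> (\<integral>\<^sup>+x. (\<integral>\<^sup>+z. ennreal ((1 + (norm x)^2)) * ennreal (G z * norm (ift g (x + z))) \<partial>lborel) \<partial>lborel)"
      unfolding wnorm_def using 1
      by (intro nn_integral_mono) (simp add: nn_integral_cmult ennreal_mult mult_left_mono)
    also have "\<dots> = (\<integral>\<^sup>+z. (\<integral>\<^sup>+x. ennreal ((1 + (norm x)^2)) * ennreal (G z * norm (ift g (x + z))) \<partial>lborel) \<partial>lborel)"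
      by (rule lborel_pair.Fubini') measurable
    also have "\<dots> \<le> (\<integral>\<^sup>+z. ennreal (2 * (G z * (1 + (norm z)^2))) * wnorm (ift g) \<partial>lborel)"
    proof (rule nn_integral_mono)
      fix z :: 'a
      have "(\<integral>\<^sup>+x. ennreal ((1 + (norm x)^2)) * ennreal (G z * norm (ift g (x + z))) \<partial>lborel)
        = (\<integral>\<^sup>+x. ennreal ((1 + (norm (x - z))^2)) * ennreal (G z * norm (ift g x)) \<partial>lborel)"
        using nn_integral_lborel_shift(1)[of "\<lambda>x. ennreal ((1 + (norm (x - z))^2)) * ennreal (G z * norm (ift g x))" z]
        by (simp add: add.commute)
      also have "\<dots> \<le> (\<integral>\<^sup>+x. ennreal (2 * (G z * (1 + (norm z)^2))) * ennreal ((1 + (norm x)^2) * norm (ift g x)) \<partial>lborel)"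
      proof (rule nn_integral_mono)
        fix x
        have "(1 + (norm (x - z))^2) * (G z * norm (ift g x)) \<le> (2 * (1 + (norm x)^2) * (1 + (norm z)^2)) * (G z * norm (ift g x))"
          using one_plus_norm_sq_add_le[of x "- z"] G0 by (intro mult_right_mono) auto
        also have "\<dots> = (2 * (G z * (1 + (norm z)^2))) * ((1 + (norm x)^2) * norm (ift g x))"
          by (simp only: mult_ac)
        finally show "ennreal ((1 + (norm (x - z))^2)) * ennreal (G z * norm (ift g x)) \<le> ennreal (2 * (G z * (1 + (norm z)^2))) * ennreal ((1 + (norm x)^2) * norm (ift g x))"
          by (rule ennreal_mult_leI[rotated 4]) (use G0 in auto)
      qed
      also have "\<dots> = ennreal (2 * (G z * (1 + (norm z)^2))) * wnorm (ift g)"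
        unfolding wnorm_def by (rule nn_integral_cmult) measurable
      finally show "(\<integral>\<^sup>+x. ennreal ((1 + (norm x)^2)) * ennreal (G z * norm (ift g (x + z))) \<partial>lborel) \<le> ennreal (2 * (G z * (1 + (norm z)^2))) * wnorm (ift g)" .
    qed
    also have "\<dots> = (\<integral>\<^sup>+z. ennreal 2 * ennreal (G z * (1 + (norm z)^2)) \<partial>lborel) * wnorm (ift g)"
      using G0 by (subst nn_integral_multc) (auto simp: ennreal_mult)
    also have "\<dots> = ennreal 2 * (\<integral>\<^sup>+z. ennreal (G z * (1 + (norm z)^2)) \<partial>lborel) * wnorm (ift g)"
      by (subst nn_integral_cmult) measurable
    also have "\<dots> \<le> ennreal 2 * ennreal (C * (1 + s)) * wnorm (ift g)"
      using le[OF s] unfolding G_def by (intro mult_right_mono mult_left_mono) auto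
    also have "ennreal 2 * ennreal (C * (1 + s)) = ennreal (2 * C * (1 + s))"
      using C s by (subst ennreal_mult[symmetric]) (auto simp: mult_ac)
    finally show ?thesis .
  qed
  then show ?thesis using C by (intro exI[of _ "2 * C"]) auto
qed

subsection \<open>Schwartz functions\<close>

lemma iter_dderiv_append: "iter_dderiv vs (dderiv b f) = iter_dderiv (vs @ [b]) f"
  by (induction vs) auto

lemma schwartz_dderiv:
  assumes "schwartz f" "b \<in> Basis"
  shows "schwartz (dderiv b f)"
  using assms unfolding schwartz_def smooth_fun_def iter_dderiv_append by auto

lemma schwartz_differentiable: "schwartz f \<Longrightarrow> f differentiable at x"
  unfolding schwartz_def smooth_fun_def by (metis empty_subsetI iter_dderiv.simps(1) list.set(1))

lemma schwartz_continuous: "schwartz f \<Longrightarrow> continuous_on UNIV f"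
  by (simp add: continuous_at_imp_continuous_on differentiable_imp_continuous_within schwartz_differentiable)

lemma schwartz_measurable: "schwartz f \<Longrightarrow> f \<in> borel_measurable borel"
  by (rule borel_measurable_continuous_onI) (rule schwartz_continuous)

lemma one_plus_sq_power_le: "(1 + r^2) ^ m \<le> 2 ^ m * (1 + r ^ (2 * m))" for r :: real
proof (cases "r^2 \<le> 1")
  case True
  then have "(1 + r^2) ^ m \<le> 2 ^ m" by (intro power_mono) auto
  also have "\<dots> \<le> 2 ^ m * (1 + r ^ (2 * m))" by simp
  finally show ?thesis .
next
  case False
  then have "(1 + r^2) ^ m \<le> (2 * r^2) ^ m" by (intro power_mono) auto
  also have "\<dots> = 2 ^ m * r ^ (2 * m)" by (simp add: power_mult_distrib power_mult)
  also have "\<dots> \<le> 2 ^ m * (1 + r ^ (2 * m))" by simp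
  finally show ?thesis .
qed

lemma schwartz_decay:
  assumes "schwartz f"
  obtains C where "0 \<le> C" "\<And>x. (1 + (norm x)^2) ^ m * \<bar>f x\<bar> \<le> C"
proof -
  have "bounded (range (\<lambda>x. norm x ^ k * f x))" for k
    using assms unfolding schwartz_def by (metis empty_subsetI iter_dderiv.simps(1) list.set(1))
  then have "\<exists>B. \<forall>x. \<bar>norm x ^ k * f x\<bar> \<le> B" for k
    by (auto simp: bounded_iff)
  then obtain B where B: "\<And>k x. \<bar>norm x ^ k * f x\<bar> \<le> B k" by metis
  have "(1 + (norm x)^2) ^ m * \<bar>f x\<bar> \<le> 2 ^ m * (B 0 + B (2 * m))" for x
  proof -
    have "(1 + (norm x)^2) ^ m * \<bar>f x\<bar> \<le> (2 ^ m * (1 + norm x ^ (2 * m))) * \<bar>f x\<bar>"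
      by (intro mult_right_mono one_plus_sq_power_le) auto
    also have "\<dots> = 2 ^ m * (\<bar>norm x ^ 0 * f x\<bar> + \<bar>norm x ^ (2 * m) * f x\<bar>)"
      by (simp add: abs_mult algebra_simps)
    also have "\<dots> \<le> 2 ^ m * (B 0 + B (2 * m))"
      by (intro mult_left_mono add_mono B) auto
    finally show ?thesis .
  qed
  moreover have "0 \<le> 2 ^ m * (B 0 + B (2 * m))"
    using order_trans[OF abs_ge_zero B] by (intro mult_nonneg_nonneg add_nonneg_nonneg) auto
  ultimately show ?thesis using that by blast
qed

lemma le_powr_minus_of_mult_le:
  assumes "(1 + r^2) ^ m * A \<le> C"
  shows "A \<le> C * (1 + r^2) powr (- real m)"
proof -
  have "1 + r^2 > 0" by (simp add: add_pos_nonneg)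
  then show ?thesis
    using assms by (simp add: powr_minus powr_realpow field_simps)
qed

lemma integrable_rapid_decay:
  fixes f :: "'a::euclidean_space \<Rightarrow> 'b::{banach, second_countable_topology}"
  assumes [measurable]: "f \<in> borel_measurable borel" and le: "\<And>x. (1 + (norm x)^2) ^ DIM('a) * norm (f x) \<le> C"
  shows "integrable lborel f"
proof (rule Bochner_Integration.integrable_bound)
  have "real DIM('a) / 2 < real DIM('a)" by simp
  from integrable_one_plus_norm_sq_powr[OF this]
  show "integrable lborel (\<lambda>x::'a. C * (1 + (norm x)^2) powr (- real DIM('a)))"
    by simp
  show "AE x in lborel. norm (f x) \<le> norm (C * (1 + (norm x)^2) powr (- real DIM('a)))"
    using le_powr_minus_of_mult_le[OF le] by (auto intro: order_trans[OF _ abs_ge_self])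
qed simp

lemma schwartz_integrable_weighted:
  assumes f: "schwartz (f :: 'a::euclidean_space \<Rightarrow> real)"
  shows "integrable lborel (\<lambda>x. (1 + (norm x)^2) ^ j * f x)"
proof -
  obtain C where C: "\<And>x. (1 + (norm x)^2) ^ (DIM('a) + j) * \<bar>f x\<bar> \<le> C" using schwartz_decay[OF f] by blast
  have [measurable]: "f \<in> borel_measurable borel" by (rule schwartz_measurable[OF f])
  show ?thesis
    using C by (intro integrable_rapid_decay[of _ C]) (auto simp: abs_mult power_add mult.assoc)
qed

lemma schwartz_integrable: "schwartz (f :: 'a::euclidean_space \<Rightarrow> real) \<Longrightarrow> integrable lborel f"
  using schwartz_integrable_weighted[of f 0] by simp

lemma fourier_eq_ift: "fourier f \<xi> = ift f (- \<xi>)"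
  by (simp add: fourier_def ift_def inner_commute)

lemma fourier_inv_eq_ift: "fourier_inv g (x::'a::euclidean_space) = ift g x / (2 * pi) ^ DIM('a)"
  by (simp add: fourier_inv_def ift_def inner_commute)

lemma schwartz_dderiv_line:
  assumes f: "schwartz f"
  shows "((\<lambda>h. f (x + h *\<^sub>R b)) has_real_derivative dderiv b f (x + h *\<^sub>R b)) (at h)"
proof -
  have "(f has_derivative frechet_derivative f (at (x + h *\<^sub>R b))) (at (x + h *\<^sub>R b))"
    using schwartz_differentiable[OF f] frechet_derivative_works by blast
  moreover have "((\<lambda>h. x + h *\<^sub>R b) has_derivative (\<lambda>h. h *\<^sub>R b)) (at h)"
    by (auto intro!: derivative_eq_intros)
  ultimately have "((\<lambda>h. f (x + h *\<^sub>R b)) has_derivative (\<lambda>k. frechet_derivative f (at (x + h *\<^sub>R b)) (k *\<^sub>R b))) (at h)"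
    by (rule has_derivative_compose[rotated])
  moreover have "linear (frechet_derivative f (at (x + h *\<^sub>R b)))"
    using linear_frechet_derivative schwartz_differentiable[OF f] by blast
  ultimately show ?thesis
    by (simp add: has_field_derivative_def dderiv_def linear_scale mult_commute_abs)
qed

text \<open>No integration by parts: the transform of a difference quotient is the transform of f
  times (cis (h (b . \<xi>)) - 1) / h, because of translation invariance, and both sides pass to the
  limit h to 0.\<close>

lemma fourier_dderiv:
  fixes f :: "'a::euclidean_space \<Rightarrow> real"
  assumes f: "schwartz f" and b: "b \<in> Basis"
  shows "fourier (\<lambda>x. complex_of_real (dderiv b f x)) \<xi> = \<i> * complex_of_real (\<xi> \<bullet> b) * fourier (\<lambda>x. complex_of_real (f x)) \<xi>"
proof -
  let ?n = "DIM('a)"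
  define h where "h k = 1 / real (Suc k)" for k
  have h: "h k > 0" "h k \<le> 1" "h k \<noteq> 0" for k by (auto simp: h_def)
  have h0: "h \<longlonglongrightarrow> 0" unfolding h_def using LIMSEQ_inverse_real_of_nat by (simp add: inverse_eq_divide)
  have [measurable]: "f \<in> borel_measurable borel" "dderiv b f \<in> borel_measurable borel"
    using schwartz_measurable f schwartz_dderiv[OF f b] by auto
  define u where "u k x = complex_of_real ((f (x + h k *\<^sub>R b) - f x) / h k) * cis (- (x \<bullet> \<xi>))" for k x
  obtain C where C: "0 \<le> C" "\<And>x. (1 + (norm x)^2) ^ ?n * \<bar>dderiv b f x\<bar> \<le> C"
    using schwartz_decay[OF schwartz_dderiv[OF f b]] by blast
  have lim1: "(\<lambda>k. LINT x|lborel. u k x) \<longlonglongrightarrow> fourier (\<lambda>x. complex_of_real (dderiv b f x)) \<xi>"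
    unfolding fourier_def
  proof (rule integral_dominated_convergence)
    have "real ?n / 2 < real ?n" by simp
    from integrable_one_plus_norm_sq_powr[OF this]
    show "integrable lborel (\<lambda>x::'a. (4 ^ ?n * C) * (1 + (norm x)^2) powr (- real ?n))" by simp
    show "AE x in lborel. (\<lambda>k. u k x) \<longlonglongrightarrow> complex_of_real (dderiv b f x) * cis (- (x \<bullet> \<xi>))"
    proof (rule AE_I2)
      fix x
      have "((\<lambda>k. (f (x + k *\<^sub>R b) - f x) / k) \<longlongrightarrow> dderiv b f x) (at 0)"
        using schwartz_dderiv_line[OF f, of x b 0] by (simp add: DERIV_def)
      moreover have "filterlim h (at 0) sequentially"
        using h0 h(3) by (auto simp: filterlim_at)
      ultimately have "(\<lambda>k. (f (x + h k *\<^sub>R b) - f x) / h k) \<longlonglongrightarrow> dderiv b f x"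
        by (rule filterlim_compose)
      then show "(\<lambda>k. u k x) \<longlonglongrightarrow> complex_of_real (dderiv b f x) * cis (- (x \<bullet> \<xi>))"
        unfolding u_def by (intro tendsto_intros)
    qed
    show "AE x in lborel. norm (u k x) \<le> (4 ^ ?n * C) * (1 + (norm x)^2) powr (- real ?n)" for k
    proof (rule AE_I2)
      fix x
      obtain \<tau> where \<tau>: "0 < \<tau>" "\<tau> < h k" "f (x + h k *\<^sub>R b) - f (x + 0 *\<^sub>R b) = (h k - 0) * dderiv b f (x + \<tau> *\<^sub>R b)"
        using MVT2[OF h(1)[of k], of "\<lambda>h. f (x + h *\<^sub>R b)" "\<lambda>h. dderiv b f (x + h *\<^sub>R b)"] schwartz_dderiv_line[OF f] by blast
      have t1: "(norm (\<tau> *\<^sub>R b))^2 \<le> 1" using \<tau> h(2)[of k] b by (simp add: power_le_one)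
      have nu: "norm (u k x) = \<bar>dderiv b f (x + \<tau> *\<^sub>R b)\<bar>"
        using \<tau>(3) h(3)[of k] by (simp add: u_def norm_mult)
      \<comment> \<open>The mean value point is within distance 1 of x, so the weight changes by a
        factor of at most 2 * 2; its n-th power is the constant 4^n of the majorant.\<close>
      have "1 + (norm x)^2 \<le> 4 * (1 + (norm (x + \<tau> *\<^sub>R b))^2)"
      proof -
        have "1 + (norm x)^2 \<le> 2 * (1 + (norm (x + \<tau> *\<^sub>R b))^2) * (1 + (norm (- \<tau> *\<^sub>R b))^2)"
          using one_plus_norm_sq_add_le[of "x + \<tau> *\<^sub>R b" "- \<tau> *\<^sub>R b"] by simp
        also have "\<dots> \<le> 2 * (1 + (norm (x + \<tau> *\<^sub>R b))^2) * 2"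
          using t1 by (intro mult_left_mono) auto
        finally show ?thesis by simp
      qed
      then have pw: "(1 + (norm x)^2) ^ ?n \<le> (4 * (1 + (norm (x + \<tau> *\<^sub>R b))^2)) ^ ?n"
        by (intro power_mono) auto
      have "(1 + (norm x)^2) ^ ?n * norm (u k x) \<le> (4 * (1 + (norm (x + \<tau> *\<^sub>R b))^2)) ^ ?n * \<bar>dderiv b f (x + \<tau> *\<^sub>R b)\<bar>"
        unfolding nu by (intro mult_right_mono pw) auto
      also have "\<dots> \<le> 4 ^ ?n * C"
        using C(2)[of "x + \<tau> *\<^sub>R b"] unfolding power_mult_distrib by (simp add: mult.assoc)
      finally show "norm (u k x) \<le> (4 ^ ?n * C) * (1 + (norm x)^2) powr (- real ?n)"
        by (rule le_powr_minus_of_mult_le)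
    qed
  qed (unfold u_def, measurable)
  let ?F = "fourier (\<lambda>x. complex_of_real (f x)) \<xi>"
  have fc: "integrable lborel (\<lambda>x. complex_of_real (f x))" using schwartz_integrable[OF f] by simp
  have intc: "integrable lborel (\<lambda>x. complex_of_real (f x) * cis (- (x \<bullet> \<xi>)))"
    by (rule integrable_mult_bounded[OF fc, of _ 1]) auto
  have val: "(LINT x|lborel. u k x) = ?F * ((cis (h k * (b \<bullet> \<xi>)) - 1) / complex_of_real (h k))" for k
  proof -
    define w where "w x = complex_of_real (f x) * cis (- ((x - h k *\<^sub>R b) \<bullet> \<xi>))" for x
    have w: "w x = complex_of_real (f x) * cis (- (x \<bullet> \<xi>)) * cis (h k * (b \<bullet> \<xi>))" for x
      by (simp add: w_def inner_diff_left cis_mult mult.assoc)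
    have [measurable]: "w \<in> borel_measurable borel" unfolding w_def by measurable
    have wi: "integrable lborel w" unfolding w using intc by (simp add: fun_eq_iff)
    have s: "integrable lborel (\<lambda>x. w (x + h k *\<^sub>R b))" "(LINT x|lborel. w (x + h k *\<^sub>R b)) = integral\<^sup>L lborel w"
      using integrable_lborel_shift(1)[OF wi, of "h k *\<^sub>R b"] integral_lborel_shift(1)[of w "h k *\<^sub>R b"] by (simp_all add: add.commute)
    have "(LINT x|lborel. u k x) = (LINT x|lborel. (w (x + h k *\<^sub>R b) - complex_of_real (f x) * cis (- (x \<bullet> \<xi>))) / complex_of_real (h k))"
      by (rule Bochner_Integration.integral_cong) (simp_all add: u_def w_def left_diff_distrib)
    also have "\<dots> = (integral\<^sup>L lborel w - ?F) / complex_of_real (h k)"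
      using s intc by (simp add: fourier_def)
    also have "integral\<^sup>L lborel w = ?F * cis (h k * (b \<bullet> \<xi>))"
      unfolding w fourier_def by simp
    finally show ?thesis by (simp add: algebra_simps)
  qed
  have "(\<lambda>k. ?F * ((cis (h k * (b \<bullet> \<xi>)) - 1) / complex_of_real (h k))) \<longlonglongrightarrow> ?F * (\<i> * complex_of_real (\<xi> \<bullet> b))"
  proof (rule tendsto_mult_left)
    have "((\<lambda>z. exp (\<i> * complex_of_real (b \<bullet> \<xi>) * z)) has_field_derivative \<i> * complex_of_real (b \<bullet> \<xi>)) (at 0)"
      by (auto intro!: derivative_eq_intros)
    then have "((\<lambda>z. (exp (\<i> * complex_of_real (b \<bullet> \<xi>) * z) - 1) / z) \<longlongrightarrow> \<i> * complex_of_real (b \<bullet> \<xi>)) (at 0)"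
      by (simp add: DERIV_def)
    moreover have "filterlim (\<lambda>k. complex_of_real (h k)) (at 0) sequentially"
      using tendsto_of_real[OF h0, where 'a=complex] h(3) by (auto simp: filterlim_at)
    ultimately have "(\<lambda>k. (exp (\<i> * complex_of_real (b \<bullet> \<xi>) * complex_of_real (h k)) - 1) / complex_of_real (h k)) \<longlonglongrightarrow> \<i> * complex_of_real (b \<bullet> \<xi>)"
      by (rule filterlim_compose)
    then show "(\<lambda>k. (cis (h k * (b \<bullet> \<xi>)) - 1) / complex_of_real (h k)) \<longlonglongrightarrow> \<i> * complex_of_real (\<xi> \<bullet> b)"
      by (simp add: cis_conv_exp mult_ac inner_commute)
  qed
  then show ?thesis
    using LIMSEQ_unique[OF lim1[unfolded val]] by (simp add: mult_ac)
qed

lemma norm_sq_Basis: "(norm (x::'a::euclidean_space))^2 = (\<Sum>b\<in>Basis. (x \<bullet> b)^2)"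
  unfolding power2_norm_eq_inner by (subst euclidean_inner) (simp add: power2_eq_square)

lemma norm_sq_fourier:
  fixes f :: "'a::euclidean_space \<Rightarrow> real"
  assumes f: "schwartz f"
  shows "complex_of_real ((norm \<xi>)^2) * fourier (\<lambda>x. complex_of_real (f x)) \<xi>
     = (\<Sum>b\<in>Basis. - fourier (\<lambda>x. complex_of_real (dderiv b (dderiv b f) x)) \<xi>)"
proof -
  have "- fourier (\<lambda>x. complex_of_real (dderiv b (dderiv b f) x)) \<xi> = complex_of_real ((\<xi> \<bullet> b)^2) * fourier (\<lambda>x. complex_of_real (f x)) \<xi>"
    if "b \<in> Basis" for b
  proof -
    have "\<i> * X * (\<i> * X * Y) = - (X * X * Y)" for X Y :: complex
      by (metis (no_types, lifting) i_squared mult.assoc mult.left_commute mult_minus1)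
    then show ?thesis
      by (simp add: fourier_dderiv schwartz_dderiv f that power2_eq_square)
  qed
  then show ?thesis by (simp add: norm_sq_Basis sum_distrib_right)
qed

lemma fourier_decay:
  fixes f :: "'a::euclidean_space \<Rightarrow> real"
  assumes f: "schwartz f"
  shows "\<exists>C. \<forall>\<xi>. norm \<xi> ^ (2 * m) * norm (fourier (\<lambda>x. complex_of_real (f x)) \<xi>) \<le> C"
  using f
proof (induction m arbitrary: f)
  case 0
  then show ?case using ift_bound[of "\<lambda>x. complex_of_real (f x)"] by (auto simp: fourier_eq_ift)
next
  case (Suc m)
  have "\<forall>b\<in>Basis. \<exists>C. \<forall>\<xi>. norm \<xi> ^ (2 * m) * norm (fourier (\<lambda>x. complex_of_real (dderiv b (dderiv b f) x)) \<xi>) \<le> C"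
    using Suc by (auto intro: schwartz_dderiv)
  then obtain C where C: "\<And>b \<xi>. b \<in> Basis \<Longrightarrow> norm \<xi> ^ (2 * m) * norm (fourier (\<lambda>x. complex_of_real (dderiv b (dderiv b f) x)) \<xi>) \<le> C b"
    by metis
  have "norm \<xi> ^ (2 * Suc m) * norm (fourier (\<lambda>x. complex_of_real (f x)) \<xi>) \<le> (\<Sum>b\<in>Basis. C b)" for \<xi>
  proof -
    have "norm \<xi> ^ (2 * Suc m) * norm (fourier (\<lambda>x. complex_of_real (f x)) \<xi>)
      = norm \<xi> ^ (2 * m) * norm (complex_of_real ((norm \<xi>)^2) * fourier (\<lambda>x. complex_of_real (f x)) \<xi>)"
      by (simp add: norm_mult power2_eq_square norm_power)
    also have "\<dots> = norm \<xi> ^ (2 * m) * norm (\<Sum>b\<in>Basis. - fourier (\<lambda>x. complex_of_real (dderiv b (dderiv b f) x)) \<xi>)"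
      unfolding norm_sq_fourier[OF Suc.prems] ..
    also have "\<dots> \<le> norm \<xi> ^ (2 * m) * (\<Sum>b\<in>Basis. norm (fourier (\<lambda>x. complex_of_real (dderiv b (dderiv b f) x)) \<xi>))"
      by (intro mult_left_mono order_trans[OF norm_sum]) auto
    also have "\<dots> \<le> (\<Sum>b\<in>Basis. C b)"
      unfolding sum_distrib_left by (intro sum_mono C)
    finally show ?thesis .
  qed
  then show ?case by blast
qed

lemma borel_measurable_fourier [measurable]:
  assumes [measurable]: "f \<in> borel_measurable borel"
  shows "fourier f \<in> borel_measurable (borel :: 'a::euclidean_space measure)"
  unfolding fourier_eq_ift[abs_def] by (rule measurable_compose[OF _ borel_measurable_ift]) auto

lemma fourier_integrable_weighted:
  fixes f :: "'a::euclidean_space \<Rightarrow> real"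
  assumes f: "schwartz f" and w[measurable]: "w \<in> borel_measurable borel" and le: "\<And>\<xi>. \<bar>w \<xi>\<bar> \<le> (1 + (norm \<xi>)^2) ^ j"
  shows "integrable lborel (\<lambda>\<xi>. complex_of_real (w \<xi>) * fourier (\<lambda>x. complex_of_real (f x)) \<xi>)"
proof -
  let ?F = "fourier (\<lambda>x. complex_of_real (f x))"
  have [measurable]: "f \<in> borel_measurable borel" by (rule schwartz_measurable[OF f])
  obtain C where C: "\<And>m \<xi>. norm \<xi> ^ (2 * m) * norm (?F \<xi>) \<le> C m"
    using fourier_decay[OF f] by metis
  have dec: "(1 + (norm \<xi>)^2) ^ m * norm (?F \<xi>) \<le> 2 ^ m * (C 0 + C m)" for m \<xi>
  proof -
    have "(1 + (norm \<xi>)^2) ^ m * norm (?F \<xi>) \<le> (2 ^ m * (1 + norm \<xi> ^ (2 * m))) * norm (?F \<xi>)"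
      by (intro mult_right_mono one_plus_sq_power_le) auto
    also have "\<dots> = 2 ^ m * (norm \<xi> ^ (2 * 0) * norm (?F \<xi>) + norm \<xi> ^ (2 * m) * norm (?F \<xi>))"
      by (simp add: algebra_simps)
    also have "\<dots> \<le> 2 ^ m * (C 0 + C m)"
      by (intro mult_left_mono add_mono C) auto
    finally show ?thesis .
  qed
  show ?thesis
  proof (rule integrable_rapid_decay)
    fix \<xi> :: 'a
    have "(1 + (norm \<xi>)^2) ^ DIM('a) * norm (complex_of_real (w \<xi>) * ?F \<xi>) = ((1 + (norm \<xi>)^2) ^ DIM('a) * norm (?F \<xi>)) * \<bar>w \<xi>\<bar>"
      by (simp add: norm_mult)
    also have "\<dots> \<le> ((1 + (norm \<xi>)^2) ^ DIM('a) * norm (?F \<xi>)) * (1 + (norm \<xi>)^2) ^ j"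
      by (intro mult_left_mono le) auto
    also have "\<dots> = (1 + (norm \<xi>)^2) ^ (DIM('a) + j) * norm (?F \<xi>)" by (simp add: power_add)
    also have "\<dots> \<le> 2 ^ (DIM('a) + j) * (C 0 + C (DIM('a) + j))" by (rule dec)
    finally show "(1 + (norm \<xi>)^2) ^ DIM('a) * norm (complex_of_real (w \<xi>) * ?F \<xi>) \<le> 2 ^ (DIM('a) + j) * (C 0 + C (DIM('a) + j))" .
  qed measurable
qed

lemma fourier_integrable:
  fixes f :: "'a::euclidean_space \<Rightarrow> real"
  shows "schwartz f \<Longrightarrow> integrable lborel (fourier (\<lambda>x. complex_of_real (f x)))"
  using fourier_integrable_weighted[of f "\<lambda>_. 1" 0] by simp

text \<open>Regularise by exp (- s |\<xi>|^2). By the multiplication formula the regularised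
  integral is a Gaussian average of f around x at scale 2 sqrt s, and s tends to 0 on both
  sides.\<close>

lemma fourier_inversion:
  fixes f :: "'a::euclidean_space \<Rightarrow> real"
  assumes f: "schwartz f"
  shows "ift (fourier (\<lambda>x. complex_of_real (f x))) x = (2 * pi) ^ DIM('a) * complex_of_real (f x)"
proof -
  let ?n = "real DIM('a) / 2"
  let ?F = "fourier (\<lambda>x. complex_of_real (f x))"
  have [measurable]: "f \<in> borel_measurable borel" by (rule schwartz_measurable[OF f])
  define s where "s k = 1 / real (Suc k)" for k
  have s: "s k > 0" for k by (simp add: s_def)
  have s0: "s \<longlonglongrightarrow> 0" unfolding s_def using LIMSEQ_inverse_real_of_nat by (simp add: inverse_eq_divide)
  have Fi: "integrable lborel ?F" by (rule fourier_integrable[OF f])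
  have lim1: "(\<lambda>k. LINT \<xi>|lborel. complex_of_real (exp (- s k * (norm \<xi>)^2)) * (?F \<xi> * cis (x \<bullet> \<xi>))) \<longlonglongrightarrow> ift ?F x"
    unfolding ift_def
  proof (rule integral_dominated_convergence)
    show "integrable lborel (\<lambda>\<xi>. norm (?F \<xi>))" using Fi by simp
    show "AE \<xi> in lborel. (\<lambda>k. complex_of_real (exp (- s k * (norm \<xi>)^2)) * (?F \<xi> * cis (x \<bullet> \<xi>))) \<longlonglongrightarrow> ?F \<xi> * cis (x \<bullet> \<xi>)"
    proof (rule AE_I2)
      fix \<xi> :: 'a
      have "(\<lambda>k. complex_of_real (exp (- s k * (norm \<xi>)^2)) * (?F \<xi> * cis (x \<bullet> \<xi>))) \<longlonglongrightarrow> complex_of_real (exp (- 0 * (norm \<xi>)^2)) * (?F \<xi> * cis (x \<bullet> \<xi>))"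
        by (intro tendsto_intros s0)
      then show "(\<lambda>k. complex_of_real (exp (- s k * (norm \<xi>)^2)) * (?F \<xi> * cis (x \<bullet> \<xi>))) \<longlonglongrightarrow> ?F \<xi> * cis (x \<bullet> \<xi>)" by simp
    qed
    show "AE \<xi> in lborel. norm (complex_of_real (exp (- s k * (norm \<xi>)^2)) * (?F \<xi> * cis (x \<bullet> \<xi>))) \<le> norm (?F \<xi>)" for k
      using s[of k] by (intro AE_I2) (simp add: norm_mult mult_left_le_one_le)
  qed measurable
  define B where "B = (LINT z|lborel. complex_of_real (exp (- 1 * (norm (z::'a))^2)))"
  have B: "B = pi powr ?n" using gauss_integral[of 1, where 'a='a] by (simp add: B_def has_bochner_integral_iff)
  have val: "(LINT \<xi>|lborel. complex_of_real (exp (- s k * (norm \<xi>)^2)) * (?F \<xi> * cis (x \<bullet> \<xi>)))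
     = complex_of_real ((4 * pi) powr ?n) * (LINT z|lborel. complex_of_real (exp (- 1 * (norm z)^2)) * complex_of_real (f (x + (2 * sqrt (s k)) *\<^sub>R z)))" for k
  proof -
    \<comment> \<open>The reflection turns the forward transform into \<open>ift\<close>, to which
      \<open>ift_mult_formula\<close> applies. It is undone by the substitution y = - x - 2 sqrt s
      z.\<close>
    define g where "g y = complex_of_real (f (- y))" for y
    have gi: "integrable lborel g"
      using integrable_lborel_shift(2)[OF schwartz_integrable[OF f], of 0] by (simp add: g_def[abs_def])
    have Fg: "?F \<xi> = ift g \<xi>" for \<xi>
      using integral_lborel_shift(2)[of "\<lambda>y. g y * cis (\<xi> \<bullet> y)" 0]
      by (simp add: fourier_def ift_def g_def inner_commute)
    have c: "(2 * sqrt (s k)) ^ DIM('a) * (pi / s k) powr ?n = (4 * pi) powr ?n"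
    proof -
      have "(2 * sqrt (s k)) ^ DIM('a) = (2 * sqrt (s k)) powr (2 * ?n)" using s[of k] by (simp add: powr_realpow)
      also have "\<dots> = ((2 * sqrt (s k)) powr 2) powr ?n" by (simp add: powr_powr)
      also have "(2 * sqrt (s k)) powr 2 = 4 * s k" using s[of k] by (simp add: power_mult_distrib)
      finally have "(2 * sqrt (s k)) ^ DIM('a) * (pi / s k) powr ?n = (4 * s k * (pi / s k)) powr ?n"
        using s[of k] by (simp only: powr_mult)
      then show ?thesis using s[of k] by simp
    qed
    have gi2: "has_bochner_integral lborel (\<lambda>\<xi>. complex_of_real (exp (- s k * (norm \<xi>)^2)) * cis (\<xi> \<bullet> (x + y))) (complex_of_real ((pi / s k) powr ?n * exp (- ((norm (x + y))^2) / (4 * s k))))" for y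
      by (rule gauss_fourier[OF s])
    have gi3: "integrable lborel (\<lambda>\<xi>. complex_of_real (exp (- s k * (norm \<xi>)^2)) * cis (x \<bullet> \<xi>))"
      using gi2[of 0] by (simp add: has_bochner_integral_iff inner_commute)
    have "(LINT \<xi>|lborel. complex_of_real (exp (- s k * (norm \<xi>)^2)) * (?F \<xi> * cis (x \<bullet> \<xi>)))
       = (LINT \<xi>|lborel. (complex_of_real (exp (- s k * (norm \<xi>)^2)) * cis (x \<bullet> \<xi>)) * ift g \<xi>)"
      by (simp add: Fg mult_ac)
    also have "\<dots> = (LINT y|lborel. g y * ift (\<lambda>\<xi>. complex_of_real (exp (- s k * (norm \<xi>)^2)) * cis (x \<bullet> \<xi>)) y)"
      by (rule ift_mult_formula[OF gi3 gi])
    also have "\<dots> = (LINT y|lborel. g y * complex_of_real ((pi / s k) powr ?n * exp (- ((norm (x + y))^2) / (4 * s k))))"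
    proof (rule Bochner_Integration.integral_cong[OF refl])
      fix y
      have "ift (\<lambda>\<xi>. complex_of_real (exp (- s k * (norm \<xi>)^2)) * cis (x \<bullet> \<xi>)) y = (LINT \<xi>|lborel. complex_of_real (exp (- s k * (norm \<xi>)^2)) * cis (\<xi> \<bullet> (x + y)))"
        by (simp add: ift_def inner_add_right inner_commute mult.assoc cis_mult)
      also have "\<dots> = complex_of_real ((pi / s k) powr ?n * exp (- ((norm (x + y))^2) / (4 * s k)))"
        using gi2[of y] by (simp only: has_bochner_integral_iff)
      finally show "g y * ift (\<lambda>\<xi>. complex_of_real (exp (- s k * (norm \<xi>)^2)) * cis (x \<bullet> \<xi>)) y = g y * complex_of_real ((pi / s k) powr ?n * exp (- ((norm (x + y))^2) / (4 * s k)))"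
        by simp
    qed
    also have "\<dots> = \<bar>- (2 * sqrt (s k))\<bar> ^ DIM('a) *\<^sub>R (LINT z|lborel. g (- x + (- (2 * sqrt (s k))) *\<^sub>R z) * complex_of_real ((pi / s k) powr ?n * exp (- ((norm (x + (- x + (- (2 * sqrt (s k))) *\<^sub>R z)))^2) / (4 * s k))))"
      using s[of k] by (intro integral_lborel_affine) (auto simp: g_def)
    also have "\<dots> = (2 * sqrt (s k)) ^ DIM('a) *\<^sub>R (LINT z|lborel. complex_of_real ((pi / s k) powr ?n) * (complex_of_real (exp (- 1 * (norm z)^2)) * complex_of_real (f (x + (2 * sqrt (s k)) *\<^sub>R z))))"
    proof -
      have "g (- x + (- (2 * sqrt (s k))) *\<^sub>R z) = complex_of_real (f (x + (2 * sqrt (s k)) *\<^sub>R z))" for z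
        by (simp add: g_def add.commute)
      moreover have "- ((norm (x + (- x + (- (2 * sqrt (s k))) *\<^sub>R z)))^2) / (4 * s k) = - 1 * (norm z)^2" for z
        using s[of k] by (simp add: power_mult_distrib)
      moreover have "\<bar>- (2 * sqrt (s k))\<bar> = 2 * sqrt (s k)" using s[of k] by simp
      ultimately show ?thesis by (simp only: of_real_mult) (simp only: mult_ac)
    qed
    also have "\<dots> = complex_of_real ((2 * sqrt (s k)) ^ DIM('a) * (pi / s k) powr ?n) * (LINT z|lborel. complex_of_real (exp (- 1 * (norm z)^2)) * complex_of_real (f (x + (2 * sqrt (s k)) *\<^sub>R z)))"
      by (simp add: scaleR_conv_of_real mult.assoc)
    finally show ?thesis unfolding c .
  qed
  obtain C where C: "\<And>x. \<bar>f x\<bar> \<le> C" using schwartz_decay[OF f, of 0] by auto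
  have "(\<lambda>k. LINT z|lborel. complex_of_real (exp (- 1 * (norm (z::'a))^2)) * complex_of_real (f (x + (2 * sqrt (s k)) *\<^sub>R z))) \<longlonglongrightarrow> (LINT z|lborel. complex_of_real (exp (- 1 * (norm (z::'a))^2)) * complex_of_real (f x))"
  proof (rule integral_dominated_convergence)
    show "integrable lborel (\<lambda>z::'a. C * exp (- 1 * (norm z)^2))"
      using gauss_integral[of 1, where 'a='a] by (simp add: has_bochner_integral_iff)
    show "AE z::'a in lborel. (\<lambda>k. complex_of_real (exp (- 1 * (norm z)^2)) * complex_of_real (f (x + (2 * sqrt (s k)) *\<^sub>R z))) \<longlonglongrightarrow> complex_of_real (exp (- 1 * (norm z)^2)) * complex_of_real (f x)"
    proof (rule AE_I2)
      fix z :: 'a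
      have "(\<lambda>k. x + (2 * sqrt (s k)) *\<^sub>R z) \<longlonglongrightarrow> x + (2 * sqrt 0) *\<^sub>R z"
        by (intro tendsto_intros s0)
      then have "(\<lambda>k. x + (2 * sqrt (s k)) *\<^sub>R z) \<longlonglongrightarrow> x" by simp
      then have "(\<lambda>k. f (x + (2 * sqrt (s k)) *\<^sub>R z)) \<longlonglongrightarrow> f x"
        using schwartz_continuous[OF f] by (metis continuous_on_eq_continuous_at isCont_tendsto_compose open_UNIV UNIV_I)
      then show "(\<lambda>k. complex_of_real (exp (- 1 * (norm z)^2)) * complex_of_real (f (x + (2 * sqrt (s k)) *\<^sub>R z))) \<longlonglongrightarrow> complex_of_real (exp (- 1 * (norm z)^2)) * complex_of_real (f x)"
        by (intro tendsto_intros)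
    qed
    show "AE z::'a in lborel. norm (complex_of_real (exp (- 1 * (norm z)^2)) * complex_of_real (f (x + (2 * sqrt (s k)) *\<^sub>R z))) \<le> C * exp (- 1 * (norm z)^2)" for k
      using C by (intro AE_I2) (simp add: norm_mult mult.commute)
  qed measurable
  then have "(\<lambda>k. complex_of_real ((4 * pi) powr ?n) * (LINT z|lborel. complex_of_real (exp (- 1 * (norm (z::'a))^2)) * complex_of_real (f (x + (2 * sqrt (s k)) *\<^sub>R z)))) \<longlonglongrightarrow> complex_of_real ((4 * pi) powr ?n) * (B * complex_of_real (f x))"
    unfolding B_def by (intro tendsto_mult_left) simp
  from LIMSEQ_unique[OF lim1[unfolded val] this]
  have "ift ?F x = complex_of_real ((4 * pi) powr ?n * pi powr ?n) * complex_of_real (f x)"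
    by (simp add: B mult.assoc)
  also have "(4 * pi) powr ?n * pi powr ?n = ((2 * pi)^2) powr ?n"
    by (simp add: powr_mult[symmetric] power2_eq_square mult.assoc)
  also have "\<dots> = (2 * pi) ^ DIM('a)"
  proof -
    have "((2 * pi)^2) powr ?n = ((2 * pi) powr 2) powr ?n" by simp
    also have "\<dots> = (2 * pi) powr DIM('a)" unfolding powr_powr by simp
    also have "\<dots> = (2 * pi) ^ DIM('a)" by (rule powr_realpow) simp
    finally show ?thesis .
  qed
  finally show ?thesis by simp
qed

subsection \<open>Smoothing by heat differences\<close>

text \<open>Integrability is part of the notion: for a non-integrable \<open>g\<close> the integral
  \<open>ift g\<close> is 0 by convention, and its norm would be finite for no reason.\<close>

definition ift_wfinite :: "('a::euclidean_space \<Rightarrow> complex) \<Rightarrow> bool" where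
  "ift_wfinite g \<longleftrightarrow> integrable lborel g \<and> wnorm (ift g) < \<infinity>"

lemma ift_wfinite_measurable: "ift_wfinite g \<Longrightarrow> g \<in> borel_measurable borel"
  by (auto simp: ift_wfinite_def)

lemma ift_wfinite_add:
  assumes "ift_wfinite f" "ift_wfinite g"
  shows "ift_wfinite (\<lambda>\<xi>. f \<xi> + g \<xi>)"
proof -
  have [measurable]: "f \<in> borel_measurable borel" "g \<in> borel_measurable borel"
    using assms by (auto dest: ift_wfinite_measurable)
  have "ift (\<lambda>\<xi>. f \<xi> + g \<xi>) = (\<lambda>x. ift f x + ift g x)"
    using assms by (auto simp: ift_wfinite_def intro!: ext ift_add)
  then have "wnorm (ift (\<lambda>\<xi>. f \<xi> + g \<xi>)) \<le> wnorm (ift f) + wnorm (ift g)"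
    using wnorm_add[of "ift f" "ift g"] by simp
  then show ?thesis using assms by (auto simp: ift_wfinite_def intro: order.strict_trans1)
qed

lemma ift_wfinite_uminus: "ift_wfinite f \<Longrightarrow> ift_wfinite (\<lambda>\<xi>. - f \<xi>)"
  by (simp add: ift_wfinite_def ift_def[abs_def] wnorm_def)

lemma ift_wfinite_sum: "finite A \<Longrightarrow> (\<And>a. a \<in> A \<Longrightarrow> ift_wfinite (g a)) \<Longrightarrow> ift_wfinite (\<lambda>\<xi>. \<Sum>a\<in>A. g a \<xi>)"
  by (induction A rule: finite_induct) (auto intro: ift_wfinite_add simp: ift_wfinite_def[of "\<lambda>_. 0"] ift_def[abs_def] wnorm_def)

text \<open>Even powers of |\<xi>| are iterated Laplacians of f, which stay in the Schwartz class.
  Odd powers are not differential operators, hence the approach through heat differences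
  below.\<close>

lemma ift_wfinite_fourier_pow:
  fixes f :: "'a::euclidean_space \<Rightarrow> real"
  assumes f: "schwartz f"
  shows "ift_wfinite (\<lambda>\<xi>. complex_of_real (norm \<xi> ^ (2 * j)) * fourier (\<lambda>x. complex_of_real (f x)) \<xi>)"
  using f
proof (induction j arbitrary: f)
  case 0
  have [measurable]: "f \<in> borel_measurable borel" by (rule schwartz_measurable[OF 0])
  have "wnorm (ift (fourier (\<lambda>x. complex_of_real (f x)))) = ennreal ((2 * pi) ^ DIM('a)) * wnorm (\<lambda>x. complex_of_real (f x))"
    unfolding fourier_inversion[OF 0, abs_def] by (subst wnorm_cmult) (simp_all add: norm_power norm_mult)
  moreover have "wnorm (\<lambda>x. complex_of_real (f x)) < \<infinity>"
    using schwartz_integrable_weighted[OF 0, of 1] unfolding wnorm_def integrable_iff_bounded by (simp add: abs_mult)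
  ultimately show ?case
    using fourier_integrable[OF 0] by (simp add: ift_wfinite_def ennreal_mult_less_top)
next
  case (Suc j)
  have "complex_of_real (norm \<xi> ^ (2 * Suc j)) * fourier (\<lambda>x. complex_of_real (f x)) \<xi>
    = (\<Sum>b\<in>Basis. - (complex_of_real (norm \<xi> ^ (2 * j)) * fourier (\<lambda>x. complex_of_real (dderiv b (dderiv b f) x)) \<xi>))" for \<xi>
  proof -
    have "complex_of_real (norm \<xi> ^ (2 * Suc j)) * fourier (\<lambda>x. complex_of_real (f x)) \<xi>
       = complex_of_real (norm \<xi> ^ (2 * j)) * (complex_of_real ((norm \<xi>)^2) * fourier (\<lambda>x. complex_of_real (f x)) \<xi>)"
      by (simp add: power2_eq_square)
    also have "\<dots> = complex_of_real (norm \<xi> ^ (2 * j)) * (\<Sum>b\<in>Basis. - fourier (\<lambda>x. complex_of_real (dderiv b (dderiv b f) x)) \<xi>)"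
      by (simp only: norm_sq_fourier[OF Suc.prems])
    also have "\<dots> = (\<Sum>b\<in>Basis. - (complex_of_real (norm \<xi> ^ (2 * j)) * fourier (\<lambda>x. complex_of_real (dderiv b (dderiv b f) x)) \<xi>))"
      by (simp only: sum_distrib_left mult_minus_right)
    finally show ?thesis .
  qed
  moreover have "ift_wfinite (\<lambda>\<xi>. \<Sum>b\<in>(Basis::'a set). - (complex_of_real (norm \<xi> ^ (2 * j)) * fourier (\<lambda>x. complex_of_real (dderiv b (dderiv b f) x)) \<xi>))"
    by (intro ift_wfinite_sum ift_wfinite_uminus Suc.IH schwartz_dderiv Suc.prems) auto
  ultimately show ?case by simp
qed

lemma wnorm_heat0:
  "\<exists>C::real. C \<ge> 1 \<and> (\<forall>s\<ge>0. \<forall>g :: 'a::euclidean_space \<Rightarrow> complex. integrable lborel g \<longrightarrow>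
      wnorm (ift (\<lambda>\<xi>. complex_of_real (exp (- s * (norm \<xi>)^2)) * g \<xi>)) \<le> ennreal (C * (1 + s)) * wnorm (ift g))"
proof -
  obtain C :: real where C: "C \<ge> 0" and le: "\<And>s g :: 'a \<Rightarrow> complex. s > 0 \<Longrightarrow> integrable lborel g \<Longrightarrow>
      wnorm (ift (\<lambda>\<xi>. complex_of_real (exp (- s * (norm \<xi>)^2)) * g \<xi>)) \<le> ennreal (C * (1 + s)) * wnorm (ift g)"
    using wnorm_heat[where 'a='a] by blast
  have "wnorm (ift (\<lambda>\<xi>. complex_of_real (exp (- s * (norm \<xi>)^2)) * g \<xi>)) \<le> ennreal ((C + 1) * (1 + s)) * wnorm (ift g)"
    if "s \<ge> 0" "integrable lborel g" for s and g :: "'a \<Rightarrow> complex"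
  proof (cases "s = 0")
    case True
    have "1 * wnorm (ift g) \<le> ennreal (C + 1) * wnorm (ift g)"
      using C by (intro mult_right_mono) (auto simp flip: ennreal_1 intro!: ennreal_leI)
    then show ?thesis using True by simp
  next
    case False
    then have "wnorm (ift (\<lambda>\<xi>. complex_of_real (exp (- s * (norm \<xi>)^2)) * g \<xi>)) \<le> ennreal (C * (1 + s)) * wnorm (ift g)"
      using that by (intro le) auto
    also have "\<dots> \<le> ennreal ((C + 1) * (1 + s)) * wnorm (ift g)"
      using that by (intro mult_right_mono ennreal_leI) auto
    finally show ?thesis .
  qed
  then show ?thesis using C by (intro exI[of _ "C + 1"]) auto
qed

text \<open>Symbol of the identity minus the heat semigroup at time t.\<close>

definition heat_diff :: "real \<Rightarrow> 'a::euclidean_space \<Rightarrow> real" where "heat_diff t \<xi> = 1 - exp (- t * (norm \<xi>)^2)"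

lemma heat_diff_bounds: "0 \<le> t \<Longrightarrow> 0 \<le> heat_diff t \<xi>" "heat_diff t \<xi> \<le> 1"
  by (auto simp: heat_diff_def)

lemma heat_diff_measurable [measurable]: "(\<lambda>p. heat_diff (fst p) (snd p)) \<in> borel_measurable (borel \<Otimes>\<^sub>M borel)" "heat_diff t \<in> borel_measurable borel"
  unfolding heat_diff_def by measurable

lemma heat_diff_power_integrable:
  assumes "integrable lborel g" "0 \<le> t"
  shows "integrable lborel (\<lambda>\<xi>. complex_of_real (heat_diff t \<xi> ^ k) * g \<xi>)"
proof -
  have "integrable lborel (\<lambda>\<xi>. g \<xi> * complex_of_real (heat_diff t \<xi> ^ k))"
  proof (rule integrable_mult_bounded[of _ _ 1, OF assms(1)])
    show "norm (complex_of_real (heat_diff t \<xi> ^ k)) \<le> 1" for \<xi> :: 'a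
      unfolding norm_of_real using assms(2) heat_diff_bounds[of t \<xi>] by (subst abs_of_nonneg) (auto intro: power_le_one)
  qed measurable
  then show ?thesis by (simp add: mult.commute)
qed

text \<open>The factor N stands on the left instead of being divided by, so that the frequency 0 is
  covered.\<close>

lemma exp_segment_integral:
  fixes t N :: real
  assumes t: "0 \<le> t"
  shows "(\<integral>s. indicator {0..t} s * exp (- s * N) \<partial>lborel) * N = 1 - exp (- t * N)"
proof -
  have "(\<integral>s. (exp (- s * N) * N) * indicator {0..t} s \<partial>lborel) = - exp (- t * N) - (- exp (- 0 * N))"
    by (rule integral_FTC_Icc_real[OF t]) (use t in \<open>auto intro!: derivative_eq_intros continuous_intros\<close>)
  moreover have "(\<integral>s. (exp (- s * N) * N) * indicator {0..t} s \<partial>lborel) = (\<integral>s. (indicator {0..t} s * exp (- s * N)) * N \<partial>lborel)"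
    by (simp add: mult_ac)
  ultimately show ?thesis by simp
qed

text \<open>Induction on \<open>k\<close>: one factor \<open>1 - exp (- t N)\<close> is the integral of \<open>N exp (- s N)\<close> over \<open>s\<close> in \<open>[0, t]\<close>, so it
  costs one power of \<open>N = |\<xi>|^2\<close> and gains one power of \<open>t\<close>.\<close>
lemma heat_diff_small:
  fixes g :: "'a::euclidean_space \<Rightarrow> complex"
  assumes "\<And>j. j \<le> k \<Longrightarrow> ift_wfinite (\<lambda>\<xi>. complex_of_real (norm \<xi> ^ (2 * j)) * g \<xi>)"
  shows "\<exists>C\<ge>0. \<forall>t. 0 < t \<and> t \<le> 1 \<longrightarrow> wnorm (ift (\<lambda>\<xi>. complex_of_real (heat_diff t \<xi> ^ k) * g \<xi>)) \<le> ennreal (C * t ^ k)"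
  using assms
proof (induction k arbitrary: g)
  case 0
  then have "wnorm (ift g) < \<infinity>" by (simp add: ift_wfinite_def)
  then show ?case by (intro exI[of _ "enn2real (wnorm (ift g))"]) auto
next
  case (Suc k)
  define g' where "g' \<xi> = complex_of_real ((norm \<xi>)^2) * g \<xi>" for \<xi>
  have "ift_wfinite (\<lambda>\<xi>. complex_of_real (norm \<xi> ^ (2 * j)) * g' \<xi>)" if "j \<le> k" for j
    using Suc.prems[of "Suc j"] that by (simp add: g'_def power2_eq_square mult_ac)
  from Suc.IH[OF this] obtain C where C: "C \<ge> 0"
    and IH: "\<And>t. 0 < t \<Longrightarrow> t \<le> 1 \<Longrightarrow> wnorm (ift (\<lambda>\<xi>. complex_of_real (heat_diff t \<xi> ^ k) * g' \<xi>)) \<le> ennreal (C * t ^ k)"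
    by blast
  obtain H :: real where H: "H \<ge> 1" and heat: "\<And>s g :: 'a \<Rightarrow> complex. s \<ge> 0 \<Longrightarrow> integrable lborel g \<Longrightarrow>
      wnorm (ift (\<lambda>\<xi>. complex_of_real (exp (- s * (norm \<xi>)^2)) * g \<xi>)) \<le> ennreal (H * (1 + s)) * wnorm (ift g)"
    using wnorm_heat0[where 'a='a] by blast
  have g'i: "integrable lborel g'" using Suc.prems[of 1] by (simp add: ift_wfinite_def g'_def[abs_def])
  \<comment> \<open>The heat flow costs H (1 + s) \<le> 2 H for s \<le> t \<le> 1, and integrating s
    over [0, t] gives the new power of t.\<close>
  have "wnorm (ift (\<lambda>\<xi>. complex_of_real (heat_diff t \<xi> ^ Suc k) * g \<xi>)) \<le> ennreal (2 * H * C * t ^ Suc k)" if t: "0 < t" "t \<le> 1" for t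
  proof -
    define h where "h \<xi> = complex_of_real (heat_diff t \<xi> ^ k) * g' \<xi>" for \<xi>
    have hi: "integrable lborel h" unfolding h_def using t by (intro heat_diff_power_integrable g'i) auto
    then have [measurable]: "h \<in> borel_measurable borel" by auto
    define J where "J = (indicator {0..t} :: real \<Rightarrow> real)"
    have Ji: "integrable lborel (\<lambda>s. complex_of_real (J s))" unfolding J_def using t by simp
    have J0: "J s \<ge> 0" for s by (simp add: J_def)
    have [measurable]: "J \<in> borel_measurable borel" unfolding J_def by measurable
    define u where "u s = ift (\<lambda>\<xi>. complex_of_real (exp (- s * (norm \<xi>)^2)) * h \<xi>)" for s
    have um: "(\<lambda>p. u (fst p) (snd p)) \<in> borel_measurable (lborel \<Otimes>\<^sub>M lborel)"
      unfolding u_def ift_def by measurable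
    have eq: "ift (\<lambda>\<xi>. complex_of_real (heat_diff t \<xi> ^ Suc k) * g \<xi>) x = (LINT s|lborel. complex_of_real (J s) * u s x)" for x
    proof -
      \<comment> \<open>The absolute value of s keeps the exponential bounded by 1 for all s, as
        \<open>integrable_pair_bounded\<close> asks; \<open>J\<close> vanishes for negative s, so
        nothing changes.\<close>
      have "integrable (lborel \<Otimes>\<^sub>M lborel) (\<lambda>(\<xi>, s). h \<xi> * complex_of_real (J s) * (case (\<xi>, s) of (\<xi>, s) \<Rightarrow> complex_of_real (exp (- \<bar>s\<bar> * (norm \<xi>)^2)) * cis (x \<bullet> \<xi>)))"
        by (rule integrable_pair_bounded[OF hi Ji]) (auto simp: split_beta norm_mult)
      moreover have key: "complex_of_real (J s) * complex_of_real (exp (- \<bar>s\<bar> * (norm \<xi>)^2)) = complex_of_real (J s) * complex_of_real (exp (- s * (norm \<xi>)^2))" for s and \<xi> :: 'a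
        by (auto simp: J_def indicator_def)
      then have "h \<xi> * complex_of_real (J s) * (complex_of_real (exp (- \<bar>s\<bar> * (norm \<xi>)^2)) * cis (x \<bullet> \<xi>))
         = complex_of_real (J s) * (complex_of_real (exp (- s * (norm \<xi>)^2)) * h \<xi> * cis (x \<bullet> \<xi>))" for \<xi> s
      proof -
        have "h \<xi> * complex_of_real (J s) * (complex_of_real (exp (- \<bar>s\<bar> * (norm \<xi>)^2)) * cis (x \<bullet> \<xi>))
          = (complex_of_real (J s) * complex_of_real (exp (- \<bar>s\<bar> * (norm \<xi>)^2))) * (h \<xi> * cis (x \<bullet> \<xi>))"
          by (simp only: mult_ac)
        also have "\<dots> = complex_of_real (J s) * (complex_of_real (exp (- s * (norm \<xi>)^2)) * h \<xi> * cis (x \<bullet> \<xi>))"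
          unfolding key by (simp only: mult_ac)
        finally show ?thesis .
      qed
      ultimately have I: "integrable (lborel \<Otimes>\<^sub>M lborel) (\<lambda>(\<xi>, s). complex_of_real (J s) * (complex_of_real (exp (- s * (norm \<xi>)^2)) * h \<xi> * cis (x \<bullet> \<xi>)))"
        by (simp only: prod.case)
      have "(LINT s|lborel. complex_of_real (J s) * u s x) = (LINT s|lborel. LINT \<xi>|lborel. complex_of_real (J s) * (complex_of_real (exp (- s * (norm \<xi>)^2)) * h \<xi> * cis (x \<bullet> \<xi>)))"
        by (simp add: u_def ift_def)
      also have "\<dots> = (LINT \<xi>|lborel. LINT s|lborel. complex_of_real (J s) * (complex_of_real (exp (- s * (norm \<xi>)^2)) * h \<xi> * cis (x \<bullet> \<xi>)))"
        by (rule lborel_pair.Fubini_integral[OF I])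
      also have "\<dots> = (LINT \<xi>|lborel. complex_of_real (heat_diff t \<xi> ^ Suc k) * g \<xi> * cis (x \<bullet> \<xi>))"
      proof (rule Bochner_Integration.integral_cong[OF refl])
        fix \<xi> :: 'a
        have "(LINT s|lborel. complex_of_real (J s) * (complex_of_real (exp (- s * (norm \<xi>)^2)) * h \<xi> * cis (x \<bullet> \<xi>)))
           = (LINT s|lborel. complex_of_real (J s * exp (- s * (norm \<xi>)^2)) * (h \<xi> * cis (x \<bullet> \<xi>)))"
          by (simp only: of_real_mult mult.assoc)
        also have "\<dots> = complex_of_real (\<integral>s. J s * exp (- s * (norm \<xi>)^2) \<partial>lborel) * (h \<xi> * cis (x \<bullet> \<xi>))"
          by (simp only: integral_mult_left_zero integral_complex_of_real)
        also have "\<dots> = complex_of_real ((\<integral>s. J s * exp (- s * (norm \<xi>)^2) \<partial>lborel) * (norm \<xi>)^2) * (complex_of_real (heat_diff t \<xi> ^ k) * g \<xi> * cis (x \<bullet> \<xi>))"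
          by (simp add: h_def g'_def mult_ac)
        also have "(\<integral>s. J s * exp (- s * (norm \<xi>)^2) \<partial>lborel) * (norm \<xi>)^2 = heat_diff t \<xi>"
          unfolding J_def heat_diff_def by (rule exp_segment_integral) (use t in simp)
        finally show "(LINT s|lborel. complex_of_real (J s) * (complex_of_real (exp (- s * (norm \<xi>)^2)) * h \<xi> * cis (x \<bullet> \<xi>))) = complex_of_real (heat_diff t \<xi> ^ Suc k) * g \<xi> * cis (x \<bullet> \<xi>)"
          by (simp add: mult.assoc)
      qed
      finally show ?thesis by (simp add: ift_def)
    qed
    have "wnorm (ift (\<lambda>\<xi>. complex_of_real (heat_diff t \<xi> ^ Suc k) * g \<xi>)) \<le> (\<integral>\<^sup>+x. (\<integral>\<^sup>+s. ennreal ((1 + (norm x)^2)) * ennreal (J s * norm (u s x)) \<partial>lborel) \<partial>lborel)"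
      unfolding wnorm_def
    proof (rule nn_integral_mono)
      fix x :: 'a
      have [measurable]: "(\<lambda>s. u s x) \<in> borel_measurable borel"
        using measurable_compose[OF _ um, of "\<lambda>s. (s, x)" borel] by simp
      have "ennreal (norm (ift (\<lambda>\<xi>. complex_of_real (heat_diff t \<xi> ^ Suc k) * g \<xi>) x)) \<le> (\<integral>\<^sup>+s. ennreal (norm (complex_of_real (J s) * u s x)) \<partial>lborel)"
        unfolding eq by (rule norm_integral_le_nn_integral)
      then have "ennreal (1 + (norm x)^2) * ennreal (norm (ift (\<lambda>\<xi>. complex_of_real (heat_diff t \<xi> ^ Suc k) * g \<xi>) x)) \<le> ennreal (1 + (norm x)^2) * (\<integral>\<^sup>+s. ennreal (J s * norm (u s x)) \<partial>lborel)"
        using J0 by (intro mult_left_mono) (auto simp: norm_mult)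
      then show "ennreal ((1 + (norm x)^2) * norm (ift (\<lambda>\<xi>. complex_of_real (heat_diff t \<xi> ^ Suc k) * g \<xi>) x)) \<le> (\<integral>\<^sup>+s. ennreal ((1 + (norm x)^2)) * ennreal (J s * norm (u s x)) \<partial>lborel)"
        by (subst nn_integral_cmult) (auto simp: ennreal_mult)
    qed
    also have "\<dots> = (\<integral>\<^sup>+s. (\<integral>\<^sup>+x. ennreal ((1 + (norm x)^2)) * ennreal (J s * norm (u s x)) \<partial>lborel) \<partial>lborel)"
    proof (rule lborel_pair.Fubini'[symmetric])
      have "(\<lambda>p. u (snd p) (fst p)) \<in> borel_measurable (lborel \<Otimes>\<^sub>M lborel)"
        using measurable_compose[OF _ um, of "\<lambda>p. (snd p, fst p)" "lborel \<Otimes>\<^sub>M lborel"] by simp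
      then show "(\<lambda>(x, s). ennreal (1 + (norm x)^2) * ennreal (J s * norm (u s x))) \<in> borel_measurable (lborel \<Otimes>\<^sub>M lborel)"
        using um unfolding split_beta by measurable
    qed
    also have "\<dots> \<le> (\<integral>\<^sup>+s. ennreal (2 * H) * ennreal (C * t ^ k) * ennreal (J s) \<partial>lborel)"
    proof (rule nn_integral_mono)
      fix s :: real
      have [measurable]: "u s \<in> borel_measurable borel"
        unfolding u_def by measurable
      have "(\<integral>\<^sup>+x. ennreal ((1 + (norm x)^2)) * ennreal (J s * norm (u s x)) \<partial>lborel) = (\<integral>\<^sup>+x. ennreal (J s) * ennreal ((1 + (norm x)^2) * norm (u s x)) \<partial>lborel)"
        using J0 by (simp add: ennreal_mult mult_ac)
      also have "\<dots> = ennreal (J s) * wnorm (u s)" unfolding wnorm_def by (rule nn_integral_cmult) measurable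
      also have "\<dots> \<le> ennreal (J s) * (ennreal (2 * H) * ennreal (C * t ^ k))"
      proof (cases "s \<in> {0..t}")
        case True
        have "wnorm (u s) \<le> ennreal (H * (1 + s)) * wnorm (ift h)"
          unfolding u_def using True by (intro heat hi) auto
        also have "\<dots> \<le> ennreal (2 * H) * ennreal (C * t ^ k)"
        proof (intro mult_mono)
          have "H * (1 + s) \<le> H * 2" using True t H by (intro mult_left_mono) auto
          then show "ennreal (H * (1 + s)) \<le> ennreal (2 * H)" by (intro ennreal_leI) simp
          show "wnorm (ift h) \<le> ennreal (C * t ^ k)" unfolding h_def by (rule IH[OF t])
        qed auto
        finally show ?thesis by (rule mult_left_mono) simp
      qed (simp add: J_def)
      finally show "(\<integral>\<^sup>+x. ennreal ((1 + (norm x)^2)) * ennreal (J s * norm (u s x)) \<partial>lborel) \<le> ennreal (2 * H) * ennreal (C * t ^ k) * ennreal (J s)"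
        by (simp add: mult_ac)
    qed
    also have "\<dots> = ennreal (2 * H) * ennreal (C * t ^ k) * ennreal t"
      using t by (subst nn_integral_cmult) (auto simp: J_def ennreal_indicator)
    also have "\<dots> = ennreal (2 * H * C * t ^ Suc k)"
      using H C t by (simp add: ennreal_mult[symmetric] mult_ac)
    finally show ?thesis .
  qed
  then show ?case using H C by (intro exI[of _ "2 * H * C"]) auto
qed

text \<open>The extra factor exp (- s |\<xi>|^2) carries the induction: a heat difference splits it
  into the same terms at times s and s + t, and the two linear bounds add up to at most three times
  the old one. However many factors there are, the growth stays linear in t.\<close>

lemma heat_diff_large:
  fixes g :: "'a::euclidean_space \<Rightarrow> complex"
  assumes g: "ift_wfinite g"
  shows "\<exists>C\<ge>0. \<forall>s t. 0 \<le> s \<and> 0 \<le> t \<longrightarrow> wnorm (ift (\<lambda>\<xi>. complex_of_real (exp (- s * (norm \<xi>)^2)) * (complex_of_real (heat_diff t \<xi> ^ k) * g \<xi>))) \<le> ennreal (C * (1 + s + t))"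
proof (induction k)
  case 0
  obtain H :: real where H: "H \<ge> 1" and heat: "\<And>s g :: 'a \<Rightarrow> complex. s \<ge> 0 \<Longrightarrow> integrable lborel g \<Longrightarrow>
      wnorm (ift (\<lambda>\<xi>. complex_of_real (exp (- s * (norm \<xi>)^2)) * g \<xi>)) \<le> ennreal (H * (1 + s)) * wnorm (ift g)"
    using wnorm_heat0[where 'a='a] by blast
  obtain w where w: "w \<ge> 0" "wnorm (ift g) = ennreal w" using g unfolding ift_wfinite_def by (cases "wnorm (ift g)") auto
  have "wnorm (ift (\<lambda>\<xi>. complex_of_real (exp (- s * (norm \<xi>)^2)) * g \<xi>)) \<le> ennreal (H * w * (1 + s + t))" if "0 \<le> s" "0 \<le> t" for s t
  proof -
    have "wnorm (ift (\<lambda>\<xi>. complex_of_real (exp (- s * (norm \<xi>)^2)) * g \<xi>)) \<le> ennreal (H * (1 + s)) * ennreal w"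
      using heat[of s g] that g w by (simp add: ift_wfinite_def)
    also have "\<dots> = ennreal (H * w * (1 + s))" using H w that by (subst ennreal_mult[symmetric]) (auto simp: mult_ac)
    also have "\<dots> \<le> ennreal (H * w * (1 + s + t))" using H w that by (intro ennreal_leI mult_left_mono) auto
    finally show ?thesis .
  qed
  then show ?case using H w by (intro exI[of _ "H * w"]) auto
next
  case (Suc k)
  then obtain C where C: "C \<ge> 0" and IH: "\<And>s t. 0 \<le> s \<Longrightarrow> 0 \<le> t \<Longrightarrow> wnorm (ift (\<lambda>\<xi>. complex_of_real (exp (- s * (norm \<xi>)^2)) * (complex_of_real (heat_diff t \<xi> ^ k) * g \<xi>))) \<le> ennreal (C * (1 + s + t))"
    by blast
  have gi: "integrable lborel g" and [measurable]: "g \<in> borel_measurable borel" using g by (auto simp: ift_wfinite_def)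
  have "wnorm (ift (\<lambda>\<xi>. complex_of_real (exp (- s * (norm \<xi>)^2)) * (complex_of_real (heat_diff t \<xi> ^ Suc k) * g \<xi>))) \<le> ennreal (3 * C * (1 + s + t))" if st: "0 \<le> s" "0 \<le> t" for s t
  proof -
    define a where "a s \<xi> = complex_of_real (exp (- s * (norm \<xi>)^2)) * (complex_of_real (heat_diff t \<xi> ^ k) * g \<xi>)" for s \<xi>
    have ai: "integrable lborel (a s)" if "0 \<le> s" for s
    proof -
      have "integrable lborel (\<lambda>\<xi>. (complex_of_real (heat_diff t \<xi> ^ k) * g \<xi>) * complex_of_real (exp (- s * (norm \<xi>)^2)))"
        using that by (intro integrable_mult_bounded[of _ _ 1] heat_diff_power_integrable gi st) auto
      then show ?thesis by (simp add: a_def[abs_def] mult_ac)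
    qed
    have [measurable]: "a s \<in> borel_measurable borel" for s unfolding a_def by measurable
    have "complex_of_real (exp (- s * (norm \<xi>)^2)) * (complex_of_real (heat_diff t \<xi> ^ Suc k) * g \<xi>) = a s \<xi> + - a (s + t) \<xi>" for \<xi>
    proof -
      have "exp (- s * (norm \<xi>)^2) * heat_diff t \<xi> = exp (- s * (norm \<xi>)^2) - exp (- (s + t) * (norm \<xi>)^2)"
        by (simp add: heat_diff_def right_diff_distrib exp_add[symmetric]) (simp add: algebra_simps)
      then have "complex_of_real (exp (- s * (norm \<xi>)^2)) * complex_of_real (heat_diff t \<xi>) = complex_of_real (exp (- s * (norm \<xi>)^2)) - complex_of_real (exp (- (s + t) * (norm \<xi>)^2))"
        by (metis of_real_diff of_real_mult)
      moreover have "E * (D * Q) = E * Q + - (E' * Q)" if "E * D = E - E'" for E D E' Q :: complex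
        using arg_cong[OF that, of "\<lambda>z. z * Q"] by (simp add: algebra_simps)
      ultimately show ?thesis by (simp only: a_def power_Suc of_real_mult mult.assoc)
    qed
    then have "ift (\<lambda>\<xi>. complex_of_real (exp (- s * (norm \<xi>)^2)) * (complex_of_real (heat_diff t \<xi> ^ Suc k) * g \<xi>)) = (\<lambda>x. ift (a s) x + ift (\<lambda>\<xi>. - a (s + t) \<xi>) x)"
      using st by (intro ext) (simp only:, intro ift_add ai Bochner_Integration.integrable_minus, auto)
    then have "wnorm (ift (\<lambda>\<xi>. complex_of_real (exp (- s * (norm \<xi>)^2)) * (complex_of_real (heat_diff t \<xi> ^ Suc k) * g \<xi>))) \<le> wnorm (ift (a s)) + wnorm (ift (\<lambda>\<xi>. - a (s + t) \<xi>))"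
      by (simp only:) (rule wnorm_add; measurable)
    also have "wnorm (ift (\<lambda>\<xi>. - a (s + t) \<xi>)) = wnorm (ift (a (s + t)))"
      by (simp add: ift_def[abs_def] wnorm_def)
    also have "wnorm (ift (a s)) + wnorm (ift (a (s + t))) \<le> ennreal (C * (1 + s + t)) + ennreal (C * (1 + (s + t) + t))"
      unfolding a_def using st by (intro add_mono IH) auto
    also have "\<dots> = ennreal (C * (1 + s + t) + C * (1 + (s + t) + t))"
      using C st by (intro ennreal_plus[symmetric]) auto
    also have "\<dots> \<le> ennreal (3 * C * (1 + s + t))"
    proof (rule ennreal_leI)
      have "0 \<le> C * (1 + s)" using C st by simp
      then show "C * (1 + s + t) + C * (1 + (s + t) + t) \<le> 3 * C * (1 + s + t)"
        by (simp add: algebra_simps)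
    qed
    finally show ?thesis .
  qed
  then show ?case using C by (intro exI[of _ "3 * C"]) auto
qed

subsection \<open>Subordination\<close>

lemma nn_integral_powr_01:
  assumes p: "0 < p"
  shows "(\<integral>\<^sup>+t. ennreal (indicator {0<..1} t * t powr (p - 1)) \<partial>lborel) < \<infinity>"
proof -
  have "(\<integral>\<^sup>+t. ennreal (indicator {0<..1} t * t powr (p - 1)) \<partial>lborel)
     \<le> (\<integral>\<^sup>+t. ennreal (exp 1) * ennreal (indicator {0..} t * t powr (p - 1) * exp (- 1 * t)) \<partial>lborel)"
  proof (rule nn_integral_mono)
    fix t :: real
    have "indicator {0<..1} t * t powr (p - 1) \<le> exp 1 * (indicator {0..} t * t powr (p - 1) * exp (- 1 * t))"
    proof (cases "t \<in> {0<..1}")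
      case True
      then have "1 \<le> exp 1 * exp (- 1 * t)" by (simp flip: exp_add)
      then have "t powr (p - 1) * 1 \<le> t powr (p - 1) * (exp 1 * exp (- 1 * t))"
        by (intro mult_left_mono) auto
      then show ?thesis using True by (simp add: mult_ac)
    qed simp
    then show "ennreal (indicator {0<..1} t * t powr (p - 1)) \<le> ennreal (exp 1) * ennreal (indicator {0..} t * t powr (p - 1) * exp (- 1 * t))"
      by (subst ennreal_mult[symmetric]) (auto intro: ennreal_leI)
  qed
  also have "\<dots> = ennreal (exp 1) * ennreal (Gamma p * 1 powr (- p))"
    using gamma_nn_integral[OF p, of 1] by (subst nn_integral_cmult) auto
  also have "\<dots> < \<infinity>" by (simp add: ennreal_mult_less_top)
  finally show ?thesis .
qed

lemma nn_integral_powr_1_inf: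
  assumes q: "1 < q"
  shows "(\<integral>\<^sup>+t. ennreal (indicator {1..} t * t powr (- q)) \<partial>lborel) < \<infinity>"
proof -
  have "(\<integral>\<^sup>+t\<in>{1..}. ennreal (t powr (- q)) \<partial>lborel) = ennreal (0 - (- (1 powr (1 - q)) / (q - 1)))"
  proof (rule nn_integral_FTC_atLeast[where F="\<lambda>t. - (t powr (1 - q)) / (q - 1)"])
    show "((\<lambda>t. - (t powr (1 - q)) / (q - 1)) has_real_derivative x powr (- q)) (at x)" if "1 \<le> x" for x
    proof -
      have "((\<lambda>t. t powr (1 - q)) has_real_derivative (1 - q) * x powr (1 - q - 1)) (at x)"
        using that by (intro has_real_derivative_powr) simp
      from DERIV_cdivide[OF DERIV_minus[OF this], of "q - 1"] show ?thesis
        by (rule DERIV_cong) (use q in \<open>simp flip: mult_minus_left\<close>)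
    qed
    have "((\<lambda>t. t powr (1 - q)) \<longlongrightarrow> 0) at_top"
      using q by (intro tendsto_neg_powr) (auto intro: filterlim_ident)
    from tendsto_divide[OF tendsto_minus[OF this] tendsto_const[of "q - 1"]]
    show "((\<lambda>t. - (t powr (1 - q)) / (q - 1)) \<longlongrightarrow> 0) at_top" using q by simp
  qed auto
  moreover have "(\<integral>\<^sup>+t. ennreal (indicator {1..} t * t powr (- q)) \<partial>lborel) = (\<integral>\<^sup>+t\<in>{1..}. ennreal (t powr (- q)) \<partial>lborel)"
    by (intro nn_integral_cong) (auto split: split_indicator)
  ultimately show ?thesis by simp
qed

lemma one_minus_exp_bounds:
  fixes t :: real
  assumes "0 \<le> t"
  shows "0 \<le> 1 - exp (- t)" "1 - exp (- t) \<le> 1" "1 - exp (- t) \<le> t"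
  using assms exp_ge_add_one_self[of "- t"] by auto

text \<open>Substituting \<open>t / N\<close> for \<open>t\<close> expresses \<open>N powr (n / 2)\<close> through the same integral with \<open>exp (- t N)\<close>; the exponent \<open>n\<close>
  makes the integrand behave like \<open>t powr (n / 2 - 1)\<close> near \<open>0\<close>.\<close>
definition subordination_const :: "nat \<Rightarrow> ennreal" where
  "subordination_const n = (\<integral>\<^sup>+t. ennreal (indicator {0<..} t * t powr (- (real n / 2) - 1) * (1 - exp (- t)) ^ n) \<partial>lborel)"

lemma subordination_const_finite:
  assumes n: "0 < n"
  shows "subordination_const n < \<infinity>"
proof -
  have "subordination_const n \<le> (\<integral>\<^sup>+t. ennreal (indicator {0<..1} t * t powr (real n / 2 - 1)) + ennreal (indicator {1..} t * t powr (- (real n / 2 + 1))) \<partial>lborel)"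
    unfolding subordination_const_def
  proof (rule nn_integral_mono)
    fix t :: real
    show "ennreal (indicator {0<..} t * t powr (- (real n / 2) - 1) * (1 - exp (- t)) ^ n) \<le> ennreal (indicator {0<..1} t * t powr (real n / 2 - 1)) + ennreal (indicator {1..} t * t powr (- (real n / 2 + 1)))"
    proof (cases "t \<le> 1")
      case True
      show ?thesis
      proof (cases "0 < t")
        case pos: True
        have "(1 - exp (- t)) ^ n \<le> t ^ n" using one_minus_exp_bounds[of t] pos by (intro power_mono) auto
        then have "t powr (- (real n / 2) - 1) * (1 - exp (- t)) ^ n \<le> t powr (- (real n / 2) - 1) * t ^ n" by (intro mult_left_mono) auto
        also have "\<dots> = t powr (real n / 2 - 1)" using pos by (simp add: powr_realpow[symmetric] powr_add[symmetric])
        finally show ?thesis using pos True by (auto intro!: order_trans[OF _ add_increasing2] ennreal_leI)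
      qed simp
    next
      case False
      have "(1 - exp (- t)) ^ n \<le> 1" using one_minus_exp_bounds[of t] False by (intro power_le_one) auto
      then have "t powr (- (real n / 2) - 1) * (1 - exp (- t)) ^ n \<le> t powr (- (real n / 2) - 1) * 1" by (intro mult_left_mono) auto
      then show ?thesis using False by (auto intro!: ennreal_leI)
    qed
  qed
  also have "\<dots> = (\<integral>\<^sup>+t. ennreal (indicator {0<..1} t * t powr (real n / 2 - 1)) \<partial>lborel) + (\<integral>\<^sup>+t. ennreal (indicator {1..} t * t powr (- (real n / 2 + 1))) \<partial>lborel)"
    by (rule nn_integral_add) measurable
  also have "\<dots> < \<infinity>"
    using nn_integral_powr_01[of "real n / 2"] nn_integral_powr_1_inf[of "real n / 2 + 1"] n by simp
  finally show ?thesis .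
qed

lemma subordination_const_pos: "0 < subordination_const n"
proof -
  \<comment> \<open>Lower bound of the integrand on [1, 2]: the decreasing factor taken at 2 times
    the increasing factor taken at 1.\<close>
  define e where "e = 2 powr (- (real n / 2) - 1) * (1 - exp (- 1)) ^ n"
  have e: "e > 0" by (simp add: e_def)
  have "ennreal e = (\<integral>\<^sup>+t. ennreal e * indicator {1..2} t \<partial>(lborel :: real measure))"
    by (simp add: nn_integral_cmult_indicator)
  also have "\<dots> \<le> subordination_const n"
    unfolding subordination_const_def
  proof (rule nn_integral_mono)
    fix t :: real
    show "ennreal e * indicator {1..2} t \<le> ennreal (indicator {0<..} t * t powr (- (real n / 2) - 1) * (1 - exp (- t)) ^ n)"
    proof (cases "t \<in> {1..2}")
      case True
      then have "e \<le> t powr (- (real n / 2) - 1) * (1 - exp (- t)) ^ n"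
        unfolding e_def by (intro mult_mono power_mono powr_mono2') auto
      then show ?thesis using True by (auto intro: ennreal_leI)
    qed simp
  qed
  finally show ?thesis using e by (metis ennreal_less_zero_iff order.strict_trans1 not_less)
qed

lemma subordination_const_scale:
  assumes N: "0 < N"
  shows "(\<integral>\<^sup>+t. ennreal (indicator {0<..} t * t powr (- (real n / 2) - 1) * (1 - exp (- t * N)) ^ n) \<partial>lborel) = ennreal (N powr (real n / 2)) * subordination_const n"
proof -
  let ?f = "\<lambda>t. ennreal (indicator {0<..} t * t powr (- (real n / 2) - 1) * (1 - exp (- t * N)) ^ n)"
  have "(\<integral>\<^sup>+t. ?f t \<partial>lborel) = ennreal (1 / N) * (\<integral>\<^sup>+t. ?f (0 + (1 / N) * t) \<partial>lborel)"
    using nn_integral_real_affine[of ?f "1 / N" 0] N by simp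
  also have "(\<integral>\<^sup>+t. ?f (0 + (1 / N) * t) \<partial>lborel) = (\<integral>\<^sup>+t. ennreal (N powr (real n / 2 + 1)) * ennreal (indicator {0<..} t * t powr (- (real n / 2) - 1) * (1 - exp (- t)) ^ n) \<partial>lborel)"
  proof (rule nn_integral_cong)
    fix t :: real
    show "?f (0 + (1 / N) * t) = ennreal (N powr (real n / 2 + 1)) * ennreal (indicator {0<..} t * t powr (- (real n / 2) - 1) * (1 - exp (- t)) ^ n)"
    proof (cases "0 < t")
      case True
      have "((1 / N) * t) powr (- (real n / 2) - 1) = N powr (real n / 2 + 1) * t powr (- (real n / 2) - 1)"
      proof -
        have "(1 / N) powr (- (real n / 2) - 1) = N powr (real n / 2 + 1)"
          using N by (simp add: powr_def ln_div algebra_simps)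
        then show ?thesis using powr_mult[of "1/N" t "- (real n / 2) - 1"] by simp
      qed
      moreover have "(1 - exp (- t)) ^ n \<ge> 0" using one_minus_exp_bounds[of t] True by simp
      ultimately show ?thesis using True N by (simp add: ennreal_mult[symmetric] mult.assoc)
    qed (use N in \<open>simp add: zero_less_divide_iff\<close>)
  qed
  also have "\<dots> = ennreal (N powr (real n / 2 + 1)) * subordination_const n"
    unfolding subordination_const_def by (rule nn_integral_cmult) measurable
  also have "ennreal (1 / N) * (ennreal (N powr (real n / 2 + 1)) * subordination_const n) = ennreal (1 / N * N powr (real n / 2 + 1)) * subordination_const n"
    using N by (subst mult.assoc[symmetric], subst ennreal_mult[symmetric]) auto
  also have "1 / N * N powr (real n / 2 + 1) = N powr (real n / 2)"
    using N by (simp add: powr_add)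
  finally show ?thesis .
qed

lemma norm_sq_powr_half: "0 < n \<Longrightarrow> ((norm x)^2) powr (real n / 2) = norm x ^ n"
proof (cases "norm x = 0")
  case False
  assume "0 < n"
  have "((norm x)^2) powr (real n / 2) = (norm x powr 2) powr (real n / 2)" by simp
  also have "\<dots> = norm x powr real n" unfolding powr_powr by simp
  also have "\<dots> = norm x ^ n" using False by (simp add: powr_realpow)
  finally show ?thesis .
qed simp

text \<open>By subordination a constant times |\<xi>|^n times the transform is the integral of
  t^(-n/2-1) (1 - exp (- t |\<xi>|^2))^n times the transform, so the weighted norm is at most the
  corresponding integral of \<open>wnorm (u t)\<close>. Near 0 the norm is O(t^n), which is more
  than enough. At infinity it grows linearly, and t^(-n/2) is integrable there because n >
  2.\<close>

lemma wnorm_ift_norm_power_fourier: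
  fixes f :: "'a::euclidean_space \<Rightarrow> real"
  assumes dim: "3 \<le> DIM('a)" and f: "schwartz f"
  shows "ift_wfinite (\<lambda>\<xi>. complex_of_real (norm \<xi> ^ DIM('a)) * fourier (\<lambda>x. complex_of_real (f x)) \<xi>)"
proof -
  let ?n = "DIM('a)"
  let ?F = "fourier (\<lambda>x. complex_of_real (f x))"
  define g where "g \<xi> = complex_of_real (norm \<xi> ^ ?n) * ?F \<xi>" for \<xi>
  have n: "0 < ?n" by simp
  have [measurable]: "f \<in> borel_measurable borel" by (rule schwartz_measurable[OF f])
  have gi: "integrable lborel g"
    unfolding g_def
  proof (rule fourier_integrable_weighted[OF f])
    show "\<bar>norm \<xi> ^ ?n\<bar> \<le> (1 + (norm \<xi>)^2) ^ ?n" for \<xi> :: 'a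
    proof -
      have "norm \<xi> \<le> 1 + (norm \<xi>)^2"
        using zero_le_power2[of "norm \<xi> - 1/2"] by (simp add: power2_eq_square algebra_simps)
      then have "norm \<xi> ^ ?n \<le> (1 + (norm \<xi>)^2) ^ ?n" by (intro power_mono) auto
      then show ?thesis by simp
    qed
  qed measurable
  have [measurable]: "g \<in> borel_measurable borel" using gi by auto
  define c where "c = enn2real (subordination_const ?n)"
  have c: "c > 0" "subordination_const ?n = ennreal c"
    using subordination_const_finite[OF n] subordination_const_pos[of ?n] by (auto simp: c_def enn2real_positive_iff)
  define K where "K t \<xi> = indicator {0<..} t * t powr (- (real ?n / 2) - 1) * heat_diff t \<xi> ^ ?n" for t and \<xi> :: 'a
  have K0: "K t \<xi> \<ge> 0" for t \<xi>
    using heat_diff_bounds(1)[of t \<xi>] by (auto simp: K_def indicator_def)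
  have [measurable]: "(\<lambda>p. K (fst p) (snd p)) \<in> borel_measurable (borel \<Otimes>\<^sub>M borel)" "(\<lambda>p. K (snd p) (fst p)) \<in> borel_measurable (borel \<Otimes>\<^sub>M borel)"
    "K t \<in> borel_measurable borel" "(\<lambda>t. K t \<xi>) \<in> borel_measurable borel" for t \<xi>
    unfolding K_def heat_diff_def by measurable
  have Kint: "(\<integral>\<^sup>+t. ennreal (K t \<xi>) \<partial>lborel) = ennreal (c * norm \<xi> ^ ?n)" for \<xi>
  proof (cases "\<xi> = 0")
    case True
    then show ?thesis by (simp add: K_def heat_diff_def zero_power)
  next
    case False
    have "(\<integral>\<^sup>+t. ennreal (K t \<xi>) \<partial>lborel) = ennreal (((norm \<xi>)^2) powr (real ?n / 2)) * ennreal c"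
      unfolding c(2)[symmetric] K_def heat_diff_def by (rule subordination_const_scale) (use False in simp)
    then show ?thesis
      unfolding norm_sq_powr_half[OF n] using c(1) by (simp add: ennreal_mult[symmetric] mult.commute)
  qed
  then have KB: "has_bochner_integral lborel (\<lambda>t. K t \<xi>) (c * norm \<xi> ^ ?n)" for \<xi>
    using K0 c(1) by (intro has_bochner_integral_nn_integral) auto
  have Fi: "integrable lborel ?F" by (rule fourier_integrable[OF f])
  have Fm[measurable]: "?F \<in> borel_measurable borel" using Fi by auto
  define u where "u t = ift (\<lambda>\<xi>. complex_of_real (heat_diff t \<xi> ^ ?n) * ?F \<xi>)" for t
  define k where "k t = indicator {0<..} t * t powr (- (real ?n / 2) - 1)" for t :: real
  have k0: "k t \<ge> 0" for t by (simp add: k_def)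
  have [measurable]: "k \<in> borel_measurable borel" unfolding k_def by measurable
  have um: "(\<lambda>p. u (fst p) (snd p)) \<in> borel_measurable (lborel \<Otimes>\<^sub>M lborel)"
    unfolding u_def ift_def heat_diff_def by measurable
  have Kk: "K t \<xi> = k t * heat_diff t \<xi> ^ ?n" for t \<xi> by (simp add: K_def k_def)
  have cg: "complex_of_real c * ift g x = (LINT t|lborel. complex_of_real (k t) * u t x)" for x
  proof -
    define G where "G \<xi> t = complex_of_real (K t \<xi>) * (?F \<xi> * cis (x \<bullet> \<xi>))" for \<xi> t
    have Gm: "(\<lambda>(\<xi>, t). G \<xi> t) \<in> borel_measurable (lborel \<Otimes>\<^sub>M lborel)"
      unfolding G_def split_beta by measurable
    have I: "integrable (lborel \<Otimes>\<^sub>M lborel) (\<lambda>(\<xi>, t). G \<xi> t)"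
    proof (rule lborel_pair.Fubini_integrable[OF Gm])
      have "(\<integral>t. norm (G \<xi> t) \<partial>lborel) = c * norm (g \<xi>)" for \<xi>
      proof -
        have "norm (G \<xi> t) = K t \<xi> * norm (?F \<xi>)" for t using K0 by (simp add: G_def norm_mult)
        then show ?thesis using KB[of \<xi>] by (simp add: has_bochner_integral_iff g_def norm_mult norm_power)
      qed
      then show "integrable lborel (\<lambda>\<xi>. \<integral>t. norm (case (\<xi>, t) of (\<xi>, t) \<Rightarrow> G \<xi> t) \<partial>lborel)"
        using gi by simp
      show "AE \<xi> in lborel. integrable lborel (\<lambda>t. case (\<xi>, t) of (\<xi>, t) \<Rightarrow> G \<xi> t)"
        using KB by (auto simp: G_def has_bochner_integral_iff)
    qed
    have "complex_of_real c * ift g x = (LINT \<xi>|lborel. LINT t|lborel. G \<xi> t)"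
    proof -
      have "(LINT t|lborel. G \<xi> t) = complex_of_real c * (g \<xi> * cis (x \<bullet> \<xi>))" for \<xi>
      proof -
        have "(LINT t|lborel. G \<xi> t) = complex_of_real (\<integral>t. K t \<xi> \<partial>lborel) * (?F \<xi> * cis (x \<bullet> \<xi>))"
          unfolding G_def by (simp only: integral_mult_left_zero integral_complex_of_real)
        also have "(\<integral>t. K t \<xi> \<partial>lborel) = c * norm \<xi> ^ ?n" using KB by (simp add: has_bochner_integral_iff)
        finally show ?thesis by (simp add: g_def mult_ac)
      qed
      then show ?thesis by (simp add: ift_def)
    qed
    also have "\<dots> = (LINT t|lborel. LINT \<xi>|lborel. G \<xi> t)"
      using lborel_pair.Fubini_integral[OF I] by simp
    also have "\<dots> = (LINT t|lborel. complex_of_real (k t) * u t x)"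
    proof (rule Bochner_Integration.integral_cong[OF refl])
      fix t
      have "G \<xi> t = complex_of_real (k t) * (complex_of_real (heat_diff t \<xi> ^ ?n) * ?F \<xi> * cis (x \<bullet> \<xi>))" for \<xi>
        by (simp add: G_def Kk mult.assoc)
      then show "(LINT \<xi>|lborel. G \<xi> t) = complex_of_real (k t) * u t x" by (simp add: u_def ift_def)
    qed
    finally show ?thesis .
  qed
  have "ennreal c * wnorm (ift g) = wnorm (\<lambda>x. complex_of_real c * ift g x)"
    using c(1) by (subst wnorm_cmult) auto
  also have "\<dots> \<le> (\<integral>\<^sup>+x. (\<integral>\<^sup>+t. ennreal (1 + (norm x)^2) * ennreal (k t * norm (u t x)) \<partial>lborel) \<partial>lborel)"
    unfolding wnorm_def
  proof (rule nn_integral_mono)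
    fix x :: 'a
    have [measurable]: "(\<lambda>s. u s x) \<in> borel_measurable borel"
      using measurable_compose[OF _ um, of "\<lambda>s. (s, x)" borel] by simp
    have "ennreal (norm (complex_of_real c * ift g x)) \<le> (\<integral>\<^sup>+t. ennreal (norm (complex_of_real (k t) * u t x)) \<partial>lborel)"
      unfolding cg by (rule norm_integral_le_nn_integral)
    then have "ennreal (1 + (norm x)^2) * ennreal (norm (complex_of_real c * ift g x)) \<le> ennreal (1 + (norm x)^2) * (\<integral>\<^sup>+t. ennreal (k t * norm (u t x)) \<partial>lborel)"
      using k0 by (intro mult_left_mono) (auto simp: norm_mult)
    then show "ennreal ((1 + (norm x)^2) * norm (complex_of_real c * ift g x)) \<le> (\<integral>\<^sup>+t. ennreal (1 + (norm x)^2) * ennreal (k t * norm (u t x)) \<partial>lborel)"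
      by (subst nn_integral_cmult) (auto simp: ennreal_mult)
  qed
  also have "\<dots> = (\<integral>\<^sup>+t. (\<integral>\<^sup>+x. ennreal (1 + (norm x)^2) * ennreal (k t * norm (u t x)) \<partial>lborel) \<partial>lborel)"
  proof (rule lborel_pair.Fubini'[symmetric])
    have "(\<lambda>p. u (snd p) (fst p)) \<in> borel_measurable (lborel \<Otimes>\<^sub>M lborel)"
      using measurable_compose[OF _ um, of "\<lambda>p. (snd p, fst p)" "lborel \<Otimes>\<^sub>M lborel"] by simp
    then show "(\<lambda>(x, t). ennreal (1 + (norm x)^2) * ennreal (k t * norm (u t x))) \<in> borel_measurable (lborel \<Otimes>\<^sub>M lborel)"
      using um unfolding split_beta by measurable
  qed
  also have "\<dots> = (\<integral>\<^sup>+t. ennreal (k t) * wnorm (u t) \<partial>lborel)"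
  proof (rule nn_integral_cong)
    fix t :: real
    have [measurable]: "u t \<in> borel_measurable borel" unfolding u_def by measurable
    have "(\<integral>\<^sup>+x. ennreal (1 + (norm x)^2) * ennreal (k t * norm (u t x)) \<partial>lborel) = (\<integral>\<^sup>+x. ennreal (k t) * ennreal ((1 + (norm x)^2) * norm (u t x)) \<partial>lborel)"
      using k0 by (simp add: ennreal_mult mult_ac)
    also have "\<dots> = ennreal (k t) * wnorm (u t)" unfolding wnorm_def by (rule nn_integral_cmult) measurable
    finally show "(\<integral>\<^sup>+x. ennreal (1 + (norm x)^2) * ennreal (k t * norm (u t x)) \<partial>lborel) = ennreal (k t) * wnorm (u t)" .
  qed
  also have "\<dots> < \<infinity>"
  proof -
    obtain A where A: "A \<ge> 0" and small: "\<And>t. 0 < t \<Longrightarrow> t \<le> 1 \<Longrightarrow> wnorm (u t) \<le> ennreal (A * t ^ ?n)"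
      using heat_diff_small[of ?n ?F] ift_wfinite_fourier_pow[OF f] unfolding u_def by blast
    have "ift_wfinite ?F" using ift_wfinite_fourier_pow[OF f, of 0] by simp
    then obtain B where B: "B \<ge> 0" and large0: "\<And>s t. 0 \<le> s \<Longrightarrow> 0 \<le> t \<Longrightarrow> wnorm (ift (\<lambda>\<xi>. complex_of_real (exp (- s * (norm \<xi>)^2)) * (complex_of_real (heat_diff t \<xi> ^ ?n) * ?F \<xi>))) \<le> ennreal (B * (1 + s + t))"
      using heat_diff_large[of ?F ?n] by blast
    have large: "wnorm (u t) \<le> ennreal (B * (1 + t))" if "0 \<le> t" for t
      using large0[of 0 t] that by (simp add: u_def)
    have "(\<integral>\<^sup>+t. ennreal (k t) * wnorm (u t) \<partial>lborel) \<le> (\<integral>\<^sup>+t. ennreal A * ennreal (indicator {0<..1} t * t powr (real ?n / 2 - 1)) + ennreal (2 * B) * ennreal (indicator {1..} t * t powr (- (real ?n / 2))) \<partial>lborel)"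
    proof (rule nn_integral_mono)
      fix t :: real
      consider "t \<le> 0" | "0 < t" "t \<le> 1" | "1 < t" by linarith
      then show "ennreal (k t) * wnorm (u t) \<le> ennreal A * ennreal (indicator {0<..1} t * t powr (real ?n / 2 - 1)) + ennreal (2 * B) * ennreal (indicator {1..} t * t powr (- (real ?n / 2)))"
      proof cases
        case 2
        have "ennreal (k t) * wnorm (u t) \<le> ennreal (k t) * ennreal (A * t ^ ?n)"
          using small 2 by (intro mult_left_mono) auto
        also have "\<dots> = ennreal (A * (k t * t ^ ?n))" using k0 A 2 by (subst ennreal_mult[symmetric]) (auto simp: mult_ac)
        also have "k t * t ^ ?n = t powr (real ?n / 2 - 1)"
          using 2 by (simp add: k_def powr_realpow[symmetric] powr_add[symmetric])
        finally show ?thesis using 2 A by (auto simp: ennreal_mult intro: add_increasing2)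
      next
        case 3
        have "ennreal (k t) * wnorm (u t) \<le> ennreal (k t) * ennreal (B * (1 + t))"
          using large[of t] 3 by (intro mult_left_mono) auto
        also have "\<dots> = ennreal (k t * (B * (1 + t)))" using k0 B 3 by (subst ennreal_mult[symmetric]) auto
        also have "\<dots> \<le> ennreal (2 * B * t powr (- (real ?n / 2)))"
        proof (rule ennreal_leI)
          have "k t * (B * (1 + t)) \<le> k t * (B * (2 * t))" using 3 B k0 by (intro mult_left_mono) auto
          also have "\<dots> = 2 * B * (k t * t)" by simp
          also have "k t * t = t powr (- (real ?n / 2))"
            using 3 powr_add[of t "- (real ?n / 2) - 1" 1] by (simp add: k_def)
          finally show "k t * (B * (1 + t)) \<le> 2 * B * t powr (- (real ?n / 2))" .
        qed
        finally show ?thesis using 3 B by (simp add: ennreal_mult)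
      qed (simp add: k_def)
    qed
    also have "\<dots> = ennreal A * (\<integral>\<^sup>+t. ennreal (indicator {0<..1} t * t powr (real ?n / 2 - 1)) \<partial>lborel) + ennreal (2 * B) * (\<integral>\<^sup>+t. ennreal (indicator {1..} t * t powr (- (real ?n / 2))) \<partial>lborel)"
      by (subst nn_integral_add) (simp_all add: nn_integral_cmult)
    also have "\<dots> < \<infinity>"
      using nn_integral_powr_01[of "real ?n / 2"] nn_integral_powr_1_inf[of "real ?n / 2"] dim n
      by (simp add: ennreal_mult_less_top)
    finally show ?thesis .
  qed
  finally have "wnorm (ift g) < \<infinity>"
    using c(1) by (auto simp: ennreal_mult_less_top)
  then show ?thesis using gi by (simp add: ift_wfinite_def g_def[abs_def])
qed

subsection \<open>The fractional Laplacian of a Schwartz function\<close>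

lemma nn_integral_exp_inverse:
  fixes c :: real
  assumes c: "0 < c"
  shows "(\<integral>\<^sup>+s. ennreal (indicator {0<..} s * (exp (- c / s) / s^2)) \<partial>lborel) = ennreal (1 / c)"
proof -
  define f where "f s = (if s \<le> 0 then 0 else exp (- c / s) / s^2)" for s :: real
  define F where "F s = (if s \<le> 0 then 0 else exp (- c / s) / c)" for s :: real
  have [measurable]: "f \<in> borel_measurable borel" unfolding f_def by measurable
  \<comment> \<open>The fundamental theorem is applied on the closed half-line, which includes the
    singular point. The quadratic term of the exponential series makes exp (- c / h) of order
    h^2.\<close>
  have F0: "(F has_real_derivative 0) (at 0)"
    unfolding DERIV_def
  proof (rule Lim_null_comparison)
    show "((\<lambda>h. 2 / c ^ 3 * \<bar>h\<bar>) \<longlongrightarrow> 0) (at 0)"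
      using c by (auto intro!: tendsto_eq_intros)
    have "norm ((F (0 + h) - F 0) / h) \<le> 2 / c ^ 3 * \<bar>h\<bar>" for h
    proof (cases "h > 0")
      case True
      have "(c / h)^2 / 2 \<le> 1 + c / h + (c / h)^2 / 2" using c True by simp
      also have "\<dots> \<le> exp (c / h)" by (rule exp_lower_Taylor_quadratic) (use c True in simp)
      finally have "exp (- c / h) \<le> 2 * h^2 / c^2"
        using c True by (simp add: exp_minus field_simps)
      then have "exp (- c / h) / (c * h) \<le> (2 * h^2 / c^2) / (c * h)"
        using c True by (intro divide_right_mono) auto
      also have "\<dots> = 2 / c ^ 3 * h" using c True by (simp add: field_simps power2_eq_square power3_eq_cube)
      finally show ?thesis using True c by (simp add: F_def)
    next
      case False
      have "0 \<le> 2 / c ^ 3 * \<bar>h\<bar>" using c by (intro mult_nonneg_nonneg) auto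
      then show ?thesis using False by (simp add: F_def)
    qed
    then show "\<forall>\<^sub>F h in at 0. norm ((F (0 + h) - F 0) / h) \<le> 2 / c ^ 3 * \<bar>h\<bar>" by simp
  qed
  have "(\<integral>\<^sup>+s\<in>{0..}. ennreal (f s) \<partial>lborel) = ennreal (1 / c - F 0)"
  proof (rule nn_integral_FTC_atLeast[where F=F])
    show "(F has_real_derivative f x) (at x)" if "0 \<le> x" for x
    proof (cases "x = 0")
      case True
      then show ?thesis using F0 by (simp add: f_def)
    next
      case False
      then have x: "x > 0" using that by simp
      have "((\<lambda>s. exp (- c / s) / c) has_real_derivative exp (- c / x) / x^2) (at x)"
        using x c by (auto intro!: derivative_eq_intros simp: field_simps power2_eq_square)
      then have "(F has_real_derivative exp (- c / x) / x^2) (at x)"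
        by (rule has_field_derivative_transform_within_open[where S="{0<..}"]) (use x in \<open>auto simp: F_def\<close>)
      then show ?thesis using x by (simp add: f_def)
    qed
    have "((\<lambda>s. exp (- c / s) / c) \<longlongrightarrow> exp 0 / c) at_top"
      by (intro tendsto_intros tendsto_divide_0[OF tendsto_const] filterlim_at_top_imp_at_infinity filterlim_ident) (use c in auto)
    moreover have "\<forall>\<^sub>F s in at_top. exp (- c / s) / c = F s"
      using eventually_gt_at_top[of 0] by eventually_elim (simp add: F_def)
    ultimately show "(F \<longlongrightarrow> 1 / c) at_top" by (auto elim: Lim_transform_eventually)
  qed (auto simp: f_def)
  moreover have "(\<integral>\<^sup>+s. ennreal (indicator {0<..} s * (exp (- c / s) / s^2)) \<partial>lborel) = (\<integral>\<^sup>+s\<in>{0..}. ennreal (f s) \<partial>lborel)"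
    by (intro nn_integral_cong) (auto simp: f_def split: split_indicator)
  ultimately show ?thesis by (simp add: F_def)
qed

text \<open>Frullani's integral in the variable 1/s: the difference of exponentials is the integral
  over c in [a, b] of exp (- c / s) / s, and the s-integral of exp (- c / s) / s^2 is 1/c.\<close>

lemma nn_integral_frullani:
  fixes a b :: real
  assumes ab: "0 < a" "a \<le> b"
  shows "(\<integral>\<^sup>+s. ennreal (indicator {0<..} s * ((exp (- a / s) - exp (- b / s)) / s)) \<partial>lborel) = ennreal (ln b - ln a)"
proof -
  have "(\<integral>\<^sup>+s. ennreal (indicator {0<..} s * ((exp (- a / s) - exp (- b / s)) / s)) \<partial>lborel)
      = (\<integral>\<^sup>+s. (\<integral>\<^sup>+c. ennreal (indicator {a..b} c * (indicator {0<..} s * (exp (- c / s) / s^2))) \<partial>lborel) \<partial>lborel)"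
  proof (rule nn_integral_cong)
    fix s :: real
    show "ennreal (indicator {0<..} s * ((exp (- a / s) - exp (- b / s)) / s)) = (\<integral>\<^sup>+c. ennreal (indicator {a..b} c * (indicator {0<..} s * (exp (- c / s) / s^2))) \<partial>lborel)"
    proof (cases "0 < s")
      case True
      have "(\<integral>\<^sup>+c\<in>{a..b}. ennreal (exp (- c / s) / s^2) \<partial>lborel) = ennreal (- exp (- b / s) / s - - exp (- a / s) / s)"
        by (rule nn_integral_FTC_Icc[where F="\<lambda>c. - exp (- c / s) / s"])
           (use True ab in \<open>auto intro!: derivative_eq_intros simp: power2_eq_square\<close>)
      moreover have "(\<integral>\<^sup>+c. ennreal (indicator {a..b} c * (exp (- c / s) / s^2)) \<partial>lborel) = (\<integral>\<^sup>+c\<in>{a..b}. ennreal (exp (- c / s) / s^2) \<partial>lborel)"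
        by (intro nn_integral_cong) (auto split: split_indicator)
      ultimately show ?thesis using True by (simp add: diff_divide_distrib)
    qed simp
  qed
  also have "\<dots> = (\<integral>\<^sup>+c. (\<integral>\<^sup>+s. ennreal (indicator {a..b} c * (indicator {0<..} s * (exp (- c / s) / s^2))) \<partial>lborel) \<partial>lborel)"
    by (rule lborel_pair.Fubini') measurable
  also have "\<dots> = (\<integral>\<^sup>+c\<in>{a..b}. ennreal (1 / c) \<partial>lborel)"
  proof (rule nn_integral_cong)
    fix c :: real
    show "(\<integral>\<^sup>+s. ennreal (indicator {a..b} c * (indicator {0<..} s * (exp (- c / s) / s^2))) \<partial>lborel) = ennreal (1 / c) * indicator {a..b} c"
      using nn_integral_exp_inverse[of c] ab by (cases "c \<in> {a..b}") auto
  qed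
  also have "\<dots> = ennreal (ln b - ln a)"
    by (rule nn_integral_FTC_Icc) (use ab in \<open>auto intro!: derivative_eq_intros simp: divide_inverse\<close>)
  finally show ?thesis .
qed

text \<open>With N = |z|^2 this writes - 2 ln |z| as a superposition of Gaussians of width s. The
  subtracted exp (- 1 / s) is independent of z; it gives convergence for large s and disappears when
  paired with a function of integral 0.\<close>

definition frullani_kernel :: "real \<Rightarrow> real \<Rightarrow> real" where
  "frullani_kernel N s = indicator {0<..} s * ((exp (- N / s) - exp (- 1 / s)) / s)"

lemma frullani_kernel_measurable [measurable]: "(\<lambda>p. frullani_kernel (fst p) (snd p)) \<in> borel_measurable (borel \<Otimes>\<^sub>M borel)" "frullani_kernel N \<in> borel_measurable borel"
  unfolding frullani_kernel_def by measurable

lemma frullani_kernel_integral: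
  assumes N: "0 < N"
  shows "has_bochner_integral lborel (frullani_kernel N) (- ln N)" "has_bochner_integral lborel (\<lambda>s. norm (frullani_kernel N s)) \<bar>ln N\<bar>"
proof -
  have "has_bochner_integral lborel (frullani_kernel N) (- ln N) \<and> has_bochner_integral lborel (\<lambda>s. norm (frullani_kernel N s)) \<bar>ln N\<bar>"
  proof (cases "N \<le> 1")
    case True
    have nn: "frullani_kernel N s \<ge> 0" for s using True by (auto simp: frullani_kernel_def indicator_def divide_right_mono)
    have "has_bochner_integral lborel (frullani_kernel N) (- ln N)"
      using nn_integral_frullani[OF N True] nn True N
      by (intro has_bochner_integral_nn_integral) (auto simp: frullani_kernel_def)
    then show ?thesis using nn True N by simp
  next
    case False
    have nn: "- frullani_kernel N s \<ge> 0" for s using False by (auto simp: frullani_kernel_def indicator_def intro!: divide_nonpos_pos divide_right_mono)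
    have "has_bochner_integral lborel (\<lambda>s. - frullani_kernel N s) (ln N)"
    proof (rule has_bochner_integral_nn_integral)
      have "- frullani_kernel N s = indicator {0<..} s * ((exp (- 1 / s) - exp (- N / s)) / s)" for s
        by (simp add: frullani_kernel_def field_simps split: split_indicator)
      then show "(\<integral>\<^sup>+s. ennreal (- frullani_kernel N s) \<partial>lborel) = ennreal (ln N)"
        using nn_integral_frullani[of 1 N] False by simp
    qed (use nn False in auto)
    moreover from has_bochner_integral_minus[OF this] have "has_bochner_integral lborel (frullani_kernel N) (- ln N)" by simp
    moreover have "norm (frullani_kernel N s) = - frullani_kernel N s" for s using nn[of s] by simp
    ultimately show ?thesis using False by simp
  qed
  then show "has_bochner_integral lborel (frullani_kernel N) (- ln N)" "has_bochner_integral lborel (\<lambda>s. norm (frullani_kernel N s)) \<bar>ln N\<bar>" by auto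
qed

lemma abs_ln_le: "0 < r \<Longrightarrow> \<bar>ln r\<bar> \<le> r + 1 / r" for r :: real
proof -
  assume r: "0 < r"
  have "0 < 1 / r" using r by simp
  moreover have "ln r \<le> r - 1" "- ln r \<le> 1 / r - 1"
    using ln_le_minus_one[of r] ln_le_minus_one[of "1 / r"] r by (simp_all add: ln_div)
  ultimately show ?thesis using r by linarith
qed

lemma gauss_weight_fourier_bound:
  fixes n :: nat and r t :: real
  assumes n: "0 < n" and t: "0 < t" and r: "0 \<le> r"
  shows "r ^ n * exp (- (r^2) / (4 * t)) \<le> sqrt (4 * t * n) ^ n * exp (- (1 / (8 * t)) * r^2)"
proof -
  \<comment> \<open>Chosen so that the n-th power of sqrt q \<le> exp (q / 2) has exactly the
    exponent r^2 / (8 t), half of the available Gaussian.\<close>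
  define q where "q = r^2 / (4 * t * n)"
  have q0: "q \<ge> 0" using t n by (simp add: q_def)
  have "q \<le> exp q" using exp_ge_add_one_self[of q] by linarith
  then have "sqrt q \<le> sqrt (exp q)" by simp
  also have "sqrt (exp q) = exp (q / 2)"
    by (rule real_sqrt_unique) (simp_all add: power2_eq_square flip: exp_add)
  finally have "sqrt q ^ n \<le> exp (q / 2) ^ n" using q0 by (intro power_mono) auto
  also have "exp (q / 2) ^ n = exp (r^2 / (8 * t))"
    using n t by (simp add: exp_of_nat_mult[symmetric] q_def)
  finally have 1: "sqrt q ^ n \<le> exp (r^2 / (8 * t))" .
  have "r = sqrt (4 * t * n) * sqrt q" using n t r by (simp add: q_def real_sqrt_mult real_sqrt_divide)
  then have "r ^ n = sqrt (4 * t * n) ^ n * sqrt q ^ n" by (metis power_mult_distrib)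
  also have "\<dots> \<le> sqrt (4 * t * n) ^ n * exp (r^2 / (8 * t))"
    using 1 t by (intro mult_left_mono) auto
  finally have "r ^ n * exp (- (r^2) / (4 * t)) \<le> (sqrt (4 * t * n) ^ n * exp (r^2 / (8 * t))) * exp (- (r^2) / (4 * t))"
    by (rule mult_right_mono) simp
  also have "exp (r^2 / (8 * t)) * exp (- (r^2) / (4 * t)) = exp (- (1 / (8 * t)) * r^2)"
    by (simp add: exp_add[symmetric])
  then have "(sqrt (4 * t * n) ^ n * exp (r^2 / (8 * t))) * exp (- (r^2) / (4 * t)) = sqrt (4 * t * n) ^ n * exp (- (1 / (8 * t)) * r^2)"
    by (simp only: mult.assoc)
  finally show ?thesis .
qed

section \<open>Moments and logarithmic potential of (-\<Delta>)^(n/2) f\<close>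

locale frac_lap_schwartz =
  fixes f :: "'a::euclidean_space \<Rightarrow> real"
  assumes dim: "3 \<le> DIM('a)" and f: "schwartz f"
begin

definition "fhat = fourier (\<lambda>x. complex_of_real (f x))"
definition "g \<xi> = complex_of_real (norm \<xi> ^ DIM('a)) * fhat \<xi>"
text \<open>\<open>Psi\<close> is (2 pi)^n times (-\<Delta>)^(n/2) f, before real parts are
  taken.\<close>

definition "Psi = ift g"

lemma g_wfinite: "ift_wfinite g"
  using wnorm_ift_norm_power_fourier[OF dim f] by (simp add: g_def[abs_def] fhat_def)

lemma g_int: "integrable lborel g" using g_wfinite by (simp add: ift_wfinite_def)

lemma g_meas [measurable]: "g \<in> borel_measurable borel" using g_int by auto

lemma fhat_int: "integrable lborel fhat" unfolding fhat_def by (rule fourier_integrable[OF f])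

lemma fhat_meas [measurable]: "fhat \<in> borel_measurable borel" using fhat_int by auto

lemma Psi_meas [measurable]: "Psi \<in> borel_measurable borel" unfolding Psi_def by measurable

lemma Psi_bound: "norm (Psi x) \<le> (LINT \<xi>|lborel. norm (g \<xi>))"
  unfolding Psi_def by (rule ift_bound)

lemma Psi_weighted: "integrable lborel (\<lambda>x. (1 + (norm x)^2) * norm (Psi x))"
  using g_wfinite unfolding ift_wfinite_def wnorm_def Psi_def[symmetric] by (intro integrableI_bounded) auto

lemma Psi_int: "integrable lborel Psi"
proof (rule Bochner_Integration.integrable_bound[OF Psi_weighted])
  have "1 * norm (Psi x) \<le> (1 + (norm x)^2) * norm (Psi x)" for x by (intro mult_right_mono) auto
  then show "AE x in lborel. norm (Psi x) \<le> norm ((1 + (norm x)^2) * norm (Psi x))" by simp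
qed simp

lemma Psi_sq_int: "integrable lborel (\<lambda>x. complex_of_real ((norm x)^2) * Psi x)"
proof (rule Bochner_Integration.integrable_bound[OF Psi_weighted])
  have "(norm x)^2 * norm (Psi x) \<le> (1 + (norm x)^2) * norm (Psi x)" for x by (intro mult_right_mono) auto
  then show "AE x in lborel. norm (complex_of_real ((norm x)^2) * Psi x) \<le> norm ((1 + (norm x)^2) * norm (Psi x))"
    by (simp add: norm_mult norm_power)
qed simp

lemma gauss_Psi:
  assumes t: "0 < t"
  shows "(LINT z|lborel. complex_of_real (exp (- t * (norm z)^2)) * Psi (y + z))
    = ift (\<lambda>\<xi>. complex_of_real ((pi / t) powr (DIM('a) / 2) * exp (- ((norm \<xi>)^2) / (4 * t))) * g \<xi>) y"
  unfolding Psi_def by (rule gauss_ift[OF g_int t])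

text \<open>On the Fourier side the Gaussian is concentrated at |\<xi>| of order sqrt t, where the
  factor |\<xi>|^n in \<open>g\<close> is of order t^(n/2). Thus wide Gaussians nearly annihilate
  \<open>Psi\<close>, which encodes its vanishing moments.\<close>

lemma gauss_Psi_small:
  "\<exists>K. \<forall>t>0. norm (LINT z|lborel. complex_of_real (exp (- t * (norm z)^2)) * Psi z) \<le> K * sqrt t ^ DIM('a)"
proof -
  obtain B where B: "\<And>\<xi>. norm (fhat \<xi>) \<le> B" using fourier_decay[OF f, of 0] by (auto simp: fhat_def)
  have B0: "B \<ge> 0" using B[of 0] norm_ge_zero order_trans by blast
  \<comment> \<open>Collects the bound of the transform, the constant of the weight estimate, the
    prefactor (pi / t)^(n/2) and the Gaussian mass (8 pi t)^(n/2). The powers of t are - n/2, n/2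
    and n/2, which leave t^(n/2).\<close>
  define K where "K = B * (sqrt (4 * DIM('a)) ^ DIM('a) * sqrt pi ^ DIM('a) * sqrt (8 * pi) ^ DIM('a))"
  have "norm (LINT z|lborel. complex_of_real (exp (- t * (norm z)^2)) * Psi z) \<le> K * sqrt t ^ DIM('a)" if t: "t > 0" for t
  proof -
    have pw: "x powr (real DIM('a) / 2) = sqrt x ^ DIM('a)" if "x > 0" for x
    proof -
      have "x powr (real DIM('a) / 2) = (x powr (1 / 2)) powr DIM('a)" unfolding powr_powr by simp
      also have "\<dots> = sqrt x ^ DIM('a)" using that by (simp add: powr_half_sqrt powr_realpow)
      finally show ?thesis .
    qed
    define h where "h \<xi> = complex_of_real ((pi / t) powr (DIM('a) / 2) * exp (- ((norm \<xi>)^2) / (4 * t))) * g \<xi>" for \<xi>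
    have "norm (LINT z|lborel. complex_of_real (exp (- t * (norm z)^2)) * Psi z) = norm (ift h 0)"
      using gauss_Psi[OF t, of 0] by (simp add: h_def[abs_def])
    also have "\<dots> \<le> (LINT \<xi>|lborel. norm (h \<xi>))" by (rule ift_bound)
    also have "\<dots> \<le> (LINT \<xi>|lborel. sqrt (pi / t) ^ DIM('a) * B * sqrt (4 * t * DIM('a)) ^ DIM('a) * exp (- (1 / (8 * t)) * (norm (\<xi>::'a))^2))"
    proof (rule integral_mono')
      show "integrable lborel (\<lambda>\<xi>::'a. sqrt (pi / t) ^ DIM('a) * B * sqrt (4 * t * DIM('a)) ^ DIM('a) * exp (- (1 / (8 * t)) * (norm \<xi>)^2))"
        using gauss_integral[of "1 / (8 * t)", where 'a='a] t by (simp add: has_bochner_integral_iff)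
      fix \<xi> :: 'a
      have "norm (h \<xi>) = (sqrt (pi / t) ^ DIM('a) * norm (fhat \<xi>)) * (norm \<xi> ^ DIM('a) * exp (- ((norm \<xi>)^2) / (4 * t)))"
        using t pw[of "pi / t"] by (simp add: h_def g_def norm_mult norm_power)
      also have "\<dots> \<le> (sqrt (pi / t) ^ DIM('a) * B) * (sqrt (4 * t * DIM('a)) ^ DIM('a) * exp (- (1 / (8 * t)) * (norm \<xi>)^2))"
        using t B B0 by (intro mult_mono gauss_weight_fourier_bound mult_left_mono) auto
      finally show "norm (h \<xi>) \<le> sqrt (pi / t) ^ DIM('a) * B * sqrt (4 * t * DIM('a)) ^ DIM('a) * exp (- (1 / (8 * t)) * (norm \<xi>)^2)"
        by (simp only: mult.assoc)
    qed (use B0 t in auto)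
    also have "\<dots> = sqrt (pi / t) ^ DIM('a) * B * sqrt (4 * t * DIM('a)) ^ DIM('a) * (pi / (1 / (8 * t))) powr (DIM('a) / 2)"
      using gauss_integral[of "1 / (8 * t)", where 'a='a] t by (simp add: has_bochner_integral_iff)
    also have "(pi / (1 / (8 * t))) powr (DIM('a) / 2) = sqrt (8 * pi) ^ DIM('a) * sqrt t ^ DIM('a)"
      using pw[of "8 * pi * t"] t by (simp add: real_sqrt_mult power_mult_distrib mult_ac)
    also have "sqrt (pi / t) ^ DIM('a) * B * sqrt (4 * t * DIM('a)) ^ DIM('a) * (sqrt (8 * pi) ^ DIM('a) * sqrt t ^ DIM('a)) = K * sqrt t ^ DIM('a)"
      using t by (simp add: K_def real_sqrt_mult real_sqrt_divide power_mult_distrib power_divide)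
    finally show ?thesis .
  qed
  then show ?thesis by blast
qed

text \<open>Let M(s) be the pairing with exp (- s |z|^2). As s tends to 0 it converges to the
  integral of \<open>Psi\<close>, but is O(s^(n/2)). Then M(s) / s converges to minus the second
  moment and is O(s^(n/2 - 1)), which tends to 0 since n \<ge> 3.\<close>

lemma Psi_moments:
  "(LINT x|lborel. Psi x) = 0" "(LINT x|lborel. complex_of_real ((norm x)^2) * Psi x) = 0"
proof -
  obtain K where K: "\<And>t. t > 0 \<Longrightarrow> norm (LINT z|lborel. complex_of_real (exp (- t * (norm z)^2)) * Psi z) \<le> K * sqrt t ^ DIM('a)"
    using gauss_Psi_small by blast
  define s where "s k = 1 / real (Suc k)" for k
  have s: "s k > 0" for k by (simp add: s_def)
  have s0: "s \<longlonglongrightarrow> 0" unfolding s_def using LIMSEQ_inverse_real_of_nat by (simp add: inverse_eq_divide)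
  define M where "M k = (LINT z|lborel. complex_of_real (exp (- s k * (norm z)^2)) * Psi z)" for k
  have sq0: "(\<lambda>k. sqrt (s k)) \<longlonglongrightarrow> 0" using tendsto_real_sqrt[OF s0] by simp
  have "M \<longlonglongrightarrow> 0"
  proof (rule Lim_null_comparison)
    show "\<forall>\<^sub>F k in sequentially. norm (M k) \<le> K * sqrt (s k) ^ DIM('a)" using K s by (simp add: M_def)
    show "(\<lambda>k. K * sqrt (s k) ^ DIM('a)) \<longlonglongrightarrow> 0"
      using tendsto_mult_left[OF tendsto_power[OF sq0, of "DIM('a)"], of K] by (simp add: zero_power)
  qed
  moreover have "M \<longlonglongrightarrow> (LINT x|lborel. Psi x)"
    unfolding M_def
  proof (rule integral_dominated_convergence)
    show "integrable lborel (\<lambda>x. norm (Psi x))" using Psi_int by simp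
    show "AE z in lborel. (\<lambda>k. complex_of_real (exp (- s k * (norm z)^2)) * Psi z) \<longlonglongrightarrow> Psi z"
    proof (rule AE_I2)
      fix z :: 'a
      have "(\<lambda>k. complex_of_real (exp (- s k * (norm z)^2)) * Psi z) \<longlonglongrightarrow> complex_of_real (exp (- 0 * (norm z)^2)) * Psi z"
        by (intro tendsto_intros s0)
      then show "(\<lambda>k. complex_of_real (exp (- s k * (norm z)^2)) * Psi z) \<longlonglongrightarrow> Psi z" by simp
    qed
    show "AE z in lborel. norm (complex_of_real (exp (- s k * (norm z)^2)) * Psi z) \<le> norm (Psi z)" for k
      using s[of k] by (intro AE_I2) (simp add: norm_mult mult_left_le_one_le)
  qed measurable
  ultimately show int0: "(LINT x|lborel. Psi x) = 0" by (rule LIMSEQ_unique[rotated])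
  define D where "D k z = complex_of_real ((exp (- s k * (norm z)^2) - 1) / s k) * Psi z" for k z
  have gi: "integrable lborel (\<lambda>z. complex_of_real (exp (- s k * (norm z)^2)) * Psi z)" for k
    using integrable_mult_bounded[OF Psi_int, of "\<lambda>z. complex_of_real (exp (- s k * (norm z)^2))" 1] s[of k]
    by (simp add: mult.commute)
  have Dint: "(LINT z|lborel. D k z) = M k / complex_of_real (s k)" for k
  proof -
    have "D k z = (complex_of_real (exp (- s k * (norm z)^2)) * Psi z - Psi z) / complex_of_real (s k)" for z
      by (simp add: D_def left_diff_distrib)
    then show ?thesis using gi Psi_int int0 by (simp add: M_def)
  qed
  have "(\<lambda>k. M k / complex_of_real (s k)) \<longlonglongrightarrow> 0"
  proof (rule Lim_null_comparison)
    have "norm (M k / complex_of_real (s k)) \<le> K * sqrt (s k) ^ (DIM('a) - 2)" for k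
    proof -
      have "DIM('a) = (DIM('a) - 2) + 2" using dim by simp
      from arg_cong[OF this, of "\<lambda>m. sqrt (s k) ^ m"]
      have "sqrt (s k) ^ DIM('a) = sqrt (s k) ^ (DIM('a) - 2) * sqrt (s k) ^ 2"
        by (simp only: power_add)
      also have "sqrt (s k) ^ 2 = s k" using s[of k] by simp
      finally have "norm (M k) \<le> K * sqrt (s k) ^ (DIM('a) - 2) * s k" using K[OF s[of k]] by (simp add: M_def mult.assoc)
      then show ?thesis using s[of k] by (simp add: norm_divide field_simps)
    qed
    then show "\<forall>\<^sub>F k in sequentially. norm (M k / complex_of_real (s k)) \<le> K * sqrt (s k) ^ (DIM('a) - 2)" by simp
    show "(\<lambda>k. K * sqrt (s k) ^ (DIM('a) - 2)) \<longlonglongrightarrow> 0"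
      using tendsto_mult_left[OF tendsto_power[OF sq0, of "DIM('a) - 2"], of K] dim by (simp add: zero_power)
  qed
  moreover have "(\<lambda>k. LINT z|lborel. D k z) \<longlonglongrightarrow> (LINT z|lborel. - (complex_of_real ((norm z)^2) * Psi z))"
  proof (rule integral_dominated_convergence)
    show "integrable lborel (\<lambda>z. norm (complex_of_real ((norm z)^2) * Psi z))" using Psi_sq_int by (rule integrable_norm)
    show "AE z in lborel. (\<lambda>k. D k z) \<longlonglongrightarrow> - (complex_of_real ((norm z)^2) * Psi z)"
    proof (rule AE_I2)
      fix z :: 'a
      have "((\<lambda>h. exp (- h * (norm z)^2)) has_real_derivative - ((norm z)^2)) (at 0)"
        by (auto intro!: derivative_eq_intros)
      then have "((\<lambda>h. (exp (- h * (norm z)^2) - 1) / h) \<longlongrightarrow> - ((norm z)^2)) (at 0)" by (simp add: DERIV_def)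
      moreover have "filterlim s (at 0) sequentially" using s0 s by (auto simp: filterlim_at intro!: eventuallyI less_imp_neq[symmetric])
      ultimately have "(\<lambda>k. (exp (- s k * (norm z)^2) - 1) / s k) \<longlonglongrightarrow> - ((norm z)^2)" by (rule filterlim_compose)
      then have "(\<lambda>k. D k z) \<longlonglongrightarrow> complex_of_real (- ((norm z)^2)) * Psi z"
        unfolding D_def by (intro tendsto_intros)
      then show "(\<lambda>k. D k z) \<longlonglongrightarrow> - (complex_of_real ((norm z)^2) * Psi z)" by simp
    qed
    show "AE z in lborel. norm (D k z) \<le> norm (complex_of_real ((norm z)^2) * Psi z)" for k
    proof (rule AE_I2)
      fix z :: 'a
      have "0 \<le> s k * (norm z)^2" using s[of k] by simp
      from one_minus_exp_bounds[OF this] have "\<bar>(exp (- s k * (norm z)^2) - 1) / s k\<bar> \<le> (norm z)^2"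
        using s[of k] by (simp add: field_simps)
      then show "norm (D k z) \<le> norm (complex_of_real ((norm z)^2) * Psi z)"
        unfolding D_def norm_mult norm_of_real by (intro mult_right_mono) auto
    qed
  qed (unfold D_def, measurable)
  ultimately have "(LINT z|lborel. - (complex_of_real ((norm z)^2) * Psi z)) = 0"
    unfolding Dint by (rule LIMSEQ_unique[rotated])
  then show "(LINT x|lborel. complex_of_real ((norm x)^2) * Psi x) = 0" by simp
qed

lemma Psi_shift_int: "integrable lborel (\<lambda>z. Psi (y + z))"
  by (rule integrable_lborel_shift(1)[OF Psi_int])

lemma ln_Psi_int: "integrable lborel (\<lambda>z. complex_of_real (ln (norm z)) * Psi (y + z))"
proof -
  define B where "B = (LINT \<xi>|lborel. norm (g \<xi>))"
  have B: "norm (Psi x) \<le> B" for x unfolding B_def by (rule Psi_bound)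
  \<comment> \<open>The majorant follows |ln r| \<le> r + 1 / r: the term r is absorbed by the
    weight through the Peetre-type inequality, the term 1 / r by boundedness of \<open>Psi\<close>
    on the unit ball and by its integrability outside.\<close>
  define w where "w z = 2 * (1 + (norm y)^2) * ((1 + (norm (y + z))^2) * norm (Psi (y + z))) + B * (norm z powr (- 1) * indicator (cball 0 1) z) + norm (Psi (y + z))" for z
  have "integrable lborel w"
    unfolding w_def
  proof (intro Bochner_Integration.integrable_add integrable_mult_right integrable_norm Psi_shift_int)
    show "integrable lborel (\<lambda>z. (1 + (norm (y + z))^2) * norm (Psi (y + z)))"
      by (rule integrable_lborel_shift(1)[OF Psi_weighted])
    show "integrable lborel (\<lambda>z::'a. norm z powr (- 1) * indicator (cball 0 1) z)"
      by (rule integrable_norm_powr_ball) (use dim in simp)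
  qed
  then show ?thesis
  proof (rule Bochner_Integration.integrable_bound)
    have "norm (complex_of_real (ln (norm z)) * Psi (y + z)) \<le> w z" for z
    proof (cases "z = 0")
      case True
      then show ?thesis using B[of y] by (simp add: w_def)
    next
      case False
      have "\<bar>ln (norm z)\<bar> \<le> norm z + 1 / norm z" using abs_ln_le False by simp
      then have "norm (complex_of_real (ln (norm z)) * Psi (y + z)) \<le> (norm z + 1 / norm z) * norm (Psi (y + z))"
        unfolding norm_mult norm_of_real by (intro mult_right_mono) auto
      also have "\<dots> = norm z * norm (Psi (y + z)) + 1 / norm z * norm (Psi (y + z))" by (rule distrib_right)
      also have "norm z * norm (Psi (y + z)) \<le> 2 * (1 + (norm y)^2) * ((1 + (norm (y + z))^2) * norm (Psi (y + z)))"
      proof -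
        have "norm z \<le> 1 + (norm z)^2"
          using zero_le_power2[of "norm z - 1/2"] by (simp add: power2_eq_square algebra_simps)
        also have "\<dots> \<le> 2 * (1 + (norm y)^2) * (1 + (norm (y + z))^2)"
          using one_plus_norm_sq_add_le[of "- y" "y + z"] by simp
        finally have "norm z * norm (Psi (y + z)) \<le> (2 * (1 + (norm y)^2) * (1 + (norm (y + z))^2)) * norm (Psi (y + z))"
          by (rule mult_right_mono) simp
        then show ?thesis by (simp only: mult.assoc)
      qed
      also have "1 / norm z * norm (Psi (y + z)) \<le> B * (norm z powr (- 1) * indicator (cball 0 1) z) + norm (Psi (y + z))"
      proof (cases "norm z \<le> 1")
        case True
        have "1 / norm z * norm (Psi (y + z)) \<le> 1 / norm z * B" using B by (intro mult_left_mono) auto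
        then show ?thesis using True False
          by (simp add: powr_minus_divide mult.commute add_increasing2)
      next
        case n1: False
        then have "1 / norm z * norm (Psi (y + z)) \<le> 1 * norm (Psi (y + z))" by (intro mult_right_mono) (auto simp: divide_le_eq)
        then show ?thesis using n1 by simp
      qed
      finally show ?thesis by (simp add: w_def)
    qed
    then show "AE z in lborel. norm (complex_of_real (ln (norm z)) * Psi (y + z)) \<le> norm (w z)"
      by (auto intro: order_trans[OF _ abs_ge_self])
  qed measurable
qed

text \<open>The logarithm is a multiple of the fundamental solution. Write it as the Frullani
  superposition of Gaussians; the z-independent part vanishes against \<open>Psi\<close>. On the
  Fourier side the width integral of s^(n/2 - 1) exp (- s |\<xi>|^2 / 4) is Gamma (n/2) 2^n /
  |\<xi>|^n, which cancels the factor |\<xi>|^n of \<open>g\<close>, and Fourier inversion returns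
  f.\<close>

lemma ln_Psi_integral:
  "(LINT z|lborel. complex_of_real (- 2 * ln (norm z)) * Psi (y + z))
     = complex_of_real (pi powr (DIM('a) / 2) * Gamma (DIM('a) / 2) * 2 ^ DIM('a) * (2 * pi) ^ DIM('a) * f y)"
proof -
  let ?n = "real DIM('a) / 2"
  have n0: "?n > 0" by simp
  define k where "k z s = frullani_kernel ((norm z)^2) s" for z :: 'a and s
  have km[measurable]: "(\<lambda>p. k (fst p) (snd p)) \<in> borel_measurable (borel \<Otimes>\<^sub>M borel)" "k z \<in> borel_measurable borel" for z
    unfolding k_def frullani_kernel_def by measurable
  have kB: "has_bochner_integral lborel (k z) (- 2 * ln (norm z))" "has_bochner_integral lborel (\<lambda>s. norm (k z s)) (2 * \<bar>ln (norm z)\<bar>)" if "z \<noteq> 0" for z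
    using frullani_kernel_integral[of "(norm z)^2"] that unfolding k_def by (simp_all add: ln_realpow abs_mult)
  define G where "G z s = complex_of_real (k z s) * Psi (y + z)" for z s
  have I: "integrable (lborel \<Otimes>\<^sub>M lborel) (\<lambda>(z, s). G z s)"
  proof (rule lborel_pair.Fubini_integrable)
    show "(\<lambda>(z, s). G z s) \<in> borel_measurable (lborel \<Otimes>\<^sub>M lborel)"
      unfolding G_def split_beta by measurable
    have "AE z in lborel. 2 * norm (complex_of_real (ln (norm z)) * Psi (y + z)) = (\<integral>s. norm (G z s) \<partial>lborel)"
      using AE_lborel_singleton[of "0::'a"]
    proof eventually_elim
      case (elim z)
      then show ?case using kB(2)[OF elim] by (simp add: G_def norm_mult has_bochner_integral_iff)
    qed
    moreover have "integrable lborel (\<lambda>z. 2 * norm (complex_of_real (ln (norm z)) * Psi (y + z)))"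
      using ln_Psi_int by (intro integrable_mult_right integrable_norm)
    moreover have "(\<lambda>z. \<integral>s. norm (G z s) \<partial>lborel) \<in> borel_measurable lborel"
      unfolding G_def by (rule lborel.borel_measurable_lebesgue_integral) (unfold split_beta, measurable)
    ultimately show "integrable lborel (\<lambda>z. \<integral>s. norm (case (z, s) of (z, s) \<Rightarrow> G z s) \<partial>lborel)"
      unfolding prod.case by (rule integrable_cong_AE_imp[rotated 2])
    show "AE z in lborel. integrable lborel (\<lambda>s. case (z, s) of (z, s) \<Rightarrow> G z s)"
      using AE_lborel_singleton[of "0::'a"]
      by eventually_elim (auto simp: G_def has_bochner_integral_iff dest: kB(1))
  qed
  define P where "P s = indicator {0<..} s * s powr (?n - 1) * pi powr ?n" for s :: real
  have P0: "P s \<ge> 0" for s by (simp add: P_def)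
  define H where "H s \<xi> = complex_of_real (P s * exp (- ((norm \<xi>)^2 / 4) * s)) * (g \<xi> * cis (y \<bullet> \<xi>))" for s \<xi>
  have [measurable]: "P \<in> borel_measurable borel" unfolding P_def by measurable
  have "(LINT z|lborel. complex_of_real (- 2 * ln (norm z)) * Psi (y + z)) = (LINT z|lborel. LINT s|lborel. G z s)"
  proof (rule integral_cong_AE)
    show "AE z in lborel. complex_of_real (- 2 * ln (norm z)) * Psi (y + z) = (LINT s|lborel. G z s)"
      using AE_lborel_singleton[of "0::'a"]
    proof eventually_elim
      case (elim z)
      then show ?case using kB(1)[OF elim] by (simp only: G_def integral_mult_left_zero integral_complex_of_real has_bochner_integral_iff)
    qed
    show "(\<lambda>z. LINT s|lborel. G z s) \<in> borel_measurable lborel" unfolding G_def by (rule lborel.borel_measurable_lebesgue_integral) (unfold split_beta, measurable)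
  qed measurable
  also have "\<dots> = (LINT s|lborel. LINT z|lborel. G z s)"
    using lborel_pair.Fubini_integral[OF I] by simp
  also have "\<dots> = (LINT s|lborel. LINT \<xi>|lborel. H s \<xi>)"
  proof (rule Bochner_Integration.integral_cong[OF refl])
    fix s :: real
    show "(LINT z|lborel. G z s) = (LINT \<xi>|lborel. H s \<xi>)"
    proof (cases "0 < s")
      case True
      have e: "integrable lborel (\<lambda>z. complex_of_real (exp (- (1 / s) * (norm z)^2)) * Psi (y + z))"
        using integrable_mult_bounded[OF Psi_shift_int, of "\<lambda>z. complex_of_real (exp (- (1 / s) * (norm z)^2))" 1 y] True
        by (simp add: mult.commute)
      have "G z s = complex_of_real (1 / s) * (complex_of_real (exp (- (1 / s) * (norm z)^2)) * Psi (y + z) - complex_of_real (exp (- 1 / s)) * Psi (y + z))" for z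
        using True by (simp add: G_def k_def frullani_kernel_def diff_divide_distrib left_diff_distrib)
      then have "(LINT z|lborel. G z s) = complex_of_real (1 / s) * ((LINT z|lborel. complex_of_real (exp (- (1 / s) * (norm z)^2)) * Psi (y + z)) - complex_of_real (exp (- 1 / s)) * (LINT z|lborel. Psi (y + z)))"
        using e Psi_shift_int[of y] by simp
      also have "(LINT z|lborel. Psi (y + z)) = 0" using integral_lborel_shift(1)[of Psi y] Psi_moments(1) by simp
      also have "(LINT z|lborel. complex_of_real (exp (- (1 / s) * (norm z)^2)) * Psi (y + z)) = ift (\<lambda>\<xi>. complex_of_real ((pi / (1 / s)) powr ?n * exp (- ((norm \<xi>)^2) / (4 * (1 / s)))) * g \<xi>) y"
        by (rule gauss_Psi) (use True in simp)
      also have "complex_of_real (1 / s) * (\<dots> - complex_of_real (exp (- 1 / s)) * 0) = (LINT \<xi>|lborel. H s \<xi>)"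
      proof -
        have ps: "1 / s * (pi / (1 / s)) powr ?n = P s"
        proof -
          have a: "(pi / (1 / s)) powr ?n = pi powr ?n * s powr ?n" using True by (simp add: powr_mult)
          have b: "s powr ?n = s * s powr (?n - 1)" using True by (simp add: powr_diff)
          show ?thesis unfolding a b using True by (simp add: P_def)
        qed
        have "H s \<xi> = complex_of_real (1 / s) * (complex_of_real ((pi / (1 / s)) powr ?n * exp (- ((norm \<xi>)^2) / (4 * (1 / s)))) * g \<xi> * cis (y \<bullet> \<xi>))" for \<xi>
        proof -
          have "- ((norm \<xi>)^2) / (4 * (1 / s)) = - ((norm \<xi>)^2 / 4) * s" by simp
          then show ?thesis unfolding H_def ps[symmetric] by (simp only: of_real_mult mult.assoc)
        qed
        then show ?thesis by (simp add: ift_def)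
      qed
      finally show ?thesis .
    qed (simp add: G_def k_def frullani_kernel_def H_def P_def)
  qed
  also have "\<dots> = (LINT \<xi>|lborel. complex_of_real (pi powr ?n * Gamma ?n * 2 ^ DIM('a)) * (fhat \<xi> * cis (y \<bullet> \<xi>)))"
  proof -
    have Hnn: "has_bochner_integral lborel (\<lambda>s. P s * exp (- ((norm \<xi>)^2 / 4) * s)) (pi powr ?n * Gamma ?n * 2 ^ DIM('a) / norm \<xi> ^ DIM('a))" if "\<xi> \<noteq> 0" for \<xi> :: 'a
    proof (rule has_bochner_integral_nn_integral)
      have N: "(norm \<xi>)^2 / 4 > 0" using that by simp
      have "(\<integral>\<^sup>+s. ennreal (P s * exp (- ((norm \<xi>)^2 / 4) * s)) \<partial>lborel) = (\<integral>\<^sup>+s. ennreal (pi powr ?n) * ennreal (indicator {0..} s * s powr (?n - 1) * exp (- ((norm \<xi>)^2 / 4) * s)) \<partial>lborel)"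
        by (intro nn_integral_cong) (auto simp: P_def ennreal_mult[symmetric] mult_ac indicator_def)
      also have "\<dots> = ennreal (pi powr ?n) * ennreal (Gamma ?n * ((norm \<xi>)^2 / 4) powr (- ?n))"
        by (subst nn_integral_cmult) (simp_all only: gamma_nn_integral[OF n0 N], measurable)
      also have "((norm \<xi>)^2 / 4) powr (- ?n) = 2 ^ DIM('a) / norm \<xi> ^ DIM('a)"
      proof -
        have "((norm \<xi>)^2 / 4) powr ?n = norm \<xi> ^ DIM('a) / 2 ^ DIM('a)"
        proof -
          have "(norm \<xi>)^2 / 4 = (norm (norm \<xi> / 2))^2" by (simp add: power_divide)
          also have "\<dots> powr ?n = norm (norm \<xi> / 2) ^ DIM('a)" by (rule norm_sq_powr_half) simp
          finally show ?thesis by (simp add: power_divide)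
        qed
        then show ?thesis by (simp add: powr_minus_divide)
      qed
      finally show "(\<integral>\<^sup>+s. ennreal (P s * exp (- ((norm \<xi>)^2 / 4) * s)) \<partial>lborel) = ennreal (pi powr ?n * Gamma ?n * 2 ^ DIM('a) / norm \<xi> ^ DIM('a))"
        using Gamma_real_pos[OF n0] by (simp add: ennreal_mult[symmetric] mult.assoc)
    qed (use P0 Gamma_real_pos[OF n0] in auto)
    have gm: "H s \<xi> = complex_of_real (P s * exp (- ((norm \<xi>)^2 / 4) * s)) * (g \<xi> * cis (y \<bullet> \<xi>))" for s \<xi> by (simp add: H_def)
    have I2: "integrable (lborel \<Otimes>\<^sub>M lborel) (\<lambda>(\<xi>, s). H s \<xi>)"
    proof (rule lborel_pair.Fubini_integrable)
      show "(\<lambda>(\<xi>, s). H s \<xi>) \<in> borel_measurable (lborel \<Otimes>\<^sub>M lborel)"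
        unfolding H_def split_beta by measurable
      have "AE \<xi> in lborel. pi powr ?n * Gamma ?n * 2 ^ DIM('a) * norm (fhat \<xi>) = (\<integral>s. norm (H s \<xi>) \<partial>lborel)"
        using AE_lborel_singleton[of "0::'a"]
      proof eventually_elim
        case (elim \<xi>)
        have "norm (H s \<xi>) = (P s * exp (- ((norm \<xi>)^2 / 4) * s)) * norm (g \<xi>)" for s
          using P0 by (simp add: H_def norm_mult)
        then have "(\<integral>s. norm (H s \<xi>) \<partial>lborel) = (pi powr ?n * Gamma ?n * 2 ^ DIM('a) / norm \<xi> ^ DIM('a)) * norm (g \<xi>)"
          using Hnn[OF elim] by (simp add: has_bochner_integral_iff)
        then show ?case using elim by (simp add: g_def norm_mult norm_power)
      qed
      moreover have "integrable lborel (\<lambda>\<xi>. pi powr ?n * Gamma ?n * 2 ^ DIM('a) * norm (fhat \<xi>))"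
        using fhat_int by (intro integrable_mult_right integrable_norm)
      moreover have "(\<lambda>\<xi>. \<integral>s. norm (H s \<xi>) \<partial>lborel) \<in> borel_measurable lborel"
        unfolding H_def by (rule lborel.borel_measurable_lebesgue_integral) (unfold split_beta, measurable)
      ultimately show "integrable lborel (\<lambda>\<xi>. \<integral>s. norm (case (\<xi>, s) of (\<xi>, s) \<Rightarrow> H s \<xi>) \<partial>lborel)"
        unfolding prod.case by (rule integrable_cong_AE_imp[rotated 2])
      show "AE \<xi> in lborel. integrable lborel (\<lambda>s. case (\<xi>, s) of (\<xi>, s) \<Rightarrow> H s \<xi>)"
        using AE_lborel_singleton[of "0::'a"]
      proof eventually_elim
        case (elim \<xi>)
        then have "integrable lborel (\<lambda>s. complex_of_real (P s * exp (- ((norm \<xi>)^2 / 4) * s)))"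
          using Hnn[OF elim] by (intro integrable_of_real) (simp add: has_bochner_integral_iff)
        then show ?case unfolding prod.case H_def by (rule integrable_mult_left)
      qed
    qed
    have "(LINT s|lborel. LINT \<xi>|lborel. H s \<xi>) = (LINT \<xi>|lborel. LINT s|lborel. H s \<xi>)"
      using lborel_pair.Fubini_integral[OF I2] by simp
    moreover have "(LINT \<xi>|lborel. LINT s|lborel. H s \<xi>) = (LINT \<xi>|lborel. complex_of_real (pi powr ?n * Gamma ?n * 2 ^ DIM('a)) * (fhat \<xi> * cis (y \<bullet> \<xi>)))"
    proof (rule integral_cong_AE)
      show "AE \<xi> in lborel. (LINT s|lborel. H s \<xi>) = complex_of_real (pi powr ?n * Gamma ?n * 2 ^ DIM('a)) * (fhat \<xi> * cis (y \<bullet> \<xi>))"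
        using AE_lborel_singleton[of "0::'a"]
      proof eventually_elim
        case (elim \<xi>)
        have "(LINT s|lborel. H s \<xi>) = complex_of_real (\<integral>s. P s * exp (- ((norm \<xi>)^2 / 4) * s) \<partial>lborel) * (g \<xi> * cis (y \<bullet> \<xi>))"
          unfolding H_def by (simp only: integral_mult_left_zero integral_complex_of_real)
        also have "(\<integral>s. P s * exp (- ((norm \<xi>)^2 / 4) * s) \<partial>lborel) = pi powr ?n * Gamma ?n * 2 ^ DIM('a) / norm \<xi> ^ DIM('a)"
          using Hnn[OF elim] by (simp add: has_bochner_integral_iff)
        finally show ?case using elim by (simp add: g_def)
      qed
      show "(\<lambda>\<xi>. LINT s|lborel. H s \<xi>) \<in> borel_measurable lborel" unfolding H_def by (rule lborel.borel_measurable_lebesgue_integral) (unfold split_beta, measurable)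
    qed measurable
    ultimately show ?thesis by simp
  qed
  also have "\<dots> = complex_of_real (pi powr ?n * Gamma ?n * 2 ^ DIM('a)) * ift fhat y"
    by (simp add: ift_def)
  also have "ift fhat y = complex_of_real ((2 * pi) ^ DIM('a) * f y)"
    unfolding fhat_def fourier_inversion[OF f] by simp
  finally show ?thesis by (simp only: of_real_mult mult.assoc)
qed

lemma frac_lap_eq: "frac_lap (real DIM('a) / 2) f x = Re (Psi x) / (2 * pi) ^ DIM('a)"
proof -
  have "norm \<xi> powr (2 * (real DIM('a) / 2)) = norm \<xi> ^ DIM('a)" for \<xi> :: 'a
    by (cases "\<xi> = 0") (simp_all add: powr_realpow zero_power)
  then have "frac_lap (real DIM('a) / 2) f x = Re (ift g x / (2 * pi) ^ DIM('a))"
    unfolding frac_lap_def fourier_inv_eq_ift by (simp add: g_def[abs_def] fhat_def)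
  then show ?thesis
    unfolding Psi_def by (metis Re_divide_of_real of_real_mult of_real_numeral of_real_power)
qed

end

section \<open>The constant \<open>gamma_n\<close>, and summary of the facts about
  (-\<Delta>)^(n/2)\<close>

lemma Gamma_legendre_duplication_real:
  fixes x :: real
  assumes x: "0 < x"
  shows "Gamma x * Gamma (x + 1 / 2) = exp ((1 - 2 * x) * ln 2) * sqrt pi * Gamma (2 * x)"
proof -
  have h: "complex_of_real x + 1 / 2 = complex_of_real (x + 1 / 2)" by simp
  have t: "2 * complex_of_real x = complex_of_real (2 * x)" by simp
  have "complex_of_real x \<notin> \<int>\<^sub>\<le>\<^sub>0" "complex_of_real x + 1 / 2 \<notin> \<int>\<^sub>\<le>\<^sub>0"
    unfolding h of_real_in_nonpos_Ints_iff using x by (auto dest: nonpos_Ints_nonpos)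
  from Gamma_legendre_duplication[OF this]
  have "complex_of_real (Gamma x * Gamma (x + 1 / 2)) = exp (complex_of_real ((1 - 2 * x) * ln 2)) * complex_of_real (sqrt pi * Gamma (2 * x))"
    unfolding h t Gamma_complex_of_real by (simp add: mult.assoc)
  then have "complex_of_real (Gamma x * Gamma (x + 1 / 2)) = complex_of_real (exp ((1 - 2 * x) * ln 2) * sqrt pi * Gamma (2 * x))"
    by (simp only: exp_of_real) (simp only: of_real_mult mult.assoc)
  then show ?thesis by (simp only: of_real_eq_iff)
qed

text \<open>The duplication formula at n/2 trades (n - 1)! and Gamma ((n + 1) / 2) for Gamma (n /
  2), the form in which the constant comes out of the Fourier computation.\<close>

lemma gamma_n_eq:
  assumes "1 \<le> n"
  shows "gamma_n n = 2 ^ (n - 1) * pi powr (real n / 2) * Gamma (real n / 2)"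
proof -
  have n0: "0 < real n" using assms by simp
  let ?G = "Gamma (real n / 2)" and ?H = "Gamma (real n / 2 + 1 / 2)"
  have "Gamma (real n / 2) * Gamma (real n / 2 + 1 / 2) = exp ((1 - 2 * (real n / 2)) * ln 2) * sqrt pi * Gamma (2 * (real n / 2))"
    by (rule Gamma_legendre_duplication_real) (use assms in auto)
  moreover have "Gamma (2 * (real n / 2)) = fact (n - 1)"
    using Gamma_fact[of "n - 1", where 'a=real] assms by (simp add: of_nat_diff)
  moreover have "exp ((1 - 2 * (real n / 2)) * ln 2) = 1 / 2 ^ (n - 1)"
  proof -
    have "exp ((1 - 2 * (real n / 2)) * ln 2) = 2 powr (- real (n - 1))"
      using assms by (simp add: powr_def of_nat_diff)
    then show ?thesis by (simp add: powr_minus_divide powr_realpow)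
  qed
  ultimately have fact: "fact (n - 1) * sqrt pi = 2 ^ (n - 1) * (?G * ?H)"
    by (simp add: field_simps)
  have H: "?H > 0" by (rule Gamma_real_pos) (use assms in simp)
  have "gamma_n n = fact (n - 1) * pi powr (real n / 2 + 1 / 2) / ?H"
    unfolding gamma_n_def sphere_vol_def by (simp add: add_divide_distrib)
  also have "pi powr (real n / 2 + 1 / 2) = pi powr (real n / 2) * sqrt pi"
    by (simp add: powr_add powr_half_sqrt)
  also have "fact (n - 1) * (pi powr (real n / 2) * sqrt pi) / ?H = (fact (n - 1) * sqrt pi) * pi powr (real n / 2) / ?H"
    by simp
  finally show ?thesis unfolding fact using H by simp
qed

lemma frac_lap_properties:
  fixes f :: "'a::euclidean_space \<Rightarrow> real"
  assumes dim: "3 \<le> DIM('a)" and f: "schwartz f"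
  defines "\<psi> \<equiv> frac_lap (real DIM('a) / 2) f"
  shows "\<psi> \<in> borel_measurable borel"
    and "\<exists>B. \<forall>x. \<bar>\<psi> x\<bar> \<le> B"
    and "integrable lborel (\<lambda>x. (1 + (norm x)^2) * \<psi> x)"
    and "(\<integral>x. \<psi> x \<partial>lborel) = 0"
    and "(\<integral>x. (norm x)^2 * \<psi> x \<partial>lborel) = 0"
    and "integrable lborel (\<lambda>x. ln (norm (x - y)) * \<psi> x)"
    and "(\<integral>x. ln (norm (x - y)) * \<psi> x \<partial>lborel) = - gamma_n DIM('a) * f y"
proof -
  interpret frac_lap_schwartz f by unfold_locales (use dim f in auto)
  define c where "c = (2 * pi) ^ DIM('a)"
  have c: "c > 0" by (simp add: c_def)
  have \<psi>: "\<psi> x = Re (Psi x) / c" for x unfolding \<psi>_def c_def by (rule frac_lap_eq)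
  show m[measurable]: "\<psi> \<in> borel_measurable borel" unfolding \<psi> by measurable
  have le: "\<bar>\<psi> x\<bar> \<le> norm (Psi x) / c" for x
    unfolding \<psi> using c abs_Re_le_cmod[of "Psi x"] by (simp add: divide_right_mono)
  have "\<bar>\<psi> x\<bar> \<le> (LINT \<xi>|lborel. norm (g \<xi>)) / c" for x
    using order_trans[OF le divide_right_mono[OF Psi_bound]] c by simp
  then show "\<exists>B. \<forall>x. \<bar>\<psi> x\<bar> \<le> B" by blast
  show "integrable lborel (\<lambda>x. (1 + (norm x)^2) * \<psi> x)"
  proof (rule Bochner_Integration.integrable_bound)
    show "integrable lborel (\<lambda>x. (1 + (norm x)^2) * norm (Psi x) / c)" using Psi_weighted by simp
    have "\<bar>(1 + (norm x)^2) * \<psi> x\<bar> \<le> (1 + (norm x)^2) * norm (Psi x) / c" for x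
    proof -
      have "(1 + (norm x)^2) * \<bar>\<psi> x\<bar> \<le> (1 + (norm x)^2) * (norm (Psi x) / c)"
        by (intro mult_left_mono le) auto
      then show ?thesis by (simp add: abs_mult)
    qed
    then show "AE x in lborel. norm ((1 + (norm x)^2) * \<psi> x) \<le> norm ((1 + (norm x)^2) * norm (Psi x) / c)"
      using c by auto
  qed measurable
  show "(\<integral>x. \<psi> x \<partial>lborel) = 0"
    using Psi_int Psi_moments(1) by (simp add: \<psi>)
  have "(\<integral>x. (norm x)^2 * \<psi> x \<partial>lborel) = (\<integral>x. Re (complex_of_real ((norm x)^2) * Psi x) / c \<partial>lborel)"
    by (simp add: \<psi>)
  also have "\<dots> = 0" using Psi_sq_int Psi_moments(2) by (simp only: integral_divide_zero integral_Re) simp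
  finally show "(\<integral>x. (norm x)^2 * \<psi> x \<partial>lborel) = 0" .
  define L where "L x = complex_of_real (ln (norm (x - y))) * Psi x" for x
  have [measurable]: "L \<in> borel_measurable borel" unfolding L_def by measurable
  have L: "complex_of_real (ln (norm z)) * Psi (y + z) = L (y + z)" for z by (simp add: L_def)
  have Li: "integrable lborel L"
    using ln_Psi_int[of y] integrable_lborel_affine_iff[of L 1 y] by (simp add: L)
  have lnL: "ln (norm (x - y)) * \<psi> x = Re (L x) / c" for x by (simp add: L_def \<psi>)
  show "integrable lborel (\<lambda>x. ln (norm (x - y)) * \<psi> x)" unfolding lnL using Li by simp
  have "complex_of_real (- 2) * (LINT x|lborel. L x) = (LINT z|lborel. complex_of_real (- 2) * L (y + z))"
    using integral_lborel_shift(1)[of L y] by simp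
  also have "\<dots> = (LINT z|lborel. complex_of_real (- 2 * ln (norm z)) * Psi (y + z))"
    by (simp only: L[symmetric] of_real_mult mult.assoc)
  also have "\<dots> = complex_of_real (pi powr (DIM('a) / 2) * Gamma (DIM('a) / 2) * 2 ^ DIM('a) * c * f y)"
    unfolding c_def by (rule ln_Psi_integral)
  finally have "Re (complex_of_real (- 2) * (LINT x|lborel. L x)) = Re (complex_of_real (pi powr (DIM('a) / 2) * Gamma (DIM('a) / 2) * 2 ^ DIM('a) * c * f y))"
    by (rule arg_cong)
  then have "- 2 * Re (LINT x|lborel. L x) = pi powr (DIM('a) / 2) * Gamma (DIM('a) / 2) * 2 ^ DIM('a) * c * f y"
    by (simp only: times_complex.sel Re_complex_of_real Im_complex_of_real mult_zero_left diff_zero)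
  \<comment> \<open>The Fourier computation concerns - 2 ln |z|; dividing by 2 turns 2^n into the
    2^(n-1) of \<open>gamma_n_eq\<close>.\<close>
  moreover have "(2::real) ^ DIM('a) = 2 * 2 ^ (DIM('a) - 1)" using dim by (metis DIM_positive power_eq_if not_gr_zero)
  ultimately have "- Re (LINT x|lborel. L x) = gamma_n DIM('a) * f y * c"
    using gamma_n_eq[of "DIM('a)"] dim by (simp add: mult_ac)
  then have "Re (LINT x|lborel. L x) = - gamma_n DIM('a) * f y * c" by simp
  then show "(\<integral>x. ln (norm (x - y)) * \<psi> x \<partial>lborel) = - gamma_n DIM('a) * f y"
    unfolding lnL using Li c by simp
qed

subsection \<open>The potential of a radial density\<close>

lemma abs_ln_powr_le:
  fixes r d :: real
  assumes "0 < r" "0 < d"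
  shows "\<bar>ln r\<bar> \<le> (r powr d + r powr (- d)) / d"
proof -
  have "d * \<bar>ln r\<bar> = \<bar>ln (r powr d)\<bar>" using assms by (simp add: ln_powr abs_mult)
  also have "\<dots> \<le> r powr d + 1 / r powr d" using assms by (intro abs_ln_le) simp
  finally show ?thesis using assms by (simp add: powr_minus_divide field_simps)
qed

text \<open>The singularities at y = x and y = 0 may coincide, so they are not separated by disjoint
  balls. Their product is bounded by the sum of two single powers, each centred at one of the
  points.\<close>

lemma integrable_ln_powr_ball:
  fixes x :: "'a::euclidean_space"
  assumes a: "a > - real DIM('a)" and R: "0 \<le> R"
  shows "integrable lborel (\<lambda>y. ln (norm (x - y)) * (norm y powr a * indicator (cball 0 R) y))"
proof -
  \<comment> \<open>Only the singular part of the power is kept, the rest being bounded by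
    \<open>C\<close>. The exponent \<open>d\<close> for the logarithm takes half of the room between
    b and - n, so b - d is still above - n.\<close>
  define b where "b = min a 0"
  define d where "d = (DIM('a) + b) / 2"
  have b: "b \<le> 0" "b > - real DIM('a)" "b \<le> a" using a by (auto simp: b_def)
  have d: "d > 0" "b - d > - real DIM('a)" using b by (auto simp: d_def field_simps)
  define C where "C = (1 + R) powr (a - b)"
  define D where "D = (1 + R + norm x) powr d"
  have C0: "C \<ge> 0" "D \<ge> 0" by (auto simp: C_def D_def)
  define w where "w y = (C / d) * (D * (norm y powr b * indicator (cball 0 R) y) + (norm y powr (b - d) * indicator (cball 0 R) y)
      + (norm (x - y) powr (b - d) * indicator (cball 0 (R + norm x)) (x - y)))" for y
  have i3: "integrable lborel (\<lambda>y. norm (x - y) powr (b - d) * indicator (cball 0 (R + norm x)) (x - y))"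
    by (rule integrable_lborel_shift(2)[OF integrable_norm_powr_ball[OF d(2)]])
  have "integrable lborel w"
    unfolding w_def
    by (intro integrable_mult_right Bochner_Integration.integrable_add i3 integrable_norm_powr_ball b d)
  then show ?thesis
  proof (rule Bochner_Integration.integrable_bound)
    show "(\<lambda>y. ln (norm (x - y)) * (norm y powr a * indicator (cball 0 R) y)) \<in> borel_measurable lborel"
      by (intro borel_measurable_times borel_measurable_indicator) auto
    have "norm (ln (norm (x - y)) * (norm y powr a * indicator (cball 0 R) y)) \<le> w y" for y
    proof (cases "norm y \<le> R \<and> y \<noteq> 0 \<and> y \<noteq> x")
      case True
      define r where "r = norm (x - y)"
      have r: "r > 0" using True by (auto simp: r_def)
      have rR: "r \<le> R + norm x" using True norm_triangle_ineq4[of x y] by (simp add: r_def)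
      have y: "norm y > 0" using True by simp
      have 1: "norm y powr a \<le> C * norm y powr b"
      proof -
        have "norm y powr (a - b) \<le> C" unfolding C_def using True b by (intro powr_mono2) auto
        then have "norm y powr (a - b) * norm y powr b \<le> C * norm y powr b" by (intro mult_right_mono) auto
        then show ?thesis by (simp flip: powr_add)
      qed
      have 2: "r powr d \<le> D" unfolding D_def using r rR d by (intro powr_mono2) auto
      \<comment> \<open>Both exponents are nonpositive, so replacing the larger of the two distances
        by the smaller one only increases the product.\<close>
      have 3: "r powr (- d) * norm y powr b \<le> norm y powr (b - d) + r powr (b - d)"
      proof (cases "norm y \<le> r")
        case le: True
        have "r powr (- d) \<le> norm y powr (- d)" using le y d by (intro powr_mono2') auto
        then have "r powr (- d) * norm y powr b \<le> norm y powr (- d) * norm y powr b" by (intro mult_right_mono) auto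
        also have "\<dots> = norm y powr (b - d)" by (simp flip: powr_add)
        finally show ?thesis by (simp add: add_increasing2)
      next
        case False
        have "norm y powr b \<le> r powr b" using False r b by (intro powr_mono2') auto
        then have "r powr (- d) * norm y powr b \<le> r powr (- d) * r powr b" by (intro mult_left_mono) auto
        also have "\<dots> = r powr (b - d)" by (simp flip: powr_add)
        finally show ?thesis by (simp add: add_increasing)
      qed
      have "norm (ln (norm (x - y)) * (norm y powr a * indicator (cball 0 R) y)) = \<bar>ln r\<bar> * norm y powr a"
        using True by (simp add: abs_mult r_def)
      also have "\<dots> \<le> ((r powr d + r powr (- d)) / d) * (C * norm y powr b)"
        using abs_ln_powr_le[OF r d(1)] 1 C0 d by (intro mult_mono) auto
      also have "\<dots> = (C / d) * (r powr d * norm y powr b + r powr (- d) * norm y powr b)"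
        by (simp add: field_simps)
      also have "\<dots> \<le> (C / d) * (D * norm y powr b + (norm y powr (b - d) + r powr (b - d)))"
        using 2 3 C0 d by (intro mult_left_mono add_mono mult_right_mono) auto
      also have "\<dots> = w y" using True rR by (simp add: w_def r_def)
      finally show ?thesis .
    next
      case False
      have "0 \<le> w y" unfolding w_def using C0 d by (intro mult_nonneg_nonneg add_nonneg_nonneg) auto
      then show ?thesis using False by auto
    qed
    then show "AE y in lborel. norm (ln (norm (x - y)) * (norm y powr a * indicator (cball 0 R) y)) \<le> norm (w y)"
      by (auto intro: order_trans[OF _ abs_ge_self])
  qed
qed

lemma log_ratio_far:
  fixes x y :: "'a::euclidean_space"
  assumes "2 * norm x \<le> norm y" "y \<noteq> 0"
  shows "\<bar>log_ratio 0 x y\<bar> \<le> 2 * norm x / norm y"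
proof -
  define t where "t = norm x / norm y"
  have y: "norm y > 0" using assms by simp
  have t: "0 \<le> t" "t \<le> 1 / 2" using assms y by (auto simp: t_def field_simps)
  have yt: "norm y * t = norm x" using y by (simp add: t_def)
  have lo: "norm y * (1 - t) \<le> norm (x - y)"
    using norm_triangle_ineq2[of y x] by (simp add: right_diff_distrib yt norm_minus_commute)
  have hi: "norm (x - y) \<le> norm y * (1 + t)"
    using norm_triangle_ineq4[of x y] by (simp add: distrib_left yt)
  have p: "0 < norm y * (1 - t)" using y t by simp
  have "ln (norm (x - y)) \<le> ln (norm y * (1 + t))" using lo hi p t by (subst ln_le_cancel_iff) auto
  also have "\<dots> = ln (norm y) + ln (1 + t)" using y t by (simp add: ln_mult)
  also have "ln (1 + t) \<le> t" using t by (intro ln_add_one_self_le_self) auto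
  finally have 1: "ln (norm (x - y)) - ln (norm y) \<le> t" by simp
  have "- t - 2 * t^2 \<le> ln (1 - t)" using t by (intro ln_one_minus_pos_lower_bound) auto
  moreover have "2 * t^2 \<le> t" using t mult_left_mono[of t "1/2" t] by (simp add: power2_eq_square)
  ultimately have "ln (norm y) - 2 * t \<le> ln (norm y) + ln (1 - t)" by linarith
  also have "\<dots> = ln (norm y * (1 - t))" using y t by (simp add: ln_mult)
  also have "\<dots> \<le> ln (norm (x - y))" using lo p by (subst ln_le_cancel_iff) auto
  finally show ?thesis using 1 t by (simp add: log_ratio_def t_def)
qed

text \<open>The bound \<open>le\<close> expresses u \<le> 0 for a density of the form
  \<open>rhs \<alpha> u\<close>. Being the same for all densities considered, it provides one
  majorant for every limit on a ball.\<close>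

locale radial_density =
  fixes \<alpha> :: real and f :: "'a::euclidean_space \<Rightarrow> real"
  assumes dim: "2 \<le> DIM('a)" and alpha: "-1 < \<alpha>"
    and int: "integrable lborel f" and rad: "radial f" and nonneg: "0 \<le> f y"
    and le: "f y \<le> norm y powr (real DIM('a) * \<alpha>)"
begin

lemma meas [measurable]: "f \<in> borel_measurable borel" using int by auto

lemma alpha_n: "real DIM('a) * \<alpha> > - real DIM('a)"
  using mult_strict_left_mono[OF alpha, of "real DIM('a)"] by simp

lemma ln_near_integrable:
  assumes "0 \<le> R"
  shows "integrable lborel (\<lambda>y. ln (norm (x - y)) * (f y * indicator (cball 0 R) y))"
proof (rule Bochner_Integration.integrable_bound[OF integrable_ln_powr_ball[OF alpha_n assms]])
  show "(\<lambda>y. ln (norm (x - y)) * (f y * indicator (cball 0 R) y)) \<in> borel_measurable lborel"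
    by (intro borel_measurable_times borel_measurable_indicator) auto
  show "AE y in lborel. norm (ln (norm (x - y)) * (f y * indicator (cball 0 R) y)) \<le> norm (ln (norm (x - y)) * (norm y powr (real DIM('a) * \<alpha>) * indicator (cball 0 R) y))"
    using nonneg le by (intro AE_I2) (auto simp: abs_mult split: split_indicator intro!: mult_left_mono)
qed

lemma log_ratio0_integrable: "integrable lborel (\<lambda>y. log_ratio 0 x y * f y)"
proof -
  define R where "R = 2 * norm x + 1"
  have R: "0 \<le> R" by (simp add: R_def)
  define w where "w y = norm (ln (norm (x - y)) * (f y * indicator (cball 0 R) y)) + norm (ln (norm (0 - y)) * (f y * indicator (cball 0 R) y)) + 2 * norm x * f y" for y
  have "integrable lborel w"
    unfolding w_def using int
    by (intro Bochner_Integration.integrable_add integrable_norm ln_near_integrable R integrable_mult_right)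
  then show ?thesis
  proof (rule Bochner_Integration.integrable_bound)
    have "norm (log_ratio 0 x y * f y) \<le> w y" for y
    proof (cases "norm y \<le> R")
      case True
      have "norm (log_ratio 0 x y * f y) \<le> (\<bar>ln (norm (x - y))\<bar> + \<bar>ln (norm (0 - y))\<bar>) * f y"
        unfolding log_ratio_def norm_mult using nonneg by (intro mult_mono) auto
      also have "\<dots> \<le> w y" using True nonneg[of y] by (simp add: w_def abs_mult distrib_right)
      finally show ?thesis .
    next
      case False
      then have "\<bar>log_ratio 0 x y\<bar> \<le> 2 * norm x / norm y"
        using R by (intro log_ratio_far) (auto simp: R_def)
      also have "\<dots> \<le> 2 * norm x"
      proof -
        have "1 \<le> norm y" using False norm_ge_zero[of x] unfolding R_def by linarith
        then show ?thesis by (simp add: divide_le_eq mult_le_cancel_left1)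
      qed
      finally have "\<bar>log_ratio 0 x y\<bar> * f y \<le> 2 * norm x * f y" using nonneg by (intro mult_right_mono) auto
      then show ?thesis using nonneg[of y] False by (simp add: abs_mult w_def)
    qed
    then show "AE y in lborel. norm (log_ratio 0 x y * f y) \<le> norm (w y)"
      by (auto intro: order_trans[OF _ abs_ge_self])
  qed measurable
qed

text \<open>The base point 0 gives the potential the value 0 there, and radial monotonicity then
  makes it nonnegative.\<close>

definition pot :: "'a \<Rightarrow> real" where "pot x = (\<integral>y. log_ratio 0 x y * f y \<partial>lborel)"

lemma log_ratio_integrable: "integrable lborel (\<lambda>y. log_ratio x x' y * f y)"
  and log_ratio_integral: "(\<integral>y. log_ratio x x' y * f y \<partial>lborel) = pot x' - pot x"
proof -
  have eq: "log_ratio x x' y * f y = log_ratio 0 x' y * f y - log_ratio 0 x y * f y" for y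
    by (simp add: log_ratio_def algebra_simps)
  show "integrable lborel (\<lambda>y. log_ratio x x' y * f y)"
    unfolding eq by (intro Bochner_Integration.integrable_diff log_ratio0_integrable)
  show "(\<integral>y. log_ratio x x' y * f y \<partial>lborel) = pot x' - pot x"
    unfolding eq pot_def by (intro Bochner_Integration.integral_diff log_ratio0_integrable)
qed

lemma pot_nonneg: "0 \<le> pot x"
  unfolding pot_def by (rule radial_log_ratio_zero_nonneg[OF dim int rad nonneg log_ratio0_integrable])

lemma pot_radial: "norm x = norm x' \<Longrightarrow> pot x = pot x'"
proof -
  assume "norm x = norm x'"
  from isometry_exists[OF this] obtain H where H: "linear H" "\<And>z. norm (H z) = norm z" "H x = x'" by blast
  have "H 0 = 0" using H by (simp add: linear_0)
  then show ?thesis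
    using integral_log_ratio_isometry(1)[OF H(1,2) meas rad, of 0 x] H(3) by (simp add: pot_def)
qed

lemma pot_scale:
  assumes "1 \<le> k"
  shows "pot x \<le> pot (k *\<^sub>R x)" "pot (k *\<^sub>R x) \<le> pot x + ln k * (\<integral>y. f y \<partial>lborel)"
  using radial_log_ratio_mono[OF dim assms int rad nonneg log_ratio_integrable, of x]
  unfolding log_ratio_integral by auto

lemma mass_nonneg: "0 \<le> (\<integral>y. f y \<partial>lborel)"
  using nonneg by (intro integral_nonneg_AE) auto

lemma pot_measurable [measurable]: "pot \<in> borel_measurable borel"
  unfolding pot_def log_ratio_def by measurable

end

text \<open>Convergence of the total masses is not assumed. Outside a large ball the kernel is O(|x|
  / R), so even mass escaping to infinity contributes little; inside, the common majorant |y|^(n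
  \<alpha>) allows dominated convergence.\<close>

lemma potential_tendsto:
  fixes F :: "nat \<Rightarrow> 'a::euclidean_space \<Rightarrow> real"
  assumes F: "\<And>k. radial_density \<alpha> (F k)" and f: "radial_density \<alpha> f"
    and lim: "AE y in lborel. (\<lambda>k. F k y) \<longlonglongrightarrow> f y"
    and mass: "\<And>k. (\<integral>y. F k y \<partial>lborel) \<le> M" "(\<integral>y. f y \<partial>lborel) \<le> M"
  shows "(\<lambda>k. radial_density.pot (F k) x) \<longlonglongrightarrow> radial_density.pot f x"
proof (rule LIMSEQ_I)
  fix e :: real assume e: "0 < e"
  interpret f: radial_density \<alpha> f by (rule f)
  have M0: "0 \<le> M" using f.mass_nonneg mass(2) by simp
  \<comment> \<open>The far kernel is at most 2 |x| / R. The last summand makes its contribution at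
    most e/4 for masses up to M; the first one makes \<open>log_ratio_far\<close>
    applicable.\<close>
  define R where "R = 2 * norm x + 1 + 8 * norm x * M / e"
  have "0 \<le> 8 * norm x * M / e" using M0 e by simp
  then have R: "0 < R" "2 * norm x \<le> R" unfolding R_def using norm_ge_zero[of x] by linarith+
  have Re: "2 * norm x / R * M \<le> e / 4"
  proof -
    have "8 * norm x * M / e \<le> R" by (simp add: R_def)
    then show ?thesis using R e by (simp add: field_simps)
  qed
  define near where "near h = (\<integral>y. log_ratio 0 x y * (h y * indicator (cball 0 R) y) \<partial>lborel)" for h :: "'a \<Rightarrow> real"
  have near: "\<bar>radial_density.pot h x - near h\<bar> \<le> e / 4"
    and near_int: "integrable lborel (\<lambda>y. log_ratio 0 x y * (h y * indicator (cball 0 R) y))"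
    if h: "radial_density \<alpha> h" and hM: "(\<integral>y. h y \<partial>lborel) \<le> M" for h
  proof -
    interpret h: radial_density \<alpha> h by (rule h)
    show ni: "integrable lborel (\<lambda>y. log_ratio 0 x y * (h y * indicator (cball 0 R) y))"
      using Bochner_Integration.integrable_diff[OF h.ln_near_integrable[OF less_imp_le[OF R(1)], of x] h.ln_near_integrable[OF less_imp_le[OF R(1)], of 0]]
      by (simp add: log_ratio_def left_diff_distrib)
    have "\<bar>h.pot x - near h\<bar> = \<bar>\<integral>y. log_ratio 0 x y * h y - log_ratio 0 x y * (h y * indicator (cball 0 R) y) \<partial>lborel\<bar>"
      unfolding h.pot_def near_def using h.log_ratio0_integrable ni by simp
    also have "\<dots> \<le> (\<integral>y. 2 * norm x / R * h y \<partial>lborel)"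
    proof (rule order_trans[OF integral_abs_bound integral_mono'])
      show "integrable lborel (\<lambda>y. 2 * norm x / R * h y)" using h.int by simp
      fix y
      show "\<bar>log_ratio 0 x y * h y - log_ratio 0 x y * (h y * indicator (cball 0 R) y)\<bar> \<le> 2 * norm x / R * h y"
      proof (cases "norm y \<le> R")
        case False
        then have "\<bar>log_ratio 0 x y\<bar> \<le> 2 * norm x / norm y" using R by (intro log_ratio_far) auto
        also have "\<dots> \<le> 2 * norm x / R" using False R by (intro frac_le) auto
        finally have "\<bar>log_ratio 0 x y\<bar> * h y \<le> 2 * norm x / R * h y" using h.nonneg by (intro mult_right_mono) auto
        then show ?thesis using False h.nonneg[of y] by (simp add: abs_mult)
      qed (use R h.nonneg in simp)
      show "0 \<le> 2 * norm x / R * h y" using R h.nonneg[of y] by simp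
    qed
    also have "\<dots> = 2 * norm x / R * (\<integral>y. h y \<partial>lborel)" by simp
    also have "\<dots> \<le> 2 * norm x / R * M" using R hM by (intro mult_left_mono) auto
    finally show "\<bar>h.pot x - near h\<bar> \<le> e / 4" using Re by simp
  qed
  have "(\<lambda>k. near (F k)) \<longlonglongrightarrow> near f"
    unfolding near_def
  proof (rule integral_dominated_convergence)
    define w where "w y = norm (ln (norm (x - y)) * (norm y powr (real DIM('a) * \<alpha>) * indicator (cball 0 R) y)) + norm (ln (norm (0 - y)) * (norm y powr (real DIM('a) * \<alpha>) * indicator (cball 0 R) y))" for y :: 'a
    show "integrable lborel w"
      unfolding w_def using R by (intro Bochner_Integration.integrable_add integrable_norm integrable_ln_powr_ball f.alpha_n) auto
    show "AE y in lborel. (\<lambda>k. log_ratio 0 x y * (F k y * indicator (cball 0 R) y)) \<longlonglongrightarrow> log_ratio 0 x y * (f y * indicator (cball 0 R) y)"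
      using lim by eventually_elim (intro tendsto_intros)
    show "AE y in lborel. norm (log_ratio 0 x y * (F k y * indicator (cball 0 R) y)) \<le> w y" for k
    proof (rule AE_I2)
      fix y :: 'a
      interpret Fk: radial_density \<alpha> "F k" by (rule F)
      have "norm (log_ratio 0 x y * (F k y * indicator (cball 0 R) y)) = \<bar>log_ratio 0 x y\<bar> * (F k y * indicator (cball 0 R) y)"
        using Fk.nonneg[of y] by (simp add: abs_mult)
      also have "\<dots> \<le> (\<bar>ln (norm (x - y))\<bar> + \<bar>ln (norm (0 - y))\<bar>) * (norm y powr (real DIM('a) * \<alpha>) * indicator (cball 0 R) y)"
        using Fk.nonneg[of y] Fk.le[of y] unfolding log_ratio_def by (intro mult_mono) auto
      also have "\<dots> = w y" by (simp add: w_def abs_mult distrib_right)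
      finally show "norm (log_ratio 0 x y * (F k y * indicator (cball 0 R) y)) \<le> w y" .
    qed
  qed (use near_int[OF F mass(1)] near_int[OF f mass(2)] in auto)
  from LIMSEQ_D[OF this, of "e / 4"] e obtain k0 where k0: "\<And>k. k \<ge> k0 \<Longrightarrow> \<bar>near (F k) - near f\<bar> < e / 4" by auto
  have "\<bar>radial_density.pot (F k) x - radial_density.pot f x\<bar> < e" if "k \<ge> k0" for k
    using k0[OF that] near[OF F mass(1), of k] near[OF f mass(2)] e by linarith
  then show "\<exists>no. \<forall>k\<ge>no. norm (radial_density.pot (F k) x - radial_density.pot f x) < e" by auto
qed

subsection \<open>Energy under dilations\<close>

text \<open>Splits the logarithm of |x - y| into ln (|x| + |y|), which is easily controlled under
  dilations, and a defect that is nonnegative off the diagonal and has bounded circle means.\<close>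

definition log_defect :: "'a::euclidean_space \<Rightarrow> 'a \<Rightarrow> real" where
  "log_defect x y = ln (norm x + norm y) - ln (norm (x - y))"

lemma borel_measurable_log_defect [measurable]: "(\<lambda>p. log_defect (fst p) (snd p)) \<in> borel_measurable (borel \<Otimes>\<^sub>M borel)"
  "log_defect x \<in> borel_measurable borel"
  unfolding log_defect_def by measurable

lemma log_defect_nonneg: "x \<noteq> y \<Longrightarrow> 0 \<le> log_defect x y"
proof -
  assume "x \<noteq> y"
  then have "0 < norm (x - y)" by simp
  moreover have "norm (x - y) \<le> norm x + norm y" by (rule norm_triangle_ineq4)
  ultimately show ?thesis
    unfolding log_defect_def by (subst le_diff_eq, subst add_0, subst ln_le_cancel_iff) linarith+
qed

text \<open>The mean is ln (r + |y|) - (ln Z) / 2, and Z is at least r^2 and |y|^2, so (r + |y|)^2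
  \<le> 2 r^2 + 2 |y|^2 \<le> 4 Z.\<close>

lemma plane_rot_mean_log_defect:
  fixes b c y :: "'a::euclidean_space"
  assumes bc: "b \<in> Basis" "c \<in> Basis" "b \<noteq> c" and r: "0 \<le> r" "norm y \<noteq> r"
  shows "(\<integral>\<^sup>+t. ennreal (indicator {0..1} t * log_defect (r *\<^sub>R b) (plane_rot b c (2 * pi * t) y)) \<partial>lborel) \<le> ennreal (ln 2)"
proof -
  define Z where "Z = big_root (r^2) ((norm y)^2) ((y \<bullet> b)^2 + (y \<bullet> c)^2)"
  note m = plane_rot_mean_ln[OF bc r, folded Z_def]
  have nR: "norm (plane_rot b c (2 * pi * t) y) = norm y" for t by (rule plane_rot(2)[OF bc])
  have nb: "norm (r *\<^sub>R b) = r" using bc r by simp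
  have "((\<lambda>t. log_defect (r *\<^sub>R b) (plane_rot b c (2 * pi * t) y)) has_integral (ln (r + norm y) - ln Z / 2)) {0..1}"
    unfolding log_defect_def nR nb
    using has_integral_diff[OF has_integral_const_real[of "ln (r + norm y)" 0 1] m(1)] by simp
  then have "(\<integral>\<^sup>+t. ennreal (indicator {0..1} t * log_defect (r *\<^sub>R b) (plane_rot b c (2 * pi * t) y)) \<partial>lborel) = ennreal (ln (r + norm y) - ln Z / 2)"
  proof (intro nn_integral_has_integral_lebesgue)
    show "0 \<le> log_defect (r *\<^sub>R b) (plane_rot b c (2 * pi * t) y)" for t
      by (intro log_defect_nonneg) (metis nR nb r(2))
  qed
  moreover have "ln (r + norm y) - ln Z / 2 \<le> ln 2"
  proof -
    have pos: "0 < r + norm y" using r by (smt (verit) norm_ge_zero)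
    have zz: "r^2 \<le> Z" "(norm y)^2 \<le> Z"
      unfolding Z_def using big_root(1,2)[of "r^2" "(y \<bullet> b)^2 + (y \<bullet> c)^2" "(norm y)^2"] m(4) by auto
    have "(r + norm y)^2 \<le> 2 * r^2 + 2 * (norm y)^2"
      using zero_le_power2[of "r - norm y"] by (simp add: power2_eq_square algebra_simps)
    also have "\<dots> \<le> 2^2 * Z" using zz by simp
    finally have "ln ((r + norm y)^2) \<le> ln (2^2 * Z)" using pos m(3) by (subst ln_le_cancel_iff) auto
    moreover have "ln ((r + norm y)^2) = 2 * ln (r + norm y)" using pos by (simp add: ln_realpow)
    moreover have "ln (2^2 * Z) = 2 * ln 2 + ln Z"
      using m(3) ln_mult[of "2^2" Z] ln_realpow[of 2 2] by simp
    ultimately show ?thesis by simp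
  qed
  ultimately show ?thesis by (simp add: ennreal_leI)
qed

context radial_density
begin

abbreviation "mass \<equiv> (\<integral>y. f y \<partial>lborel)"

text \<open>The bound is uniform in x. It makes the double integral in \<open>scale_energy\<close>
  absolutely convergent although no logarithmic moment of f is available.\<close>

lemma log_defect_integral_le: "(\<integral>\<^sup>+y. ennreal (log_defect x y * f y) \<partial>lborel) \<le> ennreal (ln 2 * mass)"
proof -
  obtain b c :: 'a where bc: "b \<in> Basis" "c \<in> Basis" "b \<noteq> c"
    using dim card_le_Suc0_iff_eq[of "Basis :: 'a set"] by auto
  define r where "r = norm x"
  obtain H where H: "linear H" "\<And>z. norm (H z) = norm z" "H x = r *\<^sub>R b"
    using isometry_exists[of x "r *\<^sub>R b"] bc by (auto simp: r_def)
  have fiso: "f (S y) = f y" if "\<And>z. norm (S z) = norm z" for S y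
    using rad that unfolding radial_def by blast
  have "log_defect (r *\<^sub>R b) (H y) = log_defect x y" for y
    unfolding log_defect_def H(3)[symmetric] using H by (metis linear_diff)
  then have "(\<integral>\<^sup>+y. ennreal (log_defect x y * f y) \<partial>lborel) = (\<integral>\<^sup>+y. ennreal (log_defect (r *\<^sub>R b) (H y) * f (H y)) \<partial>lborel)"
    by (simp add: fiso[OF H(2)])
  also have "\<dots> = (\<integral>\<^sup>+y. ennreal (log_defect (r *\<^sub>R b) y * f y) \<partial>lborel)"
    by (rule nn_integral_isometry[OF H(1,2)]) measurable
  also have "\<dots> = (\<integral>\<^sup>+t. indicator {0..1} t * (\<integral>\<^sup>+y. ennreal (log_defect (r *\<^sub>R b) y * f y) \<partial>lborel) \<partial>(lborel :: real measure))"
    by (subst nn_integral_multc) auto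
  also have "\<dots> = (\<integral>\<^sup>+t. (\<integral>\<^sup>+y. ennreal (indicator {0..1} t * log_defect (r *\<^sub>R b) (plane_rot b c (2 * pi * t) y) * f y) \<partial>lborel) \<partial>lborel)"
  proof (rule nn_integral_cong)
    fix t :: real
    let ?R = "plane_rot b c (2 * pi * t)"
    have "(\<integral>\<^sup>+y. ennreal (log_defect (r *\<^sub>R b) y * f y) \<partial>lborel) = (\<integral>\<^sup>+y. ennreal (log_defect (r *\<^sub>R b) (?R y) * f (?R y)) \<partial>lborel)"
      by (rule nn_integral_isometry[symmetric]) (use plane_rot[OF bc] in auto)
    also have "\<dots> = (\<integral>\<^sup>+y. ennreal (log_defect (r *\<^sub>R b) (?R y) * f y) \<partial>lborel)"
      using plane_rot(2)[OF bc] by (simp add: fiso)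
    finally show "indicator {0..1} t * (\<integral>\<^sup>+y. ennreal (log_defect (r *\<^sub>R b) y * f y) \<partial>lborel) = (\<integral>\<^sup>+y. ennreal (indicator {0..1} t * log_defect (r *\<^sub>R b) (?R y) * f y) \<partial>lborel)"
      by (cases "t \<in> {0..1}") auto
  qed
  also have "\<dots> = (\<integral>\<^sup>+y. (\<integral>\<^sup>+t. ennreal (indicator {0..1} t * log_defect (r *\<^sub>R b) (plane_rot b c (2 * pi * t) y) * f y) \<partial>lborel) \<partial>lborel)"
    by (rule lborel_pair.Fubini') (unfold log_defect_def plane_rot_def split_beta, measurable)
  also have "\<dots> \<le> (\<integral>\<^sup>+y. ennreal (ln 2 * f y) \<partial>lborel)"
  proof (rule nn_integral_mono_AE)
    show "AE y in lborel. (\<integral>\<^sup>+t. ennreal (indicator {0..1} t * log_defect (r *\<^sub>R b) (plane_rot b c (2 * pi * t) y) * f y) \<partial>lborel) \<le> ennreal (ln 2 * f y)"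
      using AE_lborel_norm_neq[of r]
    proof eventually_elim
      case (elim y)
      have ne: "r *\<^sub>R b \<noteq> plane_rot b c (2 * pi * t) y" for t
        using elim plane_rot(2)[OF bc, of "2 * pi * t" y] bc by (metis norm_Basis norm_scaleR mult_1_right abs_norm_cancel r_def)
      have "(\<integral>\<^sup>+t. ennreal (indicator {0..1} t * log_defect (r *\<^sub>R b) (plane_rot b c (2 * pi * t) y) * f y) \<partial>lborel)
         = (\<integral>\<^sup>+t. ennreal (indicator {0..1} t * log_defect (r *\<^sub>R b) (plane_rot b c (2 * pi * t) y)) * ennreal (f y) \<partial>lborel)"
        using nonneg log_defect_nonneg[OF ne] by (intro nn_integral_cong ennreal_mult) auto
      also have "\<dots> = (\<integral>\<^sup>+t. ennreal (indicator {0..1} t * log_defect (r *\<^sub>R b) (plane_rot b c (2 * pi * t) y)) \<partial>lborel) * ennreal (f y)"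
        by (rule nn_integral_multc) (unfold log_defect_def plane_rot_def, measurable)
      also have "\<dots> \<le> ennreal (ln 2) * ennreal (f y)"
        by (intro mult_right_mono plane_rot_mean_log_defect[OF bc]) (use elim in \<open>auto simp: r_def\<close>)
      finally show ?case using nonneg by (simp add: ennreal_mult)
    qed
  qed
  also have "\<dots> = ennreal (ln 2 * mass)"
    using int nonneg by (subst nn_integral_eq_integral) auto
  finally show ?thesis .
qed

text \<open>From x to k x the quantity ln (|x| + |y|) grows by an amount between 0 and ln k; the two
  defects account for the rest.\<close>

lemma log_ratio_scale_bound:
  assumes k: "1 \<le> k" and x: "x \<noteq> 0" and y: "y \<noteq> x" "y \<noteq> k *\<^sub>R x"
  shows "\<bar>log_ratio x (k *\<^sub>R x) y\<bar> \<le> log_defect x y + log_defect (k *\<^sub>R x) y + ln k"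
proof -
  define A where "A = norm x + norm y"
  define B where "B = k * norm x + norm y"
  have A: "0 < A" using x by (simp add: A_def add_pos_nonneg)
  have "norm x \<le> k * norm x" using mult_right_mono[OF k norm_ge_zero[of x]] by simp
  then have AB: "A \<le> B" by (simp add: A_def B_def)
  have "norm y \<le> k * norm y" using mult_right_mono[OF k norm_ge_zero[of y]] by simp
  then have BA: "B \<le> k * A" by (simp add: A_def B_def distrib_left)
  have 1: "ln A \<le> ln B" using A AB by simp
  have "ln B \<le> ln (k * A)" using A AB BA by (subst ln_le_cancel_iff) auto
  then have 2: "ln B \<le> ln k + ln A" using A k by (simp add: ln_mult)
  have "log_ratio x (k *\<^sub>R x) y = (ln B - log_defect (k *\<^sub>R x) y) - (ln A - log_defect x y)"
    using k by (simp add: log_ratio_def log_defect_def A_def B_def)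
  then show ?thesis using 1 2 log_defect_nonneg[of x y] log_defect_nonneg[of "k *\<^sub>R x" y] y by (auto simp: abs_le_iff)
qed

lemma log_ratio_scale_integral_le:
  assumes k: "1 \<le> k" and x: "x \<noteq> 0"
  shows "(\<integral>y. \<bar>log_ratio x (k *\<^sub>R x) y\<bar> * f y \<partial>lborel) \<le> (2 * ln 2 + ln k) * mass"
proof -
  have lk: "0 \<le> ln k" using k by simp
  have "ennreal (\<integral>y. \<bar>log_ratio x (k *\<^sub>R x) y\<bar> * f y \<partial>lborel) = (\<integral>\<^sup>+y. ennreal (\<bar>log_ratio x (k *\<^sub>R x) y\<bar> * f y) \<partial>lborel)"
  proof (rule nn_integral_eq_integral[symmetric])
    show "integrable lborel (\<lambda>y. \<bar>log_ratio x (k *\<^sub>R x) y\<bar> * f y)"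
      using integrable_norm[OF log_ratio_integrable[of x "k *\<^sub>R x"]] nonneg by (simp add: abs_mult)
  qed (use nonneg in auto)
  also have "\<dots> \<le> (\<integral>\<^sup>+y. (ennreal (log_defect x y * f y) + ennreal (log_defect (k *\<^sub>R x) y * f y)) + ennreal (ln k * f y) \<partial>lborel)"
  proof (rule nn_integral_mono_AE)
    show "AE y in lborel. ennreal (\<bar>log_ratio x (k *\<^sub>R x) y\<bar> * f y) \<le> (ennreal (log_defect x y * f y) + ennreal (log_defect (k *\<^sub>R x) y * f y)) + ennreal (ln k * f y)"
      using AE_lborel_singleton[of x] AE_lborel_singleton[of "k *\<^sub>R x"]
    proof eventually_elim
      case (elim y)
      have nn: "0 \<le> log_defect x y" "0 \<le> log_defect (k *\<^sub>R x) y" using elim by (auto intro!: log_defect_nonneg)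
      have "\<bar>log_ratio x (k *\<^sub>R x) y\<bar> * f y \<le> (log_defect x y + log_defect (k *\<^sub>R x) y + ln k) * f y"
        using nonneg by (intro mult_right_mono log_ratio_scale_bound[OF k x elim]) auto
      then have "ennreal (\<bar>log_ratio x (k *\<^sub>R x) y\<bar> * f y) \<le> ennreal (log_defect x y * f y + log_defect (k *\<^sub>R x) y * f y + ln k * f y)"
        by (intro ennreal_leI) (simp add: distrib_right)
      then show ?case using nn lk nonneg by (simp add: ennreal_plus)
    qed
  qed
  also have "\<dots> = (\<integral>\<^sup>+y. ennreal (log_defect x y * f y) \<partial>lborel) + (\<integral>\<^sup>+y. ennreal (log_defect (k *\<^sub>R x) y * f y) \<partial>lborel) + (\<integral>\<^sup>+y. ennreal (ln k * f y) \<partial>lborel)"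
    by (subst nn_integral_add, measurable)+
  also have "(\<integral>\<^sup>+y. ennreal (ln k * f y) \<partial>lborel) = ennreal (ln k * mass)"
    using int nonneg lk by (subst nn_integral_eq_integral) auto
  also have "(\<integral>\<^sup>+y. ennreal (log_defect x y * f y) \<partial>lborel) + (\<integral>\<^sup>+y. ennreal (log_defect (k *\<^sub>R x) y * f y) \<partial>lborel) + ennreal (ln k * mass)
     \<le> ennreal (ln 2 * mass) + ennreal (ln 2 * mass) + ennreal (ln k * mass)"
    by (intro add_mono log_defect_integral_le order_refl)
  also have "\<dots> = ennreal ((2 * ln 2 + ln k) * mass)"
    using lk mass_nonneg by (simp add: ennreal_plus[symmetric] algebra_simps del: ennreal_plus)
  finally show ?thesis
    using lk mass_nonneg by (subst (asm) ennreal_le_iff) auto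
qed

lemma scale_diff_bounds:
  assumes "1 \<le> k"
  shows "0 \<le> pot (k *\<^sub>R x) - pot x" "pot (k *\<^sub>R x) - pot x \<le> ln k * mass"
  using pot_scale[OF assms, of x] by auto

lemma scale_diff_bounds':
  assumes "1 \<le> k"
  shows "0 \<le> pot x - pot ((1 / k) *\<^sub>R x)" "pot x - pot ((1 / k) *\<^sub>R x) \<le> ln k * mass"
  using scale_diff_bounds[OF assms, of "(1 / k) *\<^sub>R x"] assms by auto

lemma bounded_mult_integrable:
  assumes [measurable]: "h \<in> borel_measurable borel" and "\<And>x. \<bar>h x\<bar> \<le> B"
  shows "integrable lborel (\<lambda>x. h x * f x)"
proof (rule Bochner_Integration.integrable_bound)
  show "integrable lborel (\<lambda>x. B * f x)" using int by simp
  show "AE x in lborel. norm (h x * f x) \<le> norm (B * f x)"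
    using assms(2) nonneg by (intro AE_I2) (auto simp: abs_mult intro!: mult_right_mono order_trans[OF _ abs_ge_self])
qed measurable

text \<open>Integrate ln |k x - y| - ln |x - y| against f x f y in both orders. First in y it gives
  the increments of \<open>pot\<close> from x to k x. First in x, after |k x - y| = k |x - y / k|,
  it gives ln k times the mass minus the increments from y / k to y. This is the classical
  symmetrisation of x . grad ln |x - y| in finite-difference form.\<close>

lemma scale_energy:
  assumes k: "1 \<le> k"
  shows "(\<integral>x. (pot (k *\<^sub>R x) - pot x) * f x \<partial>lborel) + (\<integral>x. (pot x - pot ((1 / k) *\<^sub>R x)) * f x \<partial>lborel) = ln k * mass * mass"
proof -
  define L where "L x y = log_ratio x (k *\<^sub>R x) y * (f x * f y)" for x y
  have Lm: "(\<lambda>(x, y). L x y) \<in> borel_measurable (lborel \<Otimes>\<^sub>M lborel)"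
    unfolding L_def log_ratio_def split_beta by measurable
  have Ly: "(\<integral>y. norm (L x y) \<partial>lborel) = f x * (\<integral>y. \<bar>log_ratio x (k *\<^sub>R x) y\<bar> * f y \<partial>lborel)" for x
  proof -
    have "norm (L x y) = f x * (\<bar>log_ratio x (k *\<^sub>R x) y\<bar> * f y)" for y
      using nonneg by (simp add: L_def abs_mult)
    then show ?thesis by simp
  qed
  have I: "integrable (lborel \<Otimes>\<^sub>M lborel) (\<lambda>(x, y). L x y)"
  proof (rule lborel_pair.Fubini_integrable[OF Lm])
    show "integrable lborel (\<lambda>x. \<integral>y. norm (case (x, y) of (x, y) \<Rightarrow> L x y) \<partial>lborel)"
    proof (rule Bochner_Integration.integrable_bound)
      show "integrable lborel (\<lambda>x. f x * ((2 * ln 2 + ln k) * mass))" using int by simp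
      show "(\<lambda>x. \<integral>y. norm (case (x, y) of (x, y) \<Rightarrow> L x y) \<partial>lborel) \<in> borel_measurable lborel"
        using Lm by (intro lborel.borel_measurable_lebesgue_integral) (simp add: split_beta)
      show "AE x in lborel. norm (\<integral>y. norm (case (x, y) of (x, y) \<Rightarrow> L x y) \<partial>lborel) \<le> norm (f x * ((2 * ln 2 + ln k) * mass))"
        using AE_lborel_singleton[of "0::'a"]
      proof eventually_elim
        case (elim x)
        have nn: "0 \<le> (\<integral>y. \<bar>log_ratio x (k *\<^sub>R x) y\<bar> * f y \<partial>lborel)"
          using nonneg by (intro integral_nonneg_AE) auto
        have "f x * (\<integral>y. \<bar>log_ratio x (k *\<^sub>R x) y\<bar> * f y \<partial>lborel) \<le> f x * ((2 * ln 2 + ln k) * mass)"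
          by (intro mult_left_mono log_ratio_scale_integral_le k elim nonneg)
        moreover have "0 \<le> 2 * ln 2 + ln k" using k by simp
        ultimately show ?case unfolding prod.case Ly using nn nonneg[of x] mass_nonneg by (simp add: abs_mult)
      qed
    qed
    show "AE x in lborel. integrable lborel (\<lambda>y. case (x, y) of (x, y) \<Rightarrow> L x y)"
    proof (rule AE_I2)
      fix x
      have "L x y = f x * (log_ratio x (k *\<^sub>R x) y * f y)" for y by (simp add: L_def)
      then show "integrable lborel (\<lambda>y. case (x, y) of (x, y) \<Rightarrow> L x y)"
        using log_ratio_integrable[of x "k *\<^sub>R x"] by simp
    qed
  qed
  have "(\<integral>y. L x y \<partial>lborel) = (pot (k *\<^sub>R x) - pot x) * f x" for x
  proof -
    have "(\<integral>y. L x y \<partial>lborel) = (\<integral>y. f x * (log_ratio x (k *\<^sub>R x) y * f y) \<partial>lborel)"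
      by (simp add: L_def mult_ac)
    then show ?thesis using log_ratio_integral[of x "k *\<^sub>R x"] by simp
  qed
  moreover have "(\<integral>x. L x y \<partial>lborel) = (ln k * mass - (pot y - pot ((1 / k) *\<^sub>R y))) * f y" for y
  proof -
    have "(\<integral>x. L x y \<partial>lborel) = (\<integral>x. f y * (ln k * f x - log_ratio ((1 / k) *\<^sub>R y) y x * f x) \<partial>lborel)"
    proof (rule integral_cong_AE)
      show "AE x in lborel. L x y = f y * (ln k * f x - log_ratio ((1 / k) *\<^sub>R y) y x * f x)"
        using AE_lborel_singleton[of "(1 / k) *\<^sub>R y"]
      proof eventually_elim
        case (elim x)
        have "k *\<^sub>R x - y = k *\<^sub>R (x - (1 / k) *\<^sub>R y)" using k by (simp add: scaleR_diff_right)
        then have "ln (norm (k *\<^sub>R x - y)) = ln k + ln (norm (x - (1 / k) *\<^sub>R y))"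
          using k elim by (simp add: ln_mult)
        then have "log_ratio x (k *\<^sub>R x) y = ln k - log_ratio ((1 / k) *\<^sub>R y) y x"
          by (simp add: log_ratio_def norm_minus_commute)
        then show ?case by (simp only: L_def) (simp only: left_diff_distrib right_diff_distrib mult_ac)
      qed
    qed (unfold L_def log_ratio_def, measurable)
    also have "\<dots> = f y * (ln k * mass - (pot y - pot ((1 / k) *\<^sub>R y)))"
      using int log_ratio_integrable[of "(1 / k) *\<^sub>R y" y] log_ratio_integral[of "(1 / k) *\<^sub>R y" y] by simp
    finally show ?thesis by (simp add: mult.commute)
  qed
  moreover have "(\<integral>x. (\<integral>y. L x y \<partial>lborel) \<partial>lborel) = (\<integral>y. (\<integral>x. L x y \<partial>lborel) \<partial>lborel)"
    using lborel_pair.Fubini_integral[OF I] by simp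
  ultimately have "(\<integral>x. (pot (k *\<^sub>R x) - pot x) * f x \<partial>lborel) = (\<integral>y. (ln k * mass - (pot y - pot ((1 / k) *\<^sub>R y))) * f y \<partial>lborel)"
    by simp
  also have "\<dots> = (\<integral>y. ln k * mass * f y - (pot y - pot ((1 / k) *\<^sub>R y)) * f y \<partial>lborel)"
    by (simp add: left_diff_distrib)
  also have "\<dots> = ln k * mass * mass - (\<integral>y. (pot y - pot ((1 / k) *\<^sub>R y)) * f y \<partial>lborel)"
  proof (subst Bochner_Integration.integral_diff)
    show "integrable lborel (\<lambda>y. (pot y - pot ((1 / k) *\<^sub>R y)) * f y)"
      using scale_diff_bounds'[OF k] by (intro bounded_mult_integrable[of _ "ln k * mass"]) auto
  qed (use int in auto)
  finally show ?thesis by simp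
qed

end

subsection \<open>The Pohozaev identity\<close>

lemma not_AE_lborel_False: "\<not> (AE x in (lborel :: 'a::euclidean_space measure). False)"
proof
  assume "AE x in (lborel :: 'a measure). False"
  then have "emeasure lborel (UNIV :: 'a set) = 0"
    using AE_iff_measurable[of UNIV "lborel :: 'a measure" "\<lambda>_. False"] by simp
  then show False by (simp add: emeasure_lborel_UNIV)
qed

lemma exp_quotient_tendsto:
  fixes c :: real
  assumes h: "h \<longlonglongrightarrow> 0" "\<And>k. h k \<noteq> 0"
  shows "(\<lambda>k. (exp (c * h k) - 1) / h k) \<longlonglongrightarrow> c"
proof -
  have "((\<lambda>x. exp (c * x)) has_real_derivative c) (at 0)" by (auto intro!: derivative_eq_intros)
  then have "((\<lambda>x. (exp (c * x) - 1) / x) \<longlongrightarrow> c) (at 0)" by (simp add: DERIV_def)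
  moreover have "filterlim h (at 0) sequentially" using h by (auto simp: filterlim_at)
  ultimately show ?thesis by (rule filterlim_compose)
qed

context radial_density
begin

lemma positive_weight_integral:
  assumes [measurable]: "h \<in> borel_measurable borel" and h: "\<And>x. 0 \<le> h x" "\<And>x. h x \<le> 1" "\<And>x. x \<noteq> 0 \<Longrightarrow> 0 < h x"
    and pos: "\<And>x. x \<noteq> 0 \<Longrightarrow> 0 < f x"
  shows "0 < (\<integral>x. h x * f x \<partial>lborel)"
proof -
  have i: "integrable lborel (\<lambda>x. h x * f x)" using h by (intro bounded_mult_integrable[of _ 1]) auto
  have "0 \<le> (\<integral>x. h x * f x \<partial>lborel)" using h nonneg by (intro integral_nonneg_AE) auto
  moreover have "(\<integral>x. h x * f x \<partial>lborel) \<noteq> 0"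
  proof
    assume "(\<integral>x. h x * f x \<partial>lborel) = 0"
    then have "AE x in lborel. h x * f x = 0"
      using integral_nonneg_eq_0_iff_AE[OF i] h nonneg by auto
    then have "AE x in (lborel :: 'a measure). False"
      using AE_lborel_singleton[of "0::'a"]
    proof eventually_elim
      case (elim x)
      then show ?case using mult_pos_pos[OF h(3) pos, of x x] by auto
    qed
    then show False using not_AE_lborel_False by blast
  qed
  ultimately show ?thesis by simp
qed

text \<open>The two integrals add up to h times the squared mass. Rescaling turns the second into
  the first with f replaced by its mass-preserving dilate. By Scheffe's lemma the dilates converge
  to f in L^1, while the increment of \<open>pot\<close> is at most h times the mass, so the
  integrals differ by o(h) and each carries half of the sum.\<close>

lemma half_energy_tendsto:
  assumes cont: "\<And>x l. x \<noteq> 0 \<Longrightarrow> l \<longlonglongrightarrow> 1 \<Longrightarrow> (\<And>k. 1 \<le> l k) \<Longrightarrow> (\<lambda>k. f (l k *\<^sub>R x)) \<longlonglongrightarrow> f x"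
    and h: "h \<longlonglongrightarrow> 0" "\<And>k. 0 < h k"
  shows "(\<lambda>k. (\<integral>x. (pot (exp (h k) *\<^sub>R x) - pot x) * f x \<partial>lborel) / h k) \<longlonglongrightarrow> mass^2 / 2"
    and "(\<lambda>k. (\<integral>x. (pot x - pot ((1 / exp (h k)) *\<^sub>R x)) * f x \<partial>lborel) / h k) \<longlonglongrightarrow> mass^2 / 2"
proof -
  define l where "l k = exp (h k)" for k
  have l: "1 \<le> l k" "0 < l k" "ln (l k) = h k" for k using h(2)[of k] by (auto simp: l_def)
  have l1: "l \<longlonglongrightarrow> 1" unfolding l_def using tendsto_exp[OF h(1)] by simp
  define F where "F k x = l k ^ DIM('a) * f (l k *\<^sub>R x)" for k x
  have [measurable]: "F k \<in> borel_measurable borel" for k unfolding F_def by measurable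
  have Fint: "integrable lborel (F k)" for k
    unfolding F_def using integrable_lborel_affine_iff[of f "l k" 0] int l(2)[of k] by simp
  have F0: "0 \<le> F k x" for k x using nonneg l(2)[of k] by (simp add: F_def)
  have FM: "(\<integral>x. F k x \<partial>lborel) = mass" for k
    unfolding F_def using integral_lborel_affine[of f "l k" 0] l(2)[of k] by simp
  define d where "d k = (\<integral>x. \<bar>F k x - f x\<bar> \<partial>lborel)" for k
  have d: "d \<longlonglongrightarrow> 0"
  proof -
    have "(\<lambda>k. \<integral>\<^sup>+x. norm (F k x - f x) \<partial>lborel) \<longlonglongrightarrow> 0"
    proof (rule Scheffe_lemma2)
      show "AE x in lborel. (\<lambda>k. F k x) \<longlonglongrightarrow> f x"
        using AE_lborel_singleton[of "0::'a"]
      proof eventually_elim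
        case (elim x)
        have "(\<lambda>k. l k ^ DIM('a) * f (l k *\<^sub>R x)) \<longlonglongrightarrow> 1 ^ DIM('a) * f x"
          by (intro tendsto_intros l1 cont elim l)
        then show ?case by (simp add: F_def)
      qed
      show "(\<integral>\<^sup>+x. norm (F k x) \<partial>lborel) \<le> (\<integral>\<^sup>+x. norm (f x) \<partial>lborel)" for k
        using nn_integral_eq_integral[OF Fint[of k]] nn_integral_eq_integral[OF int] F0 nonneg FM[of k] by simp
    qed (use int in auto)
    moreover have "(\<integral>\<^sup>+x. norm (F k x - f x) \<partial>lborel) = ennreal (d k)" for k
      unfolding d_def real_norm_def using Fint[of k] int by (intro nn_integral_eq_integral) auto
    moreover have "0 \<le> d k" for k unfolding d_def by (intro integral_nonneg_AE) auto
    ultimately show ?thesis using ennreal_tendsto_0_iff[of d] by simp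
  qed
  define I where "I k = (\<integral>x. (pot (l k *\<^sub>R x) - pot x) * f x \<partial>lborel)" for k
  define J where "J k = (\<integral>x. (pot x - pot ((1 / l k) *\<^sub>R x)) * f x \<partial>lborel)" for k
  have IJ: "I k + J k = h k * mass^2" for k
    using scale_energy[OF l(1)[of k]] by (simp add: I_def J_def l(3) power2_eq_square)
  have J': "J k = (\<integral>x. (pot (l k *\<^sub>R x) - pot x) * F k x \<partial>lborel)" for k
  proof -
    have "J k = \<bar>l k\<bar> ^ DIM('a) *\<^sub>R (\<integral>x. (pot (0 + l k *\<^sub>R x) - pot ((1 / l k) *\<^sub>R (0 + l k *\<^sub>R x))) * f (0 + l k *\<^sub>R x) \<partial>lborel)"
      unfolding J_def using l(2)[of k] by (intro integral_lborel_affine) auto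
    then show ?thesis using l(2)[of k] by (simp add: F_def mult_ac)
  qed
  have D: "\<bar>pot (l k *\<^sub>R x) - pot x\<bar> \<le> h k * mass" for k x
    using scale_diff_bounds[OF l(1)[of k], of x] by (simp add: l(3))
  have IJd: "\<bar>I k - J k\<bar> \<le> h k * mass * d k" for k
  proof -
    have i1: "integrable lborel (\<lambda>x. (pot (l k *\<^sub>R x) - pot x) * f x)"
      using D by (intro bounded_mult_integrable) auto
    have i2: "integrable lborel (\<lambda>x. (pot (l k *\<^sub>R x) - pot x) * F k x)"
    proof (rule Bochner_Integration.integrable_bound)
      show "integrable lborel (\<lambda>x. h k * mass * F k x)" using Fint by simp
      show "AE x in lborel. norm ((pot (l k *\<^sub>R x) - pot x) * F k x) \<le> norm (h k * mass * F k x)"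
        using D[of k] F0[of k] by (intro AE_I2) (auto simp: abs_mult intro!: mult_right_mono order_trans[OF D abs_ge_self[of "h k * mass", unfolded abs_mult]])
    qed measurable
    have "I k - J k = (\<integral>x. (pot (l k *\<^sub>R x) - pot x) * f x - (pot (l k *\<^sub>R x) - pot x) * F k x \<partial>lborel)"
      unfolding J' I_def using i1 i2 by simp
    also have "\<bar>\<dots>\<bar> \<le> (\<integral>x. h k * mass * \<bar>F k x - f x\<bar> \<partial>lborel)"
    proof (rule order_trans[OF integral_abs_bound integral_mono'])
      show "integrable lborel (\<lambda>x. h k * mass * \<bar>F k x - f x\<bar>)" using Fint int by simp
      fix x
      have "\<bar>(pot (l k *\<^sub>R x) - pot x) * (f x - F k x)\<bar> \<le> h k * mass * \<bar>f x - F k x\<bar>"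
        unfolding abs_mult by (intro mult_right_mono D) auto
      then show "\<bar>(pot (l k *\<^sub>R x) - pot x) * f x - (pot (l k *\<^sub>R x) - pot x) * F k x\<bar> \<le> h k * mass * \<bar>F k x - f x\<bar>"
        by (simp add: right_diff_distrib abs_minus_commute)
      show "0 \<le> h k * mass * \<bar>F k x - f x\<bar>" using h(2)[of k] mass_nonneg by simp
    qed
    finally show ?thesis by (simp add: d_def)
  qed
  have lim0: "(\<lambda>k. (I k - J k) / h k) \<longlonglongrightarrow> 0"
  proof (rule Lim_null_comparison)
    have "norm ((I k - J k) / h k) \<le> mass * d k" for k
      using IJd[of k] h(2)[of k] by (simp add: field_simps)
    then show "\<forall>\<^sub>F k in sequentially. norm ((I k - J k) / h k) \<le> mass * d k" by simp
    show "(\<lambda>k. mass * d k) \<longlonglongrightarrow> 0" using tendsto_mult_left[OF d, of mass] by simp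
  qed
  have eqI: "I k / h k = mass^2 / 2 + (1 / 2) * ((I k - J k) / h k)" for k
    using IJ[of k] h(2)[of k] by (simp add: field_simps)
  have eqJ: "J k / h k = mass^2 / 2 - (1 / 2) * ((I k - J k) / h k)" for k
    using IJ[of k] h(2)[of k] by (simp add: field_simps)
  have "(\<lambda>k. I k / h k) \<longlonglongrightarrow> mass^2 / 2 + (1 / 2) * 0"
    unfolding eqI by (intro tendsto_intros lim0)
  then show "(\<lambda>k. (\<integral>x. (pot (exp (h k) *\<^sub>R x) - pot x) * f x \<partial>lborel) / h k) \<longlonglongrightarrow> mass^2 / 2"
    by (simp add: I_def l_def)
  have "(\<lambda>k. J k / h k) \<longlonglongrightarrow> mass^2 / 2 - (1 / 2) * 0"
    unfolding eqJ by (intro tendsto_intros lim0)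
  then show "(\<lambda>k. (\<integral>x. (pot x - pot ((1 / exp (h k)) *\<^sub>R x)) * f x \<partial>lborel) / h k) \<longlonglongrightarrow> mass^2 / 2"
    by (simp add: J_def l_def)
qed

text \<open>The dilate c^n f (c x) has the mass of f and equals c^(n (1 + \<alpha>)) f x exp (n (u
  (c x) - u x)). With exp t \<ge> 1 + t this yields an inequality that is divided by h = |ln c| and
  taken to the limit. Dilating outwards (c > 1) or inwards (c < 1) produces the two opposite
  inequalities.\<close>

lemma pohozaev:
  assumes g: "0 < \<gamma>" and e: "0 \<le> e"
    and f: "\<And>x. f x = norm x powr (DIM('a) * \<alpha>) * exp (DIM('a) * (- pot x / \<gamma> - e * (norm x)^2))"
  shows "0 < mass" "e = 0 \<Longrightarrow> 2 * \<gamma> * (1 + \<alpha>) \<le> mass" "0 < e \<Longrightarrow> mass < 2 * \<gamma> * (1 + \<alpha>)"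
proof -
  let ?n = "real DIM('a)"
  have n: "?n > 0" by simp
  define u where "u x = - pot x / \<gamma> - e * (norm x)^2" for x
  have fu: "f x = norm x powr (?n * \<alpha>) * exp (?n * u x)" for x by (simp add: f u_def)
  have pos: "0 < f x" if "x \<noteq> 0" for x unfolding fu using that by simp
  show M: "0 < mass"
    using positive_weight_integral[of "\<lambda>_. 1"] pos by simp
  define h where "h k = 1 / real (Suc k)" for k
  have h: "h k > 0" "h k \<noteq> 0" for k by (auto simp: h_def)
  have h0: "h \<longlonglongrightarrow> 0" unfolding h_def using LIMSEQ_inverse_real_of_nat by (simp add: inverse_eq_divide)
  have scale: "c ^ DIM('a) * f (c *\<^sub>R x) = exp (?n * (1 + \<alpha>) * ln c) * (f x * exp (?n * (u (c *\<^sub>R x) - u x)))" if c: "0 < c" for c x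
  proof -
    have "norm (c *\<^sub>R x) powr (?n * \<alpha>) = c powr (?n * \<alpha>) * norm x powr (?n * \<alpha>)"
      using c by (simp add: powr_mult)
    moreover have "c powr (?n * \<alpha>) = exp (?n * \<alpha> * ln c)" using c by (simp add: powr_def)
    moreover have "c ^ DIM('a) = exp (?n * ln c)" using c by (simp add: exp_of_nat_mult)
    moreover have "exp (?n * (1 + \<alpha>) * ln c) = exp (?n * ln c) * exp (?n * \<alpha> * ln c)"
      by (simp add: exp_add[symmetric] algebra_simps)
    moreover have "exp (?n * u (c *\<^sub>R x)) = exp (?n * u x) * exp (?n * (u (c *\<^sub>R x) - u x))"
      by (simp add: exp_add[symmetric] algebra_simps)
    ultimately show ?thesis unfolding fu by (simp only: mult_ac)
  qed
  have cont: "(\<lambda>k. f (l k *\<^sub>R x)) \<longlonglongrightarrow> f x" if x: "x \<noteq> 0" and l: "l \<longlonglongrightarrow> 1" "\<And>k. 1 \<le> l k" for x l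
  proof -
    have lp: "0 < l k" for k using l(2)[of k] by simp
    have "(\<lambda>k. pot (l k *\<^sub>R x)) \<longlonglongrightarrow> pot x"
    proof (rule tendsto_sandwich)
      show "\<forall>\<^sub>F k in sequentially. pot x \<le> pot (l k *\<^sub>R x)" "\<forall>\<^sub>F k in sequentially. pot (l k *\<^sub>R x) \<le> pot x + ln (l k) * mass"
        using pot_scale l(2) by auto
      have "(\<lambda>k. pot x + ln (l k) * mass) \<longlonglongrightarrow> pot x + ln 1 * mass" by (intro tendsto_intros l) simp
      then show "(\<lambda>k. pot x + ln (l k) * mass) \<longlonglongrightarrow> pot x" by simp
    qed auto
    then have "(\<lambda>k. norm (l k *\<^sub>R x) powr (?n * \<alpha>) * exp (?n * (- pot (l k *\<^sub>R x) / \<gamma> - e * (norm (l k *\<^sub>R x))^2)))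
       \<longlonglongrightarrow> norm (1 *\<^sub>R x) powr (?n * \<alpha>) * exp (?n * (- pot x / \<gamma> - e * (norm (1 *\<^sub>R x))^2))"
      using x g by (intro tendsto_intros l) auto
    then show ?thesis by (simp add: f)
  qed
  define I where "I k = (\<integral>x. (pot (exp (h k) *\<^sub>R x) - pot x) * f x \<partial>lborel)" for k
  define J where "J k = (\<integral>x. (pot x - pot ((1 / exp (h k)) *\<^sub>R x)) * f x \<partial>lborel)" for k
  have IJ: "(\<lambda>k. I k / h k) \<longlonglongrightarrow> mass^2 / 2" "(\<lambda>k. J k / h k) \<longlonglongrightarrow> mass^2 / 2"
    unfolding I_def J_def by (intro half_energy_tendsto h0 h cont; assumption)+
  have l1: "1 \<le> exp (h k)" for k using h(1)[of k] by simp
  have dil: "(\<integral>x. c ^ DIM('a) * f (c *\<^sub>R x) \<partial>lborel) = mass" "integrable lborel (\<lambda>x. c ^ DIM('a) * f (c *\<^sub>R x))" if "0 < c" for c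
    using integral_lborel_affine[of f c 0] integrable_lborel_affine_iff[of f c 0] int that by simp_all
  \<comment> \<open>\<open>z\<close> is a bounded minorant of the increment of u; boundedness makes
    its integral against f meaningful even where the increment itself is unbounded.\<close>
  have ineq: "exp (?n * (1 + \<alpha>) * ln c) * (mass + ?n * (\<integral>x. z x * f x \<partial>lborel)) \<le> mass"
    if c: "0 < c" and z[measurable]: "z \<in> borel_measurable borel" "\<And>x. \<bar>z x\<bar> \<le> B" "\<And>x. z x \<le> u (c *\<^sub>R x) - u x" for c z B
  proof -
    have zi: "integrable lborel (\<lambda>x. z x * f x)" by (rule bounded_mult_integrable[OF z(1,2)])
    have "exp (?n * (1 + \<alpha>) * ln c) * (mass + ?n * (\<integral>x. z x * f x \<partial>lborel)) = (\<integral>x. exp (?n * (1 + \<alpha>) * ln c) * (f x + ?n * (z x * f x)) \<partial>lborel)"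
      using zi int by simp
    also have "\<dots> \<le> (\<integral>x. c ^ DIM('a) * f (c *\<^sub>R x) \<partial>lborel)"
    proof (rule integral_mono[OF _ dil(2)[OF c]])
      show "integrable lborel (\<lambda>x. exp (?n * (1 + \<alpha>) * ln c) * (f x + ?n * (z x * f x)))" using zi int by simp
      fix x
      have "1 + ?n * z x \<le> 1 + ?n * (u (c *\<^sub>R x) - u x)" using z(3)[of x] by (intro add_left_mono mult_left_mono) auto
      also have "\<dots> \<le> exp (?n * (u (c *\<^sub>R x) - u x))" by (rule exp_ge_add_one_self)
      finally have "f x * (1 + ?n * z x) \<le> f x * exp (?n * (u (c *\<^sub>R x) - u x))" by (intro mult_left_mono nonneg)
      then show "exp (?n * (1 + \<alpha>) * ln c) * (f x + ?n * (z x * f x)) \<le> c ^ DIM('a) * f (c *\<^sub>R x)"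
        unfolding scale[OF c] by (intro mult_left_mono) (auto simp: algebra_simps)
    qed
    finally show ?thesis unfolding dil(1)[OF c] .
  qed
  {
    \<comment> \<open>Here c = exp (h k) > 1: the potential increases outwards, and its mean
      increment is h times half the squared mass up to o(h).\<close>
    assume e0: "e = 0"
    have "exp (?n * (1 + \<alpha>) * h k) * (mass + ?n * (- I k / \<gamma>)) \<le> mass" for k
    proof -
      have "(\<integral>x. (- (1 / \<gamma>) * (pot (exp (h k) *\<^sub>R x) - pot x)) * f x \<partial>lborel) = - (1 / \<gamma>) * I k"
        unfolding I_def mult.assoc by (rule integral_mult_right_zero)
      moreover have "exp (?n * (1 + \<alpha>) * ln (exp (h k))) * (mass + ?n * (\<integral>x. (- (1 / \<gamma>) * (pot (exp (h k) *\<^sub>R x) - pot x)) * f x \<partial>lborel)) \<le> mass"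
      proof (rule ineq)
        show "\<bar>- (1 / \<gamma>) * (pot (exp (h k) *\<^sub>R x) - pot x)\<bar> \<le> 1 / \<gamma> * (h k * mass)" for x
          using scale_diff_bounds[OF l1[of k], of x] g unfolding abs_mult by (intro mult_mono) auto
        show "- (1 / \<gamma>) * (pot (exp (h k) *\<^sub>R x) - pot x) \<le> u (exp (h k) *\<^sub>R x) - u x" for x
          by (simp add: u_def e0 diff_divide_distrib right_diff_distrib)
      qed auto
      ultimately show ?thesis using g by simp
    qed
    then have "mass * ((exp (- (?n * (1 + \<alpha>)) * h k) - 1) / h k) \<ge> - (?n / \<gamma>) * (I k / h k)" for k
    proof -
      fix k
      let ?E = "exp (?n * (1 + \<alpha>) * h k)"
      assume "\<And>k. exp (?n * (1 + \<alpha>) * h k) * (mass + ?n * (- I k / \<gamma>)) \<le> mass"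
      from this[of k] have "mass + ?n * (- I k / \<gamma>) \<le> mass / ?E" by (simp add: field_simps)
      also have "mass / ?E = mass * exp (- (?n * (1 + \<alpha>)) * h k)" by (simp add: exp_minus divide_inverse)
      finally have "- (?n / \<gamma>) * I k \<le> mass * (exp (- (?n * (1 + \<alpha>)) * h k) - 1)" by (simp add: algebra_simps)
      then have "(- (?n / \<gamma>) * I k) / h k \<le> (mass * (exp (- (?n * (1 + \<alpha>)) * h k) - 1)) / h k"
        using h(1)[of k] by (intro divide_right_mono) auto
      then show "mass * ((exp (- (?n * (1 + \<alpha>)) * h k) - 1) / h k) \<ge> - (?n / \<gamma>) * (I k / h k)" by simp
    qed
    moreover have "(\<lambda>k. mass * ((exp (- (?n * (1 + \<alpha>)) * h k) - 1) / h k)) \<longlonglongrightarrow> mass * (- (?n * (1 + \<alpha>)))"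
      by (intro tendsto_mult_left exp_quotient_tendsto h0 h)
    moreover have "(\<lambda>k. - (?n / \<gamma>) * (I k / h k)) \<longlonglongrightarrow> - (?n / \<gamma>) * (mass^2 / 2)"
      by (intro tendsto_mult_left IJ)
    ultimately have "- (?n / \<gamma>) * (mass^2 / 2) \<le> mass * (- (?n * (1 + \<alpha>)))"
      by (intro LIMSEQ_le) auto
    then have "(?n * mass) * (2 * \<gamma> * (1 + \<alpha>)) \<le> (?n * mass) * mass"
      using g by (simp add: field_simps power2_eq_square)
    then show "2 * \<gamma> * (1 + \<alpha>) \<le> mass" using M n by (subst (asm) mult_le_cancel_left_pos) auto
  }
  {
    assume e0: "0 < e"
    \<comment> \<open>A truncated second moment, which serves as a bounded weight and is positive;
      it measures how far the inequality is from equality. In this case c = exp (- h k) < 1.\<close>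
    define Q where "Q = (\<integral>x. min ((norm x)^2) 1 * f x \<partial>lborel)"
    have Q: "0 < Q" unfolding Q_def using pos by (intro positive_weight_integral) auto
    have Qi: "integrable lborel (\<lambda>x. min ((norm x)^2) 1 * f x)" by (intro bounded_mult_integrable[of _ 1]) auto
    have Ji: "integrable lborel (\<lambda>x. (pot x - pot ((1 / exp (h k)) *\<^sub>R x)) * f x)" for k
      using scale_diff_bounds'[OF l1[of k]] by (intro bounded_mult_integrable[of _ "ln (exp (h k)) * mass"]) auto
    \<comment> \<open>The quadratic term of u increases by \<open>e * s k * (norm x)^2\<close> under
      the inward dilation, and s / h tends to 2.\<close>
    define s where "s k = 1 - exp (- 2 * h k)" for k
    have s: "0 < s k" for k using h(1)[of k] by (simp add: s_def)
    have main: "exp (- (?n * (1 + \<alpha>) * h k)) * (mass + ?n * (J k / \<gamma> + e * s k * Q)) \<le> mass" for k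
    proof -
      define z where "z x = (1 / \<gamma>) * (pot x - pot ((1 / exp (h k)) *\<^sub>R x)) + e * s k * min ((norm x)^2) 1" for x
      have "(\<integral>x. z x * f x \<partial>lborel) = (\<integral>x. (1 / \<gamma>) * ((pot x - pot ((1 / exp (h k)) *\<^sub>R x)) * f x) + e * s k * (min ((norm x)^2) 1 * f x) \<partial>lborel)"
        by (simp only: z_def distrib_right mult.assoc)
      also have "\<dots> = (1 / \<gamma>) * J k + e * s k * Q"
        unfolding J_def Q_def using Ji[of k] Qi by simp
      finally have zi: "(\<integral>x. z x * f x \<partial>lborel) = (1 / \<gamma>) * J k + e * s k * Q" .
      have "exp (?n * (1 + \<alpha>) * ln (1 / exp (h k))) * (mass + ?n * (\<integral>x. z x * f x \<partial>lborel)) \<le> mass"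
      proof (rule ineq)
        show "z \<in> borel_measurable borel" unfolding z_def by measurable
        fix x
        have b: "0 \<le> pot x - pot ((1 / exp (h k)) *\<^sub>R x)" "pot x - pot ((1 / exp (h k)) *\<^sub>R x) \<le> h k * mass"
          using scale_diff_bounds'[OF l1[of k], of x] by auto
        have "0 \<le> z x" unfolding z_def using b e0 s[of k] g by (intro add_nonneg_nonneg mult_nonneg_nonneg) auto
        moreover have "z x \<le> (1 / \<gamma>) * (h k * mass) + e * s k * 1"
          unfolding z_def using b e0 s[of k] g by (intro add_mono mult_left_mono) auto
        ultimately show "\<bar>z x\<bar> \<le> (1 / \<gamma>) * (h k * mass) + e * s k * 1" by simp
        have "u ((1 / exp (h k)) *\<^sub>R x) - u x = (1 / \<gamma>) * (pot x - pot ((1 / exp (h k)) *\<^sub>R x)) + e * s k * (norm x)^2"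
        proof -
          have "(norm ((1 / exp (h k)) *\<^sub>R x))^2 = exp (- 2 * h k) * (norm x)^2"
            by (simp add: power_divide power2_eq_square[of "exp _"] exp_minus exp_add[symmetric] inverse_eq_divide)
          then show ?thesis by (simp add: u_def s_def algebra_simps diff_divide_distrib)
        qed
        moreover have "e * s k * min ((norm x)^2) 1 \<le> e * s k * (norm x)^2"
          using e0 s[of k] by (intro mult_left_mono) auto
        ultimately show "z x \<le> u ((1 / exp (h k)) *\<^sub>R x) - u x" by (simp add: z_def)
      qed auto
      then show ?thesis by (simp add: zi ln_div)
    qed
    have "(?n / \<gamma>) * (J k / h k) + ?n * e * Q * (s k / h k) \<le> mass * ((exp (?n * (1 + \<alpha>) * h k) - 1) / h k)" for k
    proof -
      have "mass + ?n * (J k / \<gamma> + e * s k * Q) \<le> mass * exp (?n * (1 + \<alpha>) * h k)"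
      proof -
        have "A \<le> mass * exp x" if "exp (- x) * A \<le> mass" for A x
        proof -
          have "exp x * (exp (- x) * A) \<le> exp x * mass" using that by (intro mult_left_mono) auto
          moreover have "exp x * exp (- x) = 1" by (simp flip: exp_add)
          then have "exp x * (exp (- x) * A) = A" by (simp only: mult.assoc[symmetric] mult_1)
          ultimately show ?thesis by (simp only: mult.commute)
        qed
        from this[OF main[of k]] show ?thesis .
      qed
      then have "(?n / \<gamma>) * J k + ?n * e * Q * s k \<le> mass * (exp (?n * (1 + \<alpha>) * h k) - 1)" by (simp add: algebra_simps)
      then have "((?n / \<gamma>) * J k + ?n * e * Q * s k) / h k \<le> (mass * (exp (?n * (1 + \<alpha>) * h k) - 1)) / h k"
        using h(1)[of k] by (intro divide_right_mono) auto
      then show ?thesis by (simp add: add_divide_distrib)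
    qed
    moreover have "(\<lambda>k. mass * ((exp (?n * (1 + \<alpha>) * h k) - 1) / h k)) \<longlonglongrightarrow> mass * (?n * (1 + \<alpha>))"
      by (intro tendsto_mult_left exp_quotient_tendsto h0 h)
    moreover have "(\<lambda>k. (?n / \<gamma>) * (J k / h k) + ?n * e * Q * (s k / h k)) \<longlonglongrightarrow> (?n / \<gamma>) * (mass^2 / 2) + ?n * e * Q * 2"
    proof (rule tendsto_add[OF tendsto_mult_left tendsto_mult_left])
      show "(\<lambda>k. J k / h k) \<longlonglongrightarrow> mass^2 / 2" by (rule IJ)
      have "(\<lambda>k. - ((exp ((- 2) * h k) - 1) / h k)) \<longlonglongrightarrow> - (- 2)"
        by (intro tendsto_minus exp_quotient_tendsto h0 h)
      then show "(\<lambda>k. s k / h k) \<longlonglongrightarrow> 2" by (simp add: s_def diff_divide_distrib)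
    qed
    ultimately have "(?n / \<gamma>) * (mass^2 / 2) + ?n * e * Q * 2 \<le> mass * (?n * (1 + \<alpha>))"
      by (intro LIMSEQ_le) auto
    moreover have "0 < ?n * e * Q * 2" using n e0 Q by (intro mult_pos_pos) auto
    ultimately have "(?n / \<gamma>) * (mass^2 / 2) < mass * (?n * (1 + \<alpha>))" by linarith
    then have "(?n * mass) * mass < (?n * mass) * (2 * \<gamma> * (1 + \<alpha>))"
      using g by (simp add: field_simps power2_eq_square)
    then show "mass < 2 * \<gamma> * (1 + \<alpha>)" using M n by (subst (asm) mult_less_cancel_left_pos) auto
  }
qed

end

subsection \<open>Approximate solutions\<close>

definition norm_power :: "real \<Rightarrow> 'a::euclidean_space \<Rightarrow> real" where
  "norm_power \<alpha> y = norm y powr (real DIM('a) * \<alpha>)"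

text \<open>Upper barrier for the densities with parameter e: what remains when the nonnegative
  potential is dropped.\<close>

definition gauss_power :: "real \<Rightarrow> real \<Rightarrow> 'a::euclidean_space \<Rightarrow> real" where
  "gauss_power \<alpha> e y = norm_power \<alpha> y * exp (- real DIM('a) * (e * (norm y)^2))"

lemma norm_power_nonneg: "0 \<le> norm_power \<alpha> y" by (simp add: norm_power_def)

lemma norm_power_measurable [measurable]: "norm_power \<alpha> \<in> borel_measurable (borel :: 'a::euclidean_space measure)"
  unfolding norm_power_def by measurable

lemma gauss_power_measurable [measurable]: "gauss_power \<alpha> e \<in> borel_measurable (borel :: 'a::euclidean_space measure)"
  unfolding gauss_power_def by measurable

lemma gauss_power_integrable:
  assumes "-1 < \<alpha>" "0 < e"
  shows "integrable lborel (gauss_power \<alpha> e :: 'a::euclidean_space \<Rightarrow> real)"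
proof -
  have "real DIM('a) * \<alpha> > - real DIM('a)"
    using mult_strict_left_mono[OF assms(1), of "real DIM('a)"] by simp
  moreover have "0 < real DIM('a) * e" using assms by simp
  ultimately have "integrable lborel (\<lambda>y::'a. norm y powr (real DIM('a) * \<alpha>) * exp (- (real DIM('a) * e) * (norm y)^2))"
    by (rule integrable_norm_powr_gauss)
  then show ?thesis by (simp add: gauss_power_def[abs_def] norm_power_def mult.assoc)
qed

lemma gauss_power_mono: "e \<le> e' \<Longrightarrow> gauss_power \<alpha> e' y \<le> gauss_power \<alpha> e (y :: 'a::euclidean_space)"
  unfolding gauss_power_def using norm_power_nonneg by (intro mult_left_mono) (auto intro!: mult_right_mono)

text \<open>Supplies the largest admissible parameter: at that value even the barrier has mass below
  L, so the search for e cannot end there with too much mass.\<close>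

lemma gauss_power_mass_small:
  assumes "-1 < \<alpha>" "0 < L"
  shows "\<exists>e>0. (\<integral>y. gauss_power \<alpha> e (y :: 'a::euclidean_space) \<partial>lborel) < L"
proof -
  have "(\<lambda>k. \<integral>y. gauss_power \<alpha> (real (Suc k)) (y :: 'a) \<partial>lborel) \<longlonglongrightarrow> (\<integral>y. 0 \<partial>(lborel :: 'a measure))"
  proof (rule integral_dominated_convergence)
    show "integrable lborel (gauss_power \<alpha> 1 :: 'a \<Rightarrow> real)" by (rule gauss_power_integrable) (use assms in auto)
    show "AE y in lborel. (\<lambda>k. gauss_power \<alpha> (real (Suc k)) (y :: 'a)) \<longlonglongrightarrow> 0"
      using AE_lborel_singleton[of "0::'a"]
    proof eventually_elim
      case (elim y)
      have d: "0 < real DIM('a) * (norm y)^2" using elim by simp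
      have "(\<lambda>k. exp (- (real DIM('a) * (norm y)^2)) ^ Suc k) \<longlonglongrightarrow> 0"
        by (rule LIMSEQ_Suc[OF LIMSEQ_power_zero]) (use d in simp)
      then have "(\<lambda>k. norm_power \<alpha> y * exp (- (real DIM('a) * (norm y)^2)) ^ Suc k) \<longlonglongrightarrow> norm_power \<alpha> y * 0"
        by (rule tendsto_mult_left)
      moreover have "exp (- (real DIM('a) * (norm y)^2)) ^ Suc k = exp (- real DIM('a) * (real (Suc k) * (norm y)^2))" for k
        by (subst exp_of_nat_mult[symmetric]) (simp add: mult_ac)
      ultimately show ?case by (simp add: gauss_power_def)
    qed
    show "AE y in lborel. norm (gauss_power \<alpha> (real (Suc k)) y) \<le> gauss_power \<alpha> 1 (y :: 'a)" for k
      using gauss_power_mono[of 1 "real (Suc k)" \<alpha>, where 'a='a] norm_power_nonneg[where 'a='a] by (intro AE_I2) (simp add: gauss_power_def abs_mult)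
  qed auto
  then have "\<forall>\<^sub>F k in sequentially. (\<integral>y. gauss_power \<alpha> (real (Suc k)) (y :: 'a) \<partial>lborel) < L"
    using assms(2) by (intro order_tendstoD) simp_all
  then obtain k where "(\<integral>y. gauss_power \<alpha> (real (Suc k)) (y :: 'a) \<partial>lborel) < L"
    by (auto simp: eventually_sequentially)
  then show ?thesis by (intro exI[of _ "real (Suc k)"]) auto
qed

lemma radial_density_ball:
  fixes E :: "'a::euclidean_space \<Rightarrow> real"
  assumes dim: "2 \<le> DIM('a)" and a: "-1 < \<alpha>"
    and [measurable]: "E \<in> borel_measurable borel" and E: "\<And>y. 0 \<le> E y" "\<And>y. E y \<le> 1" "\<And>y. R < norm y \<Longrightarrow> E y = 0" "radial E" and e: "0 \<le> e"
  shows "radial_density \<alpha> (\<lambda>y. E y * gauss_power \<alpha> e y)" "E y * gauss_power \<alpha> e y \<le> gauss_power \<alpha> e y" "E y * gauss_power \<alpha> e y \<le> norm_power \<alpha> y * indicator (cball 0 R) y"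
    "integrable lborel (\<lambda>y::'a. norm_power \<alpha> y * indicator (cball 0 R) y)"
proof -
  have n: "real DIM('a) * \<alpha> > - real DIM('a)"
    using mult_strict_left_mono[OF a, of "real DIM('a)"] by simp
  show i: "integrable lborel (\<lambda>y::'a. norm_power \<alpha> y * indicator (cball 0 R) y)"
    unfolding norm_power_def by (rule integrable_norm_powr_ball[OF n])
  have g0: "0 \<le> gauss_power \<alpha> e y" for y :: 'a unfolding gauss_power_def by (intro mult_nonneg_nonneg norm_power_nonneg) auto
  have g1: "gauss_power \<alpha> e y \<le> norm_power \<alpha> y" for y :: 'a
    using norm_power_nonneg[of \<alpha> y] e by (simp add: gauss_power_def mult_left_le)
  show le1: "E y * gauss_power \<alpha> e y \<le> gauss_power \<alpha> e y" for y using mult_right_mono[OF E(2) g0, of y y] by simp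
  show le2: "E y * gauss_power \<alpha> e y \<le> norm_power \<alpha> y * indicator (cball 0 R) y" for y
    using order_trans[OF le1 g1, of y] E(3)[of y] by (auto split: split_indicator)
  show "radial_density \<alpha> (\<lambda>y. E y * gauss_power \<alpha> e y)"
  proof
    show "integrable lborel (\<lambda>y. E y * gauss_power \<alpha> e y)"
    proof (rule Bochner_Integration.integrable_bound[OF i])
      have "norm (E y * gauss_power \<alpha> e y) \<le> norm (norm_power \<alpha> y * indicator (cball 0 R) y)" for y
        using order_trans[OF le2 abs_ge_self, of y] mult_nonneg_nonneg[OF E(1) g0, of y y]
        by (simp only: real_norm_def abs_of_nonneg)
      then show "AE y in lborel. norm (E y * gauss_power \<alpha> e y) \<le> norm (norm_power \<alpha> y * indicator (cball 0 R) y)" by simp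
    qed measurable
    show "radial (\<lambda>y. E y * gauss_power \<alpha> e y)"
      unfolding radial_def
    proof (intro allI impI)
      fix x y :: 'a
      assume n: "norm x = norm y"
      then have "E x = E y" using E(4) unfolding radial_def by blast
      then show "E x * gauss_power \<alpha> e x = E y * gauss_power \<alpha> e y" by (simp add: gauss_power_def norm_power_def n)
    qed
    show "E y * gauss_power \<alpha> e y \<le> norm y powr (real DIM('a) * \<alpha>)" for y
      using order_trans[OF le1 g1, of y] by (simp add: norm_power_def)
    show "0 \<le> E y * gauss_power \<alpha> e y" for y by (rule mult_nonneg_nonneg[OF E(1) g0])
  qed (rule dim a)+
qed

text \<open>The unknowns are the values of exp (- pot / \<gamma>) at the outer radii of N^2 shells
  of width 1/N, together with e / ebar as last coordinate. Given them, the density is the barrier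
  times a factor constant on shells; recomputing its potential and adjusting e by the excess mass is
  a continuous self-map of the cube.\<close>

lemma finite_level_fixed_point:
  fixes \<alpha> \<gamma> L ebar :: real and b :: "'a::euclidean_space"
  assumes dim: "2 \<le> DIM('a)" and a: "-1 < \<alpha>" and g: "0 < \<gamma>" and L: "0 < L"
    and ebar: "0 < ebar" "(\<integral>y. gauss_power \<alpha> ebar (y :: 'a) \<partial>lborel) < L" and N: "0 < N"
  shows "\<exists>f e. radial_density \<alpha> f \<and> 0 \<le> e \<and> e \<le> ebar \<and> (\<integral>y. f y \<partial>lborel) \<le> L \<and> (0 < e \<longrightarrow> (\<integral>y. f y \<partial>lborel) = L)
     \<and> (\<forall>y::'a. f y \<le> gauss_power \<alpha> e y)
     \<and> (\<forall>y::'a. y \<noteq> 0 \<and> norm y \<le> real N \<longrightarrow> (\<exists>r. norm y \<le> r \<and> r \<le> norm y + 1 / real N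
          \<and> f y = exp (- radial_density.pot f (r *\<^sub>R b) / \<gamma>) ^ DIM('a) * gauss_power \<alpha> e y))"
proof -
  define m where "m = N * N"
  \<comment> \<open>Shells contain their outer but not their inner sphere. The origin, whose ceiling
    is 0, would land in shell 0 by truncated subtraction and is excluded in
    \<open>E\<close>.\<close>
  define idx where "idx y = nat \<lceil>real N * norm y\<rceil> - 1" for y :: 'a
  have idx_meas: "idx \<in> measurable borel (count_space UNIV)" unfolding idx_def by measurable
  have idx: "idx y < m" "norm y \<le> (real (idx y) + 1) / N" "(real (idx y) + 1) / N \<le> norm y + 1 / real N"
    if "y \<noteq> 0" "norm y \<le> real N" for y
  proof -
    have "real N * norm y > 0" using that N by simp
    then have c: "1 \<le> \<lceil>real N * norm y\<rceil>" by linarith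
    then have ri: "real (idx y) + 1 = of_int \<lceil>real N * norm y\<rceil>"
    proof -
      have "int (idx y) + 1 = \<lceil>real N * norm y\<rceil>" unfolding idx_def using c by linarith
      then show ?thesis by (metis of_int_1 of_int_add of_int_of_nat_eq)
    qed
    have "real N * norm y \<le> real N * real N" using that by (intro mult_left_mono) auto
    then have "\<lceil>real N * norm y\<rceil> \<le> int m" by (simp add: m_def ceiling_le_iff)
    then show "idx y < m" using c unfolding idx_def by linarith
    have "real N * norm y \<le> real (idx y) + 1" unfolding ri by (rule le_of_int_ceiling)
    then show "norm y \<le> (real (idx y) + 1) / N" using N by (simp add: field_simps)
    have "real (idx y) + 1 \<le> real N * norm y + 1" unfolding ri by linarith
    then have "(real (idx y) + 1) / N \<le> (real N * norm y + 1) / N" by (rule divide_right_mono) simp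
    then show "(real (idx y) + 1) / N \<le> norm y + 1 / real N" using N by (simp add: add_divide_distrib)
  qed
  \<comment> \<open>The power \<open>DIM('a)\<close> turns exp (- pot / \<gamma>) into exp (- n pot
    / \<gamma>). Vanishing outside radius N makes all these densities share an integrable
    majorant.\<close>
  define E where "E v y = (if y \<noteq> 0 \<and> norm y \<le> real N then v (idx y) ^ DIM('a) else 0)" for v :: "nat \<Rightarrow> real" and y :: 'a
  have Em[measurable]: "E v \<in> borel_measurable borel" for v
  proof -
    have [measurable]: "(\<lambda>y. v (idx y)) \<in> borel_measurable borel"
      by (rule measurable_compose[OF idx_meas]) simp
    show ?thesis unfolding E_def by measurable
  qed
  define ok where "ok v \<longleftrightarrow> (\<forall>j<m+1. 0 \<le> v j \<and> v j \<le> 1)" for v :: "nat \<Rightarrow> real"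
  define D where "D v y = E v y * gauss_power \<alpha> (ebar * v m) y" for v and y :: 'a
  have E01: "0 \<le> E v y" "E v y \<le> 1" "real N < norm y \<Longrightarrow> E v y = 0" "radial (E v)" and e0: "0 \<le> ebar * v m" if "ok v" for v y
  proof -
    show "0 \<le> E v y" "E v y \<le> 1" using that idx(1)[of y] by (auto simp: E_def ok_def intro!: power_le_one)
    show "real N < norm y \<Longrightarrow> E v y = 0" by (simp add: E_def)
    show "radial (E v)"
      unfolding radial_def
    proof (intro allI impI)
      fix y z :: 'a
      assume nz: "norm y = norm z"
      then have "idx y = idx z" "(y = 0) = (z = 0)" by (simp add: idx_def, metis norm_eq_zero)
      then show "E v y = E v z" using nz by (simp add: E_def)
    qed
    show "0 \<le> ebar * v m" using that ebar by (simp add: ok_def)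
  qed
  have RD: "radial_density \<alpha> (D v)" "D v y \<le> gauss_power \<alpha> (ebar * v m) y" "D v y \<le> norm_power \<alpha> y * indicator (cball 0 (real N)) y"
    if "ok v" for v y
    using radial_density_ball(1,2,3)[OF dim a Em E01(1)[OF that] E01(2)[OF that] E01(3)[OF that] E01(4)[OF that] e0[OF that]]
    unfolding D_def[abs_def] by auto
  define B where "B = (\<integral>y. norm_power \<alpha> y * indicator (cball 0 (real N)) (y::'a) \<partial>lborel)"
  have Bi: "integrable lborel (\<lambda>y::'a. norm_power \<alpha> y * indicator (cball 0 (real N)) y)"
    unfolding norm_power_def using mult_strict_left_mono[OF a, of "real DIM('a)"] by (intro integrable_norm_powr_ball) simp
  have DB: "(\<integral>y. D v y \<partial>lborel) \<le> B" if "ok v" for v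
    unfolding B_def using RD(1)[OF that] RD(3)[OF that] Bi
    by (intro integral_mono) (auto dest: radial_density.int)
  \<comment> \<open>The last component raises e when the mass exceeds L and lowers it when the mass
    falls short, clamped to [0, 1].\<close>
  define F where "F v i = (if i < m then exp (- radial_density.pot (D v) (((real i + 1) / N) *\<^sub>R b) / \<gamma>)
      else max 0 (min 1 (v m + ((\<integral>y. D v y \<partial>lborel) - L))))" for v i
  have lim_D: "(\<lambda>k. D (X k) y) \<longlonglongrightarrow> D x y" if "\<And>j. j < m + 1 \<Longrightarrow> (\<lambda>k. X k j) \<longlonglongrightarrow> x j" for X x y
  proof -
    have "(\<lambda>k. E (X k) y) \<longlonglongrightarrow> E x y"
      using that idx(1)[of y] by (auto simp: E_def intro!: tendsto_intros)
    moreover have "(\<lambda>k. gauss_power \<alpha> (ebar * X k m) y) \<longlonglongrightarrow> gauss_power \<alpha> (ebar * x m) y"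
      unfolding gauss_power_def using that[of m] by (intro tendsto_intros) auto
    ultimately show ?thesis unfolding D_def by (rule tendsto_mult)
  qed
  have lim_ok: "ok x" if "\<And>k. ok (X k)" "\<And>j. j < m + 1 \<Longrightarrow> (\<lambda>k. X k j) \<longlonglongrightarrow> x j" for X x
    unfolding ok_def
  proof (intro allI impI)
    fix j assume j: "j < m + 1"
    then have "0 \<le> X k j" "X k j \<le> 1" for k using that(1) by (auto simp: ok_def)
    then show "0 \<le> x j \<and> x j \<le> 1" using LIMSEQ_le_const[OF that(2)[OF j], of 0] LIMSEQ_le_const2[OF that(2)[OF j], of 1] by blast
  qed
  obtain v where v: "\<And>i. i < m + 1 \<Longrightarrow> 0 \<le> v i \<and> v i \<le> 1" and vfix: "\<And>i. i < m + 1 \<Longrightarrow> F v i = v i"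
  proof (rule brouwer_cube_seq[of "m + 1" F])
    fix x :: "nat \<Rightarrow> real" and i :: nat assume "\<And>j. j < m + 1 \<Longrightarrow> 0 \<le> x j \<and> x j \<le> 1" "i < m + 1"
    then have "ok x" by (auto simp: ok_def)
    then interpret D: radial_density \<alpha> "D x" by (intro RD(1))
    show "0 \<le> F x i \<and> F x i \<le> 1"
      using D.pot_nonneg g by (auto simp: F_def)
  next
    fix X :: "nat \<Rightarrow> nat \<Rightarrow> real" and x i assume X: "\<And>k j. j < m + 1 \<Longrightarrow> 0 \<le> X k j \<and> X k j \<le> 1" and lim: "\<And>j. j < m + 1 \<Longrightarrow> (\<lambda>k. X k j) \<longlonglongrightarrow> x j" and i: "i < m + 1"
    have okX: "ok (X k)" for k using X by (auto simp: ok_def)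
    have okx: "ok x" by (rule lim_ok[OF okX lim])
    have RDX: "radial_density \<alpha> (D (X k))" for k by (rule RD(1)[OF okX])
    have RDx: "radial_density \<alpha> (D x)" by (rule RD(1)[OF okx])
    have "(\<lambda>k. radial_density.pot (D (X k)) z) \<longlonglongrightarrow> radial_density.pot (D x) z" for z
      using lim_D[OF lim] DB[OF okX] DB[OF okx] by (intro potential_tendsto[OF RDX RDx, where M=B]) auto
    moreover have "(\<lambda>k. \<integral>y. D (X k) y \<partial>lborel) \<longlonglongrightarrow> (\<integral>y. D x y \<partial>lborel)"
    proof (rule integral_dominated_convergence[OF _ _ Bi])
      show "D x \<in> borel_measurable lborel" "D (X k) \<in> borel_measurable lborel" for k
        using radial_density.meas[OF RDx] radial_density.meas[OF RDX] by auto
      show "AE y in lborel. (\<lambda>k. D (X k) y) \<longlonglongrightarrow> D x y" using lim_D[OF lim] by simp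
      show "AE y in lborel. norm (D (X k) y) \<le> norm_power \<alpha> y * indicator (cball 0 (real N)) y" for k
        using RD(3)[OF okX] radial_density.nonneg[OF RDX] by simp
    qed
    ultimately show "(\<lambda>k. F (X k) i) \<longlonglongrightarrow> F x i"
      using g lim[of m] by (auto simp: F_def intro!: tendsto_intros)
  qed auto
  have okv: "ok v" using v by (auto simp: ok_def)
  note RDv = RD(1)[OF okv]
  define e where "e = ebar * v m"
  define M where "M = (\<integral>y. D v y \<partial>lborel)"
  have fm: "max 0 (min 1 (v m + (M - L))) = v m" using vfix[of m] by (simp add: F_def M_def)
  have vm: "0 \<le> v m" "v m \<le> 1" using v[of m] by auto
  \<comment> \<open>Too much mass at a fixed point forces the clamp at 1, that is e =
    \<open>ebar\<close>, where the barrier already has mass below L.\<close>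
  have Mle: "M \<le> L"
  proof (rule ccontr)
    assume "\<not> ?thesis"
    then have "v m = 1" using fm vm by (auto simp: max_def min_def split: if_splits)
    then have "M \<le> (\<integral>y. gauss_power \<alpha> ebar (y :: 'a) \<partial>lborel)"
      unfolding M_def using RD(2)[OF okv] radial_density.int[OF RDv] gauss_power_integrable[OF a ebar(1), where 'a='a]
      by (intro integral_mono) auto
    then show False using ebar \<open>\<not> M \<le> L\<close> by simp
  qed
  \<comment> \<open>With positive e a deficit of mass would strictly lower the last
    coordinate.\<close>
  have M2: "0 < e \<longrightarrow> M = L"
  proof
    assume "0 < e"
    then have "0 < v m" using ebar by (simp add: e_def zero_less_mult_iff)
    then show "M = L" using fm Mle vm by (auto simp: max_def min_def split: if_splits)
  qed
  have lev: "\<exists>r. norm y \<le> r \<and> r \<le> norm y + 1 / real N \<and> D v y = exp (- radial_density.pot (D v) (r *\<^sub>R b) / \<gamma>) ^ DIM('a) * gauss_power \<alpha> e y"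
    if y: "y \<noteq> 0" "norm y \<le> real N" for y
  proof (intro exI conjI)
    show "norm y \<le> (real (idx y) + 1) / N" "(real (idx y) + 1) / N \<le> norm y + 1 / real N" using idx[OF y] by auto
    have "v (idx y) = exp (- radial_density.pot (D v) (((real (idx y) + 1) / N) *\<^sub>R b) / \<gamma>)"
      using vfix[of "idx y"] idx(1)[OF y] by (simp add: F_def)
    then show "D v y = exp (- radial_density.pot (D v) (((real (idx y) + 1) / N) *\<^sub>R b) / \<gamma>) ^ DIM('a) * gauss_power \<alpha> e y"
      using y by (simp add: D_def E_def e_def)
  qed
  have eb: "0 \<le> e" "e \<le> ebar" using vm ebar by (auto simp: e_def mult_left_le)
  have Dg: "D v y \<le> gauss_power \<alpha> e y" for y using RD(2)[OF okv] by (simp add: e_def)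
  show ?thesis
  proof (rule exI[of _ "D v"], rule exI[of _ e], intro conjI allI impI)
    show "(\<integral>y. D v y \<partial>lborel) = L" if "0 < e" using M2 that by (simp add: M_def)
  qed (use RDv Mle eb Dg lev in \<open>simp_all add: M_def\<close>)
qed

subsection \<open>Passage to the limit\<close>

lemma (in radial_density) pot_decay:
  assumes "0 < r" "r \<le> r'" "norm b = 1"
  shows "pot (r *\<^sub>R b) \<le> pot (r' *\<^sub>R b)" "pot (r' *\<^sub>R b) \<le> pot (r *\<^sub>R b) + ln (r' / r) * (\<integral>y. f y \<partial>lborel)"
  using pot_scale[of "r' / r" "r *\<^sub>R b"] assms by auto

text \<open>A Helly-type selection: the radial profiles are decreasing and cannot decrease faster
  than a fixed power, uniformly in N. Convergence on the rationals therefore extends to all positive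
  radii, and the potentials converge by \<open>potential_tendsto\<close>.\<close>

lemma exists_self_consistent_density:
  fixes \<alpha> \<gamma> L :: real
  assumes dim: "2 \<le> DIM('a::euclidean_space)" and a: "-1 < \<alpha>" and g: "0 < \<gamma>" and L: "0 < L"
  shows "\<exists>f e. radial_density \<alpha> (f :: 'a \<Rightarrow> real) \<and> 0 \<le> e \<and> (\<integral>y. f y \<partial>lborel) \<le> L \<and> (0 < e \<longrightarrow> (\<integral>y. f y \<partial>lborel) = L)
     \<and> (\<forall>y. f y = norm y powr (real DIM('a) * \<alpha>) * exp (real DIM('a) * (- radial_density.pot f y / \<gamma> - e * (norm y)^2)))"
proof -
  obtain b :: 'a where b: "b \<in> Basis" using nonempty_Basis by blast
  have nb: "norm b = 1" using b by simp
  obtain ebar where ebar: "0 < ebar" "(\<integral>y. gauss_power \<alpha> ebar (y :: 'a) \<partial>lborel) < L"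
    using gauss_power_mass_small[OF a L, where 'a='a] by blast
  define good where "good N f e \<longleftrightarrow> radial_density \<alpha> f \<and> 0 \<le> e \<and> e \<le> ebar \<and> (\<integral>y. f y \<partial>lborel) \<le> L \<and> (0 < e \<longrightarrow> (\<integral>y. f y \<partial>lborel) = L)
     \<and> (\<forall>y::'a. f y \<le> gauss_power \<alpha> e y)
     \<and> (\<forall>y::'a. y \<noteq> 0 \<and> norm y \<le> real (Suc N) \<longrightarrow> (\<exists>r. norm y \<le> r \<and> r \<le> norm y + 1 / real (Suc N)
          \<and> f y = exp (- radial_density.pot f (r *\<^sub>R b) / \<gamma>) ^ DIM('a) * gauss_power \<alpha> e y))" for N f e
  have "\<exists>f e. good N f e" for N
    unfolding good_def by (rule finite_level_fixed_point[OF dim a g L ebar]) simp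
  then obtain fs es where "\<And>N. good N (fs N) (es N)" by metis
  then have fs: "radial_density \<alpha> (fs N)" and es: "0 \<le> es N" "es N \<le> ebar" and mass: "(\<integral>y. fs N y \<partial>lborel) \<le> L"
    and mass_eq: "0 < es N \<Longrightarrow> (\<integral>y. fs N y \<partial>lborel) = L" and fs_le: "fs N y \<le> gauss_power \<alpha> (es N) y"
    and fs_eq: "y \<noteq> 0 \<Longrightarrow> norm y \<le> real (Suc N) \<Longrightarrow> \<exists>r. norm y \<le> r \<and> r \<le> norm y + 1 / real (Suc N)
          \<and> fs N y = exp (- radial_density.pot (fs N) (r *\<^sub>R b) / \<gamma>) ^ DIM('a) * gauss_power \<alpha> (es N) y" for N y
    unfolding good_def by blast+
  \<comment> \<open>Over a ratio k of radii \<open>pot\<close> grows by at most L ln k, so the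
    profile exp (- pot / \<gamma>) loses at most the factor k^p.\<close>
  define p where "p = L / \<gamma>"
  have p: "p > 0" using L g by (simp add: p_def)
  define P where "P N r = exp (- radial_density.pot (fs N) (r *\<^sub>R b) / \<gamma>)" for N r
  have P01: "0 < P N r" "P N r \<le> 1" for N r
    using radial_density.pot_nonneg[OF fs, of N "r *\<^sub>R b"] g by (auto simp: P_def)
  have P_mono: "P N r' \<le> P N r" "(r / r') powr p * P N r \<le> P N r'" if "0 < r" "r \<le> r'" for N r r'
  proof -
    interpret N: radial_density \<alpha> "fs N" by (rule fs)
    note d = N.pot_decay[OF that nb]
    show "P N r' \<le> P N r" using d(1) g by (simp add: P_def divide_right_mono)
    have l: "0 \<le> ln (r' / r)" using that by simp
    have "N.pot (r' *\<^sub>R b) / \<gamma> \<le> (N.pot (r *\<^sub>R b) + ln (r' / r) * L) / \<gamma>"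
      using d(2) mult_left_mono[OF mass l, of N] g by (intro divide_right_mono) auto
    also have "\<dots> = N.pot (r *\<^sub>R b) / \<gamma> + p * ln (r' / r)" by (simp add: p_def add_divide_distrib)
    finally have "- (p * ln (r' / r)) - N.pot (r *\<^sub>R b) / \<gamma> \<le> - N.pot (r' *\<^sub>R b) / \<gamma>" by simp
    then have "exp (- (p * ln (r' / r)) - N.pot (r *\<^sub>R b) / \<gamma>) \<le> P N r'" unfolding P_def by simp
    moreover have "exp (- (p * ln (r' / r)) - N.pot (r *\<^sub>R b) / \<gamma>) = (r / r') powr p * P N r"
      using that by (simp add: P_def powr_def ln_div exp_add[symmetric] algebra_simps)
    ultimately show "(r / r') powr p * P N r \<le> P N r'" by simp
  qed
  \<comment> \<open>A negative argument encodes the normalised parameter \<open>es N / ebar\<close>,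
    so one extraction over the rationals treats it along with the profiles.\<close>
  define H where "H N r = (if r < 0 then es N / ebar else P N r)" for N r
  obtain k where k: "strict_mono k" and convQ: "\<And>r. r \<in> \<rat> \<Longrightarrow> \<exists>l. (\<lambda>j. H (k j) r) \<longlonglongrightarrow> l"
  proof (rule function_convergent_subsequence[of "\<rat>" H 1])
    show "countable (\<rat> :: real set)" by (rule countable_rat)
    show "norm (H n x) \<le> 1" for n x
      using P01[of n x] es[of n] ebar by (auto simp: H_def)
  qed blast
  have "\<exists>l. (\<lambda>j. P (k j) r) \<longlonglongrightarrow> l" if r: "0 < r" for r
  proof -
    have "Cauchy (\<lambda>j. P (k j) r)"
    proof (rule metric_CauchyI)
      fix d :: real assume d: "0 < d"
      have "((\<lambda>q. (q / r) powr p) \<longlongrightarrow> (r / r) powr p) (at_left r)"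
        using r by (intro tendsto_intros) auto
      \<comment> \<open>Looks for a ratio t = r / s above 1 with 1 - t^(-2p) < d / 2. Radii q < r <
        q' within a factor t of r satisfy q / q' \<ge> t^(-2), so every profile drops by less than d
        / 2 between them.\<close>
      then have "((\<lambda>q. (r / q) powr (- p) * (r / q) powr (- p)) \<longlongrightarrow> (r / r) powr (- p) * (r / r) powr (- p)) (at_left r)"
        using r by (intro tendsto_intros) auto
      then have "\<forall>\<^sub>F q in at_left r. dist ((r / q) powr (- p) * (r / q) powr (- p)) 1 < d / 2"
        using d r by (intro tendstoD) auto
      moreover have "\<forall>\<^sub>F q in at_left r. q \<in> {0<..<r}" using r by (rule eventually_at_left_real)
      ultimately have "\<forall>\<^sub>F q in at_left r. dist ((r / q) powr (- p) * (r / q) powr (- p)) 1 < d / 2 \<and> q \<in> {0<..<r}"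
        by eventually_elim auto
      then obtain c where c: "c < r" and cq: "\<And>q. c < q \<Longrightarrow> q < r \<Longrightarrow> dist ((r / q) powr (- p) * (r / q) powr (- p)) 1 < d / 2 \<and> q \<in> {0<..<r}"
        by (auto simp: eventually_at_left_field)
      obtain s where s: "c < s" "s < r" using dense[OF c] by blast
      have s0: "0 < s" using cq[OF s] by simp
      define t where "t = r / s"
      have t: "1 < t" "dist (t powr (- p) * t powr (- p)) 1 < d / 2" using cq[OF s] s s0 by (auto simp: t_def)
      have "r / t < r" "r < r * t" using t r by (auto simp: divide_less_eq)
      then obtain q q' where q: "q \<in> \<rat>" "r / t < q" "q < r" and q': "q' \<in> \<rat>" "r < q'" "q' < r * t"
        using Rats_dense_in_real[of "r / t" r] Rats_dense_in_real[of r "r * t"] by auto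
      have q0: "0 < q" using q(2) t r by (smt (verit) divide_pos_pos)
      have gap: "P N q - P N q' \<le> d / 2" for N
      proof -
        have "(q / q') powr p * P N q \<le> P N q'" using q q' q0 by (intro P_mono) auto
        then have "P N q - P N q' \<le> P N q * (1 - (q / q') powr p)" by (simp add: algebra_simps)
        also have "\<dots> \<le> 1 * (1 - (q / q') powr p)"
          using P01[of N q] q q' q0 p by (intro mult_right_mono) (auto simp: powr_le_one_le intro!: powr_le1)
        also have "(1 / t * (1 / t)) powr p \<le> (q / q') powr p"
        proof (rule powr_mono2)
          have "r / t / (r * t) \<le> q / q'" using q q' q0 r t by (intro frac_le) auto
          then show "1 / t * (1 / t) \<le> q / q'" using r t by (simp add: field_simps)
        qed (use p t in auto)
        then have "1 * (1 - (q / q') powr p) \<le> 1 - t powr (- p) * t powr (- p)"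
          using t by (simp add: powr_mult powr_divide powr_minus_divide)
        also have "\<dots> \<le> d / 2" using t(2) by (simp add: dist_real_def abs_if split: if_splits)
        finally show ?thesis .
      qed
      obtain l where "(\<lambda>j. H (k j) q) \<longlonglongrightarrow> l" using convQ[OF q(1)] by blast
      then have "(\<lambda>j. P (k j) q) \<longlonglongrightarrow> l" using q0 by (simp add: H_def)
      then have "Cauchy (\<lambda>j. P (k j) q)" by (rule LIMSEQ_imp_Cauchy)
      from metric_CauchyD[OF this, of "d / 2"] d obtain M where M: "\<And>i j. i \<ge> M \<Longrightarrow> j \<ge> M \<Longrightarrow> dist (P (k i) q) (P (k j) q) < d / 2" by auto
      have up: "P (k i) r - P (k j) r < d" if "i \<ge> M" "j \<ge> M" for i j
      proof -
        have "P (k i) r \<le> P (k i) q" "P (k j) q' \<le> P (k j) r" using q q' q0 r by (auto intro: P_mono)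
        then show ?thesis using M[OF that] gap[of "k j"] by (simp add: dist_real_def abs_if split: if_splits)
      qed
      then show "\<exists>M. \<forall>i\<ge>M. \<forall>j\<ge>M. dist (P (k i) r) (P (k j) r) < d"
        by (intro exI[of _ M]) (auto simp: dist_real_def abs_if)
    qed
    then show ?thesis by (simp add: Cauchy_convergent_iff convergent_def)
  qed
  then obtain G where G: "\<And>r. 0 < r \<Longrightarrow> (\<lambda>j. P (k j) r) \<longlonglongrightarrow> G r" by metis
  obtain e0 where "(\<lambda>j. H (k j) (-1)) \<longlonglongrightarrow> e0" using convQ[of "-1"] by auto
  then have "(\<lambda>j. es (k j) / ebar * ebar) \<longlonglongrightarrow> e0 * ebar" by (intro tendsto_mult_right) (simp add: H_def)
  then obtain e where e: "(\<lambda>j. es (k j)) \<longlonglongrightarrow> e" using ebar by auto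
  have e0: "0 \<le> e" using e es by (intro LIMSEQ_le_const) auto
  \<comment> \<open>The value at 0 is the one dictated by \<open>0 powr a = 0\<close> in the
    identity to be proved.\<close>
  define f where "f y = (if y = 0 then 0 else G (norm y) ^ DIM('a) * gauss_power \<alpha> e y)" for y :: 'a
  have lim: "(\<lambda>j. fs (k j) y) \<longlonglongrightarrow> f y" if y: "y \<noteq> 0" for y
  proof -
    have y0: "0 < norm y" using y by simp
    have evN: "\<forall>\<^sub>F j in sequentially. norm y \<le> real (Suc (k j))"
    proof -
      obtain n where n: "norm y \<le> real n" using real_arch_simple by blast
      have "n \<le> Suc (k j)" if "j \<ge> n" for j using seq_suble[OF k, of j] that by simp
      then have "norm y \<le> real (Suc (k j))" if "j \<ge> n" for j using n that by (meson of_nat_le_iff order_trans)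
      then show ?thesis unfolding eventually_sequentially by blast
    qed
    have "(\<lambda>j. fs (k j) y) \<longlonglongrightarrow> G (norm y) ^ DIM('a) * gauss_power \<alpha> e y"
    proof (rule tendsto_sandwich)
      \<comment> \<open>The profile is sampled at some radius between |y| and |y| + 1 / (N + 1).
        Monotonicity bounds the sample above by the profile at |y|, the power estimate bounds it
        below, and the gap closes.\<close>
      define lo where "lo j = ((norm y / (norm y + 1 / real (Suc (k j)))) powr p * P (k j) (norm y)) ^ DIM('a) * gauss_power \<alpha> (es (k j)) y" for j
      have inv0: "(\<lambda>j. 1 / real (Suc (k j))) \<longlonglongrightarrow> 0"
        using LIMSEQ_subseq_LIMSEQ[OF LIMSEQ_Suc[OF lim_1_over_n] k] by (simp add: o_def)
      have gwl: "(\<lambda>j. gauss_power \<alpha> (es (k j)) y) \<longlonglongrightarrow> gauss_power \<alpha> e y" unfolding gauss_power_def by (intro tendsto_intros e)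
      have "lo \<longlonglongrightarrow> ((norm y / (norm y + 0)) powr p * G (norm y)) ^ DIM('a) * gauss_power \<alpha> e y"
        unfolding lo_def using y0 by (intro tendsto_intros inv0 G gwl) auto
      then show "lo \<longlonglongrightarrow> G (norm y) ^ DIM('a) * gauss_power \<alpha> e y" using y0 by simp
      show "(\<lambda>j. P (k j) (norm y) ^ DIM('a) * gauss_power \<alpha> (es (k j)) y) \<longlonglongrightarrow> G (norm y) ^ DIM('a) * gauss_power \<alpha> e y"
        using y0 by (intro tendsto_intros G gwl)
      have gw0: "0 \<le> gauss_power \<alpha> c y" for c unfolding gauss_power_def by (intro mult_nonneg_nonneg norm_power_nonneg) auto
      have both: "lo j \<le> fs (k j) y \<and> fs (k j) y \<le> P (k j) (norm y) ^ DIM('a) * gauss_power \<alpha> (es (k j)) y" if jn: "norm y \<le> real (Suc (k j))" for j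
      proof -
        obtain r where r: "norm y \<le> r" "r \<le> norm y + 1 / real (Suc (k j))" and eq: "fs (k j) y = P (k j) r ^ DIM('a) * gauss_power \<alpha> (es (k j)) y"
          using fs_eq[OF y jn] unfolding P_def by blast
        have p1: "P (k j) r \<le> P (k j) (norm y)" and p2: "(norm y / r) powr p * P (k j) (norm y) \<le> P (k j) r"
          using P_mono[OF y0 r(1)] by auto
        have r0: "0 < r" using r(1) y0 by linarith
        have q: "(norm y / (norm y + 1 / real (Suc (k j)))) powr p * P (k j) (norm y) \<le> (norm y / r) powr p * P (k j) (norm y)"
          using r p P01[of "k j" "norm y"] by (intro mult_right_mono powr_mono2 frac_le r0) (auto simp: less_imp_le)
        have l0: "0 \<le> (norm y / (norm y + 1 / real (Suc (k j)))) powr p * P (k j) (norm y)"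
          using P01[of "k j" "norm y"] by (auto simp: less_imp_le)
        show ?thesis unfolding lo_def eq
          using order_trans[OF q p2] p1 P01[of "k j"] gw0 l0
          by (intro conjI mult_right_mono power_mono) (auto simp: less_imp_le)
      qed
      show "\<forall>\<^sub>F j in sequentially. lo j \<le> fs (k j) y" "\<forall>\<^sub>F j in sequentially. fs (k j) y \<le> P (k j) (norm y) ^ DIM('a) * gauss_power \<alpha> (es (k j)) y"
        using evN both by (auto elim: eventually_mono)
    qed
    then show ?thesis using y by (simp add: f_def)
  qed
  have limAE: "AE y in lborel. (\<lambda>j. fs (k j) y) \<longlonglongrightarrow> f y"
    using AE_lborel_singleton[of "0::'a"] by eventually_elim (rule lim)
  have G01: "0 \<le> G r" "G r \<le> 1" if "0 < r" for r
    using LIMSEQ_le_const[OF G[OF that], of 0] LIMSEQ_le_const2[OF G[OF that], of 1] P01 by (auto intro: less_imp_le)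
  have gw0: "0 \<le> gauss_power \<alpha> c y" for c and y :: 'a unfolding gauss_power_def by (intro mult_nonneg_nonneg norm_power_nonneg) auto
  have gpw: "gauss_power \<alpha> e y \<le> norm_power \<alpha> y" for y :: 'a using norm_power_nonneg[of \<alpha> y] e0 by (simp add: gauss_power_def mult_left_le)
  have f0: "0 \<le> f y" for y using G01[of "norm y"] gw0 by (auto simp: f_def)
  have f_gw: "f y \<le> gauss_power \<alpha> e y" for y
  proof (cases "y = 0")
    case False
    then have "G (norm y) ^ DIM('a) \<le> 1" using G01[of "norm y"] by (intro power_le_one) auto
    then show ?thesis using mult_right_mono[OF _ gw0[of e y], of "G (norm y) ^ DIM('a)" 1] False by (simp add: f_def)
  qed (simp add: f_def gw0)
  have fm[measurable]: "f \<in> borel_measurable borel"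
  proof (rule borel_measurable_LIMSEQ_real)
    show "(\<lambda>j. if y = 0 then 0 else fs (k j) y) \<longlonglongrightarrow> f y" for y using lim[of y] by (auto simp: f_def)
    show "(\<lambda>y. if y = 0 then 0 else fs (k j) y) \<in> borel_measurable borel" for j
    proof -
      have [measurable]: "fs (k j) \<in> borel_measurable borel" by (rule radial_density.meas[OF fs])
      show ?thesis by measurable
    qed
  qed
  \<comment> \<open>Mass may escape to infinity along the sequence, so only an upper bound survives
    in general.\<close>
  have fatou: "(\<integral>\<^sup>+y. ennreal (f y) \<partial>lborel) \<le> ennreal L"
  proof -
    have "(\<integral>\<^sup>+y. ennreal (f y) \<partial>lborel) = (\<integral>\<^sup>+y. liminf (\<lambda>j. ennreal (fs (k j) y)) \<partial>lborel)"
    proof (rule nn_integral_cong_AE)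
      show "AE y in lborel. ennreal (f y) = liminf (\<lambda>j. ennreal (fs (k j) y))"
        using limAE by eventually_elim (intro lim_imp_Liminf[symmetric] tendsto_ennrealI, auto)
    qed
    also have "\<dots> \<le> liminf (\<lambda>j. \<integral>\<^sup>+y. ennreal (fs (k j) y) \<partial>lborel)"
      using radial_density.meas[OF fs] by (intro nn_integral_liminf) auto
    also have "\<dots> \<le> liminf (\<lambda>j. ennreal L)"
    proof (rule Liminf_mono, rule always_eventually, rule allI)
      fix j
      show "(\<integral>\<^sup>+y. ennreal (fs (k j) y) \<partial>lborel) \<le> ennreal L"
        using radial_density.int[OF fs, of "k j"] radial_density.nonneg[OF fs, of "k j"] mass[of "k j"]
        by (subst nn_integral_eq_integral) (auto intro: ennreal_leI)
    qed
    also have "\<dots> = ennreal L" by (simp add: Liminf_const)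
    finally show ?thesis .
  qed
  have fint: "integrable lborel f"
    using fatou f0 by (intro integrableI_nonneg) (auto intro: order.strict_trans1)
  have fL: "(\<integral>y. f y \<partial>lborel) \<le> L"
    using fatou f0 L by (subst (asm) nn_integral_eq_integral[OF fint]) auto
  have rd: "radial_density \<alpha> f"
  proof
    show "radial f" unfolding radial_def f_def gauss_power_def norm_power_def by (metis norm_eq_zero)
    show "f y \<le> norm y powr (real DIM('a) * \<alpha>)" for y using order_trans[OF f_gw gpw] by (simp add: norm_power_def)
  qed (use dim a fint f0 in auto)
  interpret f: radial_density \<alpha> f by (rule rd)
  have potlim: "(\<lambda>j. radial_density.pot (fs (k j)) x) \<longlonglongrightarrow> f.pot x" for x
    by (rule potential_tendsto[OF fs rd limAE mass fL])
  have Geq: "G r = exp (- f.pot (r *\<^sub>R b) / \<gamma>)" if "0 < r" for r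
  proof (rule LIMSEQ_unique[OF G[OF that]])
    show "(\<lambda>j. P (k j) r) \<longlonglongrightarrow> exp (- f.pot (r *\<^sub>R b) / \<gamma>)"
      unfolding P_def using g by (intro tendsto_intros potlim) auto
  qed
  have feq: "f y = norm y powr (real DIM('a) * \<alpha>) * exp (real DIM('a) * (- f.pot y / \<gamma> - e * (norm y)^2))" for y
  proof (cases "y = 0")
    case False
    then have "G (norm y) = exp (- f.pot y / \<gamma>)"
      using Geq[of "norm y"] f.pot_radial[of "norm y *\<^sub>R b" y] nb by simp
    then have "f y = exp (real DIM('a) * (- f.pot y / \<gamma>)) * (norm y powr (real DIM('a) * \<alpha>) * exp (- real DIM('a) * (e * (norm y)^2)))"
      using False by (simp add: f_def gauss_power_def norm_power_def exp_of_nat_mult[symmetric])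
    also have "\<dots> = norm y powr (real DIM('a) * \<alpha>) * (exp (real DIM('a) * (- f.pot y / \<gamma>)) * exp (- real DIM('a) * (e * (norm y)^2)))"
      by (simp only: mult_ac)
    also have "exp (real DIM('a) * (- f.pot y / \<gamma>)) * exp (- real DIM('a) * (e * (norm y)^2)) = exp (real DIM('a) * (- f.pot y / \<gamma> - e * (norm y)^2))"
      by (simp add: exp_add[symmetric] right_diff_distrib)
    finally show ?thesis .
  qed (simp add: f_def)
  \<comment> \<open>Eventually the parameters exceed e / 2, so the barrier with e / 2 is an
    integrable majorant on the whole space. The parameters are then also positive, so the
    approximating masses equal L.\<close>
  have "(\<integral>y. f y \<partial>lborel) = L" if ep: "0 < e"
  proof -
    have "\<forall>\<^sub>F j in sequentially. e / 2 < es (k j)" using e ep by (intro order_tendstoD) auto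
    then obtain j0 where j0: "\<And>j. j \<ge> j0 \<Longrightarrow> e / 2 < es (k j)" unfolding eventually_sequentially by blast
    have "(\<lambda>j. \<integral>y. fs (k (j + j0)) y \<partial>lborel) \<longlonglongrightarrow> (\<integral>y. f y \<partial>lborel)"
    proof (rule integral_dominated_convergence)
      show "integrable lborel (gauss_power \<alpha> (e / 2) :: 'a \<Rightarrow> real)" using a ep by (intro gauss_power_integrable) auto
      show "AE y in lborel. (\<lambda>j. fs (k (j + j0)) y) \<longlonglongrightarrow> f y"
        using limAE by eventually_elim (rule LIMSEQ_ignore_initial_segment)
      show "AE y in lborel. norm (fs (k (j + j0)) y) \<le> gauss_power \<alpha> (e / 2) y" for j
      proof (rule AE_I2)
        fix y :: 'a
        have "fs (k (j + j0)) y \<le> gauss_power \<alpha> (es (k (j + j0))) y" by (rule fs_le)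
        also have "\<dots> \<le> gauss_power \<alpha> (e / 2) y" using j0[of "j + j0"] by (intro gauss_power_mono) auto
        finally show "norm (fs (k (j + j0)) y) \<le> gauss_power \<alpha> (e / 2) y" using radial_density.nonneg[OF fs] by simp
      qed
    qed (use radial_density.meas[OF fs] in auto)
    moreover have "(\<integral>y. fs (k (j + j0)) y \<partial>lborel) = L" for j
      using j0[of "j + j0"] ep by (intro mass_eq) auto
    ultimately show ?thesis by (simp add: LIMSEQ_const_iff)
  qed
  then show ?thesis using rd e0 fL feq by blast
qed

subsection \<open>Weak solutions\<close>

lemma le_one_plus_sq: "t \<le> 1 + t^2" for t :: real
  using zero_le_power2[of "t - 1 / 2"] by (simp add: power2_diff power_divide)

lemma ln_add_diff_le:
  fixes x y :: real
  assumes "0 \<le> x" "0 < y"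
  shows "ln (x + y) - ln y \<le> x / y"
proof -
  have "ln (x + y) - ln y = ln ((x + y) / y)" using assms ln_div[of "x + y" y] by simp
  also have "(x + y) / y = 1 + x / y" using assms by (simp add: add_divide_distrib)
  also have "ln (1 + x / y) \<le> x / y" using assms by (intro ln_add_one_self_le_self) simp
  finally show ?thesis .
qed

lemma iter_dderiv_outside_ball:
  fixes f :: "'a::euclidean_space \<Rightarrow> real"
  assumes "\<And>x. norm x > R \<Longrightarrow> f x = 0" and "norm x > R"
  shows "iter_dderiv vs f x = 0"
  using assms(2)
proof (induction vs arbitrary: x)
  case (Cons v vs)
  have "open (- cball (0::'a) R)" by (simp add: open_Compl)
  moreover have "x \<in> - cball 0 R" using Cons.prems by simp
  moreover have "0 = iter_dderiv vs f y" if "y \<in> - cball 0 R" for y using Cons.IH[of y] that by simp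
  ultimately have "(iter_dderiv vs f has_derivative (\<lambda>_. 0)) (at x)"
    by (rule has_derivative_transform_within_open[OF has_derivative_const])
  then show ?case using frechet_derivative_at[of "iter_dderiv vs f"] by (simp add: dderiv_def)
qed (use assms(1) in simp)

text \<open>Allows both parities of the dimension to be settled with Schwartz functions.\<close>

lemma test_fun_schwartz:
  fixes f :: "'a::euclidean_space \<Rightarrow> real"
  assumes "test_fun f"
  shows "schwartz f"
proof -
  have s: "smooth_fun f" using assms by (simp add: test_fun_def)
  obtain R where R: "\<And>x. f x \<noteq> 0 \<Longrightarrow> norm x \<le> R"
    using assms unfolding test_fun_def bounded_iff by blast
  have out: "norm x > R \<Longrightarrow> f x = 0" for x :: 'a using R[of x] by linarith
  have "bounded (range (\<lambda>x. norm x ^ k * iter_dderiv vs f x))" if vs: "set vs \<subseteq> Basis" for vs k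
  proof -
    have "continuous_on UNIV (iter_dderiv vs f)"
      using s vs unfolding smooth_fun_def by (intro differentiable_imp_continuous_on) (simp add: differentiable_on_def)
    then have "continuous_on (cball 0 R) (\<lambda>x. norm x ^ k * iter_dderiv vs f x)"
      by (intro continuous_intros) (auto elim: continuous_on_subset)
    then have "bounded (insert 0 ((\<lambda>x. norm x ^ k * iter_dderiv vs f x) ` cball 0 R))"
      using compact_continuous_image compact_imp_bounded by (metis bounded_insert compact_cball)
    moreover have "norm x ^ k * iter_dderiv vs f x \<in> insert 0 ((\<lambda>x. norm x ^ k * iter_dderiv vs f x) ` cball 0 R)" for x
      using iter_dderiv_outside_ball[OF out, where x = x and vs = vs] by (cases "norm x \<le> R") auto
    ultimately show ?thesis by (meson bounded_subset image_subset_iff)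
  qed
  then show ?thesis using s unfolding schwartz_def by blast
qed

context radial_density
begin

lemma abs_log_ratio_le:
  assumes "y \<noteq> x" "y \<noteq> 0"
  shows "\<bar>log_ratio 0 x y\<bar> \<le> log_defect x y + (norm x + \<bar>ln (norm (0 - y)) * indicator (cball 0 1) y\<bar>)"
proof -
  have y: "0 < norm y" using assms by simp
  have d: "0 \<le> log_defect x y" using assms by (intro log_defect_nonneg) auto
  have "ln (norm x + norm y) - ln (norm y) \<le> norm x + \<bar>ln (norm y) * indicator (cball 0 1) y\<bar>"
  proof (cases "norm y \<le> 1")
    case True
    have "ln (norm x + norm y) \<le> norm x + norm y - 1" using y by (intro ln_le_minus_one) (simp add: add_nonneg_pos)
    then show ?thesis using True by simp
  next
    case False
    have "ln (norm x + norm y) - ln (norm y) \<le> norm x / norm y" using y by (intro ln_add_diff_le) auto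
    also have "\<dots> \<le> norm x" using False y by (simp add: divide_le_eq mult_le_cancel_left1)
    finally show ?thesis using False by simp
  qed
  moreover have "ln (norm y) \<le> ln (norm x + norm y)" using y by (simp add: add_nonneg_pos)
  ultimately show ?thesis using d unfolding log_ratio_def log_defect_def by simp
qed

text \<open>Crude linear growth suffices, as it will be integrated against a function with weight 1
  + |x|^2. The singularity at y = x is hidden in \<open>log_defect\<close>, whose integral is
  bounded uniformly in x; the one at y = 0 gives the constant \<open>A0\<close>.\<close>

lemma abs_log_ratio_integral_le:
  obtains A where "0 \<le> A" "\<And>x. (\<integral>y. \<bar>log_ratio 0 x y\<bar> * f y \<partial>lborel) \<le> A + mass * norm x"
proof
  have [measurable]: "cball (0::'a) 1 \<in> sets borel" by simp
  define A0 where "A0 = (\<integral>y. \<bar>ln (norm (0 - y)) * (f y * indicator (cball 0 1) y)\<bar> \<partial>lborel)"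
  have i0: "integrable lborel (\<lambda>y. \<bar>ln (norm (0 - y)) * (f y * indicator (cball 0 1) y)\<bar>)"
    using ln_near_integrable[of 1 0] by (intro integrable_abs) simp
  have A0: "0 \<le> A0" by (simp add: A0_def)
  show "0 \<le> ln 2 * mass + A0" using A0 mass_nonneg by simp
  fix x :: 'a
  have "ennreal (\<integral>y. \<bar>log_ratio 0 x y\<bar> * f y \<partial>lborel) = (\<integral>\<^sup>+y. ennreal (\<bar>log_ratio 0 x y\<bar> * f y) \<partial>lborel)"
    using integrable_norm[OF log_ratio0_integrable[of x]] nonneg
    by (intro nn_integral_eq_integral[symmetric]) (auto simp: abs_mult)
  also have "\<dots> \<le> (\<integral>\<^sup>+y. ennreal (log_defect x y * f y) + ennreal (norm x * f y + \<bar>ln (norm (0 - y)) * (f y * indicator (cball 0 1) y)\<bar>) \<partial>lborel)"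
  proof (rule nn_integral_mono_AE)
    show "AE y in lborel. ennreal (\<bar>log_ratio 0 x y\<bar> * f y) \<le> ennreal (log_defect x y * f y) + ennreal (norm x * f y + \<bar>ln (norm (0 - y)) * (f y * indicator (cball 0 1) y)\<bar>)"
      using AE_lborel_singleton[of x] AE_lborel_singleton[of 0]
    proof eventually_elim
      case (elim y)
      have "\<bar>log_ratio 0 x y\<bar> * f y \<le> (log_defect x y + (norm x + \<bar>ln (norm (0 - y)) * indicator (cball 0 1) y\<bar>)) * f y"
        using elim by (intro mult_right_mono abs_log_ratio_le nonneg) auto
      also have "\<dots> = log_defect x y * f y + (norm x * f y + \<bar>ln (norm (0 - y)) * (f y * indicator (cball 0 1) y)\<bar>)"
        using nonneg[of y] by (simp add: algebra_simps abs_mult)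
      finally show ?case using elim nonneg[of y] log_defect_nonneg[of x y]
        by (subst ennreal_plus[symmetric]) (auto intro!: ennreal_leI simp del: ennreal_plus)
    qed
  qed
  also have "\<dots> = (\<integral>\<^sup>+y. ennreal (log_defect x y * f y) \<partial>lborel) + (\<integral>\<^sup>+y. ennreal (norm x * f y + \<bar>ln (norm (0 - y)) * (f y * indicator (cball 0 1) y)\<bar>) \<partial>lborel)"
    by (rule nn_integral_add) measurable
  also have "(\<integral>\<^sup>+y. ennreal (norm x * f y + \<bar>ln (norm (0 - y)) * (f y * indicator (cball 0 1) y)\<bar>) \<partial>lborel) = ennreal (norm x * mass + A0)"
    using i0 int nonneg unfolding A0_def by (subst nn_integral_eq_integral) auto
  also have "(\<integral>\<^sup>+y. ennreal (log_defect x y * f y) \<partial>lborel) + ennreal (norm x * mass + A0) \<le> ennreal (ln 2 * mass) + ennreal (norm x * mass + A0)"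
    by (intro add_right_mono log_defect_integral_le)
  also have "\<dots> = ennreal (ln 2 * mass + A0 + mass * norm x)"
    using A0 mass_nonneg by (subst ennreal_plus[symmetric]) (auto simp: algebra_simps)
  finally show "(\<integral>y. \<bar>log_ratio 0 x y\<bar> * f y \<partial>lborel) \<le> ln 2 * mass + A0 + mass * norm x"
    using A0 mass_nonneg by (subst (asm) ennreal_le_iff) auto
qed

lemma pot_le_linear:
  obtains A where "0 \<le> A" "\<And>x. \<bar>pot x\<bar> \<le> A + mass * norm x"
proof -
  obtain A where A: "0 \<le> A" "\<And>x. (\<integral>y. \<bar>log_ratio 0 x y\<bar> * f y \<partial>lborel) \<le> A + mass * norm x"
    by (rule abs_log_ratio_integral_le) blast
  have "\<bar>pot x\<bar> \<le> (\<integral>y. \<bar>log_ratio 0 x y\<bar> * f y \<partial>lborel)" for x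
    using integral_norm_bound[of lborel "\<lambda>y. log_ratio 0 x y * f y"] nonneg by (simp add: pot_def abs_mult)
  then show ?thesis using that A order_trans by blast
qed

text \<open>Fubini and the fundamental-solution identity. The normalising term ln |y| of the kernel
  drops out because \<psi> has integral 0.\<close>

lemma pot_frac_lap:
  assumes dim3: "3 \<le> DIM('a)" and \<phi>: "schwartz \<phi>"
  defines "\<psi> \<equiv> frac_lap (real DIM('a) / 2) \<phi>"
  shows "integrable lborel (\<lambda>x. pot x * \<psi> x)" "(\<integral>x. pot x * \<psi> x \<partial>lborel) = - gamma_n DIM('a) * (\<integral>y. f y * \<phi> y \<partial>lborel)"
proof -
  note pr = frac_lap_properties[OF dim3 \<phi>, folded \<psi>_def]
  have [measurable]: "\<psi> \<in> borel_measurable borel" by (rule pr)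
  have wi: "integrable lborel (\<lambda>x. (1 + (norm x)^2) * \<psi> x)" by (rule pr)
  have \<psi>i: "integrable lborel \<psi>"
  proof (rule Bochner_Integration.integrable_bound[OF wi])
    have "1 * \<bar>\<psi> x\<bar> \<le> (1 + (norm x)^2) * \<bar>\<psi> x\<bar>" for x by (intro mult_right_mono) auto
    then show "AE x in lborel. norm (\<psi> x) \<le> norm ((1 + (norm x)^2) * \<psi> x)" by (simp add: abs_mult)
  qed measurable
  obtain A where A: "0 \<le> A" "\<And>x. (\<integral>y. \<bar>log_ratio 0 x y\<bar> * f y \<partial>lborel) \<le> A + mass * norm x"
    by (rule abs_log_ratio_integral_le) blast
  define K where "K x y = log_ratio 0 x y * f y * \<psi> x" for x y
  have Km: "(\<lambda>(x, y). K x y) \<in> borel_measurable (lborel \<Otimes>\<^sub>M lborel)"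
    unfolding K_def log_ratio_def split_beta by measurable
  have Kn: "(\<integral>y. norm (K x y) \<partial>lborel) = (\<integral>y. \<bar>log_ratio 0 x y\<bar> * f y \<partial>lborel) * \<bar>\<psi> x\<bar>" for x
    unfolding K_def using nonneg by (simp add: abs_mult)
  have Ki: "integrable (lborel \<Otimes>\<^sub>M lborel) (\<lambda>(x, y). K x y)"
  proof (rule lborel_pair.Fubini_integrable[OF Km])
    show "AE x in lborel. integrable lborel (\<lambda>y. case (x, y) of (x, y) \<Rightarrow> K x y)"
      using log_ratio0_integrable by (intro AE_I2) (simp add: K_def)
    have "integrable lborel (\<lambda>x. (\<integral>y. \<bar>log_ratio 0 x y\<bar> * f y \<partial>lborel) * \<bar>\<psi> x\<bar>)"
    proof (rule Bochner_Integration.integrable_bound)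
      show "integrable lborel (\<lambda>x. (A + mass) * ((1 + (norm x)^2) * \<psi> x))" using wi by simp
      show "(\<lambda>x. (\<integral>y. \<bar>log_ratio 0 x y\<bar> * f y \<partial>lborel) * \<bar>\<psi> x\<bar>) \<in> borel_measurable lborel"
        using Km unfolding Kn[symmetric] by (intro lborel.borel_measurable_lebesgue_integral) (simp add: split_beta)
      have "(\<integral>y. \<bar>log_ratio 0 x y\<bar> * f y \<partial>lborel) * \<bar>\<psi> x\<bar> \<le> (A + mass) * ((1 + (norm x)^2) * \<bar>\<psi> x\<bar>)" for x
      proof -
        have "norm x \<le> 1 + (norm x)^2" by (rule le_one_plus_sq)
        then have "A * 1 + mass * norm x \<le> A * (1 + (norm x)^2) + mass * (1 + (norm x)^2)"
          using A(1) mass_nonneg by (intro add_mono mult_left_mono) auto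
        then have "(\<integral>y. \<bar>log_ratio 0 x y\<bar> * f y \<partial>lborel) \<le> (A + mass) * (1 + (norm x)^2)"
          using A(2)[of x] by (simp add: algebra_simps)
        from mult_right_mono[OF this, of "\<bar>\<psi> x\<bar>"] show ?thesis by (simp add: mult_ac)
      qed
      moreover have "0 \<le> (\<integral>y. \<bar>log_ratio 0 x y\<bar> * f y \<partial>lborel)" for x using nonneg by simp
      ultimately show "AE x in lborel. norm ((\<integral>y. \<bar>log_ratio 0 x y\<bar> * f y \<partial>lborel) * \<bar>\<psi> x\<bar>) \<le> norm ((A + mass) * ((1 + (norm x)^2) * \<psi> x))"
        using A(1) mass_nonneg by (simp add: abs_mult)
    qed
    then show "integrable lborel (\<lambda>x. \<integral>y. norm (case (x, y) of (x, y) \<Rightarrow> K x y) \<partial>lborel)" by (simp add: Kn[unfolded real_norm_def])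
  qed
  have Kx: "(\<integral>y. K x y \<partial>lborel) = pot x * \<psi> x" for x unfolding K_def pot_def by simp
  show "integrable lborel (\<lambda>x. pot x * \<psi> x)"
    using lborel_pair.integrable_fst'[OF Ki] by (simp add: Kx)
  have Ky: "(\<integral>x. K x y \<partial>lborel) = - gamma_n DIM('a) * (f y * \<phi> y)" for y
  proof -
    have "(\<integral>x. K x y \<partial>lborel) = (\<integral>x. f y * (ln (norm (x - y)) * \<psi> x - ln (norm y) * \<psi> x) \<partial>lborel)"
      unfolding K_def log_ratio_def by (intro Bochner_Integration.integral_cong) (auto simp: algebra_simps)
    also have "\<dots> = f y * ((\<integral>x. ln (norm (x - y)) * \<psi> x \<partial>lborel) - ln (norm y) * (\<integral>x. \<psi> x \<partial>lborel))"
      using pr(6) \<psi>i by (simp add: Bochner_Integration.integral_diff)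
    also have "\<dots> = f y * (- gamma_n DIM('a) * \<phi> y)" by (simp only: pr(4,7) mult_zero_right diff_0_right)
    finally show ?thesis by simp
  qed
  have "(\<integral>x. pot x * \<psi> x \<partial>lborel) = (\<integral>y. (\<integral>x. K x y \<partial>lborel) \<partial>lborel)"
    using lborel_pair.Fubini_integral[OF Ki] by (simp add: Kx)
  then show "(\<integral>x. pot x * \<psi> x \<partial>lborel) = - gamma_n DIM('a) * (\<integral>y. f y * \<phi> y \<partial>lborel)" by (simp add: Ky)
qed

end

text \<open>The integrand is at most a multiple of (1 + |x|^2)^(1 - n), integrable because 2 (n - 1)
  > n for n > 2.\<close>

lemma L_s_quadratic_growth:
  fixes u :: "'a::euclidean_space \<Rightarrow> real"
  assumes dim: "3 \<le> DIM('a)" and [measurable]: "u \<in> borel_measurable borel" and le: "\<And>x. \<bar>u x\<bar> \<le> C * (1 + (norm x)^2)"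
  shows "L_s (real DIM('a) / 2) u"
  unfolding L_s_def
proof (rule Bochner_Integration.integrable_bound)
  define n where "n = DIM('a)"
  show "integrable lborel (\<lambda>x::'a. C * 2 ^ n * (1 + (norm x)^2) powr (- (real n - 1)))"
    using dim by (intro integrable_mult_right integrable_one_plus_norm_sq_powr) (simp add: n_def)
  have C: "0 \<le> C" using le[of 0] by simp
  show "AE x in lborel. norm (\<bar>u x\<bar> / (1 + norm x powr (real DIM('a) + 2 * (real DIM('a) / 2)))) \<le> norm (C * 2 ^ n * (1 + (norm x)^2) powr (- (real n - 1)))"
  proof (rule AE_I2)
    fix x :: 'a
    have p: "norm x powr (real n + real n) = norm x ^ (2 * n)"
      using dim by (cases "x = 0") (auto simp: powr_realpow[symmetric] n_def)
    have q: "0 < 1 + (norm x)^2" by (simp add: add_pos_nonneg)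
    have "(1 + (norm x)^2) powr (- (real n - 1)) * (1 + (norm x)^2) ^ n = 1 + (norm x)^2"
      using q by (simp add: powr_realpow[symmetric] powr_add[symmetric])
    then have "\<bar>u x\<bar> \<le> C * ((1 + (norm x)^2) powr (- (real n - 1)) * (1 + (norm x)^2) ^ n)" using le[of x] by simp
    also have "\<dots> \<le> C * ((1 + (norm x)^2) powr (- (real n - 1)) * (2 ^ n * (1 + norm x ^ (2 * n))))"
      using C by (intro mult_left_mono one_plus_sq_power_le) auto
    finally have "\<bar>u x\<bar> \<le> C * 2 ^ n * (1 + (norm x)^2) powr (- (real n - 1)) * (1 + norm x ^ (2 * n))" by (simp add: mult_ac)
    then have "\<bar>u x\<bar> / (1 + norm x ^ (2 * n)) \<le> C * 2 ^ n * (1 + (norm x)^2) powr (- (real n - 1))"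
      by (subst pos_divide_le_eq) (auto intro: add_pos_nonneg)
    then show "norm (\<bar>u x\<bar> / (1 + norm x powr (real DIM('a) + 2 * (real DIM('a) / 2)))) \<le> norm (C * 2 ^ n * (1 + (norm x)^2) powr (- (real n - 1)))"
      using C by (simp add: p[unfolded mult_2[symmetric]] n_def[symmetric])
  qed
qed measurable

lemma locally_integrable_locally_bounded:
  fixes u :: "'a::euclidean_space \<Rightarrow> real"
  assumes [measurable]: "u \<in> borel_measurable borel" and le: "\<And>x. \<bar>u x\<bar> \<le> C * (1 + (norm x)^2)"
  shows "locally_integrable u"
  unfolding locally_integrable_def
proof (intro allI impI)
  fix K :: "'a set" assume K: "compact K"
  then obtain R where R: "\<And>x. x \<in> K \<Longrightarrow> norm x \<le> R" using compact_imp_bounded bounded_iff by metis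
  have C: "0 \<le> C" using le[of 0] by simp
  have [measurable]: "K \<in> sets borel" using K by (intro borel_closed compact_imp_closed)
  show "set_integrable lborel K u"
    unfolding set_integrable_def
  proof (rule Bochner_Integration.integrable_bound)
    show "integrable lborel (\<lambda>x. indicator K x * (C * (1 + R^2)))"
      using emeasure_compact_finite[OF K] by (intro integrable_mult_left integrable_real_indicator) auto
    have "\<bar>u x\<bar> \<le> C * (1 + R^2)" if "x \<in> K" for x
      using le[of x] mult_left_mono[OF _ C, of "1 + (norm x)^2" "1 + R^2"] power_mono[OF R[OF that] norm_ge_zero, of 2] by simp
    then show "AE x in lborel. norm (indicator K x *\<^sub>R u x) \<le> norm (indicator K x * (C * (1 + R^2)))"
      using C by (intro AE_I2) (auto simp: indicator_def)
  qed measurable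
qed

section \<open>From self-consistent densities to solutions of (P0)\<close>

context radial_density
begin

lemma P0_solution_of_self_consistent:
  assumes dim3: "3 \<le> DIM('a)" and e: "0 \<le> e"
    and u: "\<And>x. u x = - pot x / gamma_n DIM('a) - e * (norm x)^2" and fu: "\<And>x. f x = rhs \<alpha> u x"
  shows "P0_solution \<alpha> u"
proof -
  let ?g = "gamma_n DIM('a)"
  have g: "0 < ?g" using dim3 gamma_n_eq[of "DIM('a)"] by (simp add: Gamma_real_pos)
  have ue: "u = (\<lambda>x. - pot x / ?g - e * (norm x)^2)" using u by (rule ext)
  have rh: "rhs \<alpha> u = f" using fu by auto
  have um[measurable]: "u \<in> borel_measurable borel" unfolding ue by measurable
  obtain A where A: "0 \<le> A" "\<And>x. \<bar>pot x\<bar> \<le> A + mass * norm x" by (rule pot_le_linear) blast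
  have grow: "\<bar>u x\<bar> \<le> ((A + mass) / ?g + e) * (1 + (norm x)^2)" for x
  proof -
    have "norm x \<le> 1 + (norm x)^2" by (rule le_one_plus_sq)
    then have "A * 1 + mass * norm x \<le> A * (1 + (norm x)^2) + mass * (1 + (norm x)^2)"
      using A(1) mass_nonneg by (intro add_mono mult_left_mono) auto
    then have "\<bar>pot x\<bar> \<le> (A + mass) * (1 + (norm x)^2)" using A(2)[of x] by (simp add: algebra_simps)
    then have "\<bar>pot x\<bar> / ?g \<le> (A + mass) * (1 + (norm x)^2) / ?g" using g by (intro divide_right_mono) auto
    moreover have "\<bar>u x\<bar> \<le> \<bar>pot x\<bar> / ?g + e * (norm x)^2"
      using abs_triangle_ineq4[of "- pot x / ?g" "e * (norm x)^2"] e g by (simp add: u abs_mult)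
    moreover have "e * (norm x)^2 \<le> e * (1 + (norm x)^2)" using e by (intro mult_left_mono) auto
    ultimately show ?thesis by (simp add: algebra_simps add_divide_distrib)
  qed
  have weak: "integrable lborel (\<lambda>x. u x * frac_lap (real DIM('a) / 2) \<phi> x) \<and>
     (LINT x|lborel. u x * frac_lap (real DIM('a) / 2) \<phi> x) = (LINT x|lborel. rhs \<alpha> u x * \<phi> x)" if \<phi>: "schwartz \<phi>" for \<phi>
  proof -
    define \<psi> where "\<psi> = frac_lap (real DIM('a) / 2) \<phi>"
    note pr = frac_lap_properties[OF dim3 \<phi>, folded \<psi>_def]
    note pp = pot_frac_lap[OF dim3 \<phi>, folded \<psi>_def]
    have [measurable]: "\<psi> \<in> borel_measurable borel" by (rule pr)
    have qi: "integrable lborel (\<lambda>x. (norm x)^2 * \<psi> x)"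
    proof (rule Bochner_Integration.integrable_bound[OF pr(3)])
      have "(norm x)^2 * \<bar>\<psi> x\<bar> \<le> (1 + (norm x)^2) * \<bar>\<psi> x\<bar>" for x by (intro mult_right_mono) auto
      then show "AE x in lborel. norm ((norm x)^2 * \<psi> x) \<le> norm ((1 + (norm x)^2) * \<psi> x)" by (simp add: abs_mult)
    qed measurable
    have eq: "u x * \<psi> x = (- 1 / ?g) * (pot x * \<psi> x) - e * ((norm x)^2 * \<psi> x)" for x
      by (simp add: u algebra_simps)
    have "integrable lborel (\<lambda>x. u x * \<psi> x)" unfolding eq
      by (intro Bochner_Integration.integrable_diff integrable_mult_right pp qi)
    moreover have "(\<integral>x. u x * \<psi> x \<partial>lborel) = (\<integral>x. f x * \<phi> x \<partial>lborel)"
    proof -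
      have "(\<integral>x. u x * \<psi> x \<partial>lborel) = (\<integral>x. (- 1 / ?g) * (pot x * \<psi> x) \<partial>lborel) - (\<integral>x. e * ((norm x)^2 * \<psi> x) \<partial>lborel)"
        unfolding eq by (intro Bochner_Integration.integral_diff integrable_mult_right pp qi)
      also have "\<dots> = (- 1 / ?g) * (\<integral>x. pot x * \<psi> x \<partial>lborel) - e * (\<integral>x. (norm x)^2 * \<psi> x \<partial>lborel)" by simp
      also have "\<dots> = (\<integral>x. f x * \<phi> x \<partial>lborel)" using g by (simp add: pp(2) pr(5))
      finally show ?thesis .
    qed
    ultimately show ?thesis by (simp add: \<psi>_def rh)
  qed
  have "L_s (real DIM('a) / 2) u" by (rule L_s_quadratic_growth[OF dim3 um grow])
  moreover have "locally_integrable u" by (rule locally_integrable_locally_bounded[OF um grow])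
  ultimately show ?thesis
    using weak test_fun_schwartz int unfolding P0_solution_def rh by (auto simp: rh)
qed

text \<open>The kernel of a normal solution is ln (1 + |y|) - ln |y| minus
  \<open>log_ratio 0 x y\<close>. The first difference does not involve x, and its integral against
  f provides the constant c.\<close>

lemma normal_solution_of_self_consistent:
  assumes dim3: "3 \<le> DIM('a)"
    and u: "\<And>x. u x = - pot x / gamma_n DIM('a)" and fu: "\<And>x. f x = rhs \<alpha> u x"
  shows "normal_solution \<alpha> u"
proof -
  let ?g = "gamma_n DIM('a)"
  have rh: "rhs \<alpha> u = f" using fu by auto
  have P0: "P0_solution \<alpha> u" by (rule P0_solution_of_self_consistent[OF dim3 order_refl]) (simp_all add: u fu)
  define h where "h y = (ln (1 + norm y) - ln (norm y)) * f y" for y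
  have hi: "integrable lborel h"
  proof (rule Bochner_Integration.integrable_bound)
    show "integrable lborel (\<lambda>y. f y + norm (ln (norm (0 - y)) * (f y * indicator (cball 0 1) y)))"
      by (intro Bochner_Integration.integrable_add int integrable_norm ln_near_integrable) simp
    show "AE y in lborel. norm (h y) \<le> norm (f y + norm (ln (norm (0 - y)) * (f y * indicator (cball 0 1) y)))"
      using AE_lborel_singleton[of 0]
    proof eventually_elim
      case (elim y)
      have y: "0 < norm y" using elim by simp
      have l0: "0 \<le> ln (1 + norm y) - ln (norm y)" using y ln_mono[of "norm y" "1 + norm y"] by simp
      have "ln (1 + norm y) - ln (norm y) \<le> 1 + \<bar>ln (norm y)\<bar> * indicator (cball 0 1) y"
      proof (cases "norm y \<le> 1")
        case True
        have "ln (1 + norm y) \<le> norm y" by (intro ln_add_one_self_le_self) simp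
        then show ?thesis using True by simp
      next
        case False
        have "ln (1 + norm y) - ln (norm y) \<le> 1 / norm y" using y by (intro ln_add_diff_le) auto
        also have "\<dots> \<le> 1" using False by (simp add: divide_le_eq)
        finally show ?thesis using False by simp
      qed
      from mult_right_mono[OF this nonneg[of y]]
      have "norm (h y) \<le> (1 + \<bar>ln (norm y)\<bar> * indicator (cball 0 1) y) * f y"
        using l0 nonneg[of y] by (simp only: h_def real_norm_def abs_of_nonneg mult_nonneg_nonneg)
      then show ?case using nonneg[of y] by (simp add: abs_mult algebra_simps)
    qed
    show "h \<in> borel_measurable lborel" unfolding h_def by measurable
  qed
  have AEeq: "AE y in lborel. h y - log_ratio 0 x y * f y = ln ((1 + norm y) / norm (x - y)) * f y" for x
    using AE_lborel_singleton[of x] AE_lborel_singleton[of 0]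
  proof eventually_elim
    case (elim y)
    have "0 < 1 + norm y" by (simp add: add_pos_nonneg)
    then have "ln ((1 + norm y) / norm (x - y)) = ln (1 + norm y) - ln (norm (x - y))"
      using elim ln_div[of "1 + norm y" "norm (x - y)"] by simp
    then show ?case unfolding h_def log_ratio_def by (simp add: left_diff_distrib)
  qed
  have di: "integrable lborel (\<lambda>y. h y - log_ratio 0 x y * f y)" for x
    by (intro Bochner_Integration.integrable_diff hi log_ratio0_integrable)
  have li: "integrable lborel (\<lambda>y. ln ((1 + norm y) / norm (x - y)) * f y)" for x
    by (rule integrable_cong_AE_imp[OF di _ AEeq]) measurable
  have lI: "(\<integral>y. ln ((1 + norm y) / norm (x - y)) * f y \<partial>lborel) = (\<integral>y. h y \<partial>lborel) - pot x" for x
  proof -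
    have "(\<integral>y. ln ((1 + norm y) / norm (x - y)) * f y \<partial>lborel) = (\<integral>y. h y - log_ratio 0 x y * f y \<partial>lborel)"
      using AEeq[of x] hi by (intro integral_cong_AE) auto
    also have "\<dots> = (\<integral>y. h y \<partial>lborel) - pot x"
      unfolding pot_def by (intro Bochner_Integration.integral_diff hi log_ratio0_integrable)
    finally show ?thesis .
  qed
  have "u x = 1 / ?g * (\<integral>y. ln ((1 + norm y) / norm (x - y)) * f y \<partial>lborel) + - (\<integral>y. h y \<partial>lborel) / ?g" for x
    by (simp add: u lI diff_divide_distrib)
  then show ?thesis unfolding normal_solution_def rh using P0 li by blast
qed

end

theorem theorem1p2:
  fixes \<alpha> :: real
  assumes "DIM('a::euclidean_space) \<ge> 3" and "\<alpha> > -1"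
  shows "(\<forall>\<Lambda>. 0 < \<Lambda> \<and> \<Lambda> < Lambda1 DIM('a) * (1 + \<alpha>) \<longrightarrow>
            (\<exists>u :: 'a \<Rightarrow> real. radial u \<and> P0_solution \<alpha> u \<and> (LINT x|lborel. rhs \<alpha> u x) = \<Lambda>))
       \<and> (\<exists>u :: 'a \<Rightarrow> real. radial u \<and> normal_solution \<alpha> u \<and>
            (LINT x|lborel. rhs \<alpha> u x) = Lambda1 DIM('a) * (1 + \<alpha>))"
proof -
  let ?g = "gamma_n DIM('a)" and ?L = "Lambda1 DIM('a) * (1 + \<alpha>)"
  have g: "0 < ?g" using assms gamma_n_eq[of "DIM('a)"] by (simp add: Gamma_real_pos)
  have L: "?L = 2 * ?g * (1 + \<alpha>)" by (simp add: Lambda1_def gamma_n_def)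
  then have L0: "0 < ?L" using g assms(2) by simp
  have ex: "\<exists>u :: 'a \<Rightarrow> real. radial u \<and> P0_solution \<alpha> u \<and> (LINT x|lborel. rhs \<alpha> u x) = \<Lambda> \<and> (\<Lambda> = ?L \<longrightarrow> normal_solution \<alpha> u)"
    if \<Lambda>: "0 < \<Lambda>" "\<Lambda> \<le> ?L" for \<Lambda>
  proof -
    have dim2: "2 \<le> DIM('a)" using assms by simp
    obtain f :: "'a \<Rightarrow> real" and e where f: "radial_density \<alpha> f" and e: "0 \<le> e"
      and mle: "(\<integral>y. f y \<partial>lborel) \<le> \<Lambda>" and meq: "0 < e \<longrightarrow> (\<integral>y. f y \<partial>lborel) = \<Lambda>"
      and feq: "\<And>y. f y = norm y powr (real DIM('a) * \<alpha>) * exp (real DIM('a) * (- radial_density.pot f y / ?g - e * (norm y)^2))"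
      using exists_self_consistent_density[OF dim2 assms(2) g \<Lambda>(1)] by blast
    interpret radial_density \<alpha> f by (rule f)
    define u where "u x = - pot x / ?g - e * (norm x)^2" for x
    have fu: "f x = rhs \<alpha> u x" for x using feq[of x] by (simp add: rhs_def u_def)
    then have rh: "rhs \<alpha> u = f" by auto
    note poho = pohozaev[OF g e feq]
    have eq0: "e = 0" if "\<Lambda> = ?L" using poho(3) meq that e L by fastforce
    \<comment> \<open>For e = 0 the chain \<Lambda> \<le> \<open>?L\<close> \<le> mass \<le>
      \<Lambda> closes up, so this case can occur only at the critical value.\<close>
    have m: "mass = \<Lambda>"
    proof (cases "e = 0")
      case True
      then show ?thesis using poho(2) mle \<Lambda> L by simp
    qed (use meq e in auto)
    have "radial u" unfolding radial_def u_def using pot_radial by metis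
    moreover have "P0_solution \<alpha> u"
      by (rule P0_solution_of_self_consistent[OF assms(1) e u_def fu])
    moreover have "normal_solution \<alpha> u" if "\<Lambda> = ?L"
      using normal_solution_of_self_consistent[OF assms(1), of u] fu eq0[OF that] by (simp add: u_def)
    ultimately show ?thesis using m rh by auto
  qed
  show ?thesis using ex ex[OF L0 order_refl] by (intro conjI allI impI) (metis less_imp_le, blast)
qed

end
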